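(* Let $(M,g)$ be a Riemannian manifold of dimension $n\in\mathbb{N}$, let $I=[0,1]$, let $p\neq q$ be points of $M$, and let $\gamma:I\to M$ be a geodesic with $\gamma(0)=p$ and $\gamma(1)=q$. Assume that $\gamma$ is non-degenerate, i.e. $m(1)=0$. Then $m(t)=0$ for all but finitely many $t\in(0,1]$, and $$\mu(\gamma)=\sum_{t\in(0,1]}m(t).$$ Here $\mu(\gamma)$ is the Morse index of $\gamma$, and $m(t)$ is the dimension of the space of Jacobi fields along $\gamma$ vanishing at $0$ and at $t$.
   Context: Let $\nabla$ be the Levi-Civita connection of $g$, let $\frac{\nabla}{dx}$ be the induced covariant derivative along $\gamma$, and let $R$ be the curvature tensor with the sign convention $R(X,Y)Z=\nabla_Y\nabla_XZ-\nabla_X\nabla_YZ+\nabla_{[X,Y]}Z$ (so that $g(R(X,Y)X,Y)>0$ for linearly independent $X,Y$ on a round sphere). **Path space and Hessian.** $\Omega_{pq}$ is the Hilbert manifold of all $H^1$-paths $I\to M$ (absolutely continuous with square integrable derivative in charts) from $p$ to $q$. Its tangent space $T_\gamma\Omega_{pq}$ at $\gamma$ is identified with the space of all $H^1$ vector fields $\xi$ along $\gamma$ with $\xi(0)=0$ and $\xi(1)=0$. The geodesics from $p$ to $q$ are the critical points of the energy functional $E:\Omega_{pq}\to\mathbb{R}$, $E(\gamma)=\frac12\int_0^1 g(\gamma'(x),\gamma'(x))\,dx$. The Hessian of $E$ at a geodesic $\gamma\in\Omega_{pq}$ is the bilinear form on $T_\gamma\Omega_{pq}$ given by $$D^2_\gamma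 E(\xi,\eta)=\int_0^1 g\left(\frac{\nabla}{dx}\xi(x),\frac{\nabla}{dx}\eta(x)\right)dx-\int_0^1 g\big(R(\gamma'(x),\xi(x))\gamma'(x),\eta(x)\big)\,dx .$$ **Morse index.** $\mu(\gamma)$ is the dimension of a maximal subspace of $T_\gamma\Omega_{pq}$ on which the quadratic form $\xi\mapsto D^2_\gamma E(\xi,\xi)$ is negative definite, i.e. the supremum of $\dim U$ over all linear subspaces $U\subset T_\gamma\Omega_{pq}$ such that $D^2_\gamma E(\xi,\xi)<0$ for all $\xi\in U\setminus\{0\}$. **Conjugate instants.** Let $\Gamma(\gamma)$ be the space of smooth vector fields along $\gamma$ (defined on all of $I$). The Jacobi equation for $\xi\in\Gamma(\gamma)$ is $$\frac{\nabla^2}{dx^2}\xi(x)+R(\gamma'(x),\xi(x))\gamma'(x)=0,\quad x\in I.$$ For $t\in(0,1]$, set $$m(t)=\dim\{\xi\in\Gamma(\gamma):\ \xi\text{ satisfies the Jacobi equation},\ \xi(0)=0,\ \xi(t)=0\}.$$ The instant $t$ is called conjugate if $m(t)>0$. *)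

theory Defs
  imports "HOL-Analysis.Analysis" "HOL-Library.Function_Algebras" "HOL-Library.Extended_Nat"
begin

text \<open>Real vector spaces of functions, with the pointwise operations. Tangent vectors and vector
  fields along curves are functions below.\<close>

instantiation "fun" :: (type, real_vector) real_vector
begin
definition scaleR_fun :: "real \<Rightarrow> ('a \<Rightarrow> 'b) \<Rightarrow> 'a \<Rightarrow> 'b"
  where "scaleR_fun r f = (\<lambda>x. r *\<^sub>R f x)"
instance
  by standard (simp_all add: scaleR_fun_def plus_fun_def fun_eq_iff algebra_simps)
end

text \<open>The library constant \<^const>\<open>dim\<close> is \<open>0\<close> for infinite-dimensional spaces, whence this
  variant.\<close>

definition edim :: "'v::real_vector set \<Rightarrow> enat" where
  "edim V = (if \<exists>B. finite B \<and> V \<subseteq> span B then enat (dim V) else \<infinity>)"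


section \<open>Smooth maps\<close>

text \<open>Only used for open \<open>S\<close> and for relatively open subsets \<open>S\<close> of the interval \<open>{0..1}\<close>
  (with one-sided derivatives at the end points); in both cases derivatives within \<open>S\<close> are unique.\<close>

primrec Ck_on :: "nat \<Rightarrow> 'a::real_normed_vector set \<Rightarrow> ('a \<Rightarrow> 'b::real_normed_vector) \<Rightarrow> bool" where
  "Ck_on 0 S f \<longleftrightarrow> continuous_on S f"
| "Ck_on (Suc k) S f \<longleftrightarrow>
     f differentiable_on S \<and> (\<forall>v. Ck_on k S (\<lambda>x. frechet_derivative f (at x within S) v))"

definition smooth_on :: "'a::real_normed_vector set \<Rightarrow> ('a \<Rightarrow> 'b::real_normed_vector) \<Rightarrow> bool" where
  "smooth_on S f \<longleftrightarrow> (\<forall>k. Ck_on k S f)"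


section \<open>Smooth manifolds and tangent vectors\<close>

text \<open>A chart is a pair of its domain and its coordinate map; the values of the latter outside the
  domain are irrelevant.\<close>

type_synonym ('a, 'n) chart = "'a set \<times> ('a \<Rightarrow> real ^ 'n)"

abbreviation chart_dom :: "('a, 'n) chart \<Rightarrow> 'a set" where "chart_dom c \<equiv> fst c"
abbreviation chart_map :: "('a, 'n) chart \<Rightarrow> 'a \<Rightarrow> real ^ 'n" where "chart_map c \<equiv> snd c"

definition chart_inv :: "('a, 'n) chart \<Rightarrow> real ^ 'n \<Rightarrow> 'a" where
  "chart_inv c = inv_into (chart_dom c) (chart_map c)"

definition transition :: "('a, 'n) chart \<Rightarrow> ('a, 'n) chart \<Rightarrow> real ^ 'n \<Rightarrow> real ^ 'n" where
  "transition c d = chart_map d \<circ> chart_inv c"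

locale smooth_manifold =
  fixes M :: "'a topology" and A :: "('a, 'n::finite) chart set"
  assumes Hausdorff: "Hausdorff_space M"
    and second_countable: "second_countable M"
    and covering: "(\<Union>c\<in>A. chart_dom c) = topspace M"
    and chart_openin: "c \<in> A \<Longrightarrow> openin M (chart_dom c)"
    and chart_open_image: "c \<in> A \<Longrightarrow> open (chart_map c ` chart_dom c)"
    and chart_homeomorphic: "c \<in> A \<Longrightarrow>
      homeomorphic_map (subtopology M (chart_dom c)) (top_of_set (chart_map c ` chart_dom c)) (chart_map c)"
    and smooth_transition: "c \<in> A \<Longrightarrow> d \<in> A \<Longrightarrow>
      smooth_on (chart_map c ` (chart_dom c \<inter> chart_dom d)) (transition c d)"

text \<open>A tangent vector at \<open>p\<close> is the family of its coordinate vectors with respect to all charts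
  around \<open>p\<close>, which are related by the derivatives of the chart transitions. Components for other
  charts are \<open>0\<close>, so that equality and the vector space operations on tangent vectors are those of
  functions.\<close>

type_synonym ('a, 'n) tvec = "('a, 'n) chart \<Rightarrow> real ^ 'n"

definition tangent_space :: "('a, 'n::finite) chart set \<Rightarrow> 'a \<Rightarrow> ('a, 'n) tvec set" where
  "tangent_space A p = {v.
     (\<forall>c. \<not> (c \<in> A \<and> p \<in> chart_dom c) \<longrightarrow> v c = 0) \<and>
     (\<forall>c\<in>A. \<forall>d\<in>A. p \<in> chart_dom c \<longrightarrow> p \<in> chart_dom d \<longrightarrow>
        v d = frechet_derivative (transition c d) (at (chart_map c p)) (v c))}"

text \<open>The local vector field on the domain of the chart \<open>c\<close> whose coordinates with respect to \<open>c\<close>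
  are constantly \<open>w\<close>; for \<open>w = axis i 1\<close> this is the \<open>i\<close>-th coordinate field of \<open>c\<close>.\<close>

definition const_field ::
  "('a, 'n::finite) chart set \<Rightarrow> ('a, 'n) chart \<Rightarrow> real ^ 'n \<Rightarrow> 'a \<Rightarrow> ('a, 'n) tvec" where
  "const_field A c w q = (\<lambda>d. if d \<in> A \<and> q \<in> chart_dom c \<inter> chart_dom d
     then frechet_derivative (transition c d) (at (chart_map c q)) w else 0)"

definition smooth_functions :: "('a, 'n::finite) chart set \<Rightarrow> 'a set \<Rightarrow> ('a \<Rightarrow> real) set" where
  "smooth_functions A V =
     {f. \<forall>c\<in>A. smooth_on (chart_map c ` (chart_dom c \<inter> V)) (f \<circ> chart_inv c)}"

definition vector_fields :: "('a, 'n::finite) chart set \<Rightarrow> 'a set \<Rightarrow> ('a \<Rightarrow> ('a, 'n) tvec) set" where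
  "vector_fields A V = {X. (\<forall>q\<in>V. X q \<in> tangent_space A q) \<and>
     (\<forall>c\<in>A. smooth_on (chart_map c ` (chart_dom c \<inter> V)) (\<lambda>x. X (chart_inv c x) c))}"

text \<open>The derivative of the function \<open>f\<close> in the direction of the tangent vector \<open>v\<close> at \<open>p\<close>,
  computed in the chart \<open>c\<close> around \<open>p\<close>.\<close>

definition dir_deriv :: "('a, 'n::finite) chart \<Rightarrow> 'a \<Rightarrow> ('a, 'n) tvec \<Rightarrow> ('a \<Rightarrow> real) \<Rightarrow> real" where
  "dir_deriv c p v f = frechet_derivative (f \<circ> chart_inv c) (at (chart_map c p)) (v c)"

definition lie_bracket :: "('a, 'n::finite) chart set \<Rightarrow>
    ('a \<Rightarrow> ('a, 'n) tvec) \<Rightarrow> ('a \<Rightarrow> ('a, 'n) tvec) \<Rightarrow> 'a \<Rightarrow> ('a, 'n) tvec" where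
  "lie_bracket A X Y p = (\<lambda>c. if c \<in> A \<and> p \<in> chart_dom c
     then frechet_derivative (\<lambda>x. Y (chart_inv c x) c) (at (chart_map c p)) (X p c)
        - frechet_derivative (\<lambda>x. X (chart_inv c x) c) (at (chart_map c p)) (Y p c)
     else 0)"


section \<open>Riemannian metrics, Levi-Civita connection, curvature\<close>

locale riemannian_manifold = smooth_manifold M A
  for M :: "'a topology" and A :: "('a, 'n::finite) chart set" +
  fixes g :: "'a \<Rightarrow> ('a, 'n) tvec \<Rightarrow> ('a, 'n) tvec \<Rightarrow> real"
  assumes metric_linear: "p \<in> topspace M \<Longrightarrow>
      u \<in> tangent_space A p \<Longrightarrow> v \<in> tangent_space A p \<Longrightarrow> w \<in> tangent_space A p \<Longrightarrow>
      g p (r *\<^sub>R u + s *\<^sub>R v) w = r * g p u w + s * g p v w"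
    and metric_sym: "p \<in> topspace M \<Longrightarrow> u \<in> tangent_space A p \<Longrightarrow> v \<in> tangent_space A p \<Longrightarrow>
      g p u v = g p v u"
    and metric_pos: "p \<in> topspace M \<Longrightarrow> v \<in> tangent_space A p \<Longrightarrow> v \<noteq> 0 \<Longrightarrow> g p v v > 0"
    and metric_smooth: "openin M V \<Longrightarrow> X \<in> vector_fields A V \<Longrightarrow> Y \<in> vector_fields A V \<Longrightarrow>
      (\<lambda>q. g q (X q) (Y q)) \<in> smooth_functions A V"

text \<open>\<open>nab p v Y\<close> is the covariant derivative at \<open>p\<close>, in the direction of the tangent vector \<open>v\<close>
  at \<open>p\<close>, of a smooth vector field \<open>Y\<close> defined on some open neighbourhood of \<open>p\<close>.\<close>

locale levi_civita = riemannian_manifold M A g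
  for M :: "'a topology" and A :: "('a, 'n::finite) chart set"
    and g :: "'a \<Rightarrow> ('a, 'n) tvec \<Rightarrow> ('a, 'n) tvec \<Rightarrow> real" +
  fixes nab :: "'a \<Rightarrow> ('a, 'n) tvec \<Rightarrow> ('a \<Rightarrow> ('a, 'n) tvec) \<Rightarrow> ('a, 'n) tvec"
  assumes nab_local: "openin M V \<Longrightarrow> p \<in> V \<Longrightarrow> v \<in> tangent_space A p \<Longrightarrow>
      Y \<in> vector_fields A V \<Longrightarrow> Z \<in> vector_fields A V \<Longrightarrow> (\<And>q. q \<in> V \<Longrightarrow> Y q = Z q) \<Longrightarrow>
      nab p v Y = nab p v Z"
    and nab_smooth: "openin M V \<Longrightarrow> X \<in> vector_fields A V \<Longrightarrow> Y \<in> vector_fields A V \<Longrightarrow>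
      (\<lambda>q. nab q (X q) Y) \<in> vector_fields A V"
    and nab_tangent: "openin M V \<Longrightarrow> p \<in> V \<Longrightarrow> v \<in> tangent_space A p \<Longrightarrow> Y \<in> vector_fields A V \<Longrightarrow>
      nab p v Y \<in> tangent_space A p"
    and nab_linear: "openin M V \<Longrightarrow> p \<in> V \<Longrightarrow> v \<in> tangent_space A p \<Longrightarrow> w \<in> tangent_space A p \<Longrightarrow>
      Y \<in> vector_fields A V \<Longrightarrow>
      nab p (r *\<^sub>R v + s *\<^sub>R w) Y = r *\<^sub>R nab p v Y + s *\<^sub>R nab p w Y"
    and nab_add: "openin M V \<Longrightarrow> p \<in> V \<Longrightarrow> v \<in> tangent_space A p \<Longrightarrow>
      Y \<in> vector_fields A V \<Longrightarrow> Z \<in> vector_fields A V \<Longrightarrow>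
      nab p v (\<lambda>q. Y q + Z q) = nab p v Y + nab p v Z"
    and nab_Leibniz: "openin M V \<Longrightarrow> p \<in> V \<Longrightarrow> v \<in> tangent_space A p \<Longrightarrow>
      f \<in> smooth_functions A V \<Longrightarrow> Y \<in> vector_fields A V \<Longrightarrow> c \<in> A \<Longrightarrow> p \<in> chart_dom c \<Longrightarrow>
      nab p v (\<lambda>q. f q *\<^sub>R Y q) = dir_deriv c p v f *\<^sub>R Y p + f p *\<^sub>R nab p v Y"
    and nab_torsion_free: "openin M V \<Longrightarrow> p \<in> V \<Longrightarrow>
      X \<in> vector_fields A V \<Longrightarrow> Y \<in> vector_fields A V \<Longrightarrow>
      nab p (X p) Y - nab p (Y p) X = lie_bracket A X Y p"
    and nab_metric: "openin M V \<Longrightarrow> p \<in> V \<Longrightarrow> v \<in> tangent_space A p \<Longrightarrow>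
      Y \<in> vector_fields A V \<Longrightarrow> Z \<in> vector_fields A V \<Longrightarrow> c \<in> A \<Longrightarrow> p \<in> chart_dom c \<Longrightarrow>
      dir_deriv c p v (\<lambda>q. g q (Y q) (Z q)) = g p (nab p v Y) (Z p) + g p (Y p) (nab p v Z)"

text \<open>The sign convention is \<open>R(X,Y)Z = \<nabla>\<^sub>Y \<nabla>\<^sub>X Z - \<nabla>\<^sub>X \<nabla>\<^sub>Y Z + \<nabla>\<^bsub>[X,Y]\<^esub> Z\<close>.\<close>

definition curv_field :: "('a, 'n::finite) chart set \<Rightarrow>
    ('a \<Rightarrow> ('a, 'n) tvec \<Rightarrow> ('a \<Rightarrow> ('a, 'n) tvec) \<Rightarrow> ('a, 'n) tvec) \<Rightarrow>
    ('a \<Rightarrow> ('a, 'n) tvec) \<Rightarrow> ('a \<Rightarrow> ('a, 'n) tvec) \<Rightarrow> ('a \<Rightarrow> ('a, 'n) tvec) \<Rightarrow>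
    'a \<Rightarrow> ('a, 'n) tvec" where
  "curv_field A nab X Y Z p =
     nab p (Y p) (\<lambda>q. nab q (X q) Z) - nab p (X p) (\<lambda>q. nab q (Y q) Z)
     + nab p (lie_bracket A X Y p) Z"

text \<open>The curvature tensor at \<open>p\<close>. As the value of \<^const>\<open>curv_field\<close> at \<open>p\<close> only depends on the
  values of the three vector fields at \<open>p\<close>, any local extensions of the tangent vectors may be used;
  the component of the result in the chart \<open>c\<close> is computed with the extensions that are constant in
  \<open>c\<close>.\<close>

definition curvature :: "('a, 'n::finite) chart set \<Rightarrow>
    ('a \<Rightarrow> ('a, 'n) tvec \<Rightarrow> ('a \<Rightarrow> ('a, 'n) tvec) \<Rightarrow> ('a, 'n) tvec) \<Rightarrow>
    'a \<Rightarrow> ('a, 'n) tvec \<Rightarrow> ('a, 'n) tvec \<Rightarrow> ('a, 'n) tvec \<Rightarrow> ('a, 'n) tvec" where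
  "curvature A nab p u v w = (\<lambda>c. if c \<in> A \<and> p \<in> chart_dom c
     then curv_field A nab (const_field A c (u c)) (const_field A c (v c)) (const_field A c (w c)) p c
     else 0)"


section \<open>Curves, vector fields along curves, geodesics\<close>

text \<open>Curves are parametrised by the interval \<open>{0..1}\<close>; their values outside are irrelevant. Vector
  fields along curves are set to \<open>0\<close> outside \<open>{0..1}\<close>.\<close>

definition smooth_curve :: "'a topology \<Rightarrow> ('a, 'n::finite) chart set \<Rightarrow> (real \<Rightarrow> 'a) \<Rightarrow> bool" where
  "smooth_curve M A \<gamma> \<longleftrightarrow> continuous_map (top_of_set {0..1}) M \<gamma> \<and>
     (\<forall>c\<in>A. smooth_on {x\<in>{0..1}. \<gamma> x \<in> chart_dom c} (chart_map c \<circ> \<gamma>))"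

definition velocity :: "('a, 'n::finite) chart set \<Rightarrow> (real \<Rightarrow> 'a) \<Rightarrow> real \<Rightarrow> ('a, 'n) tvec" where
  "velocity A \<gamma> x = (\<lambda>c. if c \<in> A \<and> x \<in> {0..1} \<and> \<gamma> x \<in> chart_dom c
     then vector_derivative (chart_map c \<circ> \<gamma>) (at x within {0..1}) else 0)"

definition fields_along ::
  "('a, 'n::finite) chart set \<Rightarrow> (real \<Rightarrow> 'a) \<Rightarrow> (real \<Rightarrow> ('a, 'n) tvec) set" where
  "fields_along A \<gamma> =
     {\<xi>. (\<forall>x\<in>{0..1}. \<xi> x \<in> tangent_space A (\<gamma> x)) \<and> (\<forall>x. x \<notin> {0..1} \<longrightarrow> \<xi> x = 0)}"

definition smooth_fields_along ::
  "('a, 'n::finite) chart set \<Rightarrow> (real \<Rightarrow> 'a) \<Rightarrow> (real \<Rightarrow> ('a, 'n) tvec) set" where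
  "smooth_fields_along A \<gamma> = {\<xi> \<in> fields_along A \<gamma>.
     \<forall>c\<in>A. smooth_on {x\<in>{0..1}. \<gamma> x \<in> chart_dom c} (\<lambda>x. \<xi> x c)}"

text \<open>The covariant derivative along \<open>\<gamma>\<close> induced by \<open>nab\<close>. In a chart with coordinate fields
  \<open>\<partial>\<^sub>i\<close>, a field \<open>\<xi> = \<Sum>\<^sub>i \<xi>\<^sub>i \<partial>\<^sub>i\<close> has the derivative \<open>\<Sum>\<^sub>i \<xi>\<^sub>i' \<partial>\<^sub>i + \<xi>\<^sub>i \<nabla>\<^bsub>\<gamma>'\<^esub> \<partial>\<^sub>i\<close>; the
  second part is at each instant the derivative of the extension of \<open>\<xi> x\<close> that is constant in the
  chart.\<close>

definition cov_deriv_along :: "('a, 'n::finite) chart set \<Rightarrow>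
    ('a \<Rightarrow> ('a, 'n) tvec \<Rightarrow> ('a \<Rightarrow> ('a, 'n) tvec) \<Rightarrow> ('a, 'n) tvec) \<Rightarrow>
    (real \<Rightarrow> 'a) \<Rightarrow> (real \<Rightarrow> ('a, 'n) tvec) \<Rightarrow> real \<Rightarrow> ('a, 'n) tvec" where
  "cov_deriv_along A nab \<gamma> \<xi> x = (\<lambda>c. if c \<in> A \<and> x \<in> {0..1} \<and> \<gamma> x \<in> chart_dom c
     then vector_derivative (\<lambda>y. \<xi> y c) (at x within {0..1})
        + nab (\<gamma> x) (velocity A \<gamma> x) (const_field A c (\<xi> x c)) c
     else 0)"

definition geodesic :: "'a topology \<Rightarrow> ('a, 'n::finite) chart set \<Rightarrow>
    ('a \<Rightarrow> ('a, 'n) tvec \<Rightarrow> ('a \<Rightarrow> ('a, 'n) tvec) \<Rightarrow> ('a, 'n) tvec) \<Rightarrow> (real \<Rightarrow> 'a) \<Rightarrow> bool" where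
  "geodesic M A nab \<gamma> \<longleftrightarrow> smooth_curve M A \<gamma> \<and>
     (\<forall>x\<in>{0..1}. cov_deriv_along A nab \<gamma> (velocity A \<gamma>) x = 0)"


section \<open>Jacobi fields and conjugate instants\<close>

definition jacobi_fields :: "('a, 'n::finite) chart set \<Rightarrow>
    ('a \<Rightarrow> ('a, 'n) tvec \<Rightarrow> ('a \<Rightarrow> ('a, 'n) tvec) \<Rightarrow> ('a, 'n) tvec) \<Rightarrow>
    (real \<Rightarrow> 'a) \<Rightarrow> (real \<Rightarrow> ('a, 'n) tvec) set" where
  "jacobi_fields A nab \<gamma> = {\<xi> \<in> smooth_fields_along A \<gamma>. \<forall>x\<in>{0..1}.
     cov_deriv_along A nab \<gamma> (cov_deriv_along A nab \<gamma> \<xi>) x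
     + curvature A nab (\<gamma> x) (velocity A \<gamma> x) (\<xi> x) (velocity A \<gamma> x) = 0}"

definition conj_mult :: "('a, 'n::finite) chart set \<Rightarrow>
    ('a \<Rightarrow> ('a, 'n) tvec \<Rightarrow> ('a \<Rightarrow> ('a, 'n) tvec) \<Rightarrow> ('a, 'n) tvec) \<Rightarrow>
    (real \<Rightarrow> 'a) \<Rightarrow> real \<Rightarrow> enat" where
  "conj_mult A nab \<gamma> t = edim {\<xi> \<in> jacobi_fields A nab \<gamma>. \<xi> 0 = 0 \<and> \<xi> t = 0}"


section \<open>Sobolev vector fields, the Hessian of the energy and the Morse index\<close>

definition absolutely_continuous_on :: "real \<Rightarrow> real \<Rightarrow> (real \<Rightarrow> 'b::real_normed_vector) \<Rightarrow> bool" where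
  "absolutely_continuous_on a b f \<longleftrightarrow>
     (\<forall>\<epsilon>>0. \<exists>\<delta>>0. \<forall>D. D division_of \<Union>D \<longrightarrow> \<Union>D \<subseteq> {a..b} \<longrightarrow>
        (\<Sum>K\<in>D. Sup K - Inf K) < \<delta> \<longrightarrow> (\<Sum>K\<in>D. norm (f (Sup K) - f (Inf K))) < \<epsilon>)"

definition H1_on :: "real \<Rightarrow> real \<Rightarrow> (real \<Rightarrow> 'b::euclidean_space) \<Rightarrow> bool" where
  "H1_on a b f \<longleftrightarrow> absolutely_continuous_on a b f \<and>
     (\<exists>u. u \<in> borel_measurable lebesgue \<and>
        (AE x in lebesgue. x \<in> {a<..<b} \<longrightarrow> (f has_vector_derivative u x) (at x)) \<and>
        set_integrable lebesgue {a..b} (\<lambda>x. (norm (u x))\<^sup>2))"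

text \<open>The tangent space at \<open>\<gamma>\<close> of the manifold of \<open>H\<^sup>1\<close>-paths from \<open>\<gamma> 0\<close> to \<open>\<gamma> 1\<close>.\<close>

definition path_tangent_space ::
  "('a, 'n::finite) chart set \<Rightarrow> (real \<Rightarrow> 'a) \<Rightarrow> (real \<Rightarrow> ('a, 'n) tvec) set" where
  "path_tangent_space A \<gamma> = {\<xi> \<in> fields_along A \<gamma>. \<xi> 0 = 0 \<and> \<xi> 1 = 0 \<and>
     (\<forall>c\<in>A. \<forall>a b. 0 \<le> a \<longrightarrow> a \<le> b \<longrightarrow> b \<le> 1 \<longrightarrow> \<gamma> ` {a..b} \<subseteq> chart_dom c \<longrightarrow>
        H1_on a b (\<lambda>x. \<xi> x c))}"

definition energy_hessian :: "('a, 'n::finite) chart set \<Rightarrow>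
    ('a \<Rightarrow> ('a, 'n) tvec \<Rightarrow> ('a, 'n) tvec \<Rightarrow> real) \<Rightarrow>
    ('a \<Rightarrow> ('a, 'n) tvec \<Rightarrow> ('a \<Rightarrow> ('a, 'n) tvec) \<Rightarrow> ('a, 'n) tvec) \<Rightarrow>
    (real \<Rightarrow> 'a) \<Rightarrow> (real \<Rightarrow> ('a, 'n) tvec) \<Rightarrow> (real \<Rightarrow> ('a, 'n) tvec) \<Rightarrow> real" where
  "energy_hessian A g nab \<gamma> \<xi> \<eta> =
     (LINT x:{0..1}|lebesgue.
        g (\<gamma> x) (cov_deriv_along A nab \<gamma> \<xi> x) (cov_deriv_along A nab \<gamma> \<eta> x))
   - (LINT x:{0..1}|lebesgue.
        g (\<gamma> x) (curvature A nab (\<gamma> x) (velocity A \<gamma> x) (\<xi> x) (velocity A \<gamma> x)) (\<eta> x))"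

definition morse_index :: "('a, 'n::finite) chart set \<Rightarrow>
    ('a \<Rightarrow> ('a, 'n) tvec \<Rightarrow> ('a, 'n) tvec \<Rightarrow> real) \<Rightarrow>
    ('a \<Rightarrow> ('a, 'n) tvec \<Rightarrow> ('a \<Rightarrow> ('a, 'n) tvec) \<Rightarrow> ('a, 'n) tvec) \<Rightarrow>
    (real \<Rightarrow> 'a) \<Rightarrow> enat" where
  "morse_index A g nab \<gamma> =
     (SUP U \<in> {U. subspace U \<and> U \<subseteq> path_tangent_space A \<gamma> \<and>
                  (\<forall>\<xi>\<in>U. \<xi> \<noteq> 0 \<longrightarrow> energy_hessian A g nab \<gamma> \<xi> \<xi> < 0)}. edim U)"

end

theory Submission
  imports Defs
begin

text \<open>
  An orthonormal basis at the starting point of \<open>\<gamma>\<close> is transported parallel along \<open>\<gamma>\<close>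
  (\<open>parallel_frame_exists\<close>). In the resulting frame a field along \<open>\<gamma>\<close> becomes a function with values in
  \<open>\<real>\<^sup>n\<close>, covariant differentiation becomes ordinary differentiation (\<open>cov_deriv_field_of\<close>), and
  \<open>v \<mapsto> R(\<gamma>', v)\<gamma>'\<close> becomes a continuous family \<open>S\<close> of symmetric operators. The symmetry of \<open>S\<close> is that of
  the curvature tensor (\<open>curvature_symmetric\<close>), which follows from the first Bianchi identity and the
  skew symmetry in the last two arguments. The Jacobi equation turns into \<open>f'' = - S f\<close>, and the Hessian
  of the energy into the index form \<open>\<integral> \<bar>f'\<bar>\<^sup>2 - f \<bullet> S f\<close> on the \<open>H\<^sup>1\<close>-functions that vanish at both ends
  (\<open>hessian_field_of\<close>, \<open>path_field_coords\<close>). What remains is a statement about this equation.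

  Let \<open>X\<close> be the matrix solution with \<open>X 0 = 0\<close> and \<open>X' 0 = 1\<close>, and \<open>Y = X'\<close>. The Jacobi fields vanishing at \<open>0\<close> are
  the \<open>X v\<close>, and \<open>m(t)\<close> is the dimension of the kernel of \<open>X t\<close> (\<open>conj_mult_eq_multiplicity\<close>). Everything rests
  on the Lagrange identity: \<open>X\<^sup>T Y\<close> is symmetric. It shows that \<open>X\<close> degenerates to first order only
  (\<open>first_order_degeneration\<close>), so that conjugate instants are isolated and finite in number, and that \<open>Y t\<close>
  maps the kernel of \<open>X t\<close> onto the orthogonal complement of its range (\<open>in_range_if_orthogonal\<close>).

  For the upper bound, suppose that \<open>f t\<close> lies in the range of \<open>X t\<close> at each conjugate instant. Then
  \<open>f = X a\<close> for some coefficient \<open>a\<close>, and completing the square,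
  \<open>\<bar>f'\<bar>\<^sup>2 - f \<bullet> S f = \<bar>f' - Y a\<bar>\<^sup>2 + (f \<bullet> Y a)'\<close>, shows that the index form is nonnegative at \<open>f\<close>. Here \<open>a\<close> may be
  unbounded near a conjugate instant, but \<open>f \<bullet> Y a\<close> is continuous there (\<open>boundary_form_continuous\<close>,
  \<open>index_form_nonneg\<close>). The assumption amounts to the \<open>\<Sum>\<^sub>t m(t)\<close> linear conditions \<open>f t \<bullet> Y t b = 0\<close>, with \<open>b\<close> in a
  basis of the kernel of \<open>X t\<close>; hence a subspace on which the Hessian is negative definite has at most this
  dimension (\<open>edim_negative_subspace_le\<close>).

  For the lower bound, each \<open>c\<close> in the kernel of \<open>X t\<close> gives a broken Jacobi field, equal to \<open>X c\<close> on \<open>[0, t]\<close> and to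
  \<open>0\<close> on \<open>[t, 1]\<close>. On the span of these fields the index form vanishes, but its pairing with another
  function \<open>q\<close> sees the kinks: it is \<open>\<Sum>\<^sub>t Y t (c t) \<bullet> q t\<close>. Since \<open>1\<close> is not conjugate, all kinks are in the
  interior, and \<open>q\<close> can be chosen to vanish at both ends and to take the values \<open>Y t (c t)\<close> at the kinks. A
  small perturbation in the direction of \<open>- q\<close> then makes the index form negative definite, on a space of dimension
  \<open>\<Sum>\<^sub>t m(t)\<close> (\<open>negative_fields_exist\<close>, \<open>negative_subspace_exists\<close>).

  As the fields are only absolutely continuous, the integrations by parts rest on
  \<open>fundamental_theorem_of_calculus_absolutely_continuous\<close>.
\<close>

section \<open>Absolutely continuous functions and the fundamental theorem of calculus\<close>

lemma absolutely_continuous_on_subset: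
  "absolutely_continuous_on a b f \<Longrightarrow> a \<le> c \<Longrightarrow> d \<le> b \<Longrightarrow> absolutely_continuous_on c d f"
  unfolding absolutely_continuous_on_def
  by (meson atLeastatMost_subset_iff subset_trans)

lemma division_real_bounds:
  fixes D :: "real set set"
  assumes "D division_of \<Union>D" "\<Union>D \<subseteq> {a..b}" "K \<in> D"
  shows "Inf K \<in> {a..b}" "Sup K \<in> {a..b}" "Inf K \<le> Sup K" "K = {Inf K..Sup K}"
proof -
  obtain u v where K: "K = cbox u v" "K \<noteq> {}"
    using assms(1,3) by (metis division_ofD(3,4))
  then have "u \<le> v" "K = {u..v}" by auto
  moreover have "K \<subseteq> {a..b}" using assms by auto
  ultimately show "Inf K \<in> {a..b}" "Sup K \<in> {a..b}" "Inf K \<le> Sup K" "K = {Inf K..Sup K}" by auto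
qed

text \<open>The increments of sums, of products of bounded functions, and of quotients by functions bounded
  away from \<open>0\<close> are controlled in this way by those of the two constituents.\<close>

lemma absolutely_continuous_on_dominated:
  fixes f :: "real \<Rightarrow> 'a::real_normed_vector" and g :: "real \<Rightarrow> 'b::real_normed_vector"
    and h :: "real \<Rightarrow> 'c::real_normed_vector"
  assumes f: "absolutely_continuous_on a b f" and g: "absolutely_continuous_on a b g"
    and le: "\<And>s t. s \<in> {a..b} \<Longrightarrow> t \<in> {a..b} \<Longrightarrow>
      norm (h s - h t) \<le> C * (norm (f s - f t) + norm (g s - g t))"
  shows "absolutely_continuous_on a b h"
  unfolding absolutely_continuous_on_def
proof (intro allI impI)
  fix \<epsilon> :: real assume \<epsilon>: "\<epsilon> > 0"
  define C' where "C' = max C 1"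
  have C': "C' > 0" "C \<le> C'" by (auto simp: C'_def)
  define \<eta> where "\<eta> = \<epsilon> / (2 * C')"
  have \<eta>: "\<eta> > 0" using \<epsilon> C' by (simp add: \<eta>_def)
  obtain \<delta>1 where \<delta>1: "\<delta>1 > 0" "\<And>D. D division_of \<Union>D \<Longrightarrow> \<Union>D \<subseteq> {a..b} \<Longrightarrow>
        (\<Sum>K\<in>D. Sup K - Inf K) < \<delta>1 \<Longrightarrow> (\<Sum>K\<in>D. norm (f (Sup K) - f (Inf K))) < \<eta>"
    using f \<eta> unfolding absolutely_continuous_on_def by meson
  obtain \<delta>2 where \<delta>2: "\<delta>2 > 0" "\<And>D. D division_of \<Union>D \<Longrightarrow> \<Union>D \<subseteq> {a..b} \<Longrightarrow>
        (\<Sum>K\<in>D. Sup K - Inf K) < \<delta>2 \<Longrightarrow> (\<Sum>K\<in>D. norm (g (Sup K) - g (Inf K))) < \<eta>"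
    using g \<eta> unfolding absolutely_continuous_on_def by meson
  show "\<exists>\<delta>>0. \<forall>D. D division_of \<Union>D \<longrightarrow> \<Union>D \<subseteq> {a..b} \<longrightarrow>
        (\<Sum>K\<in>D. Sup K - Inf K) < \<delta> \<longrightarrow> (\<Sum>K\<in>D. norm (h (Sup K) - h (Inf K))) < \<epsilon>"
  proof (intro exI[of _ "min \<delta>1 \<delta>2"] conjI allI impI)
    show "min \<delta>1 \<delta>2 > 0" using \<delta>1 \<delta>2 by simp
    fix D assume D: "D division_of \<Union>D" "\<Union>D \<subseteq> {a..b}" "(\<Sum>K\<in>D. Sup K - Inf K) < min \<delta>1 \<delta>2"
    have "(\<Sum>K\<in>D. norm (h (Sup K) - h (Inf K))) \<le>
        (\<Sum>K\<in>D. C' * (norm (f (Sup K) - f (Inf K)) + norm (g (Sup K) - g (Inf K))))"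
    proof (rule sum_mono)
      fix K assume K: "K \<in> D"
      show "norm (h (Sup K) - h (Inf K)) \<le> C' * (norm (f (Sup K) - f (Inf K)) + norm (g (Sup K) - g (Inf K)))"
        by (rule order_trans[OF le[OF division_real_bounds(2,1)[OF D(1,2) K]] mult_right_mono])
          (use C' in auto)
    qed
    also have "\<dots> = C' * ((\<Sum>K\<in>D. norm (f (Sup K) - f (Inf K))) + (\<Sum>K\<in>D. norm (g (Sup K) - g (Inf K))))"
      by (simp add: sum_distrib_left sum.distrib distrib_left)
    also have "\<dots> < C' * (\<eta> + \<eta>)"
      using \<delta>1(2)[OF D(1,2)] \<delta>2(2)[OF D(1,2)] D(3) C' by (intro mult_strict_left_mono add_strict_mono) auto
    also have "\<dots> = \<epsilon>" using C' by (simp add: \<eta>_def field_simps)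
    finally show "(\<Sum>K\<in>D. norm (h (Sup K) - h (Inf K))) < \<epsilon>" .
  qed
qed

lemma absolutely_continuous_on_ident: "absolutely_continuous_on a b (\<lambda>x::real. x)"
  unfolding absolutely_continuous_on_def
proof (intro allI impI)
  fix \<epsilon> :: real assume \<epsilon>: "\<epsilon> > 0"
  show "\<exists>\<delta>>0. \<forall>D. D division_of \<Union>D \<longrightarrow> \<Union>D \<subseteq> {a..b} \<longrightarrow>
        (\<Sum>K\<in>D. Sup K - Inf K) < \<delta> \<longrightarrow> (\<Sum>K\<in>D. norm (Sup K - Inf K)) < \<epsilon>"
  proof (intro exI[of _ \<epsilon>] conjI allI impI \<epsilon>)
    fix D :: "real set set" assume D: "D division_of \<Union>D" "\<Union>D \<subseteq> {a..b}" "(\<Sum>K\<in>D. Sup K - Inf K) < \<epsilon>"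
    have "(\<Sum>K\<in>D. norm (Sup K - Inf K)) = (\<Sum>K\<in>D. Sup K - Inf K)"
      by (intro sum.cong) (use division_real_bounds(3)[OF D(1,2)] in auto)
    then show "(\<Sum>K\<in>D. norm (Sup K - Inf K)) < \<epsilon>" using D by simp
  qed
qed

lemma absolutely_continuous_on_Lipschitz:
  fixes h :: "real \<Rightarrow> 'c::real_normed_vector"
  assumes "\<And>s t. s \<in> {a..b} \<Longrightarrow> t \<in> {a..b} \<Longrightarrow> norm (h s - h t) \<le> C * \<bar>s - t\<bar>"
  shows "absolutely_continuous_on a b h"
  by (rule absolutely_continuous_on_dominated[OF absolutely_continuous_on_ident absolutely_continuous_on_ident,
      of a b h "C/2"]) (use assms in force)

lemma absolutely_continuous_on_imp_continuous_on:
  fixes f :: "real \<Rightarrow> 'a::real_normed_vector"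
  assumes "absolutely_continuous_on a b f"
  shows "continuous_on {a..b} f"
  unfolding continuous_on_iff
proof (intro ballI allI impI)
  fix x :: real and e :: real assume x: "x \<in> {a..b}" and e: "0 < e"
  obtain \<delta> where \<delta>: "\<delta> > 0" "\<And>D. D division_of \<Union>D \<Longrightarrow> \<Union>D \<subseteq> {a..b} \<Longrightarrow>
        (\<Sum>K\<in>D. Sup K - Inf K) < \<delta> \<Longrightarrow> (\<Sum>K\<in>D. norm (f (Sup K) - f (Inf K))) < e"
    using assms e unfolding absolutely_continuous_on_def by meson
  show "\<exists>d>0. \<forall>x'\<in>{a..b}. dist x' x < d \<longrightarrow> dist (f x') (f x) < e"
  proof (intro exI[of _ \<delta>] conjI ballI impI \<delta>(1))
    fix y assume y: "y \<in> {a..b}" "dist y x < \<delta>"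
    define D where "D = {cbox (min x y) (max x y)}"
    have "{cbox (min x y) (max x y)} division_of cbox (min x y) (max x y)"
      by (rule division_of_self) auto
    then have "D division_of \<Union>D" by (simp add: D_def)
    moreover have "\<Union>D \<subseteq> {a..b}" using x y by (auto simp: D_def)
    moreover have "(\<Sum>K\<in>D. Sup K - Inf K) < \<delta>" using y by (auto simp: D_def dist_real_def)
    ultimately have "(\<Sum>K\<in>D. norm (f (Sup K) - f (Inf K))) < e" by (rule \<delta>(2))
    then show "dist (f y) (f x) < e"
      by (cases "x \<le> y") (auto simp: D_def dist_norm norm_minus_commute)
  qed
qed

lemma absolutely_continuous_on_bounded:
  fixes h :: "real \<Rightarrow> 'd::real_normed_vector"
  assumes "absolutely_continuous_on a b h"
  shows "\<exists>M\<ge>0. \<forall>x\<in>{a..b}. norm (h x) \<le> M"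
proof -
  have "bounded (h ` {a..b})"
    using absolutely_continuous_on_imp_continuous_on[OF assms]
    by (intro compact_imp_bounded compact_continuous_image) auto
  then obtain M where "\<forall>x\<in>{a..b}. norm (h x) \<le> M" unfolding bounded_iff by auto
  then show ?thesis by (intro exI[of _ "max M 0"]) auto
qed

lemma absolutely_continuous_on_bilinear:
  fixes f :: "real \<Rightarrow> 'a::real_normed_vector" and g :: "real \<Rightarrow> 'b::real_normed_vector"
    and B :: "'a \<Rightarrow> 'b \<Rightarrow> 'c::real_normed_vector"
  assumes B: "bounded_bilinear B"
    and f: "absolutely_continuous_on a b f" and g: "absolutely_continuous_on a b g"
  shows "absolutely_continuous_on a b (\<lambda>x. B (f x) (g x))"
proof -
  interpret bounded_bilinear B by (rule B)
  obtain K where K: "K \<ge> 0" "\<And>x y. norm (B x y) \<le> norm x * norm y * K" using nonneg_bounded by blast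
  obtain M where M: "M \<ge> 0" "\<And>x. x\<in>{a..b} \<Longrightarrow> norm (f x) \<le> M" using absolutely_continuous_on_bounded[OF f] by auto
  obtain N where N: "N \<ge> 0" "\<And>x. x\<in>{a..b} \<Longrightarrow> norm (g x) \<le> N" using absolutely_continuous_on_bounded[OF g] by auto
  show ?thesis
  proof (rule absolutely_continuous_on_dominated[OF f g])
    fix s t assume st: "s \<in> {a..b}" "t \<in> {a..b}"
    have "B (f s) (g s) - B (f t) (g t) = B (f s) (g s - g t) + B (f s - f t) (g t)"
      by (simp add: diff_left diff_right)
    then have "norm (B (f s) (g s) - B (f t) (g t)) \<le> norm (f s) * norm (g s - g t) * K + norm (f s - f t) * norm (g t) * K"
      using K(2)[of "f s" "g s - g t"] K(2)[of "f s - f t" "g t"] norm_triangle_mono by metis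
    also have "\<dots> \<le> M * norm (g s - g t) * K + norm (f s - f t) * N * K"
      using M N K st by (intro add_mono mult_right_mono mult_left_mono) auto
    also have "\<dots> \<le> ((M + N) * K) * (norm (f s - f t) + norm (g s - g t))"
      using M N K by (simp add: algebra_simps)
    finally show "norm (B (f s) (g s) - B (f t) (g t)) \<le> ((M + N) * K) * (norm (f s - f t) + norm (g s - g t))" .
  qed
qed

lemma absolutely_continuous_on_add:
  fixes f :: "real \<Rightarrow> 'a::real_normed_vector"
  assumes "absolutely_continuous_on a b f" "absolutely_continuous_on a b g"
  shows "absolutely_continuous_on a b (\<lambda>x. f x + g x)"
  by (rule absolutely_continuous_on_dominated[OF assms, of _ 1])
    (simp add: norm_diff_triangle_ineq)

lemma open_superset_of_negligible:
  fixes N :: "'a::euclidean_space set"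
  assumes "negligible N" "e > 0"
  obtains G where "open G" "N \<subseteq> G" "G \<in> lmeasurable" "measure lebesgue G < e"
proof -
  have "N \<in> sets lebesgue" using assms negligible_imp_sets by blast
  then obtain G where G: "open G" "N \<subseteq> G" "G - N \<in> lmeasurable" "emeasure lebesgue (G - N) < ennreal e"
    using assms(2) by (rule sets_lebesgue_outer_open)
  have 1: "N \<in> lmeasurable" "measure lebesgue N = 0"
    using assms by (auto simp: negligible_imp_measurable negligible_imp_measure0)
  have eq: "G = (G - N) \<union> N" using G by auto
  then have "G \<in> lmeasurable" using G(3) 1(1) by (metis fmeasurable.Un)
  moreover have "measure lebesgue G \<le> measure lebesgue (G - N) + measure lebesgue N"
    by (subst eq, rule measure_Un_le) (use G(3) 1 in \<open>auto simp: fmeasurableD\<close>)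
  moreover have "measure lebesgue (G - N) < e"
    using G(3,4) assms(2) by (metis emeasure_eq_measure2 ennreal_less_iff measure_nonneg)
  ultimately show ?thesis using G 1 that by auto
qed

text \<open>A tagged division is split according to whether a tag lies in the exceptional null set \<open>N\<close>.
  Off \<open>N\<close> differentiability gives the usual straddle estimate; the intervals tagged in \<open>N\<close> can be
  forced into an open set of small measure, so that by absolute continuity they contribute little
  variation.\<close>

theorem fundamental_theorem_of_calculus_absolutely_continuous:
  fixes f :: "real \<Rightarrow> 'a::banach"
  assumes "a \<le> b" and ac: "absolutely_continuous_on a b f" and N: "negligible N"
    and deriv: "\<And>x. x \<in> {a..b} - N \<Longrightarrow> (f has_vector_derivative f' x) (at x within {a..b})"
  shows "(f' has_integral (f b - f a)) {a..b}"
proof -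
  \<comment> \<open>Changing \<open>f'\<close> on \<open>N\<close> removes the terms with a tag in \<open>N\<close> from the Riemann sums.\<close>
  define g where "g x = (if x \<in> N then 0 else f' x)" for x
  have "(g has_integral (f b - f a)) {a..b}"
    unfolding has_integral_real
  proof (intro allI impI)
    fix e :: real assume e: "e > 0"
    define e' where "e' = e / (2 * (b - a + 1))"
    have e': "e' > 0" "e' * (b - a) \<le> e / 2" using e \<open>a \<le> b\<close>
      by (auto simp: e'_def field_simps)
    have "\<forall>x. \<exists>d>0. x \<in> {a..b} - N \<longrightarrow>
         (\<forall>y\<in>{a..b}. norm (y-x) < d \<longrightarrow> norm (f y - f x - (y-x) *\<^sub>R f' x) \<le> e' * norm (y-x))"
      using deriv[unfolded has_vector_derivative_def has_derivative_within_alt] e'(1) by (meson zero_less_one)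
    then obtain d where d: "\<And>x. 0 < d x"
      "\<And>x y. \<lbrakk>x \<in> {a..b} - N; y \<in> {a..b}; norm (y-x) < d x\<rbrakk>
                        \<Longrightarrow> norm (f y - f x - (y-x) *\<^sub>R f' x) \<le> e' * norm (y-x)"
      by metis
    obtain \<delta> where \<delta>: "\<delta> > 0" "\<And>D. D division_of \<Union>D \<Longrightarrow> \<Union>D \<subseteq> {a..b} \<Longrightarrow>
        (\<Sum>K\<in>D. Sup K - Inf K) < \<delta> \<Longrightarrow> (\<Sum>K\<in>D. norm (f (Sup K) - f (Inf K))) < e / 2"
      using ac e half_gt_zero unfolding absolutely_continuous_on_def by meson
    obtain G where G: "open G" "N \<subseteq> G" "G \<in> lmeasurable" "measure lebesgue G < \<delta>"
      using open_superset_of_negligible[OF N \<delta>(1)] .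
    \<comment> \<open>The gauge forces intervals with a tag in \<open>N\<close> into \<open>G\<close>.\<close>
    define \<gamma> where "\<gamma> x = (if x \<in> N then G else ball x (d x))" for x
    show "\<exists>\<gamma>. gauge \<gamma> \<and> (\<forall>\<D>. \<D> tagged_division_of {a..b} \<and> \<gamma> fine \<D> \<longrightarrow>
           norm ((\<Sum>(x,k)\<in>\<D>. measure lborel k *\<^sub>R g x) - (f b - f a)) < e)"
    proof (intro exI[of _ \<gamma>] conjI allI impI)
      show "gauge \<gamma>" using G d by (auto simp: gauge_def \<gamma>_def)
      fix p assume "p tagged_division_of {a..b} \<and> \<gamma> fine p"
      then have p: "p tagged_division_of {a..b}" and fine: "\<gamma> fine p" by auto
      have fin: "finite p" using p by blast
      have K: "x \<in> K \<and> Inf K \<in> {a..b} \<and> Sup K \<in> {a..b} \<and> Inf K \<le> Sup K \<and> K \<subseteq> {a..b}"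
        if xK: "(x,K) \<in> p" for x K
      proof -
        have "x \<in> K" "K \<subseteq> {a..b}" using p xK by blast+
        moreover obtain u v where "K = cbox u v" using p xK by blast
        ultimately show ?thesis by auto
      qed
      have Kint: "\<exists>u v. K = {u..v}" if "(x,K) \<in> p" for x K
        using p that by (metis box_real(2) tagged_division_ofD(4))
      define pN where "pN = {(x,K) \<in> p. x \<in> N}"
      define pC where "pC = {(x,K) \<in> p. x \<notin> N}"
      have split: "p = pN \<union> pC" "pN \<inter> pC = {}" "finite pN" "finite pC" "pN \<subseteq> p"
        using fin by (auto simp: pN_def pC_def intro: finite_subset[OF _ fin])
      have tpart: "pN tagged_partial_division_of {a..b}"
        using tagged_partial_division_subset[OF _ split(5)] p by (simp add: tagged_division_of_def)
      have pNdiv: "pN tagged_division_of \<Union>(snd ` pN)"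
        by (rule tagged_partial_division_of_Union_self[OF tpart])
      define D where "D = snd ` pN"
      have D: "D division_of \<Union>D" unfolding D_def
        by (rule partial_division_of_tagged_division[OF tpart])
      have Dsub: "\<Union>D \<subseteq> {a..b}" unfolding D_def pN_def using K by fastforce
      have DG: "\<Union>D \<subseteq> G" using fine by (force simp: D_def pN_def fine_def \<gamma>_def)
      have "(\<Sum>K\<in>D. Sup K - Inf K) = (\<Sum>K\<in>D. measure lebesgue K)"
      proof (rule sum.cong[OF refl])
        fix K assume KD: "K \<in> D"
        have *: "Inf K \<le> Sup K" "K = {Inf K..Sup K}" using division_real_bounds(3,4)[OF D Dsub KD] .
        have "measure lebesgue {Inf K..Sup K} = Sup K - Inf K" using *(1) by simp
        then show "Sup K - Inf K = measure lebesgue K" using *(2) by simp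
      qed
      also have "\<dots> = measure lebesgue (\<Union>D)"
        by (rule content_division[OF D])
      also have "\<dots> \<le> measure lebesgue G"
        using D DG G by (intro measure_mono_fmeasurable) (auto intro!: fmeasurableD lmeasurable_division)
      finally have "(\<Sum>K\<in>D. norm (f (Sup K) - f (Inf K))) < e / 2"
        using G(4) by (intro \<delta>(2)[OF D Dsub]) simp
      moreover have "(\<Sum>(x,K)\<in>pN. norm (f (Sup K) - f (Inf K))) = (\<Sum>K\<in>D. norm (f (Sup K) - f (Inf K)))"
      proof -
        let ?h = "\<lambda>K. if K = {} then 0 else norm (f (Sup K) - f (Inf K))"
        have "(\<Sum>(x,K)\<in>pN. ?h K) = (\<Sum>K\<in>snd ` pN. ?h K)"
          by (rule sum.over_tagged_division_lemma[OF pNdiv]) auto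
        moreover have "(\<Sum>(x,K)\<in>pN. ?h K) = (\<Sum>(x,K)\<in>pN. norm (f (Sup K) - f (Inf K)))"
        proof (intro sum.cong refl, clarify)
          fix x K' assume "(x, K') \<in> pN"
          then have "K' \<noteq> {}" using K split(5) by blast
          then show "?h K' = norm (f (Sup K') - f (Inf K'))" by simp
        qed
        moreover have "(\<Sum>K\<in>D. ?h K) = (\<Sum>K\<in>D. norm (f (Sup K) - f (Inf K)))"
          using D by (intro sum.cong) auto
        ultimately show ?thesis by (simp add: D_def)
      qed
      ultimately have N_small: "(\<Sum>(x,K)\<in>pN. norm (f (Sup K) - f (Inf K))) < e / 2" by simp
      have "(\<Sum>(x,K)\<in>pC. norm (measure lborel K *\<^sub>R g x - (f (Sup K) - f (Inf K)))) \<le> (\<Sum>(x,K)\<in>pC. e' * (Sup K - Inf K))"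
      proof (rule sum_mono, clarify)
        fix x K assume xK: "(x,K) \<in> pC"
        then have xKp: "(x,K) \<in> p" "x \<notin> N" by (auto simp: pC_def)
        define u v where "u = Inf K" and "v = Sup K"
        have uv: "x \<in> {u..v}" "K = {u..v}" "u \<le> v" "u \<in> {a..b}" "v \<in> {a..b}"
          using K[OF xKp(1)] Kint[OF xKp(1)] by (auto simp: u_def v_def)
        have "K \<subseteq> \<gamma> x" using fine xKp by (auto simp: fine_def)
        then have "K \<subseteq> ball x (d x)" using xKp by (simp add: \<gamma>_def)
        moreover have "u \<in> K" "v \<in> K" using uv by auto
        ultimately have "u \<in> ball x (d x)" "v \<in> ball x (d x)" by blast+
        then have "norm (u - x) < d x" "norm (v - x) < d x" by (auto simp: dist_real_def)
        moreover have "x \<in> {a..b} - N" using uv xKp by auto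
        ultimately have "norm (f u - f x - (u-x) *\<^sub>R f' x) \<le> e' * norm (u-x)"
            "norm (f v - f x - (v-x) *\<^sub>R f' x) \<le> e' * norm (v-x)"
          using d(2)[of x u] d(2)[of x v] uv(4,5) by blast+
        moreover have "measure lborel K *\<^sub>R g x - (f v - f u) =
           (f u - f x - (u-x) *\<^sub>R f' x) - (f v - f x - (v-x) *\<^sub>R f' x)"
          using uv xKp by (simp add: g_def algebra_simps)
        ultimately have "norm (measure lborel K *\<^sub>R g x - (f v - f u)) \<le> e' * norm (u-x) + e' * norm (v-x)"
          by (simp only:) (rule order_trans[OF norm_triangle_ineq4 add_mono])
        also have "\<dots> = e' * (v - u)" using uv by (simp add: algebra_simps)
        finally show "norm (measure lborel K *\<^sub>R g x - (f (Sup K) - f (Inf K))) \<le> e' * (Sup K - Inf K)"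
          by (simp add: u_def v_def)
      qed
      also have "\<dots> \<le> (\<Sum>(x,K)\<in>p. e' * (Sup K - Inf K))"
      proof (rule sum_mono2[OF fin])
        fix y assume "y \<in> p - pC"
        then obtain x K' where "y = (x, K')" "(x, K') \<in> p" by (cases y) auto
        then show "0 \<le> (case y of (x, K) \<Rightarrow> e' * (Sup K - Inf K))" using K e'(1) by simp
      qed (use split in auto)
      also have "\<dots> = e' * (b - a)"
        using additive_tagged_division_1[OF \<open>a \<le> b\<close> p, of "\<lambda>x. e' * x"]
        by (simp add: algebra_simps)
      finally have C_small: "(\<Sum>(x,K)\<in>pC. norm (measure lborel K *\<^sub>R g x - (f (Sup K) - f (Inf K)))) \<le> e / 2"
        using e' by linarith
      have "(\<Sum>(x,k)\<in>p. measure lborel k *\<^sub>R g x) - (f b - f a) =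
          (\<Sum>(x,K)\<in>p. measure lborel K *\<^sub>R g x - (f (Sup K) - f (Inf K)))"
        using additive_tagged_division_1[OF \<open>a \<le> b\<close> p, of f]
        by (simp add: sum_subtractf case_prod_unfold)
      also have "\<dots> = (\<Sum>(x,K)\<in>pN. measure lborel K *\<^sub>R g x - (f (Sup K) - f (Inf K))) +
          (\<Sum>(x,K)\<in>pC. measure lborel K *\<^sub>R g x - (f (Sup K) - f (Inf K)))"
        unfolding split(1) by (rule sum.union_disjoint) (use split in auto)
      also have "(\<Sum>(x,K)\<in>pN. measure lborel K *\<^sub>R g x - (f (Sup K) - f (Inf K))) =
          (\<Sum>(x,K)\<in>pN. - (f (Sup K) - f (Inf K)))"
        by (intro sum.cong) (auto simp: pN_def g_def)
      finally have "norm ((\<Sum>(x,k)\<in>p. measure lborel k *\<^sub>R g x) - (f b - f a)) \<le>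
          norm (\<Sum>(x,K)\<in>pN. - (f (Sup K) - f (Inf K))) +
          norm (\<Sum>(x,K)\<in>pC. measure lborel K *\<^sub>R g x - (f (Sup K) - f (Inf K)))"
        by (simp only: norm_triangle_ineq)
      also have "\<dots> \<le> (\<Sum>(x,K)\<in>pN. norm (f (Sup K) - f (Inf K))) +
          (\<Sum>(x,K)\<in>pC. norm (measure lborel K *\<^sub>R g x - (f (Sup K) - f (Inf K))))"
        by (intro add_mono order_trans[OF norm_sum] sum_mono) (auto simp: norm_minus_commute)
      finally show "norm ((\<Sum>(x,k)\<in>p. measure lborel k *\<^sub>R g x) - (f b - f a)) < e"
        using N_small C_small by linarith
    qed
  qed
  then show ?thesis
    by (rule has_integral_spike[OF N, rotated]) (auto simp: g_def)
qed

section \<open>Sobolev functions\<close>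

text \<open>\<open>u\<close> is any representative of the almost everywhere derivative of \<open>f\<close>. For the nonnegative function
  \<open>\<bar>u\<bar>\<^sup>2\<close>, Henstock--Kurzweil and Lebesgue integrability agree.\<close>

definition H1_deriv :: "real \<Rightarrow> real \<Rightarrow> (real \<Rightarrow> 'a::euclidean_space) \<Rightarrow> (real \<Rightarrow> 'a) \<Rightarrow> bool" where
  "H1_deriv a b f u \<longleftrightarrow> absolutely_continuous_on a b f \<and>
     (\<exists>N. negligible N \<and> (\<forall>x\<in>{a..b} - N. (f has_vector_derivative u x) (at x within {a..b}))) \<and>
     (\<lambda>x. (norm (u x))\<^sup>2) integrable_on {a..b}"

lemma H1_deriv_subset:
  assumes "H1_deriv a b f u" "a \<le> c" "d \<le> b"
  shows "H1_deriv c d f u"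
proof -
  have sub: "{c..d} \<subseteq> {a..b}" using assms by auto
  obtain N where N: "negligible N" "\<forall>x\<in>{a..b} - N. (f has_vector_derivative u x) (at x within {a..b})"
    using assms unfolding H1_deriv_def by blast
  have "\<forall>x\<in>{c..d} - N. (f has_vector_derivative u x) (at x within {c..d})"
    using N(2) sub by (meson DiffD1 DiffD2 DiffI has_vector_derivative_within_subset subsetD)
  moreover have "(\<lambda>x. (norm (u x))\<^sup>2) integrable_on {c..d}"
    using assms sub unfolding H1_deriv_def by (meson integrable_on_subinterval)
  ultimately show ?thesis using assms N unfolding H1_deriv_def
    by (blast intro: absolutely_continuous_on_subset)
qed

lemma H1_deriv_has_integral:
  assumes "H1_deriv a b f u" "a \<le> s" "s \<le> t" "t \<le> b"
  shows "(u has_integral (f t - f s)) {s..t}"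
proof -
  have "H1_deriv s t f u" using assms by (auto intro: H1_deriv_subset)
  then obtain N where "absolutely_continuous_on s t f" "negligible N"
      "\<forall>x\<in>{s..t} - N. (f has_vector_derivative u x) (at x within {s..t})"
    unfolding H1_deriv_def by blast
  then show ?thesis using assms
    by (intro fundamental_theorem_of_calculus_absolutely_continuous) auto
qed

text \<open>The Cauchy--Schwarz inequality, in the additive form that comes from integrating
  \<open>y \<le> \<eta> y\<^sup>2 + 1 / (4 \<eta>)\<close>.\<close>

lemma norm_integral_le_energy:
  fixes u :: "real \<Rightarrow> 'a::euclidean_space"
  assumes u: "(u has_integral I) {s..t}" and u2: "(\<lambda>x. (norm (u x))\<^sup>2) integrable_on {s..t}"
    and "s \<le> t" and \<eta>: "\<eta> > 0"
  shows "norm I \<le> \<eta> * integral {s..t} (\<lambda>x. (norm (u x))\<^sup>2) + (t - s) / (4 * \<eta>)"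
proof -
  have "norm (integral {s..t} u) \<le> integral {s..t} (\<lambda>x. \<eta> * (norm (u x))\<^sup>2 + 1 / (4 * \<eta>))"
  proof (rule integral_norm_bound_integral)
    show "u integrable_on {s..t}" using u by blast
    show "(\<lambda>x. \<eta> * (norm (u x))\<^sup>2 + 1 / (4 * \<eta>)) integrable_on {s..t}"
      using u2 by (intro integrable_add integrable_on_mult_right integrable_const_ivl)
    fix x
    have "\<eta> * y\<^sup>2 + 1 / (4 * \<eta>) - y = (2 * \<eta> * y - 1)\<^sup>2 / (4 * \<eta>)" for y
      using \<eta> by (simp add: field_simps power2_eq_square)
    from this[of "norm (u x)"] show "norm (u x) \<le> \<eta> * (norm (u x))\<^sup>2 + 1 / (4 * \<eta>)"
      using \<eta> by (smt (verit) divide_nonneg_pos zero_le_power2)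
  qed
  also have "\<dots> = \<eta> * integral {s..t} (\<lambda>x. (norm (u x))\<^sup>2) + (t - s) / (4 * \<eta>)"
    using u2 \<open>s \<le> t\<close> by (subst integral_add) (auto intro!: integrable_on_mult_right)
  finally show ?thesis using integral_unique[OF u] by simp
qed

text \<open>Absolute continuity of the integral is elementary for a square integrable integrand:
  \<open>\<bar>u\<bar> \<le> \<eta> \<bar>u\<bar>\<^sup>2 + 1 / (4 \<eta>)\<close> bounds the variation by a small multiple of the energy plus a
  multiple of the length.\<close>

lemma absolutely_continuous_on_indefinite_integral:
  fixes f u :: "real \<Rightarrow> 'a::euclidean_space"
  assumes u: "\<And>s t. a \<le> s \<Longrightarrow> s \<le> t \<Longrightarrow> t \<le> b \<Longrightarrow> (u has_integral (f t - f s)) {s..t}"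
    and u2: "(\<lambda>x. (norm (u x))\<^sup>2) integrable_on {a..b}"
  shows "absolutely_continuous_on a b f"
  unfolding absolutely_continuous_on_def
proof (intro allI impI)
  fix \<epsilon> :: real assume \<epsilon>: "\<epsilon> > 0"
  define E where "E = integral {a..b} (\<lambda>x. (norm (u x))\<^sup>2)"
  have E: "E \<ge> 0" unfolding E_def by (rule integral_nonneg[OF u2]) auto
  define \<eta> where "\<eta> = \<epsilon> / (2 * (E + 1))"
  have \<eta>: "\<eta> > 0" "\<eta> * E \<le> \<epsilon> / 2" using \<epsilon> E by (auto simp: \<eta>_def field_simps)
  show "\<exists>\<delta>>0. \<forall>D. D division_of \<Union>D \<longrightarrow> \<Union>D \<subseteq> {a..b} \<longrightarrow>
        (\<Sum>K\<in>D. Sup K - Inf K) < \<delta> \<longrightarrow> (\<Sum>K\<in>D. norm (f (Sup K) - f (Inf K))) < \<epsilon>"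
  \<comment> \<open>With total length below \<open>2 \<eta> \<epsilon>\<close>, the second term of the bound stays below \<open>\<epsilon> / 2\<close>.\<close>
  proof (intro exI[of _ "2 * \<eta> * \<epsilon>"] conjI allI impI)
    show "2 * \<eta> * \<epsilon> > 0" using \<eta> \<epsilon> by simp
    fix D assume D: "D division_of \<Union>D" "\<Union>D \<subseteq> {a..b}" "(\<Sum>K\<in>D. Sup K - Inf K) < 2 * \<eta> * \<epsilon>"
    have "(\<Sum>K\<in>D. norm (f (Sup K) - f (Inf K)))
        \<le> (\<Sum>K\<in>D. \<eta> * integral K (\<lambda>x. (norm (u x))\<^sup>2) + (Sup K - Inf K) / (4 * \<eta>))"
    proof (rule sum_mono)
      fix K assume K: "K \<in> D"
      define s t where "s = Inf K" and "t = Sup K"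
      have st: "a \<le> s" "s \<le> t" "t \<le> b" "K = {s..t}"
        using division_real_bounds[OF D(1,2) K] by (auto simp: s_def t_def)
      have u': "(u has_integral (f t - f s)) {s..t}" using st by (intro u)
      have u2': "(\<lambda>x. (norm (u x))\<^sup>2) integrable_on {s..t}"
        using st by (intro integrable_on_subinterval[OF u2]) auto
      show "norm (f (Sup K) - f (Inf K)) \<le> \<eta> * integral K (\<lambda>x. (norm (u x))\<^sup>2) + (Sup K - Inf K) / (4 * \<eta>)"
        using norm_integral_le_energy[OF u' u2' st(2) \<eta>(1)]
        unfolding s_def[symmetric] t_def[symmetric] unfolding st(4) .
    qed
    also have "\<dots> = \<eta> * (\<Sum>K\<in>D. integral K (\<lambda>x. (norm (u x))\<^sup>2)) + (\<Sum>K\<in>D. Sup K - Inf K) / (4 * \<eta>)"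
      by (simp add: sum.distrib sum_distrib_left sum_divide_distrib)
    also have "(\<Sum>K\<in>D. integral K (\<lambda>x. (norm (u x))\<^sup>2)) = integral (\<Union>D) (\<lambda>x. (norm (u x))\<^sup>2)"
      using D u2 by (intro integral_combine_division_topdown[symmetric] integrable_on_subdivision[OF D(1)])
    also have "\<dots> \<le> E" unfolding E_def
      using D u2 by (intro integral_subset_le integrable_on_subdivision[OF D(1)]) auto
    also have "\<eta> * E + (\<Sum>K\<in>D. Sup K - Inf K) / (4 * \<eta>) < \<epsilon>"
    proof -
      have "(\<Sum>K\<in>D. Sup K - Inf K) / (4 * \<eta>) < \<epsilon> / 2" using D(3) \<eta> by (simp add: field_simps)
      then show ?thesis using \<eta> by simp
    qed
    finally show "(\<Sum>K\<in>D. norm (f (Sup K) - f (Inf K))) < \<epsilon>" using \<eta> by (simp add: mult_left_mono)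
  qed
qed

text \<open>Absolute continuity on the union is read off from the integral representation, which is additive;
  intervals of a division that contain \<open>b\<close> need not be cut.\<close>

lemma H1_deriv_combine:
  assumes ab: "H1_deriv a b f u" and bc: "H1_deriv b c f u" and "a \<le> b" "b \<le> c"
  shows "H1_deriv a c f u"
proof -
  obtain N1 where N1: "negligible N1" "\<forall>x\<in>{a..b} - N1. (f has_vector_derivative u x) (at x within {a..b})"
    using ab unfolding H1_deriv_def by blast
  obtain N2 where N2: "negligible N2" "\<forall>x\<in>{b..c} - N2. (f has_vector_derivative u x) (at x within {b..c})"
    using bc unfolding H1_deriv_def by blast
  define N where "N = N1 \<union> N2 \<union> {b}"
  have N: "negligible N" using N1 N2 by (auto simp: N_def intro!: negligible_Un)
  have "(f has_vector_derivative u x) (at x within {a..c})" if x: "x \<in> {a..c} - N" for x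
  proof (cases "x < b")
    case True
    then have "at x within {a..b} = at x within {a..c}"
      using \<open>b \<le> c\<close> by (intro at_within_nhd[of x "{..<b}"]) auto
    moreover have "x \<in> {a..b} - N1" using True x by (auto simp: N_def)
    ultimately show ?thesis using N1(2) by metis
  next
    case False
    then have "x > b" using x by (auto simp: N_def)
    then have "at x within {b..c} = at x within {a..c}"
      using \<open>a \<le> b\<close> by (intro at_within_nhd[of x "{b<..}"]) auto
    moreover have "x \<in> {b..c} - N2" using False x by (auto simp: N_def)
    ultimately show ?thesis using N2(2) by metis
  qed
  moreover have u2: "(\<lambda>x. (norm (u x))\<^sup>2) integrable_on {a..c}"
    using ab bc by (intro Henstock_Kurzweil_Integration.integrable_combine[OF assms(3,4)]) (auto simp: H1_deriv_def)
  moreover have "absolutely_continuous_on a c f"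
  proof (rule absolutely_continuous_on_indefinite_integral[OF _ u2])
    fix s t assume st: "a \<le> s" "s \<le> t" "t \<le> c"
    consider "t \<le> b" | "b \<le> s" | "s \<le> b" "b \<le> t" by linarith
    then show "(u has_integral (f t - f s)) {s..t}"
    proof cases
      case 1 then show ?thesis using st by (intro H1_deriv_has_integral[OF ab])
    next
      case 2 then show ?thesis using st by (intro H1_deriv_has_integral[OF bc])
    next
      case 3
      then have "(u has_integral (f b - f s)) {s..b}" "(u has_integral (f t - f b)) {b..t}"
        using st by (auto intro: H1_deriv_has_integral[OF ab] H1_deriv_has_integral[OF bc])
      then show ?thesis using has_integral_combine[OF 3] by fastforce
    qed
  qed
  ultimately show ?thesis using N unfolding H1_deriv_def by blast
qed

lemma H1_deriv_continuous: "H1_deriv a b f u \<Longrightarrow> continuous_on {a..b} f"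
  by (auto simp: H1_deriv_def intro: absolutely_continuous_on_imp_continuous_on)

lemma H1_deriv_integrable:
  assumes "H1_deriv a b f u"
  shows "u integrable_on {a..b}"
  using H1_deriv_has_integral[OF assms, of a b] by (cases "a \<le> b") (auto intro: has_integral_integrable)

lemma H1_deriv_bilinear:
  fixes f :: "real \<Rightarrow> 'a::euclidean_space" and g :: "real \<Rightarrow> 'b::euclidean_space"
    and B :: "'a \<Rightarrow> 'b \<Rightarrow> 'c::euclidean_space"
  assumes B: "bounded_bilinear B" and f: "H1_deriv a b f u" and g: "H1_deriv a b g v"
  shows "H1_deriv a b (\<lambda>x. B (f x) (g x)) (\<lambda>x. B (f x) (v x) + B (u x) (g x))"
proof (cases "a \<le> b")
  case True
  interpret bounded_bilinear B by (rule B)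
  let ?w = "\<lambda>x. B (f x) (v x) + B (u x) (g x)"
  have ac: "absolutely_continuous_on a b (\<lambda>x. B (f x) (g x))"
    using f g by (intro absolutely_continuous_on_bilinear[OF B]) (auto simp: H1_deriv_def)
  obtain N1 where N1: "negligible N1" "\<forall>x\<in>{a..b} - N1. (f has_vector_derivative u x) (at x within {a..b})"
    using f unfolding H1_deriv_def by blast
  obtain N2 where N2: "negligible N2" "\<forall>x\<in>{a..b} - N2. (g has_vector_derivative v x) (at x within {a..b})"
    using g unfolding H1_deriv_def by blast
  have N: "negligible (N1 \<union> N2)" using N1 N2 by auto
  have d: "((\<lambda>x. B (f x) (g x)) has_vector_derivative ?w x) (at x within {a..b})" if "x \<in> {a..b} - (N1 \<union> N2)" for x
    using that N1 N2 by (intro has_vector_derivative) auto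
  have w: "?w integrable_on {a..b}"
    using fundamental_theorem_of_calculus_absolutely_continuous[OF True ac N d] by (auto intro: has_integral_integrable)
  obtain K where K: "K \<ge> 0" "\<And>x y. norm (B x y) \<le> norm x * norm y * K" using nonneg_bounded by blast
  obtain M1 where M1: "M1 \<ge> 0" "\<And>x. x\<in>{a..b} \<Longrightarrow> norm (f x) \<le> M1" using absolutely_continuous_on_bounded f unfolding H1_deriv_def by blast
  obtain M2 where M2: "M2 \<ge> 0" "\<And>x. x\<in>{a..b} \<Longrightarrow> norm (g x) \<le> M2" using absolutely_continuous_on_bounded g unfolding H1_deriv_def by blast
  let ?bd = "\<lambda>x. 2 * (M1 * K)\<^sup>2 * (norm (v x))\<^sup>2 + 2 * (M2 * K)\<^sup>2 * (norm (u x))\<^sup>2"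
  have bd: "?bd integrable_on {a..b}"
    using f g unfolding H1_deriv_def by (intro integrable_add integrable_on_mult_right) auto
  have w2: "(\<lambda>x. (norm (?w x))\<^sup>2) integrable_on {a..b}"
  proof (rule measurable_bounded_by_integrable_imp_integrable[OF _ bd])
    have "?w \<in> borel_measurable (lebesgue_on {a..b})" using w by (rule integrable_imp_measurable)
    then show "(\<lambda>x. (norm (?w x))\<^sup>2) \<in> borel_measurable (lebesgue_on {a..b})" by measurable
    fix x assume x: "x \<in> {a..b}"
    have "norm (?w x) \<le> norm (B (f x) (v x)) + norm (B (u x) (g x))" by (rule norm_triangle_ineq)
    also have "\<dots> \<le> norm (f x) * norm (v x) * K + norm (u x) * norm (g x) * K"
      by (intro add_mono K)
    also have "\<dots> \<le> M1 * norm (v x) * K + norm (u x) * M2 * K"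
      using M1 M2 K x by (intro add_mono mult_right_mono mult_left_mono) auto
    finally have "(norm (?w x))\<^sup>2 \<le> (M1 * K * norm (v x) + M2 * K * norm (u x))\<^sup>2"
      by (intro power_mono) (auto simp: algebra_simps)
    also have "\<dots> \<le> ?bd x"
      using sum_squares_bound[of "M1 * K * norm (v x)" "M2 * K * norm (u x)"]
      by (simp only: power2_sum power_mult_distrib)
    finally show "norm ((norm (?w x))\<^sup>2) \<le> ?bd x" by simp
  qed auto
  show ?thesis unfolding H1_deriv_def using ac N d w2 by blast
next
  case False
  then show ?thesis using f g unfolding H1_deriv_def
    by (auto intro!: absolutely_continuous_on_bilinear[OF B])
qed

lemma H1_deriv_C1:
  fixes f :: "real \<Rightarrow> 'a::euclidean_space"
  assumes f: "\<And>x. x \<in> {a..b} \<Longrightarrow> (f has_vector_derivative f' x) (at x within {a..b})"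
    and f': "continuous_on {a..b} f'"
  shows "H1_deriv a b f f'"
proof -
  have u2: "(\<lambda>x. (norm (f' x))\<^sup>2) integrable_on {a..b}"
    by (intro integrable_continuous_real continuous_intros f')
  have "absolutely_continuous_on a b f"
  proof (rule absolutely_continuous_on_indefinite_integral[OF _ u2])
    fix s t assume "a \<le> s" "s \<le> t" "t \<le> b"
    then show "(f' has_integral (f t - f s)) {s..t}"
      by (intro fundamental_theorem_of_calculus)
        (auto intro: has_vector_derivative_within_subset[OF f])
  qed
  then show ?thesis using u2 f unfolding H1_deriv_def by (auto intro!: exI[of _ "{}"])
qed

lemma H1_deriv_add:
  fixes f g :: "real \<Rightarrow> 'a::euclidean_space"
  assumes f: "H1_deriv a b f u" and g: "H1_deriv a b g v"
  shows "H1_deriv a b (\<lambda>x. f x + g x) (\<lambda>x. u x + v x)"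
proof -
  obtain N1 where N1: "negligible N1" "\<forall>x\<in>{a..b} - N1. (f has_vector_derivative u x) (at x within {a..b})"
    using f unfolding H1_deriv_def by blast
  obtain N2 where N2: "negligible N2" "\<forall>x\<in>{a..b} - N2. (g has_vector_derivative v x) (at x within {a..b})"
    using g unfolding H1_deriv_def by blast
  have N: "negligible (N1 \<union> N2)" using N1 N2 by auto
  have d: "((\<lambda>x. f x + g x) has_vector_derivative u x + v x) (at x within {a..b})" if "x \<in> {a..b} - (N1 \<union> N2)" for x
    using that N1 N2 by (intro has_vector_derivative_add) auto
  have ac: "absolutely_continuous_on a b (\<lambda>x. f x + g x)"
    using f g by (intro absolutely_continuous_on_add) (auto simp: H1_deriv_def)
  have w: "(\<lambda>x. u x + v x) integrable_on {a..b}"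
    by (intro integrable_add H1_deriv_integrable[OF f] H1_deriv_integrable[OF g])
  have "(\<lambda>x. (norm (u x + v x))\<^sup>2) integrable_on {a..b}"
  proof (rule measurable_bounded_by_integrable_imp_integrable)
    show "(\<lambda>x. (norm (u x + v x))\<^sup>2) \<in> borel_measurable (lebesgue_on {a..b})"
      using integrable_imp_measurable[OF w] by measurable
    show "(\<lambda>x. 2 * (norm (u x))\<^sup>2 + 2 * (norm (v x))\<^sup>2) integrable_on {a..b}"
      using f g unfolding H1_deriv_def by (intro integrable_add integrable_on_mult_right) auto
    fix x
    have "(norm (u x + v x))\<^sup>2 \<le> (norm (u x) + norm (v x))\<^sup>2"
      by (intro power_mono norm_triangle_ineq) auto
    also have "\<dots> \<le> 2 * (norm (u x))\<^sup>2 + 2 * (norm (v x))\<^sup>2"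
      using sum_squares_bound[of "norm (u x)" "norm (v x)"] by (simp add: power2_sum)
    finally show "norm ((norm (u x + v x))\<^sup>2) \<le> 2 * (norm (u x))\<^sup>2 + 2 * (norm (v x))\<^sup>2" by simp
  qed auto
  then show ?thesis unfolding H1_deriv_def using ac N d by blast
qed

lemma H1_deriv_sum:
  fixes f :: "'i \<Rightarrow> real \<Rightarrow> 'a::euclidean_space"
  assumes "finite I" "\<And>i. i \<in> I \<Longrightarrow> H1_deriv a b (f i) (u i)"
  shows "H1_deriv a b (\<lambda>x. \<Sum>i\<in>I. f i x) (\<lambda>x. \<Sum>i\<in>I. u i x)"
  using assms
proof (induction I)
  case empty
  show ?case by (simp, rule H1_deriv_C1) (auto intro!: derivative_eq_intros)
next
  case (insert i I)
  then show ?case by (simp add: H1_deriv_add)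
qed

lemma H1_deriv_scaleR:
  fixes f :: "real \<Rightarrow> 'a::euclidean_space"
  assumes "H1_deriv a b f u"
  shows "H1_deriv a b (\<lambda>x. r *\<^sub>R f x) (\<lambda>x. r *\<^sub>R u x)"
proof -
  have "H1_deriv a b (\<lambda>x::real. r) (\<lambda>x. 0)" by (rule H1_deriv_C1) auto
  from H1_deriv_bilinear[OF bounded_bilinear_scaleR this assms] show ?thesis by simp
qed

lemma H1_deriv_diff:
  fixes f g :: "real \<Rightarrow> 'a::euclidean_space"
  assumes f: "H1_deriv a b f u" and g: "H1_deriv a b g v"
  shows "H1_deriv a b (\<lambda>x. f x - g x) (\<lambda>x. u x - v x)"
  using H1_deriv_add[OF f H1_deriv_scaleR[OF g, of "-1"]] by simp

text \<open>By the Cauchy--Schwarz inequality, \<open>\<bar>h t\<bar>\<^sup>2\<close> is at most \<open>\<bar>t - t0\<bar>\<close> times the energy of \<open>h\<close> between \<open>t0\<close>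
  and \<open>t\<close>, which tends to \<open>0\<close>.\<close>

lemma H1_deriv_square_little_o:
  fixes h :: "real \<Rightarrow> 'a::euclidean_space"
  assumes h: "H1_deriv a b h w" and t0: "t0 \<in> {a..b}" "h t0 = 0" and \<epsilon>: "\<epsilon> > 0"
  obtains \<delta> where "\<delta> > 0" "\<And>t. t \<in> {a..b} \<Longrightarrow> \<bar>t - t0\<bar> < \<delta> \<Longrightarrow> (norm (h t))\<^sup>2 \<le> \<epsilon> * \<bar>t - t0\<bar>"
proof -
  let ?e = "\<lambda>x. (norm (w x))\<^sup>2"
  define E where "E t = integral {a..t} ?e" for t
  have w2: "?e integrable_on {a..b}" using h by (simp add: H1_deriv_def)
  have "continuous_on {a..b} E" unfolding E_def by (rule indefinite_integral_continuous_1[OF w2])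
  then obtain \<delta> where \<delta>: "\<delta> > 0" "\<And>t. t \<in> {a..b} \<Longrightarrow> \<bar>t - t0\<bar> < \<delta> \<Longrightarrow> \<bar>E t - E t0\<bar> < \<epsilon>"
    using t0 \<epsilon> unfolding continuous_on_iff dist_real_def by meson
  have E_diff: "integral {s..t} ?e = E t - E s" if "a \<le> s" "s \<le> t" "t \<le> b" for s t
  proof -
    have "?e integrable_on {a..t}" using that by (intro integrable_on_subinterval[OF w2]) auto
    from Henstock_Kurzweil_Integration.integral_combine[OF that(1,2) this] show ?thesis
      by (simp add: E_def)
  qed
  have bound: "(norm (h t - h s))\<^sup>2 \<le> \<epsilon> * (t - s)"
    if st: "a \<le> s" "s < t" "t \<le> b" and E: "E t - E s < \<epsilon>" for s t
  proof -
    define \<tau> where "\<tau> = t - s"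
    \<comment> \<open>This \<open>\<eta>\<close> balances the two terms of the bound \<open>\<eta> \<epsilon> + \<tau> / (4 \<eta>)\<close>.\<close>
    define \<eta> where "\<eta> = sqrt \<tau> / (2 * sqrt \<epsilon>)"
    have \<tau>: "\<tau> > 0" using st by (simp add: \<tau>_def)
    have \<eta>: "\<eta> > 0" using \<tau> \<epsilon> by (simp add: \<eta>_def)
    have "norm (h t - h s) \<le> \<eta> * integral {s..t} ?e + (t - s) / (4 * \<eta>)"
      using st by (intro norm_integral_le_energy[OF H1_deriv_has_integral[OF h] _ _ \<eta>]
          integrable_on_subinterval[OF w2]) auto
    also have "\<dots> \<le> \<eta> * \<epsilon> + \<tau> / (4 * \<eta>)"
      using E_diff[of s t] st E \<eta> by (simp add: \<tau>_def)
    also have "\<eta> * \<epsilon> = sqrt \<tau> * sqrt \<epsilon> / 2"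
    proof -
      have "\<eta> * \<epsilon> = sqrt \<tau> * (\<epsilon> / sqrt \<epsilon>) / 2" by (simp add: \<eta>_def)
      then show ?thesis using \<epsilon> by (simp add: real_div_sqrt)
    qed
    also have "\<tau> / (4 * \<eta>) = sqrt \<tau> * sqrt \<epsilon> / 2"
      using \<tau> \<epsilon> real_sqrt_mult_self[of \<tau>] by (simp add: \<eta>_def field_simps)
    finally have "norm (h t - h s) \<le> sqrt \<tau> * sqrt \<epsilon>" by (simp add: mult.commute)
    then have "(norm (h t - h s))\<^sup>2 \<le> (sqrt \<tau> * sqrt \<epsilon>)\<^sup>2" by (intro power_mono) auto
    also have "\<dots> = \<epsilon> * (t - s)" using \<tau> \<epsilon> by (simp add: power_mult_distrib \<tau>_def)
    finally show ?thesis .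
  qed
  show ?thesis
  proof (rule that[OF \<delta>(1)])
    fix t assume t: "t \<in> {a..b}" "\<bar>t - t0\<bar> < \<delta>"
    consider "t < t0" | "t = t0" | "t0 < t" by linarith
    then show "(norm (h t))\<^sup>2 \<le> \<epsilon> * \<bar>t - t0\<bar>"
    proof cases
      case 1 then show ?thesis using bound[of t t0] \<delta>(2)[OF t] t t0 by (simp add: norm_minus_commute)
    next
      case 2 then show ?thesis using t0 by simp
    next
      case 3 then show ?thesis using bound[of t0 t] \<delta>(2)[OF t] t t0 by simp
    qed
  qed
qed

lemma H1_on_imp_H1_deriv:
  fixes f :: "real \<Rightarrow> 'a::euclidean_space"
  assumes "H1_on a b f"
  obtains u where "H1_deriv a b f u"
proof -
  obtain u where u: "absolutely_continuous_on a b f"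
      "AE x in lebesgue. x \<in> {a<..<b} \<longrightarrow> (f has_vector_derivative u x) (at x)"
      "set_integrable lebesgue {a..b} (\<lambda>x. (norm (u x))\<^sup>2)"
    using assms unfolding H1_on_def by blast
  obtain N where N: "N \<in> null_sets lebesgue" "{x. \<not> (x \<in> {a<..<b} \<longrightarrow> (f has_vector_derivative u x) (at x))} \<subseteq> N"
    using u(2) unfolding eventually_ae_filter by auto
  have "negligible (N \<union> {a, b})" using N by (auto simp: negligible_iff_null_sets[symmetric])
  moreover have "(f has_vector_derivative u x) (at x within {a..b})" if "x \<in> {a..b} - (N \<union> {a,b})" for x
  proof -
    have "x \<in> {a<..<b}" "x \<notin> N" using that by auto
    then have "(f has_vector_derivative u x) (at x)" using N by blast
    then show ?thesis by (rule has_vector_derivative_at_within)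
  qed
  moreover have "(\<lambda>x. (norm (u x))\<^sup>2) integrable_on {a..b}"
    using u(3) by (rule set_lebesgue_integral_eq_integral(1))
  ultimately have "H1_deriv a b f u" unfolding H1_deriv_def using u(1) by blast
  then show ?thesis by (rule that)
qed

lemma H1_deriv_imp_H1_on:
  fixes f :: "real \<Rightarrow> 'a::euclidean_space"
  assumes "H1_deriv a b f u"
  shows "H1_on a b f"
proof -
  define v where "v x = (if x \<in> {a..b} then u x else 0)" for x
  obtain N where N: "negligible N" "\<forall>x\<in>{a..b} - N. (f has_vector_derivative u x) (at x within {a..b})"
    using assms unfolding H1_deriv_def by blast
  have "u \<in> borel_measurable (lebesgue_on {a..b})"
    using integrable_imp_measurable[OF H1_deriv_integrable[OF assms]] .
  then have "v \<in> borel_measurable lebesgue"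
    unfolding v_def by (subst borel_measurable_if) auto
  moreover have "AE x in lebesgue. x \<in> {a<..<b} \<longrightarrow> (f has_vector_derivative v x) (at x)"
  proof (rule AE_I')
    show "N \<in> null_sets lebesgue" using N by (simp add: negligible_iff_null_sets)
    show "{x \<in> space lebesgue. \<not> (x \<in> {a<..<b} \<longrightarrow> (f has_vector_derivative v x) (at x))} \<subseteq> N"
    proof clarsimp
      fix x assume x: "a < x" "x < b" "\<not> (f has_vector_derivative v x) (at x)"
      have "at x within {a..b} = at x" using x by (intro at_within_interior) auto
      then show "x \<in> N" using N(2)[rule_format, of x] x by (cases "x \<in> N") (auto simp: v_def)
    qed
  qed
  moreover have "set_integrable lebesgue {a..b} (\<lambda>x. (norm (v x))\<^sup>2)"
  proof -
    have "(\<lambda>x. (norm (u x))\<^sup>2) integrable_on {a..b}" using assms by (simp add: H1_deriv_def)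
    then have "(\<lambda>x. (norm (v x))\<^sup>2) integrable_on {a..b}"
      by (rule integrable_eq) (auto simp: v_def)
    then show ?thesis by (rule nonnegative_absolutely_integrable_1) auto
  qed
  ultimately show ?thesis using assms unfolding H1_on_def H1_deriv_def by blast
qed

lemma H1_deriv_cong_ae:
  assumes g: "H1_deriv a b g v" and N: "negligible N"
    and eq: "\<And>x. x \<in> {a..b} \<Longrightarrow> f x = g x" "\<And>x. x \<in> {a..b} - N \<Longrightarrow> u x = v x"
  shows "H1_deriv a b f u"
proof -
  obtain N1 where N1: "negligible N1" "\<forall>x\<in>{a..b} - N1. (g has_vector_derivative v x) (at x within {a..b})"
    using g unfolding H1_deriv_def by blast
  have "absolutely_continuous_on a b f"
  proof (rule absolutely_continuous_on_dominated[where C = 1])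
    show "absolutely_continuous_on a b g" "absolutely_continuous_on a b g" using g by (auto simp: H1_deriv_def)
  qed (auto simp: eq)
  moreover have "(f has_vector_derivative u x) (at x within {a..b})" if x: "x \<in> {a..b} - (N1 \<union> N)" for x
    by (rule has_vector_derivative_transform[of x _ f g]) (use x eq N1 in auto)
  moreover have "negligible (N1 \<union> N)" using N1 N by auto
  moreover have "(\<lambda>x. (norm (u x))\<^sup>2) integrable_on {a..b}"
    by (rule integrable_spike[OF _ N, of "\<lambda>x. (norm (v x))\<^sup>2"]) (use g eq in \<open>auto simp: H1_deriv_def\<close>)
  ultimately show ?thesis unfolding H1_deriv_def by blast
qed

section \<open>Linear ordinary differential equations\<close>

lemma has_vector_derivative_glue:
  fixes f g :: "real \<Rightarrow> 'a::real_normed_vector"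
  assumes "a \<le> b" "b \<le> c" and t: "t \<in> {a..c}"
    and f: "t \<le> b \<Longrightarrow> (f has_vector_derivative f') (at t within {a..b})"
    and g: "b \<le> t \<Longrightarrow> (g has_vector_derivative g') (at t within {b..c})"
    and eq: "f b = g b" "t = b \<Longrightarrow> f' = g'"
  shows "((\<lambda>x. if x \<le> b then f x else g x) has_vector_derivative (if t \<le> b then f' else g')) (at t within {a..c})"
proof -
  have cl: "closure {a..b} \<inter> closure {b..c} = {b}" "{a..b} \<union> {b} = {a..b}" "{b..c} \<union> {b} = {b..c}"
    using assms(1,2) by auto
  have "((\<lambda>x. if x \<in> {a..b} then f x else g x) has_vector_derivative (if t \<in> {a..b} then f' else g')) (at t within {a..c})"
    by (rule has_vector_derivative_If_within_closures[where T = "{b..c}"])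
      (use assms cl in \<open>auto simp: insert_absorb\<close>)
  then have "((\<lambda>x. if x \<le> b then f x else g x) has_vector_derivative (if t \<in> {a..b} then f' else g')) (at t within {a..c})"
    by (rule has_vector_derivative_transform_within[of _ _ _ _ 1]) (use t in auto)
  then show ?thesis using t by simp
qed

lemma has_vector_derivative_quotient_tendsto:
  assumes "(f has_vector_derivative D) (at x within S)"
  shows "((\<lambda>y. (f y - f x) /\<^sub>R (y - x)) \<longlongrightarrow> D) (at x within S)"
proof -
  have "((\<lambda>y. (f y - (f x + (y - x) *\<^sub>R D)) /\<^sub>R norm (y - x)) \<longlongrightarrow> 0) (at x within S)"
    using assms by (simp add: has_vector_derivative_def has_derivative_within divide_inverse)
  then have lim: "((\<lambda>y. norm ((f y - (f x + (y - x) *\<^sub>R D)) /\<^sub>R norm (y - x))) \<longlongrightarrow> 0) (at x within S)"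
    by (rule tendsto_norm_zero)
  have eq: "norm ((f y - (f x + (y - x) *\<^sub>R D)) /\<^sub>R norm (y - x)) = norm ((f y - f x) /\<^sub>R (y - x) - D)" if "y \<noteq> x" for y
  proof -
    have "(f y - f x) /\<^sub>R (y - x) - D = (f y - (f x + (y - x) *\<^sub>R D)) /\<^sub>R (y - x)"
      using that by (simp add: diff_diff_eq[symmetric] scaleR_diff_right[of _ "f y - f x"])
    then show ?thesis by simp
  qed
  have "((\<lambda>y. norm ((f y - f x) /\<^sub>R (y - x) - D)) \<longlongrightarrow> 0) (at x within S)"
    by (rule Lim_transform_eventually[OF lim]) (use eq in \<open>auto simp: eventually_at_filter\<close>)
  then show ?thesis by (simp add: tendsto_norm_zero_iff LIM_zero_iff)
qed

text \<open>Picard iteration is a contraction when \<open>K (b - a) \<le> 1 / 2\<close>. The iteration runs in the complete space of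
  bounded continuous functions on the whole line, so that the upper limit of the integral is clamped to
  \<open>[a, b]\<close>.\<close>

lemma linear_ode_exists_short:
  fixes A :: "real \<Rightarrow> 'a::banach \<Rightarrow>\<^sub>L 'a"
  assumes ab: "a \<le> b" and A: "continuous_on {a..b} A"
    and K: "K \<ge> 0" "\<And>t. t \<in> {a..b} \<Longrightarrow> norm (A t) \<le> K" "K * (b - a) \<le> 1 / 2"
  shows "\<exists>y. y a = y0 \<and> (\<forall>t\<in>{a..b}. (y has_vector_derivative A t (y t)) (at t within {a..b}))"
proof -
  define cl where "cl t = max a (min b t)" for t
  have cl: "cl t \<in> {a..b}" "t \<in> {a..b} \<Longrightarrow> cl t = t" for t using ab by (auto simp: cl_def)
  define \<phi> where "\<phi> y t = y0 + integral {a..cl t} (\<lambda>s. A s (apply_bcontfun y s))" for y :: "real \<Rightarrow>\<^sub>C 'a" and t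
  have cont: "continuous_on {a..b} (\<lambda>s. A s (apply_bcontfun y s))" for y :: "real \<Rightarrow>\<^sub>C 'a"
  proof -
    have "continuous_on UNIV (apply_bcontfun y)"
      using apply_bcontfun[of y] by (simp add: bcontfun_def)
    then show ?thesis by (intro continuous_intros A) (auto intro: continuous_on_subset)
  qed
  have int: "(\<lambda>s. A s (apply_bcontfun y s)) integrable_on {a..cl t}" for y :: "real \<Rightarrow>\<^sub>C 'a" and t
    by (rule integrable_on_subinterval[OF integrable_continuous_real[OF cont]]) (use cl(1)[of t] in auto)
  have cont\<phi>: "continuous_on {a..b} (\<lambda>t. y0 + integral {a..t} (\<lambda>s. A s (apply_bcontfun y s)))" for y :: "real \<Rightarrow>\<^sub>C 'a"
    by (intro continuous_intros indefinite_integral_continuous_1 integrable_continuous_real cont)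
  have \<phi>: "\<phi> y \<in> bcontfun" for y
  proof -
    have "continuous_on UNIV cl" unfolding cl_def by (intro continuous_intros)
    then have "continuous_on UNIV (\<phi> y)" unfolding \<phi>_def
      using continuous_on_compose2[OF cont\<phi>, of UNIV cl] cl(1) by (auto simp: image_subset_iff)
    moreover have "range (\<phi> y) \<subseteq> (\<lambda>t. y0 + integral {a..t} (\<lambda>s. A s (apply_bcontfun y s))) ` {a..b}"
      using cl(1) by (auto simp: \<phi>_def)
    moreover have "bounded ((\<lambda>t. y0 + integral {a..t} (\<lambda>s. A s (apply_bcontfun y s))) ` {a..b})"
      by (intro compact_imp_bounded compact_continuous_image cont\<phi>) auto
    ultimately show ?thesis by (auto simp: bcontfun_def intro: bounded_subset)
  qed
  define T where "T y = Bcontfun (\<phi> y)" for y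
  have T: "apply_bcontfun (T y) = \<phi> y" for y using \<phi> by (simp add: T_def Bcontfun_inverse)
  have "\<exists>!y. T y = y"
  proof (rule banach_fix_type[of "1/2"], simp, simp, intro allI)
    fix y z :: "real \<Rightarrow>\<^sub>C 'a"
    show "dist (T y) (T z) \<le> 1 / 2 * dist y z"
    proof (rule dist_bound)
      fix t
      have "apply_bcontfun (T y) t - apply_bcontfun (T z) t =
          integral {a..cl t} (\<lambda>s. A s (apply_bcontfun y s) - A s (apply_bcontfun z s))"
        unfolding T \<phi>_def using int by (simp add: integral_diff)
      also have "norm \<dots> \<le> integral {a..cl t} (\<lambda>s. K * dist y z)"
      proof (rule integral_norm_bound_integral)
        fix s assume s: "s \<in> {a..cl t}"
        then have s': "s \<in> {a..b}" using cl(1)[of t] by auto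
        have "norm (A s (apply_bcontfun y s) - A s (apply_bcontfun z s)) = norm (A s (apply_bcontfun y s - apply_bcontfun z s))"
          by (simp add: blinfun.diff_right)
        also have "\<dots> \<le> norm (A s) * norm (apply_bcontfun y s - apply_bcontfun z s)" by (rule norm_blinfun)
        also have "\<dots> \<le> K * dist y z"
          using K(1,2) s' dist_bounded by (intro mult_mono) (auto simp: dist_norm[symmetric])
        finally show "norm (A s (apply_bcontfun y s) - A s (apply_bcontfun z s)) \<le> K * dist y z" .
      qed (use int in \<open>auto intro!: integrable_diff\<close>)
      also have "\<dots> = (cl t - a) * (K * dist y z)" using cl(1)[of t] by (simp del: integral_mult_right)
      also have "\<dots> = (K * (cl t - a)) * dist y z" by (simp only: mult_ac)
      also have "\<dots> \<le> (1 / 2) * dist y z"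
      proof (rule mult_right_mono)
        have "K * (cl t - a) \<le> K * (b - a)" using K(1) cl(1)[of t] by (intro mult_left_mono) auto
        then show "K * (cl t - a) \<le> 1 / 2" using K(3) by simp
      qed simp
      finally show "dist (apply_bcontfun (T y) t) (apply_bcontfun (T z) t) \<le> 1 / 2 * dist y z" by (simp add: dist_norm)
    qed
  qed
  then obtain y where y: "T y = y" by blast
  have yt: "apply_bcontfun y t = y0 + integral {a..t} (\<lambda>s. A s (apply_bcontfun y s))" if "t \<in> {a..b}" for t
  proof -
    have "apply_bcontfun y t = \<phi> y t" by (subst T[of y, symmetric], subst y) (rule refl)
    then show ?thesis unfolding \<phi>_def cl(2)[OF that] .
  qed
  show ?thesis
  proof (intro exI[of _ "apply_bcontfun y"] conjI ballI)
    show "apply_bcontfun y a = y0" using yt[of a] ab by simp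
    fix t assume t: "t \<in> {a..b}"
    have "((\<lambda>t. y0 + integral {a..t} (\<lambda>s. A s (apply_bcontfun y s))) has_vector_derivative A t (apply_bcontfun y t)) (at t within {a..b})"
      using integral_has_vector_derivative[OF cont t] by (auto intro!: derivative_eq_intros)
    then show "(apply_bcontfun y has_vector_derivative A t (apply_bcontfun y t)) (at t within {a..b})"
      by (rule has_vector_derivative_transform[OF t, rotated]) (use yt in auto)
  qed
qed

text \<open>Linearity makes the length of the intervals of solvability depend on a bound for \<open>A\<close> only, so that short
  solutions can be glued.\<close>

theorem linear_ode_exists:
  fixes A :: "real \<Rightarrow> 'a::banach \<Rightarrow>\<^sub>L 'a"
  assumes ab: "a \<le> b" and A: "continuous_on {a..b} A"
  shows "\<exists>y. y a = y0 \<and> (\<forall>t\<in>{a..b}. (y has_vector_derivative A t (y t)) (at t within {a..b}))"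
proof -
  have "bounded (A ` {a..b})" by (intro compact_imp_bounded compact_continuous_image A) auto
  then obtain K0 where "\<forall>t\<in>{a..b}. norm (A t) \<le> K0" unfolding bounded_iff by auto
  then obtain K where K: "K > 0" "\<And>t. t \<in> {a..b} \<Longrightarrow> norm (A t) \<le> K"
    by (metis less_max_iff_disj max.coboundedI1 zero_less_one)
  have "a \<le> a \<and> b \<le> b \<longrightarrow> (\<forall>y0. \<exists>y. y a = y0 \<and> (\<forall>t\<in>{a..b}. (y has_vector_derivative A t (y t)) (at t within {a..b})))"
    using ab
  proof (induction rule: Bolzano[where P = "\<lambda>c d. a \<le> c \<and> d \<le> b \<longrightarrow>
      (\<forall>y0. \<exists>y. y c = y0 \<and> (\<forall>t\<in>{c..d}. (y has_vector_derivative A t (y t)) (at t within {c..d})))"])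
    case (trans c d e)
    show ?case
    proof (intro impI allI)
      fix y0 assume "a \<le> c \<and> e \<le> b"
      then obtain y where y: "y c = y0" "\<forall>t\<in>{c..d}. (y has_vector_derivative A t (y t)) (at t within {c..d})"
        using trans by fastforce
      obtain z where z: "z d = y d" "\<forall>t\<in>{d..e}. (z has_vector_derivative A t (z t)) (at t within {d..e})"
        using trans \<open>a \<le> c \<and> e \<le> b\<close> by fastforce
      let ?w = "\<lambda>t. if t \<le> d then y t else z t"
      have "(?w has_vector_derivative A t (?w t)) (at t within {c..e})" if "t \<in> {c..e}" for t
        using has_vector_derivative_glue[of c d e t y "A t (y t)" z "A t (z t)"] trans y z that
        by (auto simp: if_distrib cong: if_cong)
      then show "\<exists>y. y c = y0 \<and> (\<forall>t\<in>{c..e}. (y has_vector_derivative A t (y t)) (at t within {c..e}))"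
        using y trans by (intro exI[of _ ?w]) auto
    qed
  next
    case (local x)
    show ?case
    proof (intro exI[of _ "1 / (2 * K)"] conjI allI impI)
      show "1 / (2 * K) > 0" using K by simp
      fix c d y0 assume *: "c \<le> x \<and> x \<le> d \<and> d - c < 1 / (2 * K)" "a \<le> c \<and> d \<le> b"
      show "\<exists>y. y c = y0 \<and> (\<forall>t\<in>{c..d}. (y has_vector_derivative A t (y t)) (at t within {c..d}))"
      proof (rule linear_ode_exists_short[of c d A K])
        show "continuous_on {c..d} A" by (rule continuous_on_subset[OF A]) (use * in auto)
        show "K * (d - c) \<le> 1 / 2" using * K by (simp add: field_simps)
      qed (use * K in auto)
    qed
  qed
  then show ?thesis by auto
qed

text \<open>Gronwall's inequality in both time directions: \<open>\<phi> t exp (- C t)\<close> decreases and \<open>\<phi> t exp (C t)\<close>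
  increases.\<close>

lemma zero_if_derivative_dominated:
  fixes \<phi> :: "real \<Rightarrow> real"
  assumes d: "\<And>t. t \<in> {a..b} \<Longrightarrow> (\<phi> has_real_derivative \<phi>' t) (at t within {a..b})"
    and le: "\<And>t. t \<in> {a..b} \<Longrightarrow> \<bar>\<phi>' t\<bar> \<le> C * \<phi> t"
    and nonneg: "\<And>t. t \<in> {a..b} \<Longrightarrow> 0 \<le> \<phi> t"
    and t0: "t0 \<in> {a..b}" "\<phi> t0 = 0" and t: "t \<in> {a..b}"
  shows "\<phi> t = 0"
proof -
  have d': "(\<phi> has_real_derivative \<phi>' t) (at t)" if "a < t" "t < b" for t
    using d[of t] that by (simp add: at_within_Icc_at)
  have cont: "continuous_on {a..b} \<phi>" using d by (meson DERIV_continuous continuous_on_eq_continuous_within)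
  show ?thesis
  proof (cases "t0 \<le> t")
    case True
    have "\<phi> t * exp (- C * t) \<le> \<phi> t0 * exp (- C * t0)"
    proof (rule DERIV_nonpos_imp_decreasing_open[OF True, where f = "\<lambda>t. \<phi> t * exp (- C * t)"])
      fix x assume x: "t0 < x" "x < t"
      then have xab: "a < x" "x < b" using t0 t by auto
      have "((\<lambda>t. \<phi> t * exp (- C * t)) has_real_derivative (\<phi>' x - C * \<phi> x) * exp (- C * x)) (at x)"
        by (rule derivative_eq_intros d'[OF xab] refl)+ (simp add: algebra_simps)
      moreover have "(\<phi>' x - C * \<phi> x) * exp (- C * x) \<le> 0"
        using le[of x] xab by (intro mult_nonpos_nonneg) auto
      ultimately show "\<exists>y. ((\<lambda>t. \<phi> t * exp (- C * t)) has_real_derivative y) (at x) \<and> y \<le> 0" by blast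
    next
      show "continuous_on {t0..t} (\<lambda>t. \<phi> t * exp (- C * t))"
        using t0 t by (intro continuous_intros continuous_on_subset[OF cont]) auto
    qed
    then have "\<phi> t \<le> 0" using t0 by (simp add: mult_le_0_iff)
    then show ?thesis using nonneg[OF t] by simp
  next
    case False
    then have le': "t \<le> t0" by simp
    have "\<phi> t * exp (C * t) \<le> \<phi> t0 * exp (C * t0)"
    proof (rule DERIV_nonneg_imp_increasing_open[OF le', where f = "\<lambda>t. \<phi> t * exp (C * t)"])
      fix x assume x: "t < x" "x < t0"
      then have xab: "a < x" "x < b" using t0 t by auto
      have "((\<lambda>t. \<phi> t * exp (C * t)) has_real_derivative (\<phi>' x + C * \<phi> x) * exp (C * x)) (at x)"
        by (rule derivative_eq_intros d'[OF xab] refl)+ (simp add: algebra_simps)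
      moreover have "(\<phi>' x + C * \<phi> x) * exp (C * x) \<ge> 0"
        using le[of x] xab by (intro mult_nonneg_nonneg) auto
      ultimately show "\<exists>y. ((\<lambda>t. \<phi> t * exp (C * t)) has_real_derivative y) (at x) \<and> 0 \<le> y" by blast
    next
      show "continuous_on {t..t0} (\<lambda>t. \<phi> t * exp (C * t))"
        using t0 t by (intro continuous_intros continuous_on_subset[OF cont]) auto
    qed
    then have "\<phi> t \<le> 0" using t0 by (simp add: mult_le_0_iff)
    then show ?thesis using nonneg[OF t] by simp
  qed
qed

lemma norm_diff_le_if_derivative_bounded:
  fixes f :: "real \<Rightarrow> 'a::real_normed_vector"
  assumes f: "\<And>t. t \<in> {a..b} \<Longrightarrow> (f has_vector_derivative f' t) (at t within {a..b})"
    and C: "\<And>t. t \<in> {a..b} \<Longrightarrow> norm (f' t) \<le> C" and st: "s \<in> {a..b}" "t \<in> {a..b}"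
  shows "norm (f s - f t) \<le> C * \<bar>s - t\<bar>"
proof -
  have C0: "C \<ge> 0" using C[OF st(1)] norm_ge_zero order_trans by blast
  have "norm (f s - f t) \<le> C * norm (s - t)"
  proof (rule differentiable_bound[of "{a..b}" f "\<lambda>t h. h *\<^sub>R f' t"])
    show "(f has_derivative (\<lambda>h. h *\<^sub>R f' x)) (at x within {a..b})" if "x \<in> {a..b}" for x
      using f[OF that] by (simp add: has_vector_derivative_def)
    show "onorm (\<lambda>h. h *\<^sub>R f' x) \<le> C" if "x \<in> {a..b}" for x
      using C[OF that] C0 by (intro onorm_bound) (auto simp: mult.commute[of C] intro: mult_left_mono)
  qed (use st in auto)
  then show ?thesis by simp
qed

lemma linear_blinfun_apply: "linear (blinfun_apply f)"
  by (rule bounded_linear.linear[OF blinfun.bounded_linear_right])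

lemma continuous_on_unit_bounded:
  fixes F :: "real \<Rightarrow> 'b::real_normed_vector"
  assumes "continuous_on {0..1} F"
  obtains C where "C > 0" "\<And>t. t \<in> {0..1} \<Longrightarrow> norm (F t) \<le> C"
proof -
  have "bounded (F ` {0..1})" using assms by (intro compact_imp_bounded compact_continuous_image) auto
  then obtain C where "\<forall>t\<in>{0..1}. norm (F t) \<le> C" unfolding bounded_iff by auto
  then show ?thesis by (intro that[of "max C 1"]) (auto simp: max.coboundedI1)
qed

section \<open>Jacobi systems in a Euclidean space\<close>

text \<open>\<open>X\<close> is the matrix solution of \<open>X'' = - S X\<close> with \<open>X 0 = 0\<close> and \<open>X' 0 = 1\<close>, so that \<open>\<lambda>t. X t v\<close>
  runs through the solutions of the Jacobi equation that vanish at \<open>0\<close>; \<open>Y\<close> is its derivative.\<close>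

locale jacobi_system =
  fixes S X Y :: "real \<Rightarrow> 'v::euclidean_space \<Rightarrow>\<^sub>L 'v"
  assumes S_cont: "continuous_on {0..1} S"
    and S_sym: "t \<in> {0..1} \<Longrightarrow> S t v \<bullet> w = v \<bullet> S t w"
    and X_deriv: "t \<in> {0..1} \<Longrightarrow> (X has_vector_derivative Y t) (at t within {0..1})"
    and Y_deriv: "t \<in> {0..1} \<Longrightarrow> (Y has_vector_derivative - (S t o\<^sub>L X t)) (at t within {0..1})"
    and X_0: "X 0 = 0" and Y_0: "Y 0 = id_blinfun"

lemma jacobi_system_exists:
  fixes S :: "real \<Rightarrow> 'v::euclidean_space \<Rightarrow>\<^sub>L 'v"
  assumes S: "continuous_on {0..1} S" and sym: "\<And>t v w. t \<in> {0..1} \<Longrightarrow> S t v \<bullet> w = v \<bullet> S t w"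
  obtains X Y where "jacobi_system S X Y"
proof -
  define F where "F t = (\<lambda>Z :: ('v \<Rightarrow>\<^sub>L 'v) \<times> ('v \<Rightarrow>\<^sub>L 'v). (snd Z, - (S t o\<^sub>L fst Z)))" for t
  have blF: "bounded_linear (F t)" for t
    unfolding F_def
    by (intro bounded_linear_Pair bounded_linear_snd bounded_linear_minus
        bounded_linear_compose[OF bounded_bilinear.bounded_linear_right[OF bounded_bilinear_blinfun_compose] bounded_linear_fst])
  define A where "A t = Blinfun (F t)" for t
  have A: "blinfun_apply (A t) = F t" for t unfolding A_def using blF by (rule bounded_linear_Blinfun_apply)
  have "norm (A s - A t) \<le> norm (S s - S t)" for s t
  proof (rule norm_blinfun_bound)
    fix Z :: "('v \<Rightarrow>\<^sub>L 'v) \<times> ('v \<Rightarrow>\<^sub>L 'v)"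
    have "A s Z - A t Z = (0, - ((S s - S t) o\<^sub>L fst Z))"
      by (simp add: A F_def bounded_bilinear.diff_left[OF bounded_bilinear_blinfun_compose])
    then have "norm ((A s - A t) Z) = norm ((S s - S t) o\<^sub>L fst Z)"
      by (simp add: blinfun.diff_left norm_Pair)
    also have "\<dots> \<le> norm (S s - S t) * norm (fst Z)" by (rule norm_blinfun_compose)
    also have "\<dots> \<le> norm (S s - S t) * norm Z" by (intro mult_left_mono) (auto simp: norm_fst_le[of "fst Z" "snd Z", simplified])
    finally show "norm ((A s - A t) Z) \<le> norm (S s - S t) * norm Z" .
  qed simp
  then have contA: "continuous_on {0..1} A"
    using S unfolding continuous_on_iff dist_norm by (meson le_less_trans)
  obtain Z where Z: "Z 0 = (0, id_blinfun)" "\<forall>t\<in>{0..1}. (Z has_vector_derivative A t (Z t)) (at t within {0..1})"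
    using linear_ode_exists[OF _ contA, of "(0, id_blinfun)"] by auto
  have "jacobi_system S (\<lambda>t. fst (Z t)) (\<lambda>t. snd (Z t))"
  proof
    fix t :: real assume t: "t \<in> {0..1}"
    have "(Z has_vector_derivative (snd (Z t), - (S t o\<^sub>L fst (Z t)))) (at t within {0..1})"
      using Z(2) t by (simp add: A F_def)
    from bounded_linear.has_vector_derivative[OF bounded_linear_fst this]
      bounded_linear.has_vector_derivative[OF bounded_linear_snd this]
    show "((\<lambda>t. fst (Z t)) has_vector_derivative snd (Z t)) (at t within {0..1})"
      "((\<lambda>t. snd (Z t)) has_vector_derivative - (S t o\<^sub>L fst (Z t))) (at t within {0..1})" by simp_all
  qed (use S sym Z in auto)
  then show ?thesis by (rule that)
qed

context jacobi_system
begin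

definition conjugate :: "real set" where
  "conjugate = {t \<in> {0<..1}. \<exists>v. v \<noteq> 0 \<and> X t v = 0}"

lemma X_cont: "continuous_on {0..1} X"
  using X_deriv by (meson continuous_on_eq_continuous_within has_vector_derivative_continuous)

lemma Y_cont: "continuous_on {0..1} Y"
  using Y_deriv by (meson continuous_on_eq_continuous_within has_vector_derivative_continuous)

lemma Xv_deriv: "t \<in> {0..1} \<Longrightarrow> ((\<lambda>t. X t v) has_vector_derivative Y t v) (at t within {0..1})"
  using bounded_bilinear.has_vector_derivative[OF bounded_bilinear_blinfun_apply X_deriv has_vector_derivative_const, of t v]
  by simp

lemma Yv_deriv: "t \<in> {0..1} \<Longrightarrow> ((\<lambda>t. Y t v) has_vector_derivative - S t (X t v)) (at t within {0..1})"
  using bounded_bilinear.has_vector_derivative[OF bounded_bilinear_blinfun_apply Y_deriv has_vector_derivative_const, of t v]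
  by (simp add: blinfun.minus_left)

text \<open>The Wronskian of the two solutions: its derivative vanishes because \<open>S\<close> is symmetric, and it is \<open>0\<close> at \<open>0\<close>.
  In other words, \<open>X\<^sup>T Y\<close> is symmetric.\<close>

lemma lagrange_identity:
  assumes t: "t \<in> {0..1}"
  shows "X t v \<bullet> Y t w = Y t v \<bullet> X t w"
proof -
  let ?f = "\<lambda>t. X t v \<bullet> Y t w - Y t v \<bullet> X t w"
  have "(?f has_vector_derivative 0) (at x within {0..1})" if x: "x \<in> {0..1}" for x
  proof -
    have "(?f has_vector_derivative
        (X x v \<bullet> (- S x (X x w)) + Y x v \<bullet> Y x w) - (Y x v \<bullet> Y x w + (- S x (X x v)) \<bullet> X x w)) (at x within {0..1})"
      by (intro has_vector_derivative_diff
          bounded_bilinear.has_vector_derivative[OF bounded_bilinear_inner] Xv_deriv Yv_deriv x)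
    then show ?thesis using S_sym[OF x, of "X x v" "X x w"] by simp
  qed
  then obtain c where c: "\<And>x. x \<in> {0..1} \<Longrightarrow> ?f x = c"
    using has_vector_derivative_zero_constant[of "{0..1}" ?f] by auto
  have "?f t = ?f 0" using c[of 0] c[OF t] by simp
  then show ?thesis by (simp add: X_0)
qed

text \<open>Gronwall's inequality for \<open>\<bar>f\<bar>\<^sup>2 + \<bar>f'\<bar>\<^sup>2\<close>.\<close>

lemma jacobi_solution_unique:
  assumes f: "\<And>t. t \<in> {0..1} \<Longrightarrow> (f has_vector_derivative f' t) (at t within {0..1})"
    and f': "\<And>t. t \<in> {0..1} \<Longrightarrow> (f' has_vector_derivative - S t (f t)) (at t within {0..1})"
    and t0: "t0 \<in> {0..1}" "f t0 = 0" "f' t0 = 0" and t: "t \<in> {0..1}"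
  shows "f t = 0 \<and> f' t = 0"
proof -
  obtain C where C: "C > 0" "\<And>t. t \<in> {0..1} \<Longrightarrow> norm (S t) \<le> C"
    using continuous_on_unit_bounded[OF S_cont] by metis
  let ?\<phi> = "\<lambda>t. f t \<bullet> f t + f' t \<bullet> f' t"
  let ?\<phi>' = "\<lambda>t. (f t \<bullet> f' t + f' t \<bullet> f t) + (f' t \<bullet> (- S t (f t)) + (- S t (f t)) \<bullet> f' t)"
  have "?\<phi> t = 0"
  proof (rule zero_if_derivative_dominated[where \<phi> = ?\<phi> and \<phi>' = ?\<phi>' and C = "1 + C" and a = 0 and b = 1])
    fix x :: real assume x: "x \<in> {0..1}"
    have "(?\<phi> has_vector_derivative ?\<phi>' x) (at x within {0..1})"
      by (intro has_vector_derivative_add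
          bounded_bilinear.has_vector_derivative[OF bounded_bilinear_inner] f f' x)
    then show "(?\<phi> has_real_derivative ?\<phi>' x) (at x within {0..1})"
      by (simp only: has_real_derivative_iff_has_vector_derivative)
    let ?a = "norm (f x)" and ?b = "norm (f' x)"
    have 1: "\<bar>f x \<bullet> f' x\<bar> \<le> ?a * ?b" by (rule Cauchy_Schwarz_ineq2)
    have "\<bar>f' x \<bullet> S x (f x)\<bar> \<le> ?b * norm (S x (f x))" by (rule Cauchy_Schwarz_ineq2)
    also have "\<dots> \<le> ?b * (C * ?a)"
      by (intro mult_left_mono order_trans[OF norm_blinfun] mult_right_mono C x) auto
    finally have 2: "\<bar>f' x \<bullet> S x (f x)\<bar> \<le> C * (?a * ?b)" by (simp add: algebra_simps)
    have "\<bar>?\<phi>' x\<bar> \<le> 2 * \<bar>f x \<bullet> f' x\<bar> + 2 * \<bar>f' x \<bullet> S x (f x)\<bar>"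
      by (simp add: inner_commute)
    also have "\<dots> \<le> 2 * (?a * ?b) + 2 * (C * (?a * ?b))" using 1 2 by simp
    also have "\<dots> = (1 + C) * (2 * ?a * ?b)" by (simp add: algebra_simps)
    also have "\<dots> \<le> (1 + C) * (?a\<^sup>2 + ?b\<^sup>2)"
      using C(1) sum_squares_bound by (intro mult_left_mono) auto
    finally show "\<bar>?\<phi>' x\<bar> \<le> (1 + C) * ?\<phi> x" by (simp add: power2_norm_eq_inner)
  qed (use t0 t in auto)
  then show ?thesis by (simp add: add_nonneg_eq_0_iff)
qed

lemma jacobi_solution_eq:
  assumes f: "\<And>t. t \<in> {0..1} \<Longrightarrow> (f has_vector_derivative f' t) (at t within {0..1})"
    and f': "\<And>t. t \<in> {0..1} \<Longrightarrow> (f' has_vector_derivative - S t (f t)) (at t within {0..1})"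
    and f0: "f 0 = 0" and t: "t \<in> {0..1}"
  shows "f t = X t (f' 0)"
proof -
  have "f t - X t (f' 0) = 0 \<and> f' t - Y t (f' 0) = 0"
  proof (rule jacobi_solution_unique[where f = "\<lambda>t. f t - X t (f' 0)" and f' = "\<lambda>t. f' t - Y t (f' 0)" and ?t0.0 = 0])
    fix x :: real assume x: "x \<in> {0..1}"
    show "((\<lambda>t. f t - X t (f' 0)) has_vector_derivative f' x - Y x (f' 0)) (at x within {0..1})"
      by (intro has_vector_derivative_diff f Xv_deriv x)
    have "((\<lambda>t. f' t - Y t (f' 0)) has_vector_derivative - S x (f x) - - S x (X x (f' 0))) (at x within {0..1})"
      by (intro has_vector_derivative_diff f' Yv_deriv x)
    then show "((\<lambda>t. f' t - Y t (f' 0)) has_vector_derivative - S x (f x - X x (f' 0))) (at x within {0..1})"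
      by (simp add: blinfun.diff_right)
  qed (use t f0 in \<open>auto simp: X_0 Y_0\<close>)
  then show ?thesis by simp
qed

lemma initial_vector_zero:
  assumes "t0 \<in> {0..1}" "X t0 v = 0" "Y t0 v = 0"
  shows "v = 0"
  using jacobi_solution_unique[where f = "\<lambda>t. X t v" and f' = "\<lambda>t. Y t v" and ?t0.0 = t0 and t = 0] assms
  by (auto simp: Xv_deriv Yv_deriv Y_0)

section \<open>Degeneration at conjugate instants\<close>

text \<open>By compactness and the Lagrange identity: if the bound failed for all \<open>c\<close> and \<open>\<delta>\<close>, there would be
  \<open>t\<^sub>n \<rightarrow> t0\<close> and unit vectors \<open>w\<^sub>n \<rightarrow> w\<close> with \<open>X t\<^sub>n w\<^sub>n = o(t\<^sub>n - t0)\<close>; then \<open>X t0 w = 0\<close>, and dividing the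
  identity \<open>X t\<^sub>n w\<^sub>n \<bullet> Y t\<^sub>n w = Y t\<^sub>n w\<^sub>n \<bullet> X t\<^sub>n w\<close> by \<open>t\<^sub>n - t0\<close> gives \<open>0 = \<bar>Y t0 w\<bar>\<^sup>2\<close> in the limit,
  contradicting uniqueness.\<close>

lemma first_order_degeneration:
  assumes t0: "t0 \<in> {0..1}"
  obtains c \<delta> where "c > 0" "\<delta> > 0"
    "\<And>t w. t \<in> {0..1} \<Longrightarrow> t \<noteq> t0 \<Longrightarrow> \<bar>t - t0\<bar> < \<delta> \<Longrightarrow> c * \<bar>t - t0\<bar> * norm w \<le> norm (X t w)"
proof (rule ccontr)
  assume neg: "\<not> thesis"
  have "\<exists>t w. t \<in> {0..1} \<and> t \<noteq> t0 \<and> \<bar>t - t0\<bar> < inverse (real (Suc n)) \<and>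
      norm (X t w) < inverse (real (Suc n)) * \<bar>t - t0\<bar> * norm w" for n
    using neg that[of "inverse (real (Suc n))" "inverse (real (Suc n))"] by (meson inverse_positive_iff_positive not_le of_nat_0_less_iff zero_less_Suc)
  then obtain t z where tz: "\<And>n. t n \<in> {0..1}" "\<And>n. t n \<noteq> t0" "\<And>n. \<bar>t n - t0\<bar> < inverse (real (Suc n))"
      "\<And>n. norm (X (t n) (z n)) < inverse (real (Suc n)) * \<bar>t n - t0\<bar> * norm (z n)"
    by metis
  define w where "w n = z n /\<^sub>R norm (z n)" for n
  have z0: "norm (z n) > 0" for n
    using tz(4)[of n] by (auto simp: zero_less_mult_iff)
  have w: "w n \<in> sphere 0 1" for n using z0[of n] by (simp add: w_def)
  have Xw: "norm (X (t n) (w n)) \<le> inverse (real (Suc n)) * \<bar>t n - t0\<bar>" for n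
    using tz(4)[of n] z0[of n] by (simp add: w_def blinfun.scaleR_right field_simps)
  obtain l r where l: "l \<in> sphere 0 1" and r: "strict_mono r" and lim: "(w \<circ> r) \<longlonglongrightarrow> l"
    using compact_sphere[of "0::'v" 1, unfolded compact_def] w by blast
  have t_lim: "t \<longlonglongrightarrow> t0"
  proof (rule LIMSEQ_I)
    have "(\<lambda>n. t n - t0) \<longlonglongrightarrow> 0"
      by (rule Lim_null_comparison[OF _ LIMSEQ_inverse_real_of_nat]) (use tz(3) in \<open>auto intro!: always_eventually less_imp_le\<close>)
    then show "\<exists>no. \<forall>n\<ge>no. norm (t n - t0) < e" if "e > 0" for e :: real
      using LIMSEQ_D[OF _ that] by fastforce
  qed
  define s where "s n = t (r n)" for n
  define v where "v n = w (r n)" for n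
  have s_lim: "s \<longlonglongrightarrow> t0" unfolding s_def using LIMSEQ_subseq_LIMSEQ[OF t_lim r] by (simp add: o_def)
  have v_lim: "v \<longlonglongrightarrow> l" using lim by (simp add: v_def[abs_def] o_def)
  have s: "s n \<in> {0..1}" "s n \<noteq> t0" for n using tz by (auto simp: s_def)
  have at: "filterlim s (at t0 within {0..1}) sequentially"
    using s s_lim by (auto simp: filterlim_at intro!: always_eventually)
  have inv0: "(\<lambda>n. inverse (real (Suc (r n)))) \<longlonglongrightarrow> 0"
    using LIMSEQ_subseq_LIMSEQ[OF LIMSEQ_inverse_real_of_nat r] by (simp add: o_def)
  have along: "(\<lambda>n. F (s n)) \<longlonglongrightarrow> F t0" if "continuous_on {0..1} F" for F :: "real \<Rightarrow> 'b::topological_space"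
    using continuous_on_tendsto_compose[OF that s_lim t0] s by auto
  have Xv: "norm (X (s n) (v n) /\<^sub>R (s n - t0)) \<le> inverse (real (Suc (r n)))" for n
    using Xw[of "r n"] s[of n] by (simp add: s_def v_def field_simps)
  have quot0: "(\<lambda>n. X (s n) (v n) /\<^sub>R (s n - t0)) \<longlonglongrightarrow> 0"
    by (rule Lim_null_comparison[OF _ inv0]) (use Xv in auto)
  have "(\<lambda>n. (s n - t0) *\<^sub>R (X (s n) (v n) /\<^sub>R (s n - t0))) \<longlonglongrightarrow> (t0 - t0) *\<^sub>R 0"
    by (intro tendsto_intros s_lim quot0)
  moreover have "(s n - t0) *\<^sub>R (X (s n) (v n) /\<^sub>R (s n - t0)) = X (s n) (v n)" for n
    using s[of n] by simp
  ultimately have "(\<lambda>n. X (s n) (v n)) \<longlonglongrightarrow> 0" by simp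
  moreover have "(\<lambda>n. X (s n) (v n)) \<longlonglongrightarrow> X t0 l"
    by (intro blinfun.tendsto along X_cont v_lim)
  ultimately have X0: "X t0 l = 0" by (rule LIMSEQ_unique[symmetric])
  have "((\<lambda>t. (X t l - X t0 l) /\<^sub>R (t - t0)) \<longlongrightarrow> Y t0 l) (at t0 within {0..1})"
    by (rule has_vector_derivative_quotient_tendsto[OF Xv_deriv[OF t0]])
  then have "(\<lambda>n. X (s n) l /\<^sub>R (s n - t0)) \<longlonglongrightarrow> Y t0 l"
    using filterlim_compose[OF _ at] X0 by fastforce
  then have 1: "(\<lambda>n. Y (s n) (v n) \<bullet> (X (s n) l /\<^sub>R (s n - t0))) \<longlonglongrightarrow> Y t0 l \<bullet> Y t0 l"
    by (intro tendsto_inner blinfun.tendsto along Y_cont v_lim)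
  have 2: "(\<lambda>n. Y (s n) (v n) \<bullet> (X (s n) l /\<^sub>R (s n - t0))) = (\<lambda>n. (X (s n) (v n) /\<^sub>R (s n - t0)) \<bullet> Y (s n) l)"
  proof (rule ext)
    fix n
    show "Y (s n) (v n) \<bullet> (X (s n) l /\<^sub>R (s n - t0)) = (X (s n) (v n) /\<^sub>R (s n - t0)) \<bullet> Y (s n) l"
      using lagrange_identity[OF s(1)[of n], of "v n" l] by simp
  qed
  have 3: "(\<lambda>n. (X (s n) (v n) /\<^sub>R (s n - t0)) \<bullet> Y (s n) l) \<longlonglongrightarrow> 0 \<bullet> Y t0 l"
    by (intro tendsto_inner quot0 blinfun.tendsto along Y_cont tendsto_const)
  have "Y t0 l \<bullet> Y t0 l = 0" using LIMSEQ_unique[OF 1[unfolded 2] 3] by simp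
  then have "Y t0 l = 0" by simp
  then have "l = 0" using initial_vector_zero[OF t0 X0] by simp
  then show False using l by simp
qed

lemma conjugate_isolated:
  assumes "t0 \<in> {0..1}"
  obtains \<delta> where "\<delta> > 0" "\<And>t. t \<in> {0..1} \<Longrightarrow> t \<noteq> t0 \<Longrightarrow> \<bar>t - t0\<bar> < \<delta> \<Longrightarrow> t \<notin> conjugate"
proof -
  obtain c \<delta> where c: "c > 0" "\<delta> > 0"
    "\<And>t w. t \<in> {0..1} \<Longrightarrow> t \<noteq> t0 \<Longrightarrow> \<bar>t - t0\<bar> < \<delta> \<Longrightarrow> c * \<bar>t - t0\<bar> * norm w \<le> norm (X t w)"
    using first_order_degeneration[OF assms] by metis
  have "t \<notin> conjugate" if t: "t \<in> {0..1}" "t \<noteq> t0" "\<bar>t - t0\<bar> < \<delta>" for t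
  proof
    assume "t \<in> conjugate"
    then obtain v where v: "v \<noteq> 0" "X t v = 0" by (auto simp: conjugate_def)
    have "c * \<bar>t - t0\<bar> * norm v > 0" using c t v by simp
    then show False using c(3)[OF t, of v] v by simp
  qed
  then show ?thesis using that c(2) by blast
qed

lemma finite_conjugate: "finite conjugate"
proof (rule ccontr)
  assume inf: "infinite conjugate"
  have sub: "conjugate \<subseteq> {0..1}" by (auto simp: conjugate_def)
  then obtain t0 where t0: "t0 \<in> {0..1}" "t0 islimpt conjugate"
    using Heine_Borel_imp_Bolzano_Weierstrass[OF _ inf, of "{0..1}"] by auto
  obtain \<delta> where \<delta>: "\<delta> > 0" "\<And>t. t \<in> {0..1} \<Longrightarrow> t \<noteq> t0 \<Longrightarrow> \<bar>t - t0\<bar> < \<delta> \<Longrightarrow> t \<notin> conjugate"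
    using conjugate_isolated[OF t0(1)] by blast
  obtain t where t: "t \<in> conjugate" "t \<noteq> t0" "dist t t0 < \<delta>"
    using t0(2) \<delta>(1) unfolding islimpt_approachable by blast
  then show False using \<delta>(2)[of t] sub by (auto simp: dist_real_def)
qed

section \<open>Nonnegativity of the index form\<close>

text \<open>A function \<open>f\<close> with \<open>f t\<close> in the range of \<open>X t\<close> is \<open>f t = X t (a t)\<close> for a coefficient \<open>a t\<close>
  that is unique off the conjugate instants. At these instants it is not, but \<open>boundary_form\<close>
  does not depend on its choice.\<close>

definition coefficient :: "(real \<Rightarrow> 'v) \<Rightarrow> real \<Rightarrow> 'v" where
  "coefficient f t = (SOME v. f t = X t v)"

definition boundary_form :: "(real \<Rightarrow> 'v) \<Rightarrow> real \<Rightarrow> real" where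
  "boundary_form f t = f t \<bullet> Y t (coefficient f t)"

definition index_integrand :: "(real \<Rightarrow> 'v) \<Rightarrow> (real \<Rightarrow> 'v) \<Rightarrow> real \<Rightarrow> real" where
  "index_integrand f u t = (norm (u t))\<^sup>2 - f t \<bullet> S t (f t)"

lemma X_coefficient: "\<exists>v. f t = X t v \<Longrightarrow> X t (coefficient f t) = f t"
  unfolding coefficient_def by (metis (mono_tags, lifting) someI_ex)

lemma index_integrand_integrable:
  assumes f: "H1_deriv 0 1 f u" and "0 \<le> s" "t \<le> 1"
  shows "index_integrand f u integrable_on {s..t}"
proof -
  have "continuous_on {0..1} f"
    by (rule H1_deriv_continuous[OF f])
  then have "(\<lambda>t. f t \<bullet> S t (f t)) integrable_on {0..1}"
    by (intro integrable_continuous_real continuous_intros S_cont)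
  then have "index_integrand f u integrable_on {0..1}"
    unfolding index_integrand_def[abs_def] using f by (intro integrable_diff) (auto simp: H1_deriv_def)
  then show ?thesis by (rule integrable_on_subinterval) (use assms in auto)
qed

lemma H1_deriv_Xv: "H1_deriv 0 1 (\<lambda>t. X t v) (\<lambda>t. Y t v)"
  by (rule H1_deriv_C1) (auto intro!: Xv_deriv continuous_intros Y_cont)

text \<open>With \<open>h = f - X a\<^sub>0\<close>, \<open>a\<^sub>0\<close> a coefficient at \<open>t0\<close>, the symmetry of the Lagrange identity gives
  \<open>boundary_form f = h \<bullet> Y (a - a\<^sub>0) + h \<bullet> Y a\<^sub>0 + Y a\<^sub>0 \<bullet> f\<close>. The first term tends to \<open>0\<close> at \<open>t0\<close>, since \<open>a - a\<^sub>0\<close>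
  grows at most like \<open>\<bar>h\<bar> / \<bar>t - t0\<bar>\<close> whereas \<open>\<bar>h\<bar>\<^sup>2 = o(t - t0)\<close>.\<close>

lemma boundary_form_continuous:
  assumes f: "H1_deriv 0 1 f u" and rep: "\<And>t. t \<in> {0..1} \<Longrightarrow> \<exists>v. f t = X t v"
  shows "continuous_on {0..1} (boundary_form f)"
proof -
  have "((boundary_form f) \<longlongrightarrow> boundary_form f t0) (at t0 within {0..1})" if t0: "t0 \<in> {0..1}" for t0
  proof -
    define a where "a = coefficient f"
    have Xa: "X t (a t) = f t" if "t \<in> {0..1}" for t
      unfolding a_def using rep[OF that] by (rule X_coefficient)
    define a0 where "a0 = a t0"
    define h where "h t = f t - X t a0" for t
    have h: "H1_deriv 0 1 h (\<lambda>t. u t - Y t a0)"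
      unfolding h_def[abs_def] by (intro H1_deriv_diff f H1_deriv_Xv)
    have h0: "h t0 = 0" using Xa[OF t0] by (simp add: h_def a0_def)
    obtain C where C: "C > 0" "\<And>t. t \<in> {0..1} \<Longrightarrow> norm (Y t) \<le> C"
      using continuous_on_unit_bounded[OF Y_cont] by metis
    obtain c \<delta>1 where c: "c > 0" "\<delta>1 > 0"
      "\<And>t w. t \<in> {0..1} \<Longrightarrow> t \<noteq> t0 \<Longrightarrow> \<bar>t - t0\<bar> < \<delta>1 \<Longrightarrow> c * \<bar>t - t0\<bar> * norm w \<le> norm (X t w)"
      using first_order_degeneration[OF t0] by metis
    let ?R = "\<lambda>t. h t \<bullet> Y t (a t - a0)"
    have R: "(?R \<longlongrightarrow> 0) (at t0 within {0..1})"
    proof (rule tendstoI)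
      fix e :: real assume e: "e > 0"
      define \<epsilon> where "\<epsilon> = e * c / (2 * C)"
      have \<epsilon>: "\<epsilon> > 0" using e c C by (simp add: \<epsilon>_def)
      obtain \<delta>2 where \<delta>2: "\<delta>2 > 0" "\<And>t. t \<in> {0..1} \<Longrightarrow> \<bar>t - t0\<bar> < \<delta>2 \<Longrightarrow> (norm (h t))\<^sup>2 \<le> \<epsilon> * \<bar>t - t0\<bar>"
        using H1_deriv_square_little_o[OF h t0 h0 \<epsilon>] by metis
      show "\<forall>\<^sub>F t in at t0 within {0..1}. dist (?R t) 0 < e"
        unfolding eventually_at
      proof (intro exI[of _ "min \<delta>1 \<delta>2"] conjI ballI impI)
        show "0 < min \<delta>1 \<delta>2" using c \<delta>2 by simp
        fix t assume t: "t \<in> {0..1}" "t \<noteq> t0 \<and> dist t t0 < min \<delta>1 \<delta>2"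
        define \<tau> where "\<tau> = \<bar>t - t0\<bar>"
        have \<tau>: "\<tau> > 0" "\<tau> < \<delta>1" "\<tau> < \<delta>2" using t by (auto simp: \<tau>_def dist_real_def)
        have "X t (a t - a0) = h t" using Xa[OF t(1)] by (simp add: blinfun.diff_right h_def)
        then have 1: "c * \<tau> * norm (a t - a0) \<le> norm (h t)"
          using c(3)[of t "a t - a0"] t \<tau> by (simp add: \<tau>_def)
        have "\<bar>?R t\<bar> \<le> norm (h t) * norm (Y t (a t - a0))" by (rule Cauchy_Schwarz_ineq2)
        also have "\<dots> \<le> norm (h t) * (C * norm (a t - a0))"
          by (intro mult_left_mono order_trans[OF norm_blinfun] mult_right_mono C t) auto
        finally have "c * \<tau> * \<bar>?R t\<bar> \<le> c * \<tau> * (norm (h t) * (C * norm (a t - a0)))"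
          using c(1) \<tau>(1) by (intro mult_left_mono) auto
        also have "\<dots> = C * norm (h t) * (c * \<tau> * norm (a t - a0))" by (simp add: algebra_simps)
        also have "\<dots> \<le> C * norm (h t) * norm (h t)" using 1 C(1) by (intro mult_left_mono) auto
        also have "\<dots> = C * (norm (h t))\<^sup>2" by (simp add: power2_eq_square)
        also have "\<dots> \<le> C * (\<epsilon> * \<tau>)" using \<delta>2(2)[OF t(1)] \<tau> C(1) by (intro mult_left_mono) (auto simp: \<tau>_def)
        also have "\<dots> = c * \<tau> * (e / 2)" using C(1) by (simp add: \<epsilon>_def)
        finally have "\<bar>?R t\<bar> \<le> e / 2" using c(1) \<tau>(1) by simp
        then show "dist (?R t) 0 < e" using e by simp
      qed
    qed
    have contf: "continuous_on {0..1} f"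
      by (rule H1_deriv_continuous[OF f])
    have "continuous_on {0..1} (\<lambda>t. h t \<bullet> Y t a0 + Y t a0 \<bullet> f t)"
      unfolding h_def by (intro continuous_intros contf X_cont Y_cont)
    then have "((\<lambda>t. h t \<bullet> Y t a0 + Y t a0 \<bullet> f t) \<longlongrightarrow> h t0 \<bullet> Y t0 a0 + Y t0 a0 \<bullet> f t0) (at t0 within {0..1})"
      using t0 unfolding continuous_on_def by blast
    from tendsto_add[OF R this]
    have lim: "((\<lambda>t. ?R t + (h t \<bullet> Y t a0 + Y t a0 \<bullet> f t)) \<longlongrightarrow> boundary_form f t0) (at t0 within {0..1})"
      by (simp add: h0 boundary_form_def inner_commute a0_def a_def)
    show ?thesis
    proof (rule Lim_transform_eventually[OF lim])
      have "?R t + (h t \<bullet> Y t a0 + Y t a0 \<bullet> f t) = boundary_form f t" if t: "t \<in> {0..1}" for t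
      proof -
        have "Y t a0 \<bullet> f t = X t a0 \<bullet> Y t (a t)"
          using lagrange_identity[OF t, of a0 "a t"] Xa[OF t] by simp
        then show ?thesis
          by (simp add: boundary_form_def a_def[symmetric] h_def inner_diff_left inner_diff_right blinfun.diff_right)
      qed
      then show "\<forall>\<^sub>F t in at t0 within {0..1}. ?R t + (h t \<bullet> Y t a0 + Y t a0 \<bullet> f t) = boundary_form f t"
        by (auto simp: eventually_at_filter)
    qed
  qed
  then show ?thesis unfolding continuous_on_def by blast
qed

lemma in_range_if_regular:
  assumes "t \<in> {0<..1}" "t \<notin> conjugate"
  shows "\<exists>v. y = X t v"
proof -
  have "inj (blinfun_apply (X t))"
    using linear_injective_0[OF linear_blinfun_apply[of "X t"]] assms by (auto simp: conjugate_def)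
  then have "surj (blinfun_apply (X t))"
    by (intro linear_injective_imp_surjective linear_blinfun_apply) simp_all
  then show ?thesis by (rule surjD)
qed

text \<open>By compactness, \<open>\<bar>X t w\<bar>\<close> attains a minimum over the interval times the unit sphere, and it is not \<open>0\<close>.\<close>

lemma regular_interval_coercive:
  assumes ab: "0 < \<alpha>" "\<beta> \<le> 1" and reg: "{\<alpha>..\<beta>} \<inter> conjugate = {}"
  obtains c where "c > 0" "\<And>t w. t \<in> {\<alpha>..\<beta>} \<Longrightarrow> c * norm w \<le> norm (X t w)"
proof (cases "\<alpha> \<le> \<beta>")
  case True
  let ?K = "{\<alpha>..\<beta>} \<times> sphere (0::'v) 1"
  obtain b :: 'v where b: "b \<in> Basis" using nonempty_Basis by blast
  then have ne: "?K \<noteq> {}" using True by (auto intro!: exI[of _ b])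
  have "continuous_on ?K (\<lambda>p. norm (X (fst p) (snd p)))"
    by (intro continuous_intros continuous_on_compose2[OF X_cont]) (use ab in auto)
  moreover have "compact ?K" by (intro compact_Times) auto
  ultimately have "\<exists>p\<in>?K. \<forall>q\<in>?K. norm (X (fst p) (snd p)) \<le> norm (X (fst q) (snd q))"
    by (intro continuous_attains_inf ne)
  then obtain p where p: "p \<in> ?K" "\<And>q. q \<in> ?K \<Longrightarrow> norm (X (fst p) (snd p)) \<le> norm (X (fst q) (snd q))"
    by (elim bexE) (rule that, assumption, erule bspec)
  define c where "c = norm (X (fst p) (snd p))"
  have "snd p \<noteq> 0" using p(1) by auto
  moreover have "fst p \<in> {0<..1}" "fst p \<notin> conjugate" using p(1) ab reg by auto
  ultimately have "X (fst p) (snd p) \<noteq> 0" by (auto simp: conjugate_def)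
  then have "c > 0" by (simp add: c_def)
  moreover have "c * norm w \<le> norm (X t w)" if t: "t \<in> {\<alpha>..\<beta>}" for t w
  proof (cases "w = 0")
    case False
    have "c \<le> norm (X t (w /\<^sub>R norm w))" using p(2)[of "(t, w /\<^sub>R norm w)"] t False by (simp add: c_def)
    then show ?thesis using False by (simp add: blinfun.scaleR_right field_simps)
  qed simp
  ultimately show ?thesis by (rule that)
next
  case False
  then show ?thesis by (intro that[of 1]) auto
qed

text \<open>Completing the square: \<open>(f \<bullet> Y a)' = \<bar>u\<bar>\<^sup>2 - f \<bullet> S f - \<bar>u - Y a\<bar>\<^sup>2\<close> almost everywhere. The coefficient
  \<open>a = X\<^sup>-\<^sup>1 f\<close> is absolutely continuous, and differentiable wherever \<open>f\<close> is, since \<open>X\<close> is uniformly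
  invertible on the interval; there \<open>X a' = u - Y a\<close>.\<close>

lemma boundary_form_regular_interval:
  assumes f: "H1_deriv 0 1 f u" and rep: "\<And>t. t \<in> {0..1} \<Longrightarrow> \<exists>v. f t = X t v"
    and ab: "0 < \<alpha>" "\<alpha> \<le> \<beta>" "\<beta> \<le> 1" and reg: "{\<alpha>..\<beta>} \<inter> conjugate = {}"
  shows "boundary_form f \<beta> - boundary_form f \<alpha> \<le> integral {\<alpha>..\<beta>} (index_integrand f u)"
proof -
  define a where "a = coefficient f"
  have sub: "{\<alpha>..\<beta>} \<subseteq> {0..1}" using ab by auto
  have Xa: "X t (a t) = f t" if "t \<in> {0..1}" for t
    unfolding a_def using rep[OF that] by (rule X_coefficient)
  obtain c where c: "c > 0" "\<And>t w. t \<in> {\<alpha>..\<beta>} \<Longrightarrow> c * norm w \<le> norm (X t w)"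
    using regular_interval_coercive[OF ab(1,3) reg] by metis
  have f': "H1_deriv \<alpha> \<beta> f u" using f ab by (auto intro: H1_deriv_subset)
  have contf: "continuous_on {0..1} f"
    by (rule H1_deriv_continuous[OF f])
  obtain M where M: "M > 0" "\<And>t. t \<in> {0..1} \<Longrightarrow> norm (f t) \<le> M"
    using continuous_on_unit_bounded[OF contf] by metis
  have abound: "norm (a t) \<le> M / c" if t: "t \<in> {\<alpha>..\<beta>}" for t
  proof -
    have "c * norm (a t) \<le> M" using c(2)[OF t, of "a t"] Xa[of t] M(2)[of t] t sub by force
    then show ?thesis using c(1) by (simp add: field_simps)
  qed
  have acX: "absolutely_continuous_on \<alpha> \<beta> X"
  proof -
    obtain C where C: "C > 0" "\<And>t. t \<in> {0..1} \<Longrightarrow> norm (Y t) \<le> C"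
      using continuous_on_unit_bounded[OF Y_cont] by metis
    show ?thesis
    proof (rule absolutely_continuous_on_Lipschitz[of _ _ _ C])
      show "norm (X s - X t) \<le> C * \<bar>s - t\<bar>" if "s \<in> {\<alpha>..\<beta>}" "t \<in> {\<alpha>..\<beta>}" for s t
        using norm_diff_le_if_derivative_bounded[OF X_deriv C(2)] that sub by blast
    qed
  qed
  have aca: "absolutely_continuous_on \<alpha> \<beta> a"
  proof (rule absolutely_continuous_on_dominated[where C = "max 1 (M / c) / c"])
    show "absolutely_continuous_on \<alpha> \<beta> f" using f' by (simp add: H1_deriv_def)
    show "absolutely_continuous_on \<alpha> \<beta> X" by (rule acX)
    fix s t assume st: "s \<in> {\<alpha>..\<beta>}" "t \<in> {\<alpha>..\<beta>}"
    have eq: "X s (a s - a t) = (f s - f t) - (X s - X t) (a t)"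
      using Xa[of s] Xa[of t] st sub by (simp add: blinfun.diff_right blinfun.diff_left subset_iff)
    have "c * norm (a s - a t) \<le> norm (f s - f t) + norm ((X s - X t) (a t))"
      using c(2)[OF st(1), of "a s - a t"] norm_triangle_ineq4[of "f s - f t" "(X s - X t) (a t)"] unfolding eq by simp
    also have "norm ((X s - X t) (a t)) \<le> norm (X s - X t) * (M / c)"
      by (intro order_trans[OF norm_blinfun] mult_left_mono abound st) auto
    also have "norm (f s - f t) + norm (X s - X t) * (M / c) \<le>
        max 1 (M / c) * norm (f s - f t) + max 1 (M / c) * norm (X s - X t)"
    proof (intro add_mono)
      show "norm (f s - f t) \<le> max 1 (M / c) * norm (f s - f t)"
        using mult_right_mono[of 1 "max 1 (M / c)" "norm (f s - f t)"] by simp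
      show "norm (X s - X t) * (M / c) \<le> max 1 (M / c) * norm (X s - X t)"
        by (subst mult.commute, intro mult_right_mono) auto
    qed
    finally show "norm (a s - a t) \<le> max 1 (M / c) / c * (norm (f s - f t) + norm (X s - X t))"
      using c(1) by (simp add: field_simps)
  qed
  obtain N where N: "negligible N" "\<forall>x\<in>{\<alpha>..\<beta>} - N. (f has_vector_derivative u x) (at x within {\<alpha>..\<beta>})"
    using f' unfolding H1_deriv_def by blast
  have Xd: "(X has_vector_derivative Y t) (at t within {\<alpha>..\<beta>})" if "t \<in> {\<alpha>..\<beta>}" for t
    using that sub by (intro has_vector_derivative_within_subset[OF X_deriv sub]) auto
  have Yd: "(Y has_vector_derivative - (S t o\<^sub>L X t)) (at t within {\<alpha>..\<beta>})" if "t \<in> {\<alpha>..\<beta>}" for t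
    using that sub by (intro has_vector_derivative_within_subset[OF Y_deriv sub]) auto
  have surj: "\<exists>b. r = X t b" if t: "t \<in> {\<alpha>..\<beta>}" for t r
  proof (rule in_range_if_regular)
    show "t \<in> {0<..1}" using t ab by auto
    show "t \<notin> conjugate" using t reg by blast
  qed
  have ad: "\<exists>b. (a has_vector_derivative b) (at t within {\<alpha>..\<beta>}) \<and> X t b = u t - Y t (a t)"
    if t: "t \<in> {\<alpha>..\<beta>} - N" for t
  proof -
    obtain b where b: "X t b = u t - Y t (a t)" using surj[of t "u t - Y t (a t)"] t by auto
    \<comment> \<open>\<open>\<psi> s = X s (a s - a t - (s - t) b)\<close> is the first order remainder of \<open>a\<close> at \<open>t\<close>, seen through \<open>X\<close>.\<close>
    define \<psi> where "\<psi> s = f s - X s (a t) - X s ((s - t) *\<^sub>R b)" for s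
    have "(\<psi> has_vector_derivative (u t - (X t 0 + Y t (a t)) - (X t ((1 - 0) *\<^sub>R b) + Y t ((t - t) *\<^sub>R b)))) (at t within {\<alpha>..\<beta>})"
      unfolding \<psi>_def
    proof (intro has_vector_derivative_diff bounded_bilinear.has_vector_derivative[OF bounded_bilinear_blinfun_apply])
      have "((\<lambda>s. s - t) has_real_derivative 1 - 0) (at t within {\<alpha>..\<beta>})"
        by (intro derivative_intros)
      from has_vector_derivative_scaleR[OF this has_vector_derivative_const[of b]]
      show "((\<lambda>s. (s - t) *\<^sub>R b) has_vector_derivative (1 - 0) *\<^sub>R b) (at t within {\<alpha>..\<beta>})" by simp
    qed (use t N Xd in auto)
    then have "(\<psi> has_vector_derivative 0) (at t within {\<alpha>..\<beta>})" using b by (simp add: blinfun.zero_right)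
    then have \<psi>d: "\<forall>e>0. \<forall>\<^sub>F s in at t within {\<alpha>..\<beta>}. norm (\<psi> s - \<psi> t - (s - t) *\<^sub>R 0) \<le> e * norm (s - t)"
      unfolding has_vector_derivative_def has_derivative_within_alt2 by blast
    have \<psi>t: "\<psi> t = 0" using Xa[of t] t sub by (auto simp: \<psi>_def blinfun.zero_right)
    have \<psi>X: "\<psi> s = X s (a s - a t - (s - t) *\<^sub>R b)" if "s \<in> {\<alpha>..\<beta>}" for s
      using Xa[of s] that sub by (auto simp: \<psi>_def blinfun.diff_right)
    have "(a has_vector_derivative b) (at t within {\<alpha>..\<beta>})"
      unfolding has_vector_derivative_def has_derivative_within_alt2
    proof (intro conjI allI impI bounded_linear_scaleR_left)
      fix e :: real assume e: "e > 0"
      have "\<forall>\<^sub>F s in at t within {\<alpha>..\<beta>}. norm (\<psi> s) \<le> c * e * norm (s - t)"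
        using \<psi>d[rule_format, of "c * e"] c(1) e \<psi>t by simp
      moreover have "\<forall>\<^sub>F s in at t within {\<alpha>..\<beta>}. s \<in> {\<alpha>..\<beta>}"
        by (auto simp: eventually_at_filter)
      ultimately show "\<forall>\<^sub>F s in at t within {\<alpha>..\<beta>}. norm (a s - a t - (s - t) *\<^sub>R b) \<le> e * norm (s - t)"
      proof eventually_elim
        case (elim s)
        have "c * norm (a s - a t - (s - t) *\<^sub>R b) \<le> c * (e * norm (s - t))"
          using c(2)[OF elim(2), of "a s - a t - (s - t) *\<^sub>R b"] elim(1) \<psi>X[OF elim(2)] by simp
        then show ?case using c(1) by simp
      qed
    qed
    then show ?thesis using b by blast
  qed
  let ?F = "\<lambda>t. f t \<bullet> Y t (a t)"
  define g where "g t = index_integrand f u t - (norm (u t - Y t (a t)))\<^sup>2" for t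
  have "absolutely_continuous_on \<alpha> \<beta> Y"
  proof -
    have cont: "continuous_on {0..1} (\<lambda>t. - (S t o\<^sub>L X t))"
      by (intro continuous_intros bounded_bilinear.continuous_on[OF bounded_bilinear_blinfun_compose] S_cont X_cont)
    obtain C where C: "C > 0" "\<And>t. t \<in> {0..1} \<Longrightarrow> norm (- (S t o\<^sub>L X t)) \<le> C"
      using continuous_on_unit_bounded[OF cont] by metis
    show ?thesis
    proof (rule absolutely_continuous_on_Lipschitz[of _ _ _ C])
      show "norm (Y s - Y t) \<le> C * \<bar>s - t\<bar>" if "s \<in> {\<alpha>..\<beta>}" "t \<in> {\<alpha>..\<beta>}" for s t
        using norm_diff_le_if_derivative_bounded[OF Y_deriv C(2)] that sub by blast
    qed
  qed
  then have acF: "absolutely_continuous_on \<alpha> \<beta> ?F"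
    using f' aca by (intro absolutely_continuous_on_bilinear[OF bounded_bilinear_inner]
        absolutely_continuous_on_bilinear[OF bounded_bilinear_blinfun_apply]) (auto simp: H1_deriv_def)
  have dF: "(?F has_vector_derivative g t) (at t within {\<alpha>..\<beta>})" if t: "t \<in> {\<alpha>..\<beta>} - N" for t
  proof -
    obtain b where b: "(a has_vector_derivative b) (at t within {\<alpha>..\<beta>})" "X t b = u t - Y t (a t)"
      using ad[OF t] by blast
    have t01: "t \<in> {0..1}" using t sub by auto
    have "(?F has_vector_derivative (f t \<bullet> (Y t b + (- (S t o\<^sub>L X t)) (a t)) + u t \<bullet> Y t (a t))) (at t within {\<alpha>..\<beta>})"
      using t N by (intro bounded_bilinear.has_vector_derivative[OF bounded_bilinear_inner]
          bounded_bilinear.has_vector_derivative[OF bounded_bilinear_blinfun_apply] b Yd) auto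
    moreover have "f t \<bullet> (Y t b + (- (S t o\<^sub>L X t)) (a t)) + u t \<bullet> Y t (a t) = g t"
    proof -
      have "f t \<bullet> Y t b = Y t (a t) \<bullet> (u t - Y t (a t))"
        using lagrange_identity[OF t01, of "a t" b] b(2) Xa[OF t01] by simp
      then show ?thesis
        using Xa[OF t01]
        by (simp add: g_def index_integrand_def power2_norm_eq_inner inner_diff_left inner_diff_right
            inner_add_right inner_commute blinfun.minus_left blinfun_compose.rep_eq)
    qed
    ultimately show ?thesis by simp
  qed
  have "(g has_integral (?F \<beta> - ?F \<alpha>)) {\<alpha>..\<beta>}"
    by (rule fundamental_theorem_of_calculus_absolutely_continuous[OF ab(2) acF N(1) dF])
  moreover have "(index_integrand f u has_integral integral {\<alpha>..\<beta>} (index_integrand f u)) {\<alpha>..\<beta>}"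
    using ab by (intro integrable_integral index_integrand_integrable[OF f]) auto
  ultimately have "?F \<beta> - ?F \<alpha> \<le> integral {\<alpha>..\<beta>} (index_integrand f u)"
    by (rule has_integral_le) (simp add: g_def)
  then show ?thesis by (simp add: boundary_form_def a_def)
qed

text \<open>The inequality for regular intervals is additive, and it extends to intervals that contain conjugate
  instants because these are isolated and the boundary form is continuous there. On the whole interval
  the boundary form contributes nothing, since \<open>f\<close> vanishes at both ends.\<close>

theorem index_form_nonneg:
  assumes f: "H1_deriv 0 1 f u" and "f 0 = 0" "f 1 = 0"
    and rep: "\<And>t. t \<in> conjugate \<Longrightarrow> \<exists>v. f t = X t v"
  shows "integral {0..1} (index_integrand f u) \<ge> 0"
proof -
  have rep': "\<exists>v. f t = X t v" if t: "t \<in> {0..1}" for t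
  proof (cases "t \<in> conjugate \<or> t = 0")
    case True
    then show ?thesis using rep \<open>f 0 = 0\<close> by (auto simp: X_0)
  next
    case False
    then show ?thesis using t by (intro in_range_if_regular) auto
  qed
  have int: "index_integrand f u integrable_on {s..t}" if "0 \<le> s" "t \<le> 1" for s t
    using that by (rule index_integrand_integrable[OF f])
  define G where "G t = integral {0..t} (index_integrand f u) - boundary_form f t" for t
  have G: "continuous_on {0..1} G" unfolding G_def
    by (intro continuous_intros indefinite_integral_continuous_1 int boundary_form_continuous[OF f rep']) auto
  have G_reg: "G \<alpha> \<le> G \<beta>" if ab: "0 < \<alpha>" "\<alpha> \<le> \<beta>" "\<beta> \<le> 1" "{\<alpha>..\<beta>} \<inter> conjugate = {}" for \<alpha> \<beta>
  proof -
    have "integral {0..\<alpha>} (index_integrand f u) + integral {\<alpha>..\<beta>} (index_integrand f u) = integral {0..\<beta>} (index_integrand f u)"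
      using ab by (intro Henstock_Kurzweil_Integration.integral_combine int) auto
    then show ?thesis using boundary_form_regular_interval[OF f rep' ab] by (simp add: G_def)
  qed
  have "0 \<le> (0::real) \<and> (1::real) \<le> 1 \<longrightarrow> G 0 \<le> G 1"
    using zero_le_one
  proof (induction rule: Bolzano[where P = "\<lambda>s t. 0 \<le> s \<and> t \<le> 1 \<longrightarrow> G s \<le> G t"])
    case (trans a b c) then show ?case by auto
  next
    case (local x)
    then have x: "x \<in> {0..1}" by simp
    obtain \<delta> where \<delta>: "\<delta> > 0" and reg: "\<And>t. t \<in> {0..1} \<Longrightarrow> t \<noteq> x \<Longrightarrow> \<bar>t - x\<bar> < \<delta> \<Longrightarrow> t \<notin> conjugate"
      using conjugate_isolated[OF x] by blast
    have disj: "{s..t} \<inter> conjugate = {}"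
      if "0 \<le> s" "t \<le> 1" "x \<notin> {s..t}" "x - \<delta> < s" "t < x + \<delta>" for s t
    proof -
      have "r \<notin> conjugate" if "r \<in> {s..t}" for r
        using that \<open>0 \<le> s\<close> \<open>t \<le> 1\<close> \<open>x \<notin> {s..t}\<close> \<open>x - \<delta> < s\<close> \<open>t < x + \<delta>\<close>
        by (intro reg) (auto simp: abs_less_iff)
      then show ?thesis by blast
    qed
    have Gx: "(G \<longlongrightarrow> G x) (at x within {0..1})" using G x by (simp add: continuous_on_def)
    show ?case
    proof (intro exI[of _ \<delta>] conjI allI impI \<delta>)
      fix a b assume ab: "a \<le> x \<and> x \<le> b \<and> b - a < \<delta>" "0 \<le> a \<and> b \<le> 1"
      have "G a \<le> G x"
      proof (cases "a = x")
        case False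
        then have lt: "a < x" using ab by simp
        have lim: "(G \<longlongrightarrow> G x) (at_left x)"
          using tendsto_within_subset[OF Gx, of "{a..x}"] lt ab by (simp add: at_within_Icc_at_left)
        have Gs: "G s \<le> G t" if "s \<in> {a<..<x}" "t \<in> {s..<x}" for s t
          using that ab by (intro G_reg disj) auto
        have Gsx: "G s \<le> G x" if s: "s \<in> {a<..<x}" for s
          by (rule tendsto_lowerbound[OF lim])
            (use s Gs[OF s] in \<open>auto simp: eventually_at_left_field intro!: exI[of _ s]\<close>)
        have Ga0: "(G \<longlongrightarrow> G a) (at a within {0..1})" using G lt ab x by (simp add: continuous_on_def)
        have Ga: "(G \<longlongrightarrow> G a) (at_right a)"
          using tendsto_within_subset[OF Ga0, of "{a..x}"] lt ab x by (simp add: at_within_Icc_at_right)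
        show ?thesis
          by (rule tendsto_upperbound[OF Ga])
            (use lt Gsx in \<open>auto simp: eventually_at_right_field intro!: exI[of _ x]\<close>)
      qed simp
      moreover have "G x \<le> G b"
      proof (cases "b = x")
        case False
        then have lt: "x < b" using ab by simp
        have lim: "(G \<longlongrightarrow> G x) (at_right x)"
          using tendsto_within_subset[OF Gx, of "{x..b}"] lt ab by (simp add: at_within_Icc_at_right)
        show ?thesis
        proof (rule tendsto_upperbound[OF lim])
          have "G s \<le> G b" if "s \<in> {x<..<b}" for s
            using that ab by (intro G_reg disj) auto
          then show "\<forall>\<^sub>F s in at_right x. G s \<le> G b"
            using lt by (auto simp: eventually_at_right_field intro!: exI[of _ b])
        qed simp
      qed simp
      ultimately show "G a \<le> G b" by simp
    qed
  qed
  then have "G 0 \<le> G 1" by simp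
  then show ?thesis using assms(2,3) by (simp add: G_def boundary_form_def)
qed

end

section \<open>Dimension counts\<close>

text \<open>By induction on the number of functionals: passing to the kernel of one of them loses at most one
  dimension.\<close>

lemma edim_le_card_functionals:
  fixes \<phi> :: "'i \<Rightarrow> 'v::real_vector \<Rightarrow> real"
  assumes "finite I" and "subspace U"
    and lin: "\<And>i u v r s. i \<in> I \<Longrightarrow> u \<in> U \<Longrightarrow> v \<in> U \<Longrightarrow> \<phi> i (r *\<^sub>R u + s *\<^sub>R v) = r * \<phi> i u + s * \<phi> i v"
    and ker: "\<And>u. u \<in> U \<Longrightarrow> (\<And>i. i \<in> I \<Longrightarrow> \<phi> i u = 0) \<Longrightarrow> u = 0"
  shows "edim U \<le> enat (card I)"
proof -
  have "\<exists>B. finite B \<and> card B \<le> card I \<and> U \<subseteq> span B"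
    using assms
  proof (induction I arbitrary: U)
    case empty
    then show ?case by (intro exI[of _ "{}"]) auto
  next
    case (insert i I)
    note lin = insert.prems(2)
    define U' where "U' = {u \<in> U. \<phi> i u = 0}"
    have "subspace U'"
    proof (rule subspaceI)
      show "0 \<in> U'" using subspace_0[OF insert.prems(1)] lin[of i 0 0 0 0] by (simp add: U'_def)
      fix x y assume "x \<in> U'" "y \<in> U'"
      then show "x + y \<in> U'" using subspace_add[OF insert.prems(1)] lin[of i x y 1 1] by (simp add: U'_def)
    next
      fix c x assume "x \<in> U'"
      then show "c *\<^sub>R x \<in> U'" using subspace_scale[OF insert.prems(1)] lin[of i x x c 0] by (simp add: U'_def)
    qed
    then have "\<exists>B. finite B \<and> card B \<le> card I \<and> U' \<subseteq> span B"
    proof (rule insert.IH)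
      fix u assume "u \<in> U'" "\<And>j. j \<in> I \<Longrightarrow> \<phi> j u = 0"
      then show "u = 0" by (intro insert.prems(3)) (auto simp: U'_def)
    qed (auto simp: U'_def lin)
    then obtain B where B: "finite B" "card B \<le> card I" "U' \<subseteq> span B" by blast
    show ?case
    proof (cases "U' = U")
      case True
      then show ?thesis using B insert.hyps by (intro exI[of _ B]) auto
    next
      case False
      then obtain u0 where u0: "u0 \<in> U" "\<phi> i u0 \<noteq> 0" by (auto simp: U'_def)
      have "u \<in> span (insert u0 B)" if u: "u \<in> U" for u
      proof -
        define r where "r = \<phi> i u / \<phi> i u0"
        have "u - r *\<^sub>R u0 \<in> U" using u u0 insert.prems(1) by (intro subspace_diff subspace_scale)
        moreover have "\<phi> i (u - r *\<^sub>R u0) = 0"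
          using lin[of i u u0 1 "- r"] u u0 by (simp add: r_def)
        ultimately have "u - r *\<^sub>R u0 \<in> span B" using B by (auto simp: U'_def)
        then show ?thesis by (auto simp: span_insert)
      qed
      then show ?thesis using B insert.hyps
        by (intro exI[of _ "insert u0 B"]) (auto simp: card_insert_if)
    qed
  qed
  then obtain B where B: "finite B" "card B \<le> card I" "U \<subseteq> span B" by blast
  then have "dim U \<le> card B" by (intro dim_le_card)
  then show ?thesis using B by (auto simp: edim_def)
qed

lemma card_independent_le_edim:
  assumes "independent B" "B \<subseteq> U" "finite B"
  shows "enat (card B) \<le> edim U"
proof (cases "\<exists>C. finite C \<and> U \<subseteq> span C")
  case True
  then obtain C where C: "finite C" "U \<subseteq> span C" by blast
  obtain B' where B': "B' \<subseteq> U" "independent B'" "U \<subseteq> span B'" "card B' = dim U"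
    using basis_exists by blast
  have "finite B'" using independent_span_bound[OF C(1) B'(2)] B' C by auto
  then have "card B \<le> card B'" using independent_span_bound[of B' B] assms B' by auto
  then show ?thesis using True B' by (simp add: edim_def)
next
  case False
  then show ?thesis unfolding edim_def by (subst if_not_P) auto
qed

lemma edim_linear_image:
  fixes L :: "'v::euclidean_space \<Rightarrow> 'w::real_vector"
  assumes L: "linear L" and V: "subspace V" and inj: "\<And>v. v \<in> V \<Longrightarrow> L v = 0 \<Longrightarrow> v = 0"
  shows "edim (L ` V) = enat (dim V)"
proof -
  have "inj_on L V"
  proof (rule inj_onI)
    fix x y assume xy: "x \<in> V" "y \<in> V" "L x = L y"
    have "x - y = 0" using xy by (intro inj) (auto simp: linear_diff[OF L] subspace_diff[OF V])
    then show "x = y" by simp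
  qed
  obtain B where B: "B \<subseteq> V" "independent B" "V \<subseteq> span B" "card B = dim V"
    using basis_exists by blast
  have finB: "finite B" using B(2) by (rule independent_bound_general[THEN conjunct1])
  have spanB: "span B \<subseteq> V" using B(1) V by (metis span_minimal)
  have "independent (L ` B)"
    by (rule linear_independent_injective_image[OF L B(2) inj_on_subset[OF \<open>inj_on L V\<close> spanB]])
  moreover have "card (L ` B) = card B"
    by (rule card_image[OF inj_on_subset[OF \<open>inj_on L V\<close> B(1)]])
  moreover have "L ` V \<subseteq> span (L ` B)"
    using image_mono[OF B(3), of L] by (simp add: linear_span_image[OF L])
  ultimately have "dim (L ` V) = card B" "\<exists>C. finite C \<and> L ` V \<subseteq> span C"
    using finB B(1) by (auto intro!: dim_unique[of "L ` B"] exI[of _ "L ` B"])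
  then show ?thesis by (simp add: edim_def B)
qed

text \<open>\<open>f\<close> is injective on the orthogonal complement of its kernel; count dimensions.\<close>

lemma dim_orthogonal_complement_range_le:
  fixes f :: "'v::euclidean_space \<Rightarrow> 'v"
  assumes f: "linear f"
  shows "dim {y. \<forall>w. f w \<bullet> y = 0} \<le> dim {v. f v = 0}"
proof -
  let ?K = "{v. f v = 0}" and ?R = "range f"
  have K: "subspace ?K" by (rule linear_subspace_kernel[OF f])
  have R: "subspace ?R" by (rule linear_subspace_image[OF f subspace_UNIV])
  define W where "W = {y. \<forall>x\<in>?K. orthogonal x y}"
  have W: "subspace W" unfolding W_def by (rule subspace_orthogonal_to_vectors)
  have "dim W + dim ?K = DIM('v)"
    using dim_subspace_orthogonal_to_vectors[OF K subspace_UNIV] by (simp add: W_def)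
  moreover have "dim (f ` W) = dim W"
  proof (rule dim_image_eq[OF f])
    have "inj_on f W"
    proof (rule inj_onI)
      fix x y assume xy: "x \<in> W" "y \<in> W" "f x = f y"
      then have "x - y \<in> W" "x - y \<in> ?K"
        using subspace_diff[OF W] linear_diff[OF f] by auto
      then have "orthogonal (x - y) (x - y)" by (auto simp: W_def)
      then show "x = y" by (simp add: orthogonal_def)
    qed
    then show "inj_on f (span W)" using W by (simp add: span_eq_iff[THEN iffD2])
  qed
  moreover have "dim (f ` W) \<le> dim ?R" by (intro dim_subset) auto
  moreover have "dim {y. \<forall>x\<in>?R. orthogonal x y} + dim ?R = DIM('v)"
    using dim_subspace_orthogonal_to_vectors[OF R subspace_UNIV] by simp
  ultimately show ?thesis by (simp add: orthogonal_def)
qed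

section \<open>The index of a Jacobi system\<close>

text \<open>Lagrange interpolation: the product of the factors \<open>(x - s) / (t - s)\<close> over \<open>s \<in> F\<close>.\<close>

lemma bump_function_exists:
  assumes "finite F" "t \<notin> F"
  shows "\<exists>\<phi> \<phi>' :: real \<Rightarrow> real. (\<forall>x. (\<phi> has_real_derivative \<phi>' x) (at x)) \<and> continuous_on UNIV \<phi>' \<and>
    \<phi> t = 1 \<and> (\<forall>s\<in>F. \<phi> s = 0)"
  using assms
proof (induction F)
  case empty
  show ?case by (intro exI[of _ "\<lambda>_. 1"] exI[of _ "\<lambda>_. 0"]) auto
next
  case (insert s F)
  then obtain \<phi> \<phi>' :: "real \<Rightarrow> real" where \<phi>: "\<And>x. (\<phi> has_real_derivative \<phi>' x) (at x)" "continuous_on UNIV \<phi>'"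
    "\<phi> t = 1" "\<And>s. s\<in>F \<Longrightarrow> \<phi> s = 0" by auto
  have c: "continuous_on UNIV \<phi>" using \<phi>(1) by (meson DERIV_isCont continuous_at_imp_continuous_on)
  show ?case
  proof (rule exI[of _ "\<lambda>x. \<phi> x * ((x - s) / (t - s))"],
      rule exI[of _ "\<lambda>x. \<phi>' x * ((x - s) / (t - s)) + \<phi> x * (1 / (t - s))"], intro conjI allI)
    fix x show "((\<lambda>x. \<phi> x * ((x - s) / (t - s))) has_real_derivative \<phi>' x * ((x - s) / (t - s)) + \<phi> x * (1 / (t - s))) (at x)"
      by (rule derivative_eq_intros \<phi>(1) refl)+ (use insert.prems in auto)
  qed (use \<phi> c insert.prems in \<open>auto intro!: continuous_intros\<close>)
qed

context jacobi_system
begin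

definition multiplicity :: "real \<Rightarrow> nat" where
  "multiplicity t = dim {v. X t v = 0}"

lemma kernel_subspace: "subspace {v. X t v = 0}"
  by (rule linear_subspace_kernel[OF linear_blinfun_apply])

text \<open>At each instant \<open>t\<close>, \<open>Y t\<close> maps the kernel of \<open>X t\<close> isomorphically onto the orthogonal complement of
  its range: into it by the Lagrange identity, injectively by uniqueness, and dimensions agree.\<close>

lemma in_range_if_orthogonal:
  assumes t: "t \<in> {0..1}" and y: "\<And>b. X t b = 0 \<Longrightarrow> y \<bullet> Y t b = 0"
  shows "\<exists>v. y = X t v"
proof -
  let ?K = "{v. X t v = 0}" and ?P = "{y. \<forall>w. X t w \<bullet> y = 0}"
  have P: "subspace ?P"
    by (auto simp: subspace_def inner_add_right)
  have YK: "subspace (Y t ` ?K)" by (intro linear_subspace_image linear_blinfun_apply kernel_subspace)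
  have inj: "inj_on (Y t) ?K"
  proof (rule inj_onI)
    fix a b assume "a \<in> ?K" "b \<in> ?K" "Y t a = Y t b"
    then have "X t (a - b) = 0" "Y t (a - b) = 0" by (auto simp: blinfun.diff_right)
    then show "a = b" using initial_vector_zero[OF t] by (metis eq_iff_diff_eq_0)
  qed
  have "Y t ` ?K \<subseteq> ?P" using lagrange_identity[OF t] by auto
  moreover have "dim ?P \<le> dim (Y t ` ?K)"
  proof -
    have "dim (Y t ` ?K) = dim ?K"
      by (rule dim_image_eq[OF linear_blinfun_apply]) (use inj kernel_subspace in \<open>metis span_eq_iff\<close>)
    then show ?thesis using dim_orthogonal_complement_range_le[OF linear_blinfun_apply, of "X t"] by simp
  qed
  ultimately have eq: "Y t ` ?K = ?P" by (intro subspace_dim_equal YK P)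
  have R: "subspace (range (X t))" by (intro linear_subspace_image linear_blinfun_apply subspace_UNIV)
  obtain y1 y2 where y12: "y1 \<in> span (range (X t))" "\<And>w. w \<in> span (range (X t)) \<Longrightarrow> orthogonal y2 w" "y = y1 + y2"
    using orthogonal_subspace_decomp_exists[of "range (X t)" y] by metis
  have "X t w \<bullet> y2 = 0" for w
    using y12(2)[of "X t w"] by (simp add: orthogonal_def inner_commute span_base)
  then have "y2 \<in> ?P" by simp
  then have "y2 \<in> Y t ` ?K" by (simp only: eq)
  then obtain b where b: "X t b = 0" "y2 = Y t b" by auto
  have "y1 \<bullet> y2 = 0" using y12(1,2) by (auto simp: orthogonal_def inner_commute)
  then have "y2 \<bullet> y2 = 0" using y[OF b(1)] b y12(3) by (simp add: inner_add_left)
  then show ?thesis using y12(1,3) R by (auto simp: span_eq_iff[THEN iffD2])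
qed

definition kernel_basis :: "real \<Rightarrow> 'v set" where
  "kernel_basis t = (SOME B. B \<subseteq> {v. X t v = 0} \<and> independent B \<and> {v. X t v = 0} \<subseteq> span B \<and> card B = multiplicity t)"

lemma kernel_basis:
  "kernel_basis t \<subseteq> {v. X t v = 0}" "independent (kernel_basis t)" "{v. X t v = 0} \<subseteq> span (kernel_basis t)"
  "card (kernel_basis t) = multiplicity t" "finite (kernel_basis t)"
proof -
  have "\<exists>B. B \<subseteq> {v. X t v = 0} \<and> independent B \<and> {v. X t v = 0} \<subseteq> span B \<and> card B = multiplicity t"
    unfolding multiplicity_def using basis_exists by metis
  from someI_ex[OF this, folded kernel_basis_def]
  show "kernel_basis t \<subseteq> {v. X t v = 0}" "independent (kernel_basis t)" "{v. X t v = 0} \<subseteq> span (kernel_basis t)"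
    "card (kernel_basis t) = multiplicity t" "finite (kernel_basis t)"
    by (auto intro: independent_bound_general[THEN conjunct1])
qed

text \<open>The index set of the \<open>\<Sum>\<^sub>t m(t)\<close> linear conditions \<open>f t \<bullet> Y t b = 0\<close> which say that \<open>f t\<close> lies in the range of
  \<open>X t\<close> at all conjugate instants.\<close>

definition basis_index :: "(real \<times> 'v) set" where
  "basis_index = Sigma conjugate kernel_basis"

lemma finite_basis_index: "finite basis_index"
  unfolding basis_index_def using finite_conjugate kernel_basis(5) by blast

lemma card_basis_index: "card basis_index = (\<Sum>t\<in>conjugate. multiplicity t)"
  unfolding basis_index_def using finite_conjugate kernel_basis(4,5) by (simp add: card_SigmaI)

lemma in_range_if_basis_orthogonal:
  assumes t: "t \<in> conjugate" and y: "\<And>b. (t, b) \<in> basis_index \<Longrightarrow> y \<bullet> Y t b = 0"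
  shows "\<exists>v. y = X t v"
proof (rule in_range_if_orthogonal)
  show "t \<in> {0..1}" using t by (auto simp: conjugate_def)
  fix b assume "X t b = 0"
  then have b: "b \<in> span (kernel_basis t)" using kernel_basis(3) by auto
  have lin: "linear (\<lambda>b. y \<bullet> Y t b)"
    by (intro linearI) (auto simp: blinfun.add_right inner_add_right blinfun.scaleR_right)
  show "y \<bullet> Y t b = 0"
    by (rule linear_eq_0_on_span[OF lin _ b]) (use y t in \<open>auto simp: basis_index_def\<close>)
qed

text \<open>A family of vectors \<open>c t\<close> in the kernels of \<open>X t\<close>, \<open>t\<close> conjugate, stands for the broken Jacobi field
  \<open>\<Sum>\<^sub>t 1\<^bsub>[0,t]\<^esub> X (c t)\<close>.\<close>

definition kernel_families :: "(real \<Rightarrow> 'v) set" where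
  "kernel_families = {c. (\<forall>t\<in>conjugate. X t (c t) = 0) \<and> (\<forall>t. t \<notin> conjugate \<longrightarrow> c t = 0)}"

lemma kernel_families_independent:
  obtains B where "independent B" "finite B" "B \<subseteq> kernel_families" "card B = (\<Sum>t\<in>conjugate. multiplicity t)"
proof -
  define e where "e p = (\<lambda>s. if s = fst p then snd p else 0)" for p :: "real \<times> 'v"
  have nz: "b \<noteq> 0" if "b \<in> kernel_basis t" for t b
    using kernel_basis(2)[of t] that dependent_zero by blast
  have inj: "inj_on e basis_index"
  proof (rule inj_onI)
    fix p q assume pq: "p \<in> basis_index" "q \<in> basis_index" "e p = e q"
    have "snd p \<noteq> 0" using pq(1) nz by (auto simp: basis_index_def)
    moreover have "snd p = e q (fst p)" using pq(3) by (metis e_def)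
    ultimately have "fst p = fst q" by (auto simp: e_def split: if_splits)
    then show "p = q" using \<open>snd p = e q (fst p)\<close> by (simp add: e_def prod_eq_iff)
  qed
  have fin: "finite (e ` basis_index)" using finite_basis_index by simp
  have ind: "independent (e ` basis_index)"
  proof (rule independent_if_scalars_zero[OF fin])
    fix f z assume sum0: "(\<Sum>x\<in>e ` basis_index. f x *\<^sub>R x) = 0" and "z \<in> e ` basis_index"
    then obtain t b where z: "z = e (t, b)" "t \<in> conjugate" "b \<in> kernel_basis t" by (auto simp: basis_index_def)
    have "(\<Sum>p\<in>basis_index. f (e p) *\<^sub>R e p) = 0"
      using sum0 by (simp add: sum.reindex[OF inj])
    then have "(\<Sum>p\<in>basis_index. f (e p) *\<^sub>R e p) t = 0" by (simp add: zero_fun_def)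
    moreover have "(\<Sum>p\<in>J. g p) t = (\<Sum>p\<in>J. g p t)" if "finite J" for g :: "real \<times> 'v \<Rightarrow> real \<Rightarrow> 'v" and J
      using that by (induction J) (auto simp: zero_fun_def plus_fun_def)
    ultimately have "(\<Sum>p\<in>basis_index. f (e p) *\<^sub>R e p t) = 0"
      using finite_basis_index by (simp add: scaleR_fun_def)
    then have "(\<Sum>s\<in>conjugate. \<Sum>b\<in>kernel_basis s. f (e (s, b)) *\<^sub>R e (s, b) t) = 0"
      unfolding basis_index_def using finite_conjugate kernel_basis(5) by (simp add: sum.Sigma case_prod_unfold)
    also have "(\<Sum>s\<in>conjugate. \<Sum>b\<in>kernel_basis s. f (e (s, b)) *\<^sub>R e (s, b) t) =
        (\<Sum>s\<in>conjugate. if s = t then (\<Sum>b\<in>kernel_basis t. f (e (t, b)) *\<^sub>R b) else 0)"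
      by (intro sum.cong) (auto simp: e_def)
    also have "\<dots> = (\<Sum>b\<in>kernel_basis t. f (e (t, b)) *\<^sub>R b)" using z finite_conjugate by simp
    finally have "f (e (t, b)) = 0"
      by (intro independentD[OF kernel_basis(2,5) order_refl _ z(3), where u = "\<lambda>b. f (e (t, b))"])
    then show "f z = 0" by (simp add: z)
  qed
  have "e ` basis_index \<subseteq> kernel_families"
    by (auto simp: e_def basis_index_def kernel_families_def blinfun.zero_right dest!: kernel_basis(1)[THEN subsetD])
  moreover have "card (e ` basis_index) = (\<Sum>t\<in>conjugate. multiplicity t)"
    by (simp add: card_image[OF inj] card_basis_index)
  ultimately show ?thesis using that ind fin by blast
qed

lemma broken_field_H1:
  assumes t: "t \<in> {0..1}" and v: "X t v = 0"
  shows "H1_deriv 0 1 (\<lambda>x. if x \<le> t then X x v else 0) (\<lambda>x. if x \<le> t then Y x v else 0)"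
proof (rule H1_deriv_combine[of 0 t])
  show "H1_deriv 0 t (\<lambda>x. if x \<le> t then X x v else 0) (\<lambda>x. if x \<le> t then Y x v else 0)"
    by (rule H1_deriv_cong_ae[OF H1_deriv_subset[OF H1_deriv_Xv, of 0 t v] negligible_empty]) (use t in auto)
  have zero: "H1_deriv t 1 (\<lambda>x. 0::'v) (\<lambda>x. 0)" by (rule H1_deriv_C1) auto
  have neg: "negligible {t}" by simp
  show "H1_deriv t 1 (\<lambda>x. if x \<le> t then X x v else 0) (\<lambda>x. if x \<le> t then Y x v else 0)"
    by (rule H1_deriv_cong_ae[OF zero neg]) (use t v in auto)
qed (use t in auto)

text \<open>Integration by parts on \<open>[0, t]\<close>, where the broken Jacobi field solves the equation, leaves only the
  boundary term at its kink \<open>t\<close>.\<close>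

lemma broken_field_pairing:
  assumes g: "H1_deriv 0 1 g w" and g0: "g 0 = 0" and t: "t \<in> {0..1}"
  shows "((\<lambda>x. (if x \<le> t then Y x v else 0) \<bullet> w x - (if x \<le> t then X x v else 0) \<bullet> S x (g x))
    has_integral Y t v \<bullet> g t) {0..1}"
proof -
  let ?F = "\<lambda>x. (if x \<le> t then Y x v else 0) \<bullet> w x - (if x \<le> t then X x v else 0) \<bullet> S x (g x)"
  have "H1_deriv 0 1 (\<lambda>x. Y x v) (\<lambda>x. - S x (X x v))"
    by (rule H1_deriv_C1) (auto intro!: Yv_deriv continuous_intros X_cont S_cont)
  from H1_deriv_bilinear[OF bounded_bilinear_inner this g]
  have "H1_deriv 0 1 (\<lambda>x. Y x v \<bullet> g x) (\<lambda>x. Y x v \<bullet> w x + - S x (X x v) \<bullet> g x)" .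
  from H1_deriv_has_integral[OF this, of 0 t] t g0
  have 1: "((\<lambda>x. Y x v \<bullet> w x + - S x (X x v) \<bullet> g x) has_integral Y t v \<bullet> g t) {0..t}" by simp
  have 1: "(?F has_integral Y t v \<bullet> g t) {0..t}"
    by (rule has_integral_eq[OF _ 1]) (use t S_sym in auto)
  have "((\<lambda>x. 0::real) has_integral 0) {t..1}" by simp
  then have 2: "(?F has_integral 0) {t..1}"
    by (rule has_integral_spike_finite[of "{t}", rotated 2]) auto
  show ?thesis using has_integral_combine[OF _ _ 1 2] t by simp
qed

text \<open>On the broken Jacobi fields \<open>p\<close> the index form vanishes, by the pairing formula. Subtracting a small
  multiple of a field \<open>q\<close> with \<open>q t = Y t (c t)\<close> at the conjugate instants makes it negative: the mixed
  term contributes \<open>- 2 \<epsilon> \<Sum>\<^sub>t \<bar>Y t (c t)\<bar>\<^sup>2\<close>, which dominates the quadratic term uniformly in \<open>c\<close>. As \<open>q\<close> has to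
  vanish at the end points, the kinks must lie in the interior of the interval.\<close>

theorem negative_fields_exist:
  assumes "1 \<notin> conjugate"
  obtains w w' :: "(real \<Rightarrow> 'v) \<Rightarrow> real \<Rightarrow> 'v"
  where "\<And>r c s d x. w (\<lambda>t. r *\<^sub>R c t + s *\<^sub>R d t) x = r *\<^sub>R w c x + s *\<^sub>R w d x"
    and "\<And>c. w c 0 = 0" "\<And>c. w c 1 = 0"
    and "\<And>c. c \<in> kernel_families \<Longrightarrow> H1_deriv 0 1 (w c) (w' c)"
    and "\<And>c. c \<in> kernel_families \<Longrightarrow> c \<noteq> 0 \<Longrightarrow> integral {0..1} (index_integrand (w c) (w' c)) < 0"
proof -
  let ?T = conjugate
  have T: "finite ?T" "\<And>t. t \<in> ?T \<Longrightarrow> 0 < t \<and> t < 1" "\<And>t. t \<in> ?T \<Longrightarrow> t \<in> {0..1}"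
    using finite_conjugate assms by (auto simp: conjugate_def less_le)
  have "\<exists>\<phi> \<phi>' :: real \<Rightarrow> real. (\<forall>x. (\<phi> has_real_derivative \<phi>' x) (at x)) \<and> continuous_on UNIV \<phi>' \<and>
    \<phi> t = 1 \<and> (\<forall>s\<in>{0, 1} \<union> (?T - {t}). \<phi> s = 0)" if "t \<in> ?T" for t
    using T(1,2) that by (intro bump_function_exists) auto
  then obtain \<phi> \<phi>' :: "real \<Rightarrow> real \<Rightarrow> real" where
    \<phi>d: "\<And>t x. t \<in> ?T \<Longrightarrow> (\<phi> t has_real_derivative \<phi>' t x) (at x)" and
    \<phi>'c: "\<And>t. t \<in> ?T \<Longrightarrow> continuous_on UNIV (\<phi>' t)" and
    \<phi>1: "\<And>t. t \<in> ?T \<Longrightarrow> \<phi> t t = 1" and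
    \<phi>0: "\<And>t s. t \<in> ?T \<Longrightarrow> s \<in> {0, 1} \<union> (?T - {t}) \<Longrightarrow> \<phi> t s = 0"
    by metis
  have \<phi>c: "continuous_on {0..1} (\<phi> t)" if "t \<in> ?T" for t
    using \<phi>d[OF that] by (meson DERIV_isCont continuous_at_imp_continuous_on)
  have "\<exists>M. \<forall>x\<in>{0..1}. \<bar>\<phi> t x\<bar> \<le> M \<and> \<bar>\<phi>' t x\<bar> \<le> M" if t: "t \<in> ?T" for t
  proof -
    obtain M1 where M1: "\<And>x. x \<in> {0..1} \<Longrightarrow> norm (\<phi> t x) \<le> M1"
      using continuous_on_unit_bounded[OF \<phi>c[OF t]] by metis
    obtain M2 where M2: "\<And>x. x \<in> {0..1} \<Longrightarrow> norm (\<phi>' t x) \<le> M2"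
      using continuous_on_unit_bounded[OF continuous_on_subset[OF \<phi>'c[OF t] subset_UNIV]] by metis
    show ?thesis using M1 M2 by (intro exI[of _ "max M1 M2"]) (auto simp: max.coboundedI1 max.coboundedI2)
  qed
  then obtain M where M: "\<And>t x. t \<in> ?T \<Longrightarrow> x \<in> {0..1} \<Longrightarrow> \<bar>\<phi> t x\<bar> \<le> M t \<and> \<bar>\<phi>' t x\<bar> \<le> M t" by metis
  define p where "p c x = (\<Sum>t\<in>?T. if x \<le> t then X x (c t) else 0)" for c :: "real \<Rightarrow> 'v" and x
  define p' where "p' c x = (\<Sum>t\<in>?T. if x \<le> t then Y x (c t) else 0)" for c :: "real \<Rightarrow> 'v" and x
  define q where "q c x = (\<Sum>t\<in>?T. \<phi> t x *\<^sub>R Y t (c t))" for c :: "real \<Rightarrow> 'v" and x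
  define q' where "q' c x = (\<Sum>t\<in>?T. \<phi>' t x *\<^sub>R Y t (c t))" for c :: "real \<Rightarrow> 'v" and x
  define E where "E c = (\<Sum>t\<in>?T. (norm (Y t (c t)))\<^sup>2)" for c :: "real \<Rightarrow> 'v"
  define A where "A f u g v x = u x \<bullet> v x - f x \<bullet> S x (g x)" for f u g v :: "real \<Rightarrow> 'v" and x
  have p_H1: "H1_deriv 0 1 (p c) (p' c)" if "c \<in> kernel_families" for c
    unfolding p_def[abs_def] p'_def[abs_def] using that T
    by (intro H1_deriv_sum broken_field_H1) (auto simp: kernel_families_def)
  have q_H1: "H1_deriv 0 1 (q c) (q' c)" for c
  proof -
    have "H1_deriv 0 1 (\<lambda>x. \<phi> t x *\<^sub>R Y t (c t)) (\<lambda>x. \<phi>' t x *\<^sub>R Y t (c t))" if t: "t \<in> ?T" for t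
    proof (rule H1_deriv_C1)
      fix x :: real
      have "(\<phi> t has_real_derivative \<phi>' t x) (at x within {0..1})"
        using \<phi>d[OF t] by (rule has_field_derivative_at_within)
      from has_vector_derivative_scaleR[OF this has_vector_derivative_const[of "Y t (c t)"]]
      show "((\<lambda>x. \<phi> t x *\<^sub>R Y t (c t)) has_vector_derivative \<phi>' t x *\<^sub>R Y t (c t)) (at x within {0..1})" by simp
    next
      show "continuous_on {0..1} (\<lambda>x. \<phi>' t x *\<^sub>R Y t (c t))"
        by (intro continuous_intros continuous_on_subset[OF \<phi>'c[OF t]]) auto
    qed
    then show ?thesis unfolding q_def[abs_def] q'_def[abs_def] using T(1) by (intro H1_deriv_sum)
  qed
  have p0: "p c 0 = 0" for c unfolding p_def by (intro sum.neutral) (auto simp: X_0)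
  have p1: "p c 1 = 0" for c unfolding p_def using T(2) by (intro sum.neutral) force
  have q0: "q c 0 = 0" and q1: "q c 1 = 0" for c
    unfolding q_def using \<phi>0 by (auto intro!: sum.neutral)
  have qt: "q c t = Y t (c t)" if t: "t \<in> ?T" for c t
  proof -
    have "q c t = (\<Sum>s\<in>?T. if s = t then Y t (c t) else 0)"
      unfolding q_def using t \<phi>0 \<phi>1 by (intro sum.cong) auto
    then show ?thesis using t T(1) by simp
  qed
  have pair: "(A (p c) (p' c) g v has_integral (\<Sum>t\<in>?T. Y t (c t) \<bullet> g t)) {0..1}"
    if g: "H1_deriv 0 1 g v" "g 0 = 0" for c g v
  proof -
    have "((\<lambda>x. \<Sum>t\<in>?T. (if x \<le> t then Y x (c t) else 0) \<bullet> v x - (if x \<le> t then X x (c t) else 0) \<bullet> S x (g x))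
      has_integral (\<Sum>t\<in>?T. Y t (c t) \<bullet> g t)) {0..1}"
      by (intro has_integral_sum T(1) broken_field_pairing[OF g] T(3))
    then show ?thesis
      by (simp add: A_def[abs_def] p_def p'_def inner_sum_left sum_subtractf)
  qed
  have pp: "(A (p c) (p' c) (p c) (p' c) has_integral 0) {0..1}" if c: "c \<in> kernel_families" for c
  proof -
    have "Y t (c t) \<bullet> p c t = 0" if t: "t \<in> ?T" for t
    proof -
      have "Y t (c t) \<bullet> X t (c s) = 0" for s
        using lagrange_identity[OF T(3)[OF t], of "c t" "c s"] c t by (simp add: kernel_families_def)
      then show ?thesis unfolding p_def inner_sum_right by (intro sum.neutral) auto
    qed
    then have "(\<Sum>t\<in>?T. Y t (c t) \<bullet> p c t) = 0" by (intro sum.neutral) auto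
    then show ?thesis using pair[OF p_H1[OF c] p0, of c] by simp
  qed
  have pq: "(A (p c) (p' c) (q c) (q' c) has_integral E c) {0..1}" for c
    using pair[OF q_H1 q0] by (simp add: qt E_def power2_norm_eq_inner)
  obtain K where K: "K > 0" "\<And>t. t \<in> {0..1} \<Longrightarrow> norm (S t) \<le> K"
    using continuous_on_unit_bounded[OF S_cont] by metis
  define M2 where "M2 = (\<Sum>t\<in>?T. (M t)\<^sup>2)"
  define C where "C = (1 + K) * M2"
  have C0: "C \<ge> 0" using K by (simp add: C_def M2_def sum_nonneg)
  have qq: "(index_integrand (q c) (q' c) has_integral integral {0..1} (index_integrand (q c) (q' c))) {0..1}" for c
    by (intro integrable_integral index_integrand_integrable[OF q_H1]) auto
  have qq_le: "integral {0..1} (index_integrand (q c) (q' c)) \<le> C * E c" for c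
  proof -
    have bd: "(norm (\<Sum>t\<in>?T. \<psi> t *\<^sub>R Y t (c t)))\<^sup>2 \<le> M2 * E c" if "\<And>t. t \<in> ?T \<Longrightarrow> \<bar>\<psi> t\<bar> \<le> M t" for \<psi>
    proof -
      have "norm (\<Sum>t\<in>?T. \<psi> t *\<^sub>R Y t (c t)) \<le> (\<Sum>t\<in>?T. M t * norm (Y t (c t)))"
        using that by (intro order_trans[OF norm_sum] sum_mono) (auto intro: mult_right_mono)
      then have "(norm (\<Sum>t\<in>?T. \<psi> t *\<^sub>R Y t (c t)))\<^sup>2 \<le> (\<Sum>t\<in>?T. M t * norm (Y t (c t)))\<^sup>2"
        by (intro power_mono) auto
      also have "\<dots> \<le> M2 * E c"
        unfolding M2_def E_def by (rule Cauchy_Schwarz_ineq_sum)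
      finally show ?thesis .
    qed
    have "index_integrand (q c) (q' c) x \<le> C * E c" if x: "x \<in> {0..1}" for x
    proof -
      have 1: "(norm (q c x))\<^sup>2 \<le> M2 * E c" "(norm (q' c x))\<^sup>2 \<le> M2 * E c"
        unfolding q_def q'_def using M x by (auto intro!: bd)
      have "\<bar>q c x \<bullet> S x (q c x)\<bar> \<le> norm (q c x) * (K * norm (q c x))"
        by (intro order_trans[OF Cauchy_Schwarz_ineq2] mult_left_mono order_trans[OF norm_blinfun] mult_right_mono K x) auto
      also have "\<dots> = K * (norm (q c x))\<^sup>2" by (simp add: power2_eq_square)
      also have "\<dots> \<le> K * (M2 * E c)" using 1 K by (intro mult_left_mono) auto
      finally have "index_integrand (q c) (q' c) x \<le> M2 * E c + K * (M2 * E c)"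
        using 1 by (simp add: index_integrand_def)
      then show ?thesis by (simp add: C_def algebra_simps)
    qed
    then have "integral {0..1} (index_integrand (q c) (q' c)) \<le> integral {0..1::real} (\<lambda>x. C * E c)"
      using qq by (intro integral_le) auto
    then show ?thesis by simp
  qed
  \<comment> \<open>The index form of \<open>p - \<epsilon> q\<close> will be at most \<open>\<epsilon> E (\<epsilon> C - 2)\<close>.\<close>
  define \<epsilon> where "\<epsilon> = 1 / (C + 1)"
  have \<epsilon>: "\<epsilon> > 0" "\<epsilon> * C < 2" using C0 by (auto simp: \<epsilon>_def field_simps)
  define w where "w c x = p c x - \<epsilon> *\<^sub>R q c x" for c x
  define w' where "w' c x = p' c x - \<epsilon> *\<^sub>R q' c x" for c x
  show ?thesis
  proof
    fix r s c d x
    have "p (\<lambda>t. r *\<^sub>R c t + s *\<^sub>R d t) x = r *\<^sub>R p c x + s *\<^sub>R p d x"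
      unfolding p_def scaleR_sum_right sum.distrib[symmetric]
      by (intro sum.cong) (auto simp: blinfun.add_right blinfun.scaleR_right)
    moreover have "q (\<lambda>t. r *\<^sub>R c t + s *\<^sub>R d t) x = r *\<^sub>R q c x + s *\<^sub>R q d x"
      unfolding q_def scaleR_sum_right sum.distrib[symmetric]
      by (intro sum.cong) (auto simp: blinfun.add_right blinfun.scaleR_right scaleR_add_right mult.commute)
    ultimately show "w (\<lambda>t. r *\<^sub>R c t + s *\<^sub>R d t) x = r *\<^sub>R w c x + s *\<^sub>R w d x"
      by (simp add: w_def algebra_simps)
  next
    fix c show "w c 0 = 0" "w c 1 = 0" by (simp_all add: w_def p0 p1 q0 q1)
  next
    fix c assume c: "c \<in> kernel_families"
    show "H1_deriv 0 1 (w c) (w' c)"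
      unfolding w_def[abs_def] w'_def[abs_def] by (intro H1_deriv_diff H1_deriv_scaleR p_H1 q_H1 c)
    assume "c \<noteq> 0"
    have E: "E c > 0"
    proof -
      obtain t where t: "t \<in> ?T" "c t \<noteq> 0" using c \<open>c \<noteq> 0\<close> by (auto simp: kernel_families_def fun_eq_iff)
      then have "Y t (c t) \<noteq> 0" using initial_vector_zero[OF T(3)[OF t(1)]] c by (auto simp: kernel_families_def)
      then show ?thesis unfolding E_def using t T(1) by (intro sum_pos2[of _ t]) auto
    qed
    have eq: "index_integrand (w c) (w' c) x =
        A (p c) (p' c) (p c) (p' c) x - (2 * \<epsilon>) * A (p c) (p' c) (q c) (q' c) x + \<epsilon>\<^sup>2 * index_integrand (q c) (q' c) x"
      if x: "x \<in> {0..1}" for x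
    proof -
      have "q c x \<bullet> S x (p c x) = p c x \<bullet> S x (q c x)" using S_sym[OF x] by (simp add: inner_commute)
      then show ?thesis
        by (simp add: index_integrand_def A_def w_def w'_def power2_norm_eq_inner power2_eq_square[of \<epsilon>]
            inner_diff_left inner_diff_right blinfun.diff_right blinfun.scaleR_right inner_commute algebra_simps)
    qed
    have "((\<lambda>x. A (p c) (p' c) (p c) (p' c) x - (2 * \<epsilon>) * A (p c) (p' c) (q c) (q' c) x + \<epsilon>\<^sup>2 * index_integrand (q c) (q' c) x)
      has_integral 0 - (2 * \<epsilon>) * E c + \<epsilon>\<^sup>2 * integral {0..1} (index_integrand (q c) (q' c))) {0..1}"
      by (intro has_integral_add has_integral_diff has_integral_mult_right pp[OF c] pq qq)
    then have "(index_integrand (w c) (w' c) has_integral 0 - (2 * \<epsilon>) * E c + \<epsilon>\<^sup>2 * integral {0..1} (index_integrand (q c) (q' c))) {0..1}"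
      by (rule has_integral_eq[rotated]) (use eq in auto)
    then have "integral {0..1} (index_integrand (w c) (w' c)) = - (2 * \<epsilon>) * E c + \<epsilon>\<^sup>2 * integral {0..1} (index_integrand (q c) (q' c))"
      by (simp add: integral_unique)
    also have "\<dots> \<le> - (2 * \<epsilon>) * E c + \<epsilon>\<^sup>2 * (C * E c)"
      using qq_le[of c] by (intro add_left_mono mult_left_mono) auto
    also have "\<dots> = \<epsilon> * E c * (\<epsilon> * C - 2)" by (simp add: power2_eq_square algebra_simps)
    also have "\<dots> < 0" using \<epsilon> E by (intro mult_pos_neg) auto
    finally show "integral {0..1} (index_integrand (w c) (w' c)) < 0" .
  qed
qed

end

section \<open>Calculus of smooth maps\<close>

text \<open>A common property of the two kinds of domains on which smooth maps are considered, open sets and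
  relatively open subsets of an interval. It suffices for derivatives within the set to be unique.\<close>

definition thick :: "'a::euclidean_space set \<Rightarrow> bool" where
  "thick S \<longleftrightarrow> (\<forall>x\<in>S. \<forall>i\<in>Basis. \<forall>e>0. \<exists>d. 0 < \<bar>d\<bar> \<and> \<bar>d\<bar> < e \<and> x + d *\<^sub>R i \<in> S)"

lemma thick_open:
  assumes "open S" shows "thick S"
  unfolding thick_def
proof (intro ballI allI impI)
  fix x i :: 'a and e :: real assume *: "x \<in> S" "i \<in> Basis" "e > 0"
  obtain r where r: "r > 0" "ball x r \<subseteq> S" using assms * open_contains_ball by blast
  define d where "d = min e r / 2"
  have d: "d > 0" "d < e" "d < r" using r * by (auto simp: d_def)
  then have "x + d *\<^sub>R i \<in> ball x r" using * by (simp add: dist_norm)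
  then show "\<exists>d. 0 < \<bar>d\<bar> \<and> \<bar>d\<bar> < e \<and> x + d *\<^sub>R i \<in> S" using d r by (intro exI[of _ d]) auto
qed

lemma thick_relatively_open_interval:
  fixes a b :: real
  assumes "openin (top_of_set {a..b}) S" "a < b"
  shows "thick S"
  unfolding thick_def
proof (intro ballI allI impI)
  fix x i e :: real assume *: "x \<in> S" "i \<in> Basis" "e > 0"
  then have i: "i = 1" by simp
  have x: "x \<in> {a..b}" using * assms openin_imp_subset by blast
  obtain r where r: "r > 0" "ball x r \<inter> {a..b} \<subseteq> S"
    using assms(1) *(1) unfolding openin_contains_ball by blast
  obtain d where "0 < \<bar>d\<bar>" "\<bar>d\<bar> < e" "\<bar>d\<bar> < r" "x + d \<in> {a..b}"
  proof (cases "x < b")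
    case True
    define m where "m = min (min e r) (b - x)"
    have "m > 0" "m \<le> e" "m \<le> r" "m \<le> b - x" using True r * by (auto simp: m_def)
    then show ?thesis using x by (intro that[of "m / 2"]) auto
  next
    case False
    define m where "m = min (min e r) (b - a)"
    have "m > 0" "m \<le> e" "m \<le> r" "m \<le> b - a" using assms(2) r * by (auto simp: m_def)
    then show ?thesis using x False by (intro that[of "- (m / 2)"]) auto
  qed
  moreover from this have "x + d \<in> S" using r by (auto simp: dist_real_def)
  ultimately show "\<exists>d. 0 < \<bar>d\<bar> \<and> \<bar>d\<bar> < e \<and> x + d *\<^sub>R i \<in> S" using i by auto
qed

lemma thick_frechet_derivative:
  assumes "thick S" "x \<in> S" "(f has_derivative D) (at x within S)"
  shows "frechet_derivative f (at x within S) = D"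
proof -
  have "f differentiable (at x within S)" using assms(3) by (auto simp: differentiable_def)
  then have "(f has_derivative frechet_derivative f (at x within S)) (at x within S)"
    by (rule frechet_derivative_works[THEN iffD1])
  then show ?thesis
    by (rule frechet_derivative_unique_within[OF _ assms(3)]) (use assms in \<open>auto simp: thick_def\<close>)
qed

lemma Ck_on_cong:
  assumes "\<And>x. x \<in> S \<Longrightarrow> f x = g x"
  shows "Ck_on k S f = Ck_on k S g"
proof -
  have "Ck_on k S g" if "Ck_on k S f" "\<And>x. x \<in> S \<Longrightarrow> f x = g x" for f g
    using that
  proof (induction k arbitrary: f g)
    case 0
    then show ?case by (metis Ck_on.simps(1) continuous_on_cong)
  next
    case (Suc k)
    have iff: "(f has_derivative D) (at x within S) \<longleftrightarrow> (g has_derivative D) (at x within S)" if "x \<in> S" for x D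
      using that Suc.prems(2) by (metis has_derivative_transform)
    have "frechet_derivative f (at x within S) = frechet_derivative g (at x within S)" if "x \<in> S" for x
      unfolding frechet_derivative_def using iff[OF that] by simp
    moreover have "g differentiable_on S"
    proof -
      have "\<forall>x\<in>S. \<exists>D. (f has_derivative D) (at x within S)"
        using Suc.prems(1) by (simp add: differentiable_on_def differentiable_def)
      then show ?thesis using iff unfolding differentiable_on_def differentiable_def by blast
    qed
    moreover have "Ck_on k S (\<lambda>x. frechet_derivative g (at x within S) v)" for v
      by (rule Suc.IH[of "\<lambda>x. frechet_derivative f (at x within S) v"]) (use Suc.prems(1) calculation in auto)
    ultimately show ?case by simp
  qed
  then show ?thesis using assms by metis
qed

lemma smooth_on_cong: "(\<And>x. x \<in> S \<Longrightarrow> f x = g x) \<Longrightarrow> smooth_on S f = smooth_on S g"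
  unfolding smooth_on_def using Ck_on_cong by metis

lemma Ck_on_SucD: "Ck_on (Suc k) S f \<Longrightarrow> Ck_on k S f"
proof (induction k arbitrary: f)
  case 0
  then show ?case by (simp add: differentiable_imp_continuous_on)
next
  case (Suc k)
  then show ?case by (metis Ck_on.simps(2))
qed

lemma Ck_on_has_derivative:
  "Ck_on (Suc k) S f \<Longrightarrow> x \<in> S \<Longrightarrow> (f has_derivative frechet_derivative f (at x within S)) (at x within S)"
  by (simp add: differentiable_on_def frechet_derivative_works)

lemma Ck_on_SucI:
  assumes "thick S" "\<And>x. x \<in> S \<Longrightarrow> (f has_derivative D x) (at x within S)"
    and "\<And>v. Ck_on k S (\<lambda>x. D x v)"
  shows "Ck_on (Suc k) S f"
proof -
  have "Ck_on k S (\<lambda>x. frechet_derivative f (at x within S) v)" for v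
    using assms(3)[of v] thick_frechet_derivative[OF assms(1) _ assms(2)] by (subst Ck_on_cong) auto
  then show ?thesis using assms(2) by (auto simp: differentiable_on_def differentiable_def)
qed

lemma Ck_on_const: "thick S \<Longrightarrow> Ck_on k S (\<lambda>x. c)"
proof (induction k arbitrary: c)
  case (Suc k)
  show ?case by (rule Ck_on_SucI[where D = "\<lambda>x v. 0"]) (auto simp: Suc)
qed simp

lemma Ck_on_bounded_linear:
  assumes "thick S" "bounded_linear L" "Ck_on k S f"
  shows "Ck_on k S (\<lambda>x. L (f x))"
  using assms(3)
proof (induction k arbitrary: f)
  case 0
  then show ?case using assms(2) by (simp add: bounded_linear.continuous_on)
next
  case (Suc k)
  show ?case
    by (rule Ck_on_SucI[OF assms(1) bounded_linear.has_derivative[OF assms(2) Ck_on_has_derivative[OF Suc.prems]]])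
      (use Suc in auto)
qed

lemma Ck_on_add:
  assumes "thick S" "Ck_on k S f" "Ck_on k S g"
  shows "Ck_on k S (\<lambda>x. f x + g x)"
  using assms(2,3)
proof (induction k arbitrary: f g)
  case 0
  then show ?case by (simp add: continuous_on_add)
next
  case (Suc k)
  show ?case
    by (rule Ck_on_SucI[OF assms(1) has_derivative_add[OF Ck_on_has_derivative Ck_on_has_derivative]])
      (use Suc in auto)
qed

lemma Ck_on_sum:
  assumes "thick S" "\<And>i. i \<in> I \<Longrightarrow> Ck_on k S (f i)"
  shows "Ck_on k S (\<lambda>x. \<Sum>i\<in>I. f i x)"
proof (cases "finite I")
  case True
  then show ?thesis using assms(2)
    by (induction I) (auto simp: Ck_on_const[OF assms(1)] Ck_on_add[OF assms(1)])
qed (simp add: Ck_on_const[OF assms(1)])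

lemma Ck_on_bilinear:
  assumes "thick S" "bounded_bilinear B" "Ck_on k S f" "Ck_on k S g"
  shows "Ck_on k S (\<lambda>x. B (f x) (g x))"
  using assms(3,4)
proof (induction k arbitrary: f g)
  case 0
  then show ?case by (simp add: bounded_bilinear.continuous_on[OF assms(2)])
next
  case (Suc k)
  show ?case
  proof (rule Ck_on_SucI[OF assms(1) bounded_bilinear.FDERIV[OF assms(2) Ck_on_has_derivative Ck_on_has_derivative]])
    show "Ck_on k S (\<lambda>x. B (f x) (frechet_derivative g (at x within S) v) + B (frechet_derivative f (at x within S) v) (g x))" for v
      using Suc.prems by (intro Ck_on_add assms(1) Suc.IH) (auto intro: Ck_on_SucD)
  qed (use Suc in auto)
qed

lemma linear_basis_expansion:
  fixes T :: "'v::euclidean_space \<Rightarrow> 'b::real_vector"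
  assumes "linear T"
  shows "T a = (\<Sum>i\<in>Basis. (a \<bullet> i) *\<^sub>R T i)"
  using linear_sum[OF assms, of "\<lambda>i. (a \<bullet> i) *\<^sub>R i" Basis] linear_scale[OF assms] by (simp add: euclidean_representation)

lemma Ck_on_compose:
  fixes g :: "'a::euclidean_space \<Rightarrow> 'b::euclidean_space"
  assumes "thick S" "open T" "g ` S \<subseteq> T" "Ck_on k T f" "Ck_on k S g"
  shows "Ck_on k S (\<lambda>x. f (g x))"
  using assms(4,5)
proof (induction k arbitrary: f)
  case 0
  then show ?case using assms(3) by (auto intro: continuous_on_compose2)
next
  case (Suc k)
  have fd: "(f has_derivative frechet_derivative f (at y within T)) (at y)" if "y \<in> T" for y
    using Ck_on_has_derivative[OF Suc.prems(1) that] by (simp only: at_within_open[OF that assms(2)])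
  show ?case
  proof (rule Ck_on_SucI[OF assms(1)])
    fix x assume x: "x \<in> S"
    show "((\<lambda>x. f (g x)) has_derivative (\<lambda>v. frechet_derivative f (at (g x) within T) (frechet_derivative g (at x within S) v))) (at x within S)"
      by (rule has_derivative_compose[OF Ck_on_has_derivative[OF Suc.prems(2) x] fd]) (use x assms(3) in auto)
  next
    fix v
    have "Ck_on k S (\<lambda>x. \<Sum>i\<in>Basis. (frechet_derivative g (at x within S) v \<bullet> i) *\<^sub>R frechet_derivative f (at (g x) within T) i)"
    proof (intro Ck_on_sum Ck_on_bilinear[OF _ bounded_bilinear_scaleR] Ck_on_bounded_linear[OF _ bounded_linear_inner_left] assms(1))
      show "Ck_on k S (\<lambda>x. frechet_derivative g (at x within S) v)" using Suc.prems(2) by simp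
      fix i show "Ck_on k S (\<lambda>x. frechet_derivative f (at (g x) within T) i)"
        using Suc.prems by (intro Suc.IH[of "\<lambda>y. frechet_derivative f (at y within T) i"]) (auto intro: Ck_on_SucD)
    qed
    moreover have "frechet_derivative f (at (g x) within T) w =
        (\<Sum>i\<in>Basis. (w \<bullet> i) *\<^sub>R frechet_derivative f (at (g x) within T) i)" if "x \<in> S" for x w
    proof -
      have "linear (frechet_derivative f (at (g x) within T))"
        by (rule has_derivative_linear[OF fd]) (use that assms(3) in auto)
      then show ?thesis by (rule linear_basis_expansion)
    qed
    ultimately show "Ck_on k S (\<lambda>x. frechet_derivative f (at (g x) within T) (frechet_derivative g (at x within S) v))"
      by (subst Ck_on_cong[of S _ "\<lambda>x. \<Sum>i\<in>Basis. (frechet_derivative g (at x within S) v \<bullet> i) *\<^sub>R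
        frechet_derivative f (at (g x) within T) i"]) assumption+
  qed
qed

lemma Ck_on_subset:
  assumes "thick T" "T \<subseteq> S" "Ck_on k S f"
  shows "Ck_on k T f"
  using assms(3)
proof (induction k arbitrary: f)
  case 0
  then show ?case using assms by (auto intro: continuous_on_subset)
next
  case (Suc k)
  show ?case
    by (rule Ck_on_SucI[OF assms(1) has_derivative_subset[OF Ck_on_has_derivative[OF Suc.prems] assms(2)]])
      (use Suc assms in auto)
qed

lemma smooth_on_subset: "thick T \<Longrightarrow> T \<subseteq> S \<Longrightarrow> smooth_on S f \<Longrightarrow> smooth_on T f"
  unfolding smooth_on_def by (blast intro: Ck_on_subset)

lemma smooth_on_const: "thick S \<Longrightarrow> smooth_on S (\<lambda>x. c)"
  unfolding smooth_on_def by (blast intro: Ck_on_const)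

lemma smooth_on_bounded_linear: "thick S \<Longrightarrow> bounded_linear L \<Longrightarrow> smooth_on S f \<Longrightarrow> smooth_on S (\<lambda>x. L (f x))"
  unfolding smooth_on_def by (blast intro: Ck_on_bounded_linear)

lemma smooth_on_add: "thick S \<Longrightarrow> smooth_on S f \<Longrightarrow> smooth_on S g \<Longrightarrow> smooth_on S (\<lambda>x. f x + g x)"
  unfolding smooth_on_def by (blast intro: Ck_on_add)

lemma smooth_on_sum: "thick S \<Longrightarrow> (\<And>i. i \<in> I \<Longrightarrow> smooth_on S (f i)) \<Longrightarrow> smooth_on S (\<lambda>x. \<Sum>i\<in>I. f i x)"
  unfolding smooth_on_def by (blast intro: Ck_on_sum)

lemma smooth_on_bilinear:
  "thick S \<Longrightarrow> bounded_bilinear B \<Longrightarrow> smooth_on S f \<Longrightarrow> smooth_on S g \<Longrightarrow> smooth_on S (\<lambda>x. B (f x) (g x))"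
  unfolding smooth_on_def by (blast intro: Ck_on_bilinear)

lemma smooth_on_compose:
  fixes g :: "'a::euclidean_space \<Rightarrow> 'b::euclidean_space"
  shows "thick S \<Longrightarrow> open T \<Longrightarrow> g ` S \<subseteq> T \<Longrightarrow> smooth_on T f \<Longrightarrow> smooth_on S g \<Longrightarrow> smooth_on S (\<lambda>x. f (g x))"
  unfolding smooth_on_def by (blast intro: Ck_on_compose)

lemma smooth_on_has_derivative:
  "smooth_on S f \<Longrightarrow> x \<in> S \<Longrightarrow> (f has_derivative frechet_derivative f (at x within S)) (at x within S)"
  unfolding smooth_on_def by (blast intro: Ck_on_has_derivative)

lemma smooth_on_frechet_derivative:
  "smooth_on S f \<Longrightarrow> smooth_on S (\<lambda>x. frechet_derivative f (at x within S) v)"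
  unfolding smooth_on_def by (metis Ck_on.simps(2))

lemma smooth_on_continuous: "smooth_on S f \<Longrightarrow> continuous_on S f"
  unfolding smooth_on_def by (metis Ck_on.simps(1))

lemma smooth_on_open_has_derivative:
  "open S \<Longrightarrow> smooth_on S f \<Longrightarrow> x \<in> S \<Longrightarrow> (f has_derivative frechet_derivative f (at x)) (at x)"
  using smooth_on_has_derivative[of S f x] by (simp only: at_within_open)

lemma smooth_on_open_frechet_derivative:
  assumes "open S" "smooth_on S f"
  shows "smooth_on S (\<lambda>x. frechet_derivative f (at x) v)"
proof -
  have "smooth_on S (\<lambda>x. frechet_derivative f (at x within S) v) = smooth_on S (\<lambda>x. frechet_derivative f (at x) v)"
    by (rule smooth_on_cong) (simp only: at_within_open[OF _ assms(1)])
  then show ?thesis using smooth_on_frechet_derivative[OF assms(2)] by blast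
qed

text \<open>Smoothness in the parameter is tested on fixed vectors; in finite dimensions a basis expansion
  then allows the argument to vary smoothly as well.\<close>

lemma smooth_on_linear_family:
  fixes a :: "'a::euclidean_space \<Rightarrow> 'v::euclidean_space"
  assumes "thick S" "\<And>x. x \<in> S \<Longrightarrow> linear (T x)" "\<And>i. smooth_on S (\<lambda>x. T x i)" "smooth_on S a"
  shows "smooth_on S (\<lambda>x. T x (a x))"
proof -
  have "smooth_on S (\<lambda>x. \<Sum>i\<in>Basis. (a x \<bullet> i) *\<^sub>R T x i)"
    by (intro smooth_on_sum smooth_on_bilinear[OF _ bounded_bilinear_scaleR]
        smooth_on_bounded_linear[OF _ bounded_linear_inner_left] assms)
  then show ?thesis using linear_basis_expansion[OF assms(2)] by (subst smooth_on_cong) auto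
qed

text \<open>The product rule for \<open>T y (a y)\<close>, when the derivative of \<open>T\<close> is known on fixed vectors.\<close>

lemma has_derivative_linear_family:
  fixes a :: "'a::euclidean_space \<Rightarrow> 'v::euclidean_space"
  assumes "x \<in> S" "\<And>y. y \<in> S \<Longrightarrow> linear (T y)"
    and T: "\<And>i. ((\<lambda>y. T y i) has_derivative D i) (at x within S)" and lin: "\<And>h. linear (\<lambda>v. D v h)"
    and a: "(a has_derivative a') (at x within S)"
  shows "((\<lambda>y. T y (a y)) has_derivative (\<lambda>h. D (a x) h + T x (a' h))) (at x within S)"
proof -
  have "((\<lambda>y. \<Sum>i\<in>Basis. (a y \<bullet> i) *\<^sub>R T y i) has_derivative
      (\<lambda>h. \<Sum>i\<in>Basis. (a x \<bullet> i) *\<^sub>R D i h + (a' h \<bullet> i) *\<^sub>R T x i)) (at x within S)"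
    by (intro has_derivative_sum has_derivative_scaleR T has_derivative_inner_left a)
  moreover have "(\<Sum>i\<in>Basis. (a x \<bullet> i) *\<^sub>R D i h + (a' h \<bullet> i) *\<^sub>R T x i) = D (a x) h + T x (a' h)" for h
    using linear_basis_expansion[OF lin, of "a x" h] linear_basis_expansion[OF assms(2)[OF assms(1)], of "a' h"]
    by (simp add: sum.distrib)
  ultimately have "((\<lambda>y. \<Sum>i\<in>Basis. (a y \<bullet> i) *\<^sub>R T y i) has_derivative (\<lambda>h. D (a x) h + T x (a' h))) (at x within S)"
    by simp
  then show ?thesis
    by (rule has_derivative_transform[OF assms(1), rotated]) (use linear_basis_expansion[OF assms(2)] in auto)
qed

text \<open>Bootstrapping: if \<open>y\<close> is \<open>k\<close> times continuously differentiable, then so is its derivative \<open>T x (y x)\<close>.\<close>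

lemma smooth_on_linear_ode:
  fixes y :: "real \<Rightarrow> 'v::euclidean_space"
  assumes S: "thick S" and lin: "\<And>x. x \<in> S \<Longrightarrow> linear (T x)" and T: "\<And>v. smooth_on S (\<lambda>x. T x v)"
    and y: "\<And>x. x \<in> S \<Longrightarrow> (y has_vector_derivative T x (y x)) (at x within S)"
  shows "smooth_on S y"
proof -
  have "Ck_on k S y" for k
  proof (induction k)
    case 0
    then show ?case
      using y by (simp, meson continuous_on_eq_continuous_within has_vector_derivative_continuous)
  next
    case (Suc k)
    have "Ck_on k S (\<lambda>x. \<Sum>i\<in>Basis. (y x \<bullet> i) *\<^sub>R T x i)"
      using T by (intro Ck_on_sum Ck_on_bilinear[OF _ bounded_bilinear_scaleR]
        Ck_on_bounded_linear[OF _ bounded_linear_inner_left] S Suc) (simp add: smooth_on_def)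
    then have Ty: "Ck_on k S (\<lambda>x. T x (y x))" using linear_basis_expansion[OF lin] by (subst Ck_on_cong) auto
    show ?case
    proof (rule Ck_on_SucI[OF S])
      show "(y has_derivative (\<lambda>h. h *\<^sub>R T x (y x))) (at x within S)" if "x \<in> S" for x
        using y[OF that] by (simp add: has_vector_derivative_def)
      show "Ck_on k S (\<lambda>x. v *\<^sub>R T x (y x))" for v
        by (rule Ck_on_bounded_linear[OF S bounded_linear_scaleR_right Ty])
    qed
  qed
  then show ?thesis by (simp add: smooth_on_def)
qed

lemma smooth_on_vector_derivative:
  fixes y :: "real \<Rightarrow> 'v::euclidean_space"
  assumes "smooth_on S y" "x \<in> S"
  shows "(y has_vector_derivative frechet_derivative y (at x within S) 1) (at x within S)"
proof -
  let ?D = "frechet_derivative y (at x within S)"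
  have D: "(y has_derivative ?D) (at x within S)" by (rule smooth_on_has_derivative[OF assms])
  have "(\<lambda>h. h *\<^sub>R ?D 1) = ?D"
  proof (rule ext)
    fix h show "h *\<^sub>R ?D 1 = ?D h" using linear_scale[OF has_derivative_linear[OF D], of h 1] by simp
  qed
  then show ?thesis using D by (simp only: has_vector_derivative_def)
qed

lemma smooth_on_transform:
  assumes "smooth_on S f" "\<And>x. x \<in> S \<Longrightarrow> f x = g x" shows "smooth_on S g"
  using smooth_on_cong[of S f g] assms by simp

lemma smooth_on_diff:
  assumes "thick S" "smooth_on S f" "smooth_on S g"
  shows "smooth_on S (\<lambda>x. f x - g x)"
  using smooth_on_add[OF assms(1,2) smooth_on_bounded_linear[OF assms(1) bounded_linear_minus[OF bounded_linear_ident] assms(3)]]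
  by simp

lemma linear_frechet_derivative_family:
  fixes T :: "'a::euclidean_space \<Rightarrow> 'v::euclidean_space \<Rightarrow> 'b::euclidean_space"
  assumes U: "open U" "z \<in> U" and lin: "\<And>x. x \<in> U \<Longrightarrow> linear (T x)" and T: "\<And>v. smooth_on U (\<lambda>x. T x v)"
  shows "linear (\<lambda>v. frechet_derivative (\<lambda>x. T x v) (at z) h)"
proof -
  have "frechet_derivative (\<lambda>x. T x (r *\<^sub>R v + s *\<^sub>R w)) (at z) =
      (\<lambda>h. r *\<^sub>R frechet_derivative (\<lambda>x. T x v) (at z) h + s *\<^sub>R frechet_derivative (\<lambda>x. T x w) (at z) h)" for r s v w
  proof (rule frechet_derivative_at[symmetric])
    have "((\<lambda>x. r *\<^sub>R T x v + s *\<^sub>R T x w) has_derivative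
      (\<lambda>h. r *\<^sub>R frechet_derivative (\<lambda>x. T x v) (at z) h + s *\<^sub>R frechet_derivative (\<lambda>x. T x w) (at z) h)) (at z)"
      by (intro has_derivative_add has_derivative_scaleR_right smooth_on_open_has_derivative[OF U(1) T U(2)])
    then show "((\<lambda>x. T x (r *\<^sub>R v + s *\<^sub>R w)) has_derivative
      (\<lambda>h. r *\<^sub>R frechet_derivative (\<lambda>x. T x v) (at z) h + s *\<^sub>R frechet_derivative (\<lambda>x. T x w) (at z) h)) (at z)"
      by (rule has_derivative_transform_within_open[OF _ U]) (simp add: linear_add[OF lin] linear_scale[OF lin])
  qed
  note * = fun_cong[OF this, of _ _ _ _ h]
  show ?thesis using *[of 1 _ 1] *[of _ _ 0 0] by (intro linearI) simp_all
qed

section \<open>Symmetry of second derivatives\<close>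

text \<open>The mean value theorem, applied in the direction of \<open>u\<close> to the difference of \<open>f\<close> and its translate by
  \<open>h v\<close>, and then in the direction of \<open>v\<close> to the derivative.\<close>

lemma second_difference_mean_value:
  fixes f :: "'a::euclidean_space \<Rightarrow> real"
  assumes f: "\<And>x. x \<in> ball z r \<Longrightarrow> (f has_derivative Df x) (at x)"
    and Du: "\<And>x. x \<in> ball z r \<Longrightarrow> ((\<lambda>x. Df x u) has_derivative D2 x) (at x)"
    and h: "h > 0" "h * (norm u + norm v) < r"
  obtains x where "x \<in> ball z r"
    "norm (x - z) \<le> h * (norm u + norm v)"
    "f (z + h *\<^sub>R u + h *\<^sub>R v) - f (z + h *\<^sub>R u) - f (z + h *\<^sub>R v) + f z = h\<^sup>2 * D2 x v"
proof -
  have nm: "norm (s *\<^sub>R u + t *\<^sub>R v) \<le> h * (norm u + norm v)" if "0 \<le> s" "s \<le> h" "0 \<le> t" "t \<le> h" for s t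
  proof -
    have "norm (s *\<^sub>R u + t *\<^sub>R v) \<le> s * norm u + t * norm v"
      using norm_triangle_ineq[of "s *\<^sub>R u" "t *\<^sub>R v"] that by simp
    also have "\<dots> \<le> h * norm u + h * norm v" using that by (intro add_mono mult_right_mono) auto
    finally show ?thesis by (simp add: distrib_left)
  qed
  have inb: "z + s *\<^sub>R u + t *\<^sub>R v \<in> ball z r" if "0 \<le> s" "s \<le> h" "0 \<le> t" "t \<le> h" for s t
  proof -
    have "dist z (z + s *\<^sub>R u + t *\<^sub>R v) = norm (s *\<^sub>R u + t *\<^sub>R v)"
      by (metis add.assoc add_diff_cancel_left' dist_commute dist_norm)
    then show ?thesis using nm[OF that] h by simp
  qed
  let ?F = "\<lambda>s. f (z + s *\<^sub>R u + h *\<^sub>R v) - f (z + s *\<^sub>R u + 0 *\<^sub>R v)"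
  have dF: "(?F has_real_derivative (Df (z + s *\<^sub>R u + h *\<^sub>R v) u - Df (z + s *\<^sub>R u + 0 *\<^sub>R v) u)) (at s)"
    if s: "0 \<le> s" "s \<le> h" for s
  proof -
    have "((\<lambda>s. f (z + s *\<^sub>R u + t *\<^sub>R v)) has_derivative (\<lambda>k. Df (z + s *\<^sub>R u + t *\<^sub>R v) (k *\<^sub>R u))) (at s)"
      if "0 \<le> t" "t \<le> h" for t
      by (rule has_derivative_compose[of "\<lambda>s. z + s *\<^sub>R u + t *\<^sub>R v" "\<lambda>k. k *\<^sub>R u" s UNIV f])
        (auto intro!: derivative_eq_intros f inb s that)
    then have "((\<lambda>s. f (z + s *\<^sub>R u + t *\<^sub>R v)) has_real_derivative Df (z + s *\<^sub>R u + t *\<^sub>R v) u) (at s)"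
      if t: "0 \<le> t" "t \<le> h" for t
    proof -
      have "(\<lambda>k. Df (z + s *\<^sub>R u + t *\<^sub>R v) (k *\<^sub>R u)) = (*) (Df (z + s *\<^sub>R u + t *\<^sub>R v) u)"
        using linear_scale[OF has_derivative_linear[OF f[OF inb[OF s t]]]] by (auto simp: mult.commute)
      then show ?thesis
        using \<open>\<And>t. 0 \<le> t \<Longrightarrow> t \<le> h \<Longrightarrow> ((\<lambda>s. f (z + s *\<^sub>R u + t *\<^sub>R v)) has_derivative (\<lambda>k. Df (z + s *\<^sub>R u + t *\<^sub>R v) (k *\<^sub>R u))) (at s)\<close>[OF t]
        by (simp only: has_field_derivative_def)
    qed
    from DERIV_diff[OF this[of h] this[of 0]] show ?thesis using h by simp
  qed
  obtain s where s: "0 < s" "s < h" "?F h - ?F 0 = (h - 0) * (Df (z + s *\<^sub>R u + h *\<^sub>R v) u - Df (z + s *\<^sub>R u + 0 *\<^sub>R v) u)"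
    using MVT2[of 0 h ?F, OF h(1) dF] by blast
  let ?G = "\<lambda>t. Df (z + s *\<^sub>R u + t *\<^sub>R v) u"
  have dG: "(?G has_real_derivative D2 (z + s *\<^sub>R u + t *\<^sub>R v) v) (at t)" if t: "0 \<le> t" "t \<le> h" for t
  proof -
    have b: "z + s *\<^sub>R u + t *\<^sub>R v \<in> ball z r" using inb s t by simp
    have "(?G has_derivative (\<lambda>k. D2 (z + s *\<^sub>R u + t *\<^sub>R v) (k *\<^sub>R v))) (at t)"
      by (rule has_derivative_compose[of "\<lambda>t. z + s *\<^sub>R u + t *\<^sub>R v" "\<lambda>k. k *\<^sub>R v" t UNIV "\<lambda>x. Df x u", OF _ Du[OF b]])
        (auto intro!: derivative_eq_intros)
    moreover have "(\<lambda>k. D2 (z + s *\<^sub>R u + t *\<^sub>R v) (k *\<^sub>R v)) = (*) (D2 (z + s *\<^sub>R u + t *\<^sub>R v) v)"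
      using linear_scale[OF has_derivative_linear[OF Du[OF b]]] by (auto simp: mult.commute)
    ultimately show ?thesis by (simp only: has_field_derivative_def)
  qed
  obtain t where t: "0 < t" "t < h" "?G h - ?G 0 = (h - 0) * D2 (z + s *\<^sub>R u + t *\<^sub>R v) v"
    using MVT2[of 0 h ?G, OF h(1) dG] by blast
  show ?thesis
  proof (rule that[of "z + s *\<^sub>R u + t *\<^sub>R v"])
    show "z + s *\<^sub>R u + t *\<^sub>R v \<in> ball z r" using s t by (intro inb) auto
    show "norm (z + s *\<^sub>R u + t *\<^sub>R v - z) \<le> h * (norm u + norm v)"
      using nm[of s t] s t by (simp add: algebra_simps)
    show "f (z + h *\<^sub>R u + h *\<^sub>R v) - f (z + h *\<^sub>R u) - f (z + h *\<^sub>R v) + f z = h\<^sup>2 * D2 (z + s *\<^sub>R u + t *\<^sub>R v) v"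
      using s(3) t(3) by (simp add: power2_eq_square)
  qed
qed

text \<open>Both mixed derivatives approximate the same second difference, which is symmetric in \<open>u\<close> and \<open>v\<close>.\<close>

lemma second_derivative_symmetric_real:
  fixes f :: "'a::euclidean_space \<Rightarrow> real"
  assumes U: "open U" "z \<in> U" and f: "smooth_on U f"
  shows "frechet_derivative (\<lambda>x. frechet_derivative f (at x) u) (at z) v =
    frechet_derivative (\<lambda>x. frechet_derivative f (at x) v) (at z) u"
proof -
  let ?p = "\<lambda>u v x. frechet_derivative (\<lambda>x. frechet_derivative f (at x) u) (at x) v"
  have sm: "smooth_on U (\<lambda>x. frechet_derivative f (at x) u)" for u
    by (rule smooth_on_open_frechet_derivative[OF U(1) f])
  have cont: "isCont (?p u v) z" for u v
    using smooth_on_continuous[OF smooth_on_open_frechet_derivative[OF U(1) sm]] U continuous_on_eq_continuous_at by blast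
  show ?thesis
  proof (rule ccontr)
    assume ne: "?p u v z \<noteq> ?p v u z"
    define e where "e = \<bar>?p u v z - ?p v u z\<bar> / 2"
    have e: "e > 0" using ne by (simp add: e_def)
    obtain d1 where d1: "d1 > 0" "\<And>x. dist x z < d1 \<Longrightarrow> dist (?p u v x) (?p u v z) < e"
      using cont[of u v] e unfolding continuous_at_eps_delta by blast
    obtain d2 where d2: "d2 > 0" "\<And>x. dist x z < d2 \<Longrightarrow> dist (?p v u x) (?p v u z) < e"
      using cont[of v u] e unfolding continuous_at_eps_delta by blast
    obtain r0 where r0: "r0 > 0" "ball z r0 \<subseteq> U" using U open_contains_ball by blast
    define r where "r = min r0 (min d1 d2)"
    define h where "h = r / (2 * (norm u + norm v + 1))"
    have r: "r > 0" "ball z r \<subseteq> U" "r \<le> d1" "r \<le> d2" using r0 d1 d2 by (auto simp: r_def)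
    have pos: "norm u + norm v + 1 > 0" by (simp add: add_nonneg_pos)
    have h: "h > 0" using r pos by (simp add: h_def)
    have "h * (norm u + norm v) \<le> h * (norm u + norm v + 1)" using h by simp
    also have "\<dots> = r / 2" using pos by (simp add: h_def field_simps)
    finally have hr: "h * (norm u + norm v) < r" "h * (norm v + norm u) < r" using r by (auto simp: add.commute)
    have fd: "(f has_derivative frechet_derivative f (at x)) (at x)" if "x \<in> ball z r" for x
      using smooth_on_open_has_derivative[OF U(1) f] that r by blast
    have fd2: "((\<lambda>x. frechet_derivative f (at x) u) has_derivative frechet_derivative (\<lambda>x. frechet_derivative f (at x) u) (at x)) (at x)"
      if "x \<in> ball z r" for x u
      using smooth_on_open_has_derivative[OF U(1) sm] that r by blast
    obtain x where x: "x \<in> ball z r"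
      "f (z + h *\<^sub>R u + h *\<^sub>R v) - f (z + h *\<^sub>R u) - f (z + h *\<^sub>R v) + f z = h\<^sup>2 * ?p u v x"
      using second_difference_mean_value[OF fd fd2 h hr(1)] by blast
    obtain y where y: "y \<in> ball z r"
      "f (z + h *\<^sub>R v + h *\<^sub>R u) - f (z + h *\<^sub>R v) - f (z + h *\<^sub>R u) + f z = h\<^sup>2 * ?p v u y"
      using second_difference_mean_value[OF fd fd2 h hr(2)] by blast
    have "z + h *\<^sub>R v + h *\<^sub>R u = z + h *\<^sub>R u + h *\<^sub>R v" by simp
    then have "h\<^sup>2 * ?p u v x = h\<^sup>2 * ?p v u y" using x(2) y(2) by (simp only:)
    then have "?p u v x = ?p v u y" using h by simp
    moreover have "dist (?p u v x) (?p u v z) < e" "dist (?p v u y) (?p v u z) < e"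
      using x(1) y(1) r by (auto intro!: d1(2) d2(2) simp: dist_commute)
    ultimately show False by (simp add: e_def dist_real_def) (smt (verit) field_sum_of_halves)
  qed
qed

lemma second_derivative_symmetric:
  fixes f :: "'a::euclidean_space \<Rightarrow> 'b::euclidean_space"
  assumes U: "open U" "z \<in> U" and f: "smooth_on U f"
  shows "frechet_derivative (\<lambda>x. frechet_derivative f (at x) u) (at z) v =
    frechet_derivative (\<lambda>x. frechet_derivative f (at x) v) (at z) u"
proof (rule euclidean_eqI)
  fix b :: 'b assume "b \<in> Basis"
  have sm: "smooth_on U (\<lambda>x. frechet_derivative f (at x) u)" for u
    by (rule smooth_on_open_frechet_derivative[OF U(1) f])
  have fb: "smooth_on U (\<lambda>x. f x \<bullet> b)"
    by (rule smooth_on_bounded_linear[OF thick_open[OF U(1)] bounded_linear_inner_left f])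
  have 1: "frechet_derivative (\<lambda>x. g x \<bullet> b) (at x) w = frechet_derivative g (at x) w \<bullet> b"
    if "smooth_on U g" "x \<in> U" for g :: "'a \<Rightarrow> 'b" and x w
  proof -
    have "((\<lambda>x. g x \<bullet> b) has_derivative (\<lambda>w. frechet_derivative g (at x) w \<bullet> b)) (at x)"
      by (intro has_derivative_inner_left smooth_on_open_has_derivative[OF U(1) that])
    from frechet_derivative_at[OF this, symmetric] show ?thesis by simp
  qed
  have 2: "frechet_derivative (\<lambda>x. frechet_derivative (\<lambda>x. f x \<bullet> b) (at x) u) (at z) v =
      frechet_derivative (\<lambda>x. frechet_derivative f (at x) u) (at z) v \<bullet> b" for u v
  proof -
    have "((\<lambda>x. frechet_derivative f (at x) u \<bullet> b) has_derivative
        (\<lambda>v. frechet_derivative (\<lambda>x. frechet_derivative f (at x) u) (at z) v \<bullet> b)) (at z)"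
      by (intro has_derivative_inner_left smooth_on_open_has_derivative[OF U(1) sm U(2)])
    then have "((\<lambda>x. frechet_derivative (\<lambda>x. f x \<bullet> b) (at x) u) has_derivative
        (\<lambda>v. frechet_derivative (\<lambda>x. frechet_derivative f (at x) u) (at z) v \<bullet> b)) (at z)"
      by (rule has_derivative_transform_within_open[OF _ U]) (use 1[OF f] in auto)
    from frechet_derivative_at[OF this, symmetric] show ?thesis by simp
  qed
  show "frechet_derivative (\<lambda>x. frechet_derivative f (at x) u) (at z) v \<bullet> b =
    frechet_derivative (\<lambda>x. frechet_derivative f (at x) v) (at z) u \<bullet> b"
    using second_derivative_symmetric_real[OF U fb, of u v] by (simp add: 2)
qed

section \<open>Charts and tangent vectors\<close>

context smooth_manifold
begin

lemma chart_dom_subset: "c \<in> A \<Longrightarrow> chart_dom c \<subseteq> topspace M"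
  using chart_openin openin_subset by blast

lemma chart_inj: "c \<in> A \<Longrightarrow> inj_on (chart_map c) (chart_dom c)"
  using homeomorphic_imp_injective_map[OF chart_homeomorphic] chart_dom_subset
  by (simp add: Int_absorb1)

lemma chart_inv_chart_map: "c \<in> A \<Longrightarrow> q \<in> chart_dom c \<Longrightarrow> chart_inv c (chart_map c q) = q"
  unfolding chart_inv_def by (rule inv_into_f_f[OF chart_inj])

lemma chart_map_chart_inv: "x \<in> chart_map c ` chart_dom c \<Longrightarrow> chart_map c (chart_inv c x) = x"
  unfolding chart_inv_def by (rule f_inv_into_f)

lemma chart_inv_in_dom: "x \<in> chart_map c ` chart_dom c \<Longrightarrow> chart_inv c x \<in> chart_dom c"
  unfolding chart_inv_def by (rule inv_into_into)

lemma open_chart_image: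
  assumes c: "c \<in> A" and V: "openin M V"
  shows "open (chart_map c ` (chart_dom c \<inter> V))"
proof -
  have "openin (subtopology M (chart_dom c)) (chart_dom c \<inter> V)"
    using V by (metis inf_commute openin_subtopology)
  then have "openin (top_of_set (chart_map c ` chart_dom c)) (chart_map c ` (chart_dom c \<inter> V))"
    using homeomorphic_imp_open_map[OF chart_homeomorphic[OF c]] unfolding open_map_def by blast
  then show ?thesis using chart_open_image[OF c] openin_open_eq by blast
qed

lemma transition_chart_map:
  "c \<in> A \<Longrightarrow> q \<in> chart_dom c \<Longrightarrow> transition c d (chart_map c q) = chart_map d q"
  by (simp add: transition_def chart_inv_chart_map)

lemma transition_has_derivative:
  assumes "c \<in> A" "d \<in> A" "q \<in> chart_dom c" "q \<in> chart_dom d"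
  shows "(transition c d has_derivative frechet_derivative (transition c d) (at (chart_map c q))) (at (chart_map c q))"
  using assms by (intro smooth_on_open_has_derivative[OF open_chart_image smooth_transition] chart_openin) auto

lemma transition_derivative_linear:
  assumes "c \<in> A" "d \<in> A" "q \<in> chart_dom c" "q \<in> chart_dom d"
  shows "linear (frechet_derivative (transition c d) (at (chart_map c q)))"
  using has_derivative_linear[OF transition_has_derivative[OF assms]] .

lemma transition_derivative_chain:
  assumes c: "c \<in> A" "d \<in> A" "e \<in> A" and q: "q \<in> chart_dom c" "q \<in> chart_dom d" "q \<in> chart_dom e"
  shows "frechet_derivative (transition d e) (at (chart_map d q)) (frechet_derivative (transition c d) (at (chart_map c q)) w)
    = frechet_derivative (transition c e) (at (chart_map c q)) w"
proof -
  let ?O = "chart_map c ` (chart_dom c \<inter> (chart_dom d \<inter> chart_dom e))"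
  have "((\<lambda>x. transition d e (transition c d x)) has_derivative
    (\<lambda>w. frechet_derivative (transition d e) (at (chart_map d q)) (frechet_derivative (transition c d) (at (chart_map c q)) w)))
    (at (chart_map c q))"
    by (rule has_derivative_compose[OF transition_has_derivative])
      (use c q transition_has_derivative[of d e q] in \<open>auto simp: transition_chart_map\<close>)
  then have "(transition c e has_derivative
    (\<lambda>w. frechet_derivative (transition d e) (at (chart_map d q)) (frechet_derivative (transition c d) (at (chart_map c q)) w)))
    (at (chart_map c q))"
  proof (rule has_derivative_transform_within_open[of _ _ _ _ ?O])
    show "open ?O" using c by (intro open_chart_image openin_Int chart_openin)
    show "chart_map c q \<in> ?O" using q by blast
    fix x assume "x \<in> ?O"
    then show "transition d e (transition c d x) = transition c e x"
      using c by (auto simp: transition_chart_map)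
  qed
  from frechet_derivative_at[OF this] show ?thesis by metis
qed

lemma transition_derivative_self:
  assumes c: "c \<in> A" and q: "q \<in> chart_dom c"
  shows "frechet_derivative (transition c c) (at (chart_map c q)) w = w"
proof -
  have "((\<lambda>x. x) has_derivative (\<lambda>w. w)) (at (chart_map c q))" by (rule has_derivative_ident)
  then have "(transition c c has_derivative (\<lambda>w. w)) (at (chart_map c q))"
    by (rule has_derivative_transform_within_open[OF _ chart_open_image[OF c]])
      (use c q in \<open>auto simp: transition_chart_map\<close>)
  from frechet_derivative_at[OF this] show ?thesis by metis
qed

lemma const_field_eq:
  "d \<in> A \<Longrightarrow> q \<in> chart_dom c \<Longrightarrow> q \<in> chart_dom d \<Longrightarrow>
    const_field A c w q d = frechet_derivative (transition c d) (at (chart_map c q)) w"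
  by (simp add: const_field_def)

lemma const_field_self: "c \<in> A \<Longrightarrow> q \<in> chart_dom c \<Longrightarrow> const_field A c w q c = w"
  by (simp add: const_field_eq transition_derivative_self)

lemma const_field_tangent:
  assumes "c \<in> A" "q \<in> chart_dom c"
  shows "const_field A c w q \<in> tangent_space A q"
  unfolding tangent_space_def
  using assms by (auto simp: const_field_eq transition_derivative_chain) (auto simp: const_field_def)

lemma tangent_space_component_zero:
  "v \<in> tangent_space A q \<Longrightarrow> \<not> (c \<in> A \<and> q \<in> chart_dom c) \<Longrightarrow> v c = 0"
  unfolding tangent_space_def by blast

lemma tangent_space_transition:
  "v \<in> tangent_space A q \<Longrightarrow> c \<in> A \<Longrightarrow> d \<in> A \<Longrightarrow> q \<in> chart_dom c \<Longrightarrow> q \<in> chart_dom d \<Longrightarrow>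
    v d = frechet_derivative (transition c d) (at (chart_map c q)) (v c)"
  unfolding tangent_space_def by blast

lemma tangent_spaceI:
  assumes "\<And>c. \<not> (c \<in> A \<and> q \<in> chart_dom c) \<Longrightarrow> v c = 0"
    and "\<And>c d. c \<in> A \<Longrightarrow> d \<in> A \<Longrightarrow> q \<in> chart_dom c \<Longrightarrow> q \<in> chart_dom d \<Longrightarrow>
      v d = frechet_derivative (transition c d) (at (chart_map c q)) (v c)"
  shows "v \<in> tangent_space A q"
  unfolding tangent_space_def using assms by blast

lemma tangent_eq_const_field:
  assumes c: "c \<in> A" "q \<in> chart_dom c" and v: "v \<in> tangent_space A q"
  shows "v = const_field A c (v c) q"
proof (rule ext)
  fix d
  show "v d = const_field A c (v c) q d"
  proof (cases "d \<in> A \<and> q \<in> chart_dom d")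
    case True
    then show ?thesis using tangent_space_transition[OF v c(1) _ c(2), of d] c by (simp add: const_field_eq)
  next
    case False
    then show ?thesis using tangent_space_component_zero[OF v False] by (auto simp: const_field_def)
  qed
qed

lemma tangent_eqI:
  assumes "c \<in> A" "q \<in> chart_dom c" "u \<in> tangent_space A q" "v \<in> tangent_space A q" "u c = v c"
  shows "u = v"
  using tangent_eq_const_field[OF assms(1-3)] tangent_eq_const_field[OF assms(1,2,4)] assms(5) by metis

lemma const_field_linear:
  assumes "c \<in> A"
  shows "const_field A c (r *\<^sub>R v + s *\<^sub>R w) q = r *\<^sub>R const_field A c v q + s *\<^sub>R const_field A c w q"
proof (rule ext)
  fix d
  show "const_field A c (r *\<^sub>R v + s *\<^sub>R w) q d = (r *\<^sub>R const_field A c v q + s *\<^sub>R const_field A c w q) d"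
    using transition_derivative_linear[OF assms, of d q]
    by (auto simp: const_field_def scaleR_fun_def linear_add linear_scale)
qed

lemma tangent_space_subspace: "subspace (tangent_space A q)"
proof (rule subspaceI)
  have lin: "linear (frechet_derivative (transition c d) (at (chart_map c q)))"
    if "c \<in> A" "d \<in> A" "q \<in> chart_dom c" "q \<in> chart_dom d" for c d
    using transition_derivative_linear that by blast
  show "0 \<in> tangent_space A q"
    by (rule tangent_spaceI) (simp_all add: linear_0[OF lin])
  show "x + y \<in> tangent_space A q" if xy: "x \<in> tangent_space A q" "y \<in> tangent_space A q" for x y
  proof (rule tangent_spaceI)
    fix c d assume "c \<in> A" "d \<in> A" "q \<in> chart_dom c" "q \<in> chart_dom d"
    note cd = this
    show "(x + y) d = frechet_derivative (transition c d) (at (chart_map c q)) ((x + y) c)"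
      unfolding plus_fun_def linear_add[OF lin[OF cd]] tangent_space_transition[OF xy(1) cd]
        tangent_space_transition[OF xy(2) cd] ..
  next
    fix c assume "\<not> (c \<in> A \<and> q \<in> chart_dom c)"
    then show "(x + y) c = 0"
      using tangent_space_component_zero[OF xy(1)] tangent_space_component_zero[OF xy(2)] by simp
  qed
  show "r *\<^sub>R x \<in> tangent_space A q" if x: "x \<in> tangent_space A q" for x r
  proof (rule tangent_spaceI)
    fix c d assume "c \<in> A" "d \<in> A" "q \<in> chart_dom c" "q \<in> chart_dom d"
    note cd = this
    show "(r *\<^sub>R x) d = frechet_derivative (transition c d) (at (chart_map c q)) ((r *\<^sub>R x) c)"
      unfolding scaleR_fun_def linear_scale[OF lin[OF cd]] tangent_space_transition[OF x cd] ..
  next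
    fix c assume "\<not> (c \<in> A \<and> q \<in> chart_dom c)"
    then show "(r *\<^sub>R x) c = 0" using tangent_space_component_zero[OF x] by (simp add: scaleR_fun_def)
  qed
qed

lemma chart_exists:
  assumes "q \<in> topspace M" obtains c where "c \<in> A" "q \<in> chart_dom c"
  using assms covering by blast

section \<open>Smooth functions and vector fields in charts\<close>

lemma thick_chart_image: "c \<in> A \<Longrightarrow> openin M V \<Longrightarrow> thick (chart_map c ` (chart_dom c \<inter> V))"
  by (intro thick_open open_chart_image)

lemma openin_Int_chart: "c \<in> A \<Longrightarrow> openin M V \<Longrightarrow> openin M (V \<inter> chart_dom c)"
  by (intro openin_Int chart_openin)

lemma vector_fields_tangent: "X \<in> vector_fields A V \<Longrightarrow> q \<in> V \<Longrightarrow> X q \<in> tangent_space A q"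
  unfolding vector_fields_def by blast

lemma vector_fields_smooth:
  "X \<in> vector_fields A V \<Longrightarrow> c \<in> A \<Longrightarrow> smooth_on (chart_map c ` (chart_dom c \<inter> V)) (\<lambda>x. X (chart_inv c x) c)"
  unfolding vector_fields_def by blast

lemma vector_fieldsI:
  assumes "\<And>q. q \<in> V \<Longrightarrow> X q \<in> tangent_space A q"
    and "\<And>c. c \<in> A \<Longrightarrow> smooth_on (chart_map c ` (chart_dom c \<inter> V)) (\<lambda>x. X (chart_inv c x) c)"
  shows "X \<in> vector_fields A V"
  unfolding vector_fields_def using assms by blast

lemma smooth_functionsD:
  "f \<in> smooth_functions A V \<Longrightarrow> c \<in> A \<Longrightarrow> smooth_on (chart_map c ` (chart_dom c \<inter> V)) (\<lambda>x. f (chart_inv c x))"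
  unfolding smooth_functions_def o_def by blast

lemma smooth_functionsI:
  assumes "\<And>c. c \<in> A \<Longrightarrow> smooth_on (chart_map c ` (chart_dom c \<inter> V)) (\<lambda>x. f (chart_inv c x))"
  shows "f \<in> smooth_functions A V"
  unfolding smooth_functions_def o_def using assms by blast

text \<open>The coordinate expressions of \<open>F\<close> in two charts differ by a smooth transition map.\<close>

lemma smooth_change_of_chart:
  fixes F :: "'a \<Rightarrow> 'b::real_normed_vector"
  assumes c: "c \<in> A" and d: "d \<in> A" and V: "openin M V" and W: "openin M W" "W \<subseteq> V \<inter> chart_dom c"
    and F: "smooth_on (chart_map c ` (chart_dom c \<inter> V)) (\<lambda>x. F (chart_inv c x))"
  shows "smooth_on (chart_map d ` (chart_dom d \<inter> W)) (\<lambda>x. F (chart_inv d x))"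
proof -
  let ?O = "chart_map d ` (chart_dom d \<inter> W)"
  have th: "thick ?O" by (rule thick_chart_image[OF d W(1)])
  have img: "transition d c ` ?O \<subseteq> chart_map c ` (chart_dom c \<inter> V)"
    using W(2) d by (auto simp: transition_chart_map)
  have "smooth_on ?O (transition d c)"
    by (rule smooth_on_subset[OF th _ smooth_transition[OF d c]]) (use W(2) in auto)
  from smooth_on_compose[OF th open_chart_image[OF c V] img F this]
  have "smooth_on ?O (\<lambda>x. F (chart_inv c (transition d c x)))" .
  moreover have "F (chart_inv c (transition d c x)) = F (chart_inv d x)" if x: "x \<in> ?O" for x
  proof -
    obtain q where q: "q \<in> chart_dom d" "q \<in> W" "x = chart_map d q" using x by blast
    then have "q \<in> chart_dom c" using W(2) by auto
    then show ?thesis using q c d by (simp add: transition_chart_map chart_inv_chart_map)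
  qed
  ultimately show ?thesis by (rule smooth_on_transform)
qed

lemma const_field_vector_field:
  assumes c: "c \<in> A"
  shows "const_field A c w \<in> vector_fields A (chart_dom c)"
  unfolding vector_fields_def
proof (intro CollectI conjI ballI)
  show "const_field A c w q \<in> tangent_space A q" if "q \<in> chart_dom c" for q
    using const_field_tangent[OF c that] .
  fix d assume d: "d \<in> A"
  let ?F = "\<lambda>q. frechet_derivative (transition c d) (at (chart_map c q)) w"
  have "smooth_on (chart_map c ` (chart_dom c \<inter> chart_dom d)) (\<lambda>y. frechet_derivative (transition c d) (at y) w)"
    by (rule smooth_on_open_frechet_derivative[OF open_chart_image[OF c chart_openin[OF d]] smooth_transition[OF c d]])
  then have "smooth_on (chart_map c ` (chart_dom c \<inter> chart_dom d)) (\<lambda>y. ?F (chart_inv c y))"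
    by (subst smooth_on_cong[of _ _ "\<lambda>y. frechet_derivative (transition c d) (at y) w"])
      (auto simp: chart_map_chart_inv)
  note sm = this
  have "smooth_on (chart_map d ` (chart_dom d \<inter> (chart_dom c \<inter> chart_dom d))) (\<lambda>x. ?F (chart_inv d x))"
    by (rule smooth_change_of_chart[where F = ?F, OF c d chart_openin[OF d] _ _ sm])
      (use c d in \<open>simp_all add: openin_Int_chart chart_openin\<close>)
  moreover have "chart_dom d \<inter> (chart_dom c \<inter> chart_dom d) = chart_dom d \<inter> chart_dom c" by blast
  ultimately have "smooth_on (chart_map d ` (chart_dom d \<inter> chart_dom c)) (\<lambda>x. ?F (chart_inv d x))"
    by (simp only:)
  moreover have "?F (chart_inv d x) = const_field A c w (chart_inv d x) d"
    if "x \<in> chart_map d ` (chart_dom d \<inter> chart_dom c)" for x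
    using that d by (auto simp: const_field_eq chart_inv_chart_map)
  ultimately show "smooth_on (chart_map d ` (chart_dom d \<inter> chart_dom c)) (\<lambda>x. const_field A c w (chart_inv d x) d)"
    by (rule smooth_on_transform)
qed

lemma vector_fields_subset:
  assumes Y: "Y \<in> vector_fields A V" and V: "openin M W" "W \<subseteq> V"
  shows "Y \<in> vector_fields A W"
proof (rule vector_fieldsI)
  show "Y q \<in> tangent_space A q" if "q \<in> W" for q using vector_fields_tangent[OF Y] V that by blast
  fix c assume c: "c \<in> A"
  show "smooth_on (chart_map c ` (chart_dom c \<inter> W)) (\<lambda>x. Y (chart_inv c x) c)"
    by (rule smooth_on_subset[OF thick_chart_image[OF c V(1)] _ vector_fields_smooth[OF Y c]]) (use V in blast)
qed

lemma smooth_functions_const: "openin M V \<Longrightarrow> (\<lambda>q. r) \<in> smooth_functions A V"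
  by (intro smooth_functionsI smooth_on_const thick_chart_image)

lemma component_smooth_function:
  assumes c: "c \<in> A" and V: "openin M V" and Y: "Y \<in> vector_fields A V"
  shows "(\<lambda>q. Y q c \<bullet> i) \<in> smooth_functions A (V \<inter> chart_dom c)"
proof (rule smooth_functionsI)
  fix d assume d: "d \<in> A"
  have "smooth_on (chart_map c ` (chart_dom c \<inter> V)) (\<lambda>x. Y (chart_inv c x) c \<bullet> i)"
    by (rule smooth_on_bounded_linear[OF thick_chart_image[OF c V] bounded_linear_inner_left vector_fields_smooth[OF Y c]])
  from smooth_change_of_chart[where F = "\<lambda>q. Y q c \<bullet> i", OF c d V openin_Int_chart[OF c V] order_refl this]
  show "smooth_on (chart_map d ` (chart_dom d \<inter> (V \<inter> chart_dom c))) (\<lambda>x. Y (chart_inv d x) c \<bullet> i)" .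
qed

lemma vector_fields_scaleR:
  assumes V: "openin M V" and f: "f \<in> smooth_functions A V" and Y: "Y \<in> vector_fields A V"
  shows "(\<lambda>q. f q *\<^sub>R Y q) \<in> vector_fields A V"
proof (rule vector_fieldsI)
  show "f q *\<^sub>R Y q \<in> tangent_space A q" if "q \<in> V" for q
    by (rule subspace_scale[OF tangent_space_subspace vector_fields_tangent[OF Y that]])
  fix c assume c: "c \<in> A"
  show "smooth_on (chart_map c ` (chart_dom c \<inter> V)) (\<lambda>x. (f (chart_inv c x) *\<^sub>R Y (chart_inv c x)) c)"
    unfolding scaleR_fun_def
    by (rule smooth_on_bilinear[OF thick_chart_image[OF c V] bounded_bilinear_scaleR smooth_functionsD[OF f c] vector_fields_smooth[OF Y c]])
qed

lemma vector_fields_add: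
  assumes V: "openin M V" and X: "X \<in> vector_fields A V" and Y: "Y \<in> vector_fields A V"
  shows "(\<lambda>q. X q + Y q) \<in> vector_fields A V"
proof (rule vector_fieldsI)
  show "X q + Y q \<in> tangent_space A q" if "q \<in> V" for q
    by (rule subspace_add[OF tangent_space_subspace vector_fields_tangent[OF X that] vector_fields_tangent[OF Y that]])
  fix c assume c: "c \<in> A"
  show "smooth_on (chart_map c ` (chart_dom c \<inter> V)) (\<lambda>x. (X (chart_inv c x) + Y (chart_inv c x)) c)"
    unfolding plus_fun_def
    by (rule smooth_on_add[OF thick_chart_image[OF c V] vector_fields_smooth[OF X c] vector_fields_smooth[OF Y c]])
qed

lemma vector_fields_zero:
  assumes V: "openin M V"
  shows "(\<lambda>q. 0) \<in> vector_fields A V"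
proof (rule vector_fieldsI)
  show "0 \<in> tangent_space A q" for q by (rule subspace_0[OF tangent_space_subspace])
  fix c assume c: "c \<in> A"
  show "smooth_on (chart_map c ` (chart_dom c \<inter> V)) (\<lambda>x. (0 :: ('a, 'n) tvec) c)"
    by (rule smooth_on_const[OF thick_chart_image[OF c V]])
qed

lemma vector_fields_sum:
  assumes V: "openin M V" and "finite I" and X: "\<And>i. i \<in> I \<Longrightarrow> X i \<in> vector_fields A V"
  shows "(\<lambda>q. \<Sum>i\<in>I. X i q) \<in> vector_fields A V"
  using assms(2,3)
proof (induction I)
  case empty
  then show ?case unfolding sum.empty by (intro vector_fields_zero[OF V])
next
  case (insert i I)
  then show ?case unfolding sum.insert[OF insert.hyps] by (intro vector_fields_add[OF V]) blast+
qed

lemma vector_field_has_derivative: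
  assumes c: "c \<in> A" and V: "openin M V" and Y: "Y \<in> vector_fields A V" and p: "p \<in> V" "p \<in> chart_dom c"
  shows "((\<lambda>x. Y (chart_inv c x) c) has_derivative
    frechet_derivative (\<lambda>x. Y (chart_inv c x) c) (at (chart_map c p))) (at (chart_map c p))"
  by (rule smooth_on_open_has_derivative[OF open_chart_image[OF c V]])
    (use p in \<open>auto intro: vector_fields_smooth[OF Y c]\<close>)

lemma const_field_sum:
  assumes "c \<in> A" "q \<in> chart_dom c" "v \<in> tangent_space A q"
  shows "v = (\<Sum>i\<in>Basis. (v c \<bullet> i) *\<^sub>R const_field A c i q)"
proof -
  have lin: "linear (\<lambda>w. const_field A c w q)"
    using const_field_linear[OF assms(1), of 1 _ 1 _ q] const_field_linear[OF assms(1), of _ _ 0 0 q]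
    by (intro linearI) auto
  show ?thesis
    using linear_basis_expansion[OF lin, of "v c"] tangent_eq_const_field[OF assms] by simp
qed

end

section \<open>The Levi-Civita connection in charts\<close>

context levi_civita
begin

lemma nab_zero_field:
  assumes "openin M V" "p \<in> V" "v \<in> tangent_space A p"
  shows "nab p v (\<lambda>q. 0) = 0"
  using nab_add[OF assms vector_fields_zero[OF assms(1)] vector_fields_zero[OF assms(1)]] by simp

lemma nab_sum:
  assumes V: "openin M V" "p \<in> V" and v: "v \<in> tangent_space A p" and "finite I"
    and X: "\<And>i. i \<in> I \<Longrightarrow> X i \<in> vector_fields A V"
  shows "nab p v (\<lambda>q. \<Sum>i\<in>I. X i q) = (\<Sum>i\<in>I. nab p v (X i))"
  using assms(4,5)
proof (induction I)
  case empty
  then show ?case unfolding sum.empty by (intro nab_zero_field[OF V v])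
next
  case (insert i I)
  have "(\<lambda>q. \<Sum>i\<in>I. X i q) \<in> vector_fields A V"
    using insert by (intro vector_fields_sum V) auto
  then have "nab p v (\<lambda>q. X i q + (\<Sum>i\<in>I. X i q)) = nab p v (X i) + nab p v (\<lambda>q. \<Sum>i\<in>I. X i q)"
    using insert.prems by (intro nab_add[OF V v]) blast+
  also have "nab p v (\<lambda>q. \<Sum>i\<in>I. X i q) = (\<Sum>i\<in>I. nab p v (X i))"
    using insert.prems by (intro insert.IH) blast
  finally show ?case unfolding sum.insert[OF insert.hyps] .
qed

lemma nab_scale:
  assumes V: "openin M V" "p \<in> V" and v: "v \<in> tangent_space A p" and Y: "Y \<in> vector_fields A V"
  shows "nab p v (\<lambda>q. r *\<^sub>R Y q) = r *\<^sub>R nab p v Y"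
proof -
  obtain c where c: "c \<in> A" "p \<in> chart_dom c" using V openin_subset chart_exists by blast
  have "frechet_derivative (\<lambda>x. r) (at (chart_map c p)) = (\<lambda>x. 0::real)"
    by (rule frechet_derivative_at[symmetric]) simp
  then have "dir_deriv c p v (\<lambda>q. r) = 0" by (simp add: dir_deriv_def o_def)
  then show ?thesis using nab_Leibniz[OF V v smooth_functions_const[OF V(1)] Y c, of r] by simp
qed

text \<open>In index notation, \<open>\<Gamma>\<^sup>k\<^sub>i\<^sub>j a\<^sup>i w\<^sup>j\<close> at the point with coordinates \<open>z\<close>.\<close>

definition christoffel :: "('a, 'n) chart \<Rightarrow> real ^ 'n \<Rightarrow> real ^ 'n \<Rightarrow> real ^ 'n \<Rightarrow> real ^ 'n" where
  "christoffel c z a w =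
     nab (chart_inv c z) (const_field A c a (chart_inv c z)) (const_field A c w) c"

lemma christoffel_linear:
  assumes c: "c \<in> A" and z: "z \<in> chart_map c ` chart_dom c"
  shows "linear (\<lambda>a. christoffel c z a w)" "linear (christoffel c z a)"
proof -
  note q = chart_openin[OF c] chart_inv_in_dom[OF z]
  note t = const_field_tangent[OF c q(2)] and f = const_field_vector_field[OF c]
  have "christoffel c z (r *\<^sub>R a + s *\<^sub>R b) w = r *\<^sub>R christoffel c z a w + s *\<^sub>R christoffel c z b w" for r s a b
    unfolding christoffel_def const_field_linear[OF c] nab_linear[OF q t t f]
    by (simp add: scaleR_fun_def)
  from this[of 1 _ 1] this[of _ _ 0 0] show "linear (\<lambda>a. christoffel c z a w)"
    by (intro linearI) auto
  have eq: "const_field A c (r *\<^sub>R v + s *\<^sub>R w) = (\<lambda>q. r *\<^sub>R const_field A c v q + s *\<^sub>R const_field A c w q)" for r s v w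
    by (rule ext) (rule const_field_linear[OF c])
  have "christoffel c z a (r *\<^sub>R v + s *\<^sub>R w) = r *\<^sub>R christoffel c z a v + s *\<^sub>R christoffel c z a w" for r s v w
    unfolding christoffel_def eq
    unfolding nab_add[OF q t vector_fields_scaleR[OF q(1) smooth_functions_const[OF q(1)] f]
        vector_fields_scaleR[OF q(1) smooth_functions_const[OF q(1)] f]] nab_scale[OF q t f]
    by (simp add: scaleR_fun_def)
  from this[of 1 _ 1] this[of _ _ 0 0] show "linear (christoffel c z a)"
    by (intro linearI) auto
qed

lemma christoffel_smooth:
  assumes c: "c \<in> A"
  shows "smooth_on (chart_map c ` chart_dom c) (\<lambda>z. christoffel c z a w)"
  using nab_smooth[OF chart_openin[OF c] const_field_vector_field[OF c, of a] const_field_vector_field[OF c, of w]] c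
  using vector_fields_smooth[OF _ c] unfolding christoffel_def by fastforce

text \<open>The usual coordinate formula \<open>(\<nabla>\<^sub>v Y)\<^sup>k = v(Y\<^sup>k) + \<Gamma>\<^sup>k\<^sub>i\<^sub>j v\<^sup>i Y\<^sup>j\<close>: expand \<open>Y\<close> in the coordinate fields and
  apply the Leibniz rule.\<close>

lemma nab_in_chart:
  assumes V: "openin M V" "p \<in> V" and c: "c \<in> A" "p \<in> chart_dom c" and v: "v \<in> tangent_space A p"
    and Y: "Y \<in> vector_fields A V"
  shows "nab p v Y c = frechet_derivative (\<lambda>x. Y (chart_inv c x) c) (at (chart_map c p)) (v c)
    + christoffel c (chart_map c p) (v c) (Y p c)"
proof -
  define W where "W = V \<inter> chart_dom c"
  have W: "openin M W" "p \<in> W" using V c by (simp_all add: W_def openin_Int_chart)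
  define f where "f i q = Y q c \<bullet> i" for i q
  define Z where "Z i q = f i q *\<^sub>R const_field A c i q" for i q
  have f: "f i \<in> smooth_functions A W" for i
    unfolding f_def[abs_def] W_def by (rule component_smooth_function[OF c(1) V(1) Y])
  have E: "const_field A c w \<in> vector_fields A W" for w
    by (rule vector_fields_subset[OF const_field_vector_field[OF c(1)] W(1)]) (auto simp: W_def)
  have Z: "Z i \<in> vector_fields A W" for i
    unfolding Z_def[abs_def] by (rule vector_fields_scaleR[OF W(1) f E])
  have YW: "Y \<in> vector_fields A W" by (rule vector_fields_subset[OF Y W(1)]) (auto simp: W_def)
  have dd: "dir_deriv c p v (f i) = frechet_derivative (\<lambda>x. Y (chart_inv c x) c) (at (chart_map c p)) (v c) \<bullet> i" for i
  proof -
    have "(f i \<circ> chart_inv c has_derivative (\<lambda>h. frechet_derivative (\<lambda>x. Y (chart_inv c x) c) (at (chart_map c p)) h \<bullet> i)) (at (chart_map c p))"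
      unfolding f_def o_def by (rule has_derivative_inner_left[OF vector_field_has_derivative[OF c(1) V(1) Y V(2) c(2)]])
    from frechet_derivative_at[OF this, symmetric] show ?thesis by (simp add: dir_deriv_def)
  qed
  have "nab p v Y = nab p v (\<lambda>q. \<Sum>i\<in>Basis. Z i q)"
  proof (rule nab_local[OF W v YW vector_fields_sum[OF W(1) finite_Basis Z]])
    fix q assume q: "q \<in> W"
    then have "Y q \<in> tangent_space A q" by (rule vector_fields_tangent[OF YW])
    from const_field_sum[OF c(1) _ this] q show "Y q = (\<Sum>i\<in>Basis. Z i q)"
      by (simp add: Z_def f_def W_def)
  qed
  also have "\<dots> = (\<Sum>i\<in>Basis. nab p v (Z i))" by (rule nab_sum[OF W v finite_Basis Z])
  also have "\<dots> = (\<Sum>i\<in>Basis. dir_deriv c p v (f i) *\<^sub>R const_field A c i p + f i p *\<^sub>R nab p v (const_field A c i))"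
    unfolding Z_def[abs_def] by (intro sum.cong refl nab_Leibniz[OF W v f E c])
  finally have "nab p v Y c = (\<Sum>i\<in>Basis. dir_deriv c p v (f i) *\<^sub>R const_field A c i p + f i p *\<^sub>R nab p v (const_field A c i)) c"
    by (rule fun_cong)
  also have "\<dots> = (\<Sum>i\<in>Basis. dir_deriv c p v (f i) *\<^sub>R i + f i p *\<^sub>R christoffel c (chart_map c p) (v c) i)"
  proof -
    have ev: "(\<Sum>i\<in>I. h i) c = (\<Sum>i\<in>I. h i c)" if "finite I" for h :: "real ^ 'n \<Rightarrow> ('a, 'n) tvec" and I
      using that by (induction I) auto
    have "nab p v (const_field A c i) c = christoffel c (chart_map c p) (v c) i" for i
      using tangent_eq_const_field[OF c v] c by (simp add: christoffel_def chart_inv_chart_map)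
    then show ?thesis by (simp add: ev scaleR_fun_def const_field_self[OF c])
  qed
  also have "\<dots> = (\<Sum>i\<in>Basis. dir_deriv c p v (f i) *\<^sub>R i) + (\<Sum>i\<in>Basis. f i p *\<^sub>R christoffel c (chart_map c p) (v c) i)"
    by (rule sum.distrib)
  also have "(\<Sum>i\<in>Basis. f i p *\<^sub>R christoffel c (chart_map c p) (v c) i) = christoffel c (chart_map c p) (v c) (Y p c)"
    unfolding f_def using c by (intro linear_basis_expansion[symmetric] christoffel_linear) auto
  finally show ?thesis unfolding dd by (simp add: euclidean_representation)
qed

end

section \<open>The curvature tensor\<close>

context levi_civita
begin

text \<open>The classical expression \<open>\<partial>\<Gamma> - \<partial>\<Gamma> + \<Gamma> \<Gamma> - \<Gamma> \<Gamma>\<close> for the components of the curvature tensor.\<close>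

definition curv_coord ::
  "('a, 'n) chart \<Rightarrow> real ^ 'n \<Rightarrow> real ^ 'n \<Rightarrow> real ^ 'n \<Rightarrow> real ^ 'n \<Rightarrow> real ^ 'n" where
  "curv_coord c z u v w =
     frechet_derivative (\<lambda>z. christoffel c z u w) (at z) v
   - frechet_derivative (\<lambda>z. christoffel c z v w) (at z) u
   + christoffel c z v (christoffel c z u w) - christoffel c z u (christoffel c z v w)"

lemma curv_coord_smooth:
  assumes c: "c \<in> A"
  shows "smooth_on (chart_map c ` chart_dom c) (\<lambda>z. curv_coord c z u v w)"
proof -
  note th = thick_open[OF chart_open_image[OF c]]
  have "smooth_on (chart_map c ` chart_dom c) (\<lambda>z. christoffel c z v (christoffel c z u w))" for u v w
    by (rule smooth_on_linear_family[OF th christoffel_linear(2)[OF c] christoffel_smooth[OF c] christoffel_smooth[OF c]])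
  then show ?thesis unfolding curv_coord_def
    by (intro smooth_on_diff smooth_on_add th smooth_on_open_frechet_derivative[OF chart_open_image[OF c]]
        christoffel_smooth[OF c])
qed

lemma curv_coord_linear:
  assumes c: "c \<in> A" and z: "z \<in> chart_map c ` chart_dom c"
  shows "linear (\<lambda>u. curv_coord c z u v w)" "linear (\<lambda>v. curv_coord c z u v w)" "linear (\<lambda>w. curv_coord c z u v w)"
proof -
  note chr = christoffel_linear[OF c]
  have d1: "linear (\<lambda>u. frechet_derivative (\<lambda>z. christoffel c z u w) (at z) h)" for w h
    by (rule linear_frechet_derivative_family[where T = "\<lambda>z u. christoffel c z u w", OF chart_open_image[OF c] z
      chr(1) christoffel_smooth[OF c]])
  have d2: "linear (\<lambda>w. frechet_derivative (\<lambda>z. christoffel c z u w) (at z) h)" for u h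
    by (rule linear_frechet_derivative_family[where T = "\<lambda>z w. christoffel c z u w", OF chart_open_image[OF c] z
      chr(2) christoffel_smooth[OF c]])
  have d3: "linear (frechet_derivative (\<lambda>z. christoffel c z u w) (at z))" for u w
    by (rule has_derivative_linear[OF smooth_on_open_has_derivative[OF chart_open_image[OF c] christoffel_smooth[OF c] z]])
  note lin = linear_add[OF d1] linear_scale[OF d1] linear_add[OF d2] linear_scale[OF d2] linear_add[OF d3] linear_scale[OF d3]
    linear_add[OF chr(1)[OF z]] linear_scale[OF chr(1)[OF z]] linear_add[OF chr(2)[OF z]] linear_scale[OF chr(2)[OF z]]
  show "linear (\<lambda>u. curv_coord c z u v w)" "linear (\<lambda>v. curv_coord c z u v w)" "linear (\<lambda>w. curv_coord c z u v w)"
    unfolding curv_coord_def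
    by (rule linearI; simp add: lin algebra_simps)+
qed

text \<open>The coordinate formula for \<open>\<nabla>\<close> is applied twice, the second time to \<open>\<nabla>\<^sub>X Z\<close>, whose components are
  differentiated by the product rule.\<close>

lemma iterated_nab_in_chart:
  assumes V: "openin M V" "p \<in> V" and c: "c \<in> A" "p \<in> chart_dom c"
    and X: "X \<in> vector_fields A V" and Y: "Y \<in> vector_fields A V" and Z: "Z \<in> vector_fields A V"
  defines "z \<equiv> chart_map c p"
    and "DX \<equiv> frechet_derivative (\<lambda>z. X (chart_inv c z) c) (at (chart_map c p))"
    and "DZ \<equiv> frechet_derivative (\<lambda>z. Z (chart_inv c z) c) (at (chart_map c p))"
  shows "nab p (Y p) (\<lambda>q. nab q (X q) Z) c =
      frechet_derivative (\<lambda>y. frechet_derivative (\<lambda>z. Z (chart_inv c z) c) (at y) (X p c)) (at z) (Y p c)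
    + DZ (DX (Y p c))
    + frechet_derivative (\<lambda>y. christoffel c y (X p c) (Z p c)) (at z) (Y p c)
    + christoffel c z (X p c) (DZ (Y p c)) + christoffel c z (DX (Y p c)) (Z p c)
    + christoffel c z (Y p c) (DZ (X p c)) + christoffel c z (Y p c) (christoffel c z (X p c) (Z p c))"
proof -
  let ?O = "chart_map c ` (chart_dom c \<inter> V)"
  let ?x = "\<lambda>z. X (chart_inv c z) c" and ?w = "\<lambda>z. Z (chart_inv c z) c"
  have O: "open ?O" "z \<in> ?O" "?O \<subseteq> chart_map c ` chart_dom c"
    using open_chart_image[OF c(1) V(1)] V c by (simp_all add: z_def image_mono)
  have inv: "chart_inv c z = p" using c by (simp add: z_def chart_inv_chart_map)
  have x: "smooth_on ?O ?x" and w: "smooth_on ?O ?w"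
    using vector_fields_smooth[OF X c(1)] vector_fields_smooth[OF Z c(1)] .
  have Dx: "(?x has_derivative DX) (at z within ?O)" and Dw: "(?w has_derivative DZ) (at z within ?O)"
    unfolding DX_def DZ_def z_def[symmetric]
    by (rule has_derivative_at_withinI[OF smooth_on_open_has_derivative[OF O(1) x O(2)]],
        rule has_derivative_at_withinI[OF smooth_on_open_has_derivative[OF O(1) w O(2)]])
  have linw: "linear (frechet_derivative ?w (at y))" if "y \<in> ?O" for y
    by (rule has_derivative_linear[OF smooth_on_open_has_derivative[OF O(1) w that]])
  define H where "H v = frechet_derivative (\<lambda>y. frechet_derivative ?w (at y) v) (at z)" for v
  define G where "G v u = frechet_derivative (\<lambda>y. christoffel c y v u) (at z)" for v u
  have th: "thick ?O" by (rule thick_open[OF O(1)])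
  have chr_smooth: "smooth_on ?O (\<lambda>y. christoffel c y v u)" for v u
    by (rule smooth_on_subset[OF th O(3) christoffel_smooth[OF c(1)]])
  have H: "((\<lambda>y. frechet_derivative ?w (at y) v) has_derivative H v) (at z within ?O)" for v
    unfolding H_def
    by (rule has_derivative_at_withinI[OF smooth_on_open_has_derivative[OF O(1) smooth_on_open_frechet_derivative[OF O(1) w] O(2)]])
  have G: "((\<lambda>y. christoffel c y v u) has_derivative G v u) (at z within ?O)" for v u
    unfolding G_def by (rule has_derivative_at_withinI[OF smooth_on_open_has_derivative[OF O(1) chr_smooth O(2)]])
  have linH: "linear (\<lambda>v. H v h)" for h
    unfolding H_def by (rule linear_frechet_derivative_family[OF O(1,2) linw smooth_on_open_frechet_derivative[OF O(1) w]])
  have linG: "linear (\<lambda>v. G v u h)" "linear (\<lambda>u. G v u h)" for v u h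
    unfolding G_def
    by (rule linear_frechet_derivative_family[OF O(1,2), where T = "\<lambda>y v. christoffel c y v u"],
        erule christoffel_linear(1)[OF c(1) subsetD[OF O(3)]], rule chr_smooth)
      (rule linear_frechet_derivative_family[OF O(1,2), where T = "\<lambda>y u. christoffel c y v u"],
        erule christoffel_linear(2)[OF c(1) subsetD[OF O(3)]], rule chr_smooth)
  have zU: "z \<in> chart_map c ` chart_dom c" using O by blast
  note chr = christoffel_linear[OF c(1)]
  have 1: "((\<lambda>y. frechet_derivative ?w (at y) (?x y)) has_derivative (\<lambda>h. H (?x z) h + frechet_derivative ?w (at z) (DX h))) (at z within ?O)"
    by (rule has_derivative_linear_family[OF O(2) linw H linH Dx])
  have 2: "((\<lambda>y. christoffel c y v (?w y)) has_derivative (\<lambda>h. G v (?w z) h + christoffel c z v (DZ h))) (at z within ?O)" for v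
    by (rule has_derivative_linear_family[OF O(2) chr(2)[OF subsetD[OF O(3)]] G linG(2) Dw])
  have 3: "((\<lambda>y. christoffel c y (?x y) (?w y)) has_derivative
      (\<lambda>h. (G (?x z) (?w z) h + christoffel c z (?x z) (DZ h)) + christoffel c z (DX h) (?w z))) (at z within ?O)"
  proof (rule has_derivative_linear_family[where T = "\<lambda>y a. christoffel c y a (?w y)", OF O(2) _ 2 _ Dx])
    show "linear (\<lambda>a. christoffel c y a (?w y))" if "y \<in> ?O" for y by (rule chr(1)[OF subsetD[OF O(3) that]])
    show "linear (\<lambda>v. G v (?w z) h + christoffel c z v (DZ h))" for h
      by (intro linear_compose_add linG chr(1)[OF zU])
  qed
  have N: "nab (chart_inv c y) (X (chart_inv c y)) Z c = frechet_derivative ?w (at y) (?x y) + christoffel c y (?x y) (?w y)"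
    if y: "y \<in> ?O" for y
  proof -
    have q: "chart_inv c y \<in> V" "chart_inv c y \<in> chart_dom c" "chart_map c (chart_inv c y) = y"
      using y c by (auto simp del: split_paired_All simp: chart_inv_chart_map)
    show ?thesis
      using nab_in_chart[OF V(1) q(1) c(1) q(2) vector_fields_tangent[OF X q(1)] Z] by (simp add: q(3))
  qed
  have "((\<lambda>y. frechet_derivative ?w (at y) (?x y) + christoffel c y (?x y) (?w y)) has_derivative
      (\<lambda>h. (H (?x z) h + frechet_derivative ?w (at z) (DX h)) +
        ((G (?x z) (?w z) h + christoffel c z (?x z) (DZ h)) + christoffel c z (DX h) (?w z)))) (at z within ?O)"
    by (rule has_derivative_add[OF 1 3])
  then have "((\<lambda>y. nab (chart_inv c y) (X (chart_inv c y)) Z c) has_derivative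
      (\<lambda>h. (H (?x z) h + frechet_derivative ?w (at z) (DX h)) +
        ((G (?x z) (?w z) h + christoffel c z (?x z) (DZ h)) + christoffel c z (DX h) (?w z)))) (at z within ?O)"
    by (rule has_derivative_transform[OF O(2), rotated]) (simp only: N)
  then have "frechet_derivative (\<lambda>y. nab (chart_inv c y) (X (chart_inv c y)) Z c) (at z) =
      (\<lambda>h. (H (?x z) h + frechet_derivative ?w (at z) (DX h)) +
        ((G (?x z) (?w z) h + christoffel c z (?x z) (DZ h)) + christoffel c z (DX h) (?w z)))"
    unfolding at_within_open[OF O(2,1)] by (rule frechet_derivative_at[symmetric])
  moreover have "nab p (Y p) (\<lambda>q. nab q (X q) Z) c =
      frechet_derivative (\<lambda>y. nab (chart_inv c y) (X (chart_inv c y)) Z c) (at z) (Y p c)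
      + christoffel c z (Y p c) (nab p (X p) Z c)"
    unfolding z_def
    by (rule nab_in_chart[OF V c vector_fields_tangent[OF Y V(2)] nab_smooth[OF V(1) X Z]])
  moreover have "nab p (X p) Z c = DZ (X p c) + christoffel c z (X p c) (Z p c)"
    unfolding DZ_def z_def by (rule nab_in_chart[OF V c vector_fields_tangent[OF X V(2)] Z])
  ultimately show ?thesis
    by (simp add: linear_add[OF chr(2)[OF zU]] inv H_def G_def DZ_def[folded z_def] z_def[symmetric] algebra_simps)
qed

lemma lie_bracket_tangent:
  assumes V: "openin M V" "p \<in> V" and X: "X \<in> vector_fields A V" and Y: "Y \<in> vector_fields A V"
  shows "lie_bracket A X Y p \<in> tangent_space A p"
  unfolding nab_torsion_free[OF V X Y, symmetric]
  by (intro subspace_diff[OF tangent_space_subspace] nab_tangent[OF V] vector_fields_tangent[OF _ V(2)] X Y)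

text \<open>In the coordinate expression of \<open>\<nabla>\<^sub>Y \<nabla>\<^sub>X Z - \<nabla>\<^sub>X \<nabla>\<^sub>Y Z + \<nabla>\<^bsub>[X,Y]\<^esub> Z\<close> all derivatives of the fields
  cancel, those of second order by their symmetry. Hence the curvature is a tensor.\<close>

lemma curv_field_in_chart:
  assumes V: "openin M V" "p \<in> V" and c: "c \<in> A" "p \<in> chart_dom c"
    and X: "X \<in> vector_fields A V" and Y: "Y \<in> vector_fields A V" and Z: "Z \<in> vector_fields A V"
  shows "curv_field A nab X Y Z p c = curv_coord c (chart_map c p) (X p c) (Y p c) (Z p c)"
proof -
  define z where "z = chart_map c p"
  let ?O = "chart_map c ` (chart_dom c \<inter> V)"
  have O: "open ?O" "z \<in> ?O" using open_chart_image[OF c(1) V(1)] V c by (simp_all add: z_def)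
  have zU: "z \<in> chart_map c ` chart_dom c" using c by (simp add: z_def)
  define DX where "DX = frechet_derivative (\<lambda>z. X (chart_inv c z) c) (at (chart_map c p))"
  define DY where "DY = frechet_derivative (\<lambda>z. Y (chart_inv c z) c) (at (chart_map c p))"
  define DZ where "DZ = frechet_derivative (\<lambda>z. Z (chart_inv c z) c) (at (chart_map c p))"
  have linZ: "linear DZ" unfolding DZ_def
    by (rule has_derivative_linear[OF vector_field_has_derivative[OF c(1) V(1) Z V(2) c(2)]])
  have L: "lie_bracket A X Y p c = DY (X p c) - DX (Y p c)"
    using c by (simp add: lie_bracket_def DX_def DY_def)
  have 3: "nab p (lie_bracket A X Y p) Z c = DZ (DY (X p c) - DX (Y p c)) + christoffel c z (DY (X p c) - DX (Y p c)) (Z p c)"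
    using nab_in_chart[OF V c lie_bracket_tangent[OF V X Y] Z] unfolding L DZ_def z_def .
  have sym: "frechet_derivative (\<lambda>y. frechet_derivative (\<lambda>z. Z (chart_inv c z) c) (at y) (X p c)) (at z) (Y p c)
    = frechet_derivative (\<lambda>y. frechet_derivative (\<lambda>z. Z (chart_inv c z) c) (at y) (Y p c)) (at z) (X p c)"
    by (rule second_derivative_symmetric[OF O vector_fields_smooth[OF Z c(1)]])
  note 1 = iterated_nab_in_chart[OF V c X Y Z, folded DX_def DZ_def z_def]
  note 2 = iterated_nab_in_chart[OF V c Y X Z, folded DY_def DZ_def z_def]
  note chr = christoffel_linear[OF c(1) zU]
  show ?thesis
    unfolding curv_field_def curv_coord_def z_def[symmetric]
    by (simp add: 1 2 3 sym linear_diff[OF linZ] linear_diff[OF chr(1)] algebra_simps)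
qed

lemma curvature_in_chart:
  assumes c: "c \<in> A" "p \<in> chart_dom c"
  shows "curvature A nab p u v w c = curv_coord c (chart_map c p) (u c) (v c) (w c)"
  using curv_field_in_chart[OF chart_openin[OF c(1)] c(2) c const_field_vector_field[OF c(1)]
      const_field_vector_field[OF c(1)] const_field_vector_field[OF c(1)], of "u c" "v c" "w c"] c
  by (simp add: curvature_def const_field_self)

text \<open>Each component of the curvature is computed with extensions that are constant in its own chart. As the
  value of the curvature field depends on the values of the three fields only, the extensions for one
  chart give all components.\<close>

lemma curvature_eq_curv_field:
  assumes c: "c \<in> A" "p \<in> chart_dom c"
    and u: "u \<in> tangent_space A p" and v: "v \<in> tangent_space A p" and w: "w \<in> tangent_space A p"
  shows "curvature A nab p u v w = curv_field A nab (const_field A c (u c)) (const_field A c (v c)) (const_field A c (w c)) p"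
    and "curvature A nab p u v w \<in> tangent_space A p"
proof -
  note f = const_field_vector_field[OF c(1)] and V = chart_openin[OF c(1)] c(2)
  note t = const_field_tangent[OF c]
  let ?\<tau> = "curv_field A nab (const_field A c (u c)) (const_field A c (v c)) (const_field A c (w c)) p"
  have tan: "?\<tau> \<in> tangent_space A p"
    unfolding curv_field_def
    by (intro subspace_add[OF tangent_space_subspace] subspace_diff[OF tangent_space_subspace]
        nab_tangent[OF V] t nab_smooth[OF V(1)] f lie_bracket_tangent[OF V])
  have "curvature A nab p u v w d = ?\<tau> d" for d
  proof (cases "d \<in> A \<and> p \<in> chart_dom d")
    case True
    then have d: "d \<in> A" "p \<in> chart_dom d" by auto
    show ?thesis
      using curvature_in_chart[OF d, of u v w] curv_field_in_chart[OF V d f f f, of "u c" "v c" "w c"]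
      unfolding tangent_eq_const_field[OF c u, symmetric] tangent_eq_const_field[OF c v, symmetric]
        tangent_eq_const_field[OF c w, symmetric] by simp
  next
    case False
    then show ?thesis using tangent_space_component_zero[OF tan False] by (auto simp: curvature_def)
  qed
  then show "curvature A nab p u v w = ?\<tau>" by (rule ext)
  then show "curvature A nab p u v w \<in> tangent_space A p" using tan by simp
qed

lemma const_fields_commute:
  assumes c: "c \<in> A" "q \<in> chart_dom c"
  shows "lie_bracket A (const_field A c a) (const_field A c b) q = 0"
    and "nab q (const_field A c a q) (const_field A c b) = nab q (const_field A c b q) (const_field A c a)"
proof -
  note V = chart_openin[OF c(1)] c(2) and f = const_field_vector_field[OF c(1)]
  have "frechet_derivative (\<lambda>x. const_field A c w (chart_inv c x) c) (at (chart_map c q)) = (\<lambda>h. 0)" for w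
  proof (rule frechet_derivative_at[symmetric])
    show "((\<lambda>x. const_field A c w (chart_inv c x) c) has_derivative (\<lambda>h. 0)) (at (chart_map c q))"
      by (rule has_derivative_transform_within_open[OF has_derivative_const[of w] chart_open_image[OF c(1)]])
        (use c in \<open>simp_all add: const_field_self[OF c(1)] chart_inv_in_dom\<close>)
  qed
  then have "lie_bracket A (const_field A c a) (const_field A c b) q c = 0"
    by (simp add: lie_bracket_def)
  then show "lie_bracket A (const_field A c a) (const_field A c b) q = 0"
    by (intro tangent_eqI[OF c lie_bracket_tangent[OF V f f] subspace_0[OF tangent_space_subspace]]) simp
  then show "nab q (const_field A c a q) (const_field A c b) = nab q (const_field A c b q) (const_field A c a)"
    using nab_torsion_free[OF V f f, of a b] by simp
qed

lemma curvature_const_fields: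
  assumes c: "c \<in> A" "p \<in> chart_dom c"
    and u: "u \<in> tangent_space A p" and v: "v \<in> tangent_space A p" and w: "w \<in> tangent_space A p"
  shows "curvature A nab p u v w =
    nab p v (\<lambda>q. nab q (const_field A c (u c) q) (const_field A c (w c)))
    - nab p u (\<lambda>q. nab q (const_field A c (v c) q) (const_field A c (w c)))"
proof -
  note V = chart_openin[OF c(1)] c(2) and f = const_field_vector_field[OF c(1)]
  have "nab p 0 (const_field A c (w c)) = 0"
    using nab_linear[OF V u u f, of 0 0 "w c"] by simp
  then show ?thesis
    unfolding curvature_eq_curv_field(1)[OF c u v w] curv_field_def const_fields_commute(1)[OF c]
      tangent_eq_const_field[OF c u, symmetric] tangent_eq_const_field[OF c v, symmetric] by simp
qed

text \<open>Evaluated on commuting coordinate fields, the six second covariant derivatives cancel in pairs, since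
  the connection is torsion free.\<close>

lemma first_Bianchi:
  assumes c: "c \<in> A" "p \<in> chart_dom c"
    and u: "u \<in> tangent_space A p" and v: "v \<in> tangent_space A p" and w: "w \<in> tangent_space A p"
  shows "curvature A nab p u v w + curvature A nab p v w u + curvature A nab p w u v = 0"
proof -
  note V = chart_openin[OF c(1)] c(2) and f = const_field_vector_field[OF c(1)]
  have *: "nab p x (\<lambda>q. nab q (const_field A c a q) (const_field A c b)) = nab p x (\<lambda>q. nab q (const_field A c b q) (const_field A c a))"
    if "x \<in> tangent_space A p" for x a b
    by (rule nab_local[OF V that nab_smooth[OF V(1) f f] nab_smooth[OF V(1) f f] const_fields_commute(2)[OF c(1)]])
  show ?thesis
    unfolding curvature_const_fields[OF c u v w] curvature_const_fields[OF c v w u] curvature_const_fields[OF c w u v]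
    using *[OF u, of "v c" "w c"] *[OF v, of "w c" "u c"] *[OF w, of "u c" "v c"] by simp
qed

lemma metric_add_left:
  "p \<in> topspace M \<Longrightarrow> u \<in> tangent_space A p \<Longrightarrow> v \<in> tangent_space A p \<Longrightarrow> w \<in> tangent_space A p \<Longrightarrow>
    g p (u + v) w = g p u w + g p v w"
  using metric_linear[of p u v w 1 1] by simp

lemma metric_scale_left:
  "p \<in> topspace M \<Longrightarrow> u \<in> tangent_space A p \<Longrightarrow> w \<in> tangent_space A p \<Longrightarrow>
    g p (r *\<^sub>R u) w = r * g p u w"
  using metric_linear[of p u u w r 0] by simp

lemma metric_diff_left:
  "p \<in> topspace M \<Longrightarrow> u \<in> tangent_space A p \<Longrightarrow> v \<in> tangent_space A p \<Longrightarrow> w \<in> tangent_space A p \<Longrightarrow>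
    g p (u - v) w = g p u w - g p v w"
  using metric_linear[of p u v w 1 "-1"] by simp

lemma metric_add_right:
  "p \<in> topspace M \<Longrightarrow> u \<in> tangent_space A p \<Longrightarrow> v \<in> tangent_space A p \<Longrightarrow> w \<in> tangent_space A p \<Longrightarrow>
    g p w (u + v) = g p w u + g p w v"
  using metric_add_left metric_sym subspace_add[OF tangent_space_subspace] by metis

text \<open>Skew symmetry in the last two arguments expresses that \<open>\<partial>\<^sub>u \<partial>\<^sub>v\<close> and \<open>\<partial>\<^sub>v \<partial>\<^sub>u\<close> agree on the function
  \<open>g(W, W)\<close>, which metricity allows to differentiate.\<close>

lemma curvature_skew:
  assumes p: "p \<in> topspace M"
    and u: "u \<in> tangent_space A p" and v: "v \<in> tangent_space A p" and w: "w \<in> tangent_space A p"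
  shows "g p (curvature A nab p u v w) w = 0"
proof -
  obtain c where c: "c \<in> A" "p \<in> chart_dom c" using chart_exists[OF p] .
  note V = chart_openin[OF c(1)] c(2) and f = const_field_vector_field[OF c(1)]
  note t = const_field_tangent[OF c(1)]
  define z where "z = chart_map c p"
  have zU: "z \<in> chart_map c ` chart_dom c" using c by (simp add: z_def)
  let ?W = "const_field A c (w c)"
  let ?m = "\<lambda>z. g (chart_inv c z) (?W (chart_inv c z)) (?W (chart_inv c z))"
  let ?k = "\<lambda>a q. g q (nab q (const_field A c a q) ?W) (?W q)"
  have m: "smooth_on (chart_map c ` chart_dom c) ?m"
    using smooth_functionsD[OF metric_smooth[OF V(1) f f] c(1)] by simp
  have k: "smooth_on (chart_map c ` chart_dom c) (\<lambda>z. ?k a (chart_inv c z))" for a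
    using smooth_functionsD[OF metric_smooth[OF V(1) nab_smooth[OF V(1) f f] f] c(1)] by simp
  have dm: "frechet_derivative ?m (at y) a = 2 * ?k a (chart_inv c y)" if y: "y \<in> chart_map c ` chart_dom c" for y a
  proof -
    note q = chart_inv_in_dom[OF y]
    have qM: "chart_inv c y \<in> topspace M" using q chart_dom_subset[OF c(1)] by blast
    have "dir_deriv c (chart_inv c y) (const_field A c a (chart_inv c y)) (\<lambda>q. g q (?W q) (?W q)) =
      ?k a (chart_inv c y) + g (chart_inv c y) (?W (chart_inv c y)) (nab (chart_inv c y) (const_field A c a (chart_inv c y)) ?W)"
      by (rule nab_metric[OF V(1) q t[OF q] f f c(1) q])
    also have "g (chart_inv c y) (?W (chart_inv c y)) (nab (chart_inv c y) (const_field A c a (chart_inv c y)) ?W) = ?k a (chart_inv c y)"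
      by (rule metric_sym[OF qM t[OF q] nab_tangent[OF V(1) q t[OF q] f]])
    finally show ?thesis
      by (simp add: dir_deriv_def o_def chart_map_chart_inv[OF y] const_field_self[OF c(1) q])
  qed
  have d2m: "frechet_derivative (\<lambda>y. frechet_derivative ?m (at y) a) (at z) b =
      2 * (g p (nab p (const_field A c b p) (\<lambda>q. nab q (const_field A c a q) ?W)) (?W p)
        + g p (nab p (const_field A c a p) ?W) (nab p (const_field A c b p) ?W))" for a b
  proof -
    have "((\<lambda>y. 2 * ?k a (chart_inv c y)) has_derivative (\<lambda>h. 2 * frechet_derivative (\<lambda>z. ?k a (chart_inv c z)) (at z) h)) (at z)"
      by (intro has_derivative_mult_right smooth_on_open_has_derivative[OF chart_open_image[OF c(1)] k zU])
    then have "((\<lambda>y. frechet_derivative ?m (at y) a) has_derivative (\<lambda>h. 2 * frechet_derivative (\<lambda>z. ?k a (chart_inv c z)) (at z) h)) (at z)"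
      by (rule has_derivative_transform_within_open[OF _ chart_open_image[OF c(1)] zU]) (use dm in simp)
    from frechet_derivative_at[OF this, symmetric]
    have "frechet_derivative (\<lambda>y. frechet_derivative ?m (at y) a) (at z) b = 2 * frechet_derivative (\<lambda>z. ?k a (chart_inv c z)) (at z) b" by simp
    moreover have "dir_deriv c p (const_field A c b p) (?k a) =
        g p (nab p (const_field A c b p) (\<lambda>q. nab q (const_field A c a q) ?W)) (?W p)
        + g p (nab p (const_field A c a p) ?W) (nab p (const_field A c b p) ?W)"
      by (rule nab_metric[OF V t[OF c(2)] nab_smooth[OF V(1) f f] f c])
    ultimately show ?thesis
      by (simp add: dir_deriv_def o_def z_def const_field_self[OF c])
  qed
  have sym: "g p (nab p u ?W) (nab p v ?W) = g p (nab p v ?W) (nab p u ?W)"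
    by (rule metric_sym[OF p nab_tangent[OF V u f] nab_tangent[OF V v f]])
  have "frechet_derivative (\<lambda>y. frechet_derivative ?m (at y) (u c)) (at z) (v c)
      = frechet_derivative (\<lambda>y. frechet_derivative ?m (at y) (v c)) (at z) (u c)"
    by (rule second_derivative_symmetric[OF chart_open_image[OF c(1)] zU m])
  then have "g p (nab p v (\<lambda>q. nab q (const_field A c (u c) q) ?W)) w = g p (nab p u (\<lambda>q. nab q (const_field A c (v c) q) ?W)) w"
    unfolding d2m tangent_eq_const_field[OF c u, symmetric] tangent_eq_const_field[OF c v, symmetric]
      tangent_eq_const_field[OF c w, symmetric] using sym by simp
  then show ?thesis
    unfolding curvature_const_fields[OF c u v w]
    by (subst metric_diff_left[OF p nab_tangent[OF V v] nab_tangent[OF V u] w]) (auto intro: nab_smooth[OF V(1) f f])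
qed

text \<open>Pair the cyclic identity for \<open>v, u, w\<close> with \<open>u\<close>: the third term vanishes by skew symmetry, and the other
  two are the two sides.\<close>

theorem curvature_symmetric:
  assumes p: "p \<in> topspace M"
    and u: "u \<in> tangent_space A p" and v: "v \<in> tangent_space A p" and w: "w \<in> tangent_space A p"
  shows "g p (curvature A nab p u v u) w = g p (curvature A nab p u w u) v"
proof -
  obtain c where c: "c \<in> A" "p \<in> chart_dom c" using chart_exists[OF p] .
  note R = curvature_eq_curv_field(2)[OF c]
  have anti: "curvature A nab p a b d = - curvature A nab p b a d"
    if "a \<in> tangent_space A p" "b \<in> tangent_space A p" "d \<in> tangent_space A p" for a b d
    unfolding curvature_const_fields[OF c that] curvature_const_fields[OF c that(2,1,3)] by simp
  have add: "curvature A nab p a b (d + e) = curvature A nab p a b d + curvature A nab p a b e"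
    if abde: "a \<in> tangent_space A p" "b \<in> tangent_space A p" "d \<in> tangent_space A p" "e \<in> tangent_space A p" for a b d e
  proof (rule tangent_eqI[OF c])
    show "curvature A nab p a b (d + e) \<in> tangent_space A p"
      by (intro R abde subspace_add[OF tangent_space_subspace])
    show "curvature A nab p a b d + curvature A nab p a b e \<in> tangent_space A p"
      by (intro R abde subspace_add[OF tangent_space_subspace])
    have "chart_map c p \<in> chart_map c ` chart_dom c" using c by simp
    from linear_add[OF curv_coord_linear(3)[OF c(1) this]]
    show "curvature A nab p a b (d + e) c = (curvature A nab p a b d + curvature A nab p a b e) c"
      by (simp add: curvature_in_chart[OF c])
  qed
  have skew: "g p (curvature A nab p a b d) e = - g p (curvature A nab p a b e) d"
    if abde: "a \<in> tangent_space A p" "b \<in> tangent_space A p" "d \<in> tangent_space A p" "e \<in> tangent_space A p" for a b d e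
  proof -
    have de: "d + e \<in> tangent_space A p" by (rule subspace_add[OF tangent_space_subspace abde(3,4)])
    have "0 = g p (curvature A nab p a b (d + e)) (d + e)"
      using curvature_skew[OF p abde(1,2) de] by simp
    also have "\<dots> = g p (curvature A nab p a b d) (d + e) + g p (curvature A nab p a b e) (d + e)"
      unfolding add[OF abde] by (intro metric_add_left p R abde de)
    also have "g p (curvature A nab p a b d) (d + e) = g p (curvature A nab p a b d) d + g p (curvature A nab p a b d) e"
      by (intro metric_add_right p R abde)
    also have "g p (curvature A nab p a b e) (d + e) = g p (curvature A nab p a b e) d + g p (curvature A nab p a b e) e"
      by (intro metric_add_right p R abde)
    finally show ?thesis using curvature_skew[OF p abde(1,2,3)] curvature_skew[OF p abde(1,2,4)] by simp
  qed
  have neg: "g p (- a) b = - g p a b" if "a \<in> tangent_space A p" "b \<in> tangent_space A p" for a b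
    using metric_scale_left[OF p that, of "-1"] by simp
  have "0 = g p (curvature A nab p v u w + curvature A nab p u w v + curvature A nab p w v u) u"
    unfolding first_Bianchi[OF c v u w] using metric_scale_left[OF p u u, of 0] by simp
  also have "\<dots> = g p (curvature A nab p v u w) u + g p (curvature A nab p u w v) u + g p (curvature A nab p w v u) u"
    by (simp add: metric_add_left p R u v w subspace_add[OF tangent_space_subspace])
  also have "g p (curvature A nab p w v u) u = 0" by (rule curvature_skew[OF p w v u])
  also have "g p (curvature A nab p v u w) u = g p (curvature A nab p u v u) w"
    using skew[OF v u w u] anti[OF v u u] neg[OF R[OF u v u] w] by simp
  also have "g p (curvature A nab p u w v) u = - g p (curvature A nab p u w u) v"
    by (rule skew[OF u w v u])
  finally show ?thesis by simp
qed

end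

section \<open>Covariant derivatives along a curve\<close>

lemma vector_derivative_within_unit_interval:
  "x \<in> {0..1} \<Longrightarrow> (f has_vector_derivative D) (at x within {0..1::real}) \<Longrightarrow>
    vector_derivative f (at x within {0..1}) = D"
  by (rule vector_derivative_within_cbox[of 0 1, unfolded box_real]) simp_all

context levi_civita
begin

definition metric_coord :: "('a, 'n) chart \<Rightarrow> real ^ 'n \<Rightarrow> real ^ 'n \<Rightarrow> real ^ 'n \<Rightarrow> real" where
  "metric_coord c z a b = g (chart_inv c z) (const_field A c a (chart_inv c z)) (const_field A c b (chart_inv c z))"

lemma metric_coord_smooth:
  assumes c: "c \<in> A"
  shows "smooth_on (chart_map c ` chart_dom c) (\<lambda>z. metric_coord c z a b)"
  using smooth_functionsD[OF metric_smooth[OF chart_openin[OF c] const_field_vector_field[OF c] const_field_vector_field[OF c]] c]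
  by (simp add: metric_coord_def)

lemma metric_coord_linear:
  assumes c: "c \<in> A" and z: "z \<in> chart_map c ` chart_dom c"
  shows "linear (\<lambda>a. metric_coord c z a b)" "linear (metric_coord c z a)"
proof -
  note t = const_field_tangent[OF c chart_inv_in_dom[OF z]]
  have M: "chart_inv c z \<in> topspace M"
    using chart_inv_in_dom[OF z] chart_dom_subset[OF c] by blast
  have "metric_coord c z (r *\<^sub>R a + s *\<^sub>R a') b = r * metric_coord c z a b + s * metric_coord c z a' b" for r s a a' b
    unfolding metric_coord_def const_field_linear[OF c] by (rule metric_linear[OF M t t t])
  from this[of 1 _ 1] this[of _ _ 0 0] show lin: "linear (\<lambda>a. metric_coord c z a b)" for b
    by (intro linearI) simp_all
  have "metric_coord c z a = (\<lambda>b. metric_coord c z b a)"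
    unfolding metric_coord_def by (rule ext, rule metric_sym[OF M t t])
  then show "linear (metric_coord c z a)" using lin[of a] by (simp only:)
qed

lemma metric_eq_metric_coord:
  assumes c: "c \<in> A" "p \<in> chart_dom c" and u: "u \<in> tangent_space A p" and v: "v \<in> tangent_space A p"
  shows "g p u v = metric_coord c (chart_map c p) (u c) (v c)"
  unfolding metric_coord_def chart_inv_chart_map[OF c] tangent_eq_const_field[OF c u, symmetric]
    tangent_eq_const_field[OF c v, symmetric] ..

end

locale curve_in_manifold = levi_civita M A g nab
  for M :: "'a topology" and A :: "('a, 'n::finite) chart set"
    and g :: "'a \<Rightarrow> ('a, 'n) tvec \<Rightarrow> ('a, 'n) tvec \<Rightarrow> real"
    and nab :: "'a \<Rightarrow> ('a, 'n) tvec \<Rightarrow> ('a \<Rightarrow> ('a, 'n) tvec) \<Rightarrow> ('a, 'n) tvec" +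
  fixes \<gamma> :: "real \<Rightarrow> 'a"
  assumes curve_smooth: "smooth_curve M A \<gamma>"
begin

abbreviation "vel \<equiv> velocity A \<gamma>"

definition chart_times :: "('a, 'n) chart \<Rightarrow> real set" where
  "chart_times c = {x \<in> {0..1}. \<gamma> x \<in> chart_dom c}"

definition local_curve :: "('a, 'n) chart \<Rightarrow> real \<Rightarrow> real ^ 'n" where
  "local_curve c x = chart_map c (\<gamma> x)"

lemma chart_times_iff: "x \<in> chart_times c \<longleftrightarrow> x \<in> {0..1} \<and> \<gamma> x \<in> chart_dom c"
  by (simp add: chart_times_def)

lemma curve_in: "x \<in> {0..1} \<Longrightarrow> \<gamma> x \<in> topspace M"
  using curve_smooth unfolding smooth_curve_def continuous_map_def by auto

lemma chart_times_openin: "c \<in> A \<Longrightarrow> openin (top_of_set {0..1}) (chart_times c)"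
  using openin_continuous_map_preimage[OF conjunct1[OF curve_smooth[unfolded smooth_curve_def]] chart_openin]
  by (simp add: chart_times_def)

lemma thick_chart_times: "c \<in> A \<Longrightarrow> thick (chart_times c)"
  by (rule thick_relatively_open_interval[OF chart_times_openin]) auto

lemma at_within_Int_chart_times:
  assumes "c \<in> A" "J \<subseteq> {0..1}" "x \<in> chart_times c"
  shows "at x within (J \<inter> chart_times c) = at x within J"
proof -
  obtain T where T: "open T" "chart_times c = {0..1} \<inter> T"
    using chart_times_openin[OF assms(1)] by (auto simp: openin_open)
  show ?thesis
    by (rule at_within_nhd[of x T]) (use T assms in auto)
qed

lemma at_within_chart_times:
  "c \<in> A \<Longrightarrow> x \<in> chart_times c \<Longrightarrow> at x within chart_times c = at x within {0..1}"
proof -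
  assume "c \<in> A" "x \<in> chart_times c"
  moreover have "{0..1} \<inter> chart_times c = chart_times c" by (auto simp del: split_paired_All simp: chart_times_def)
  ultimately show ?thesis using at_within_Int_chart_times[of c "{0..1}" x] by simp
qed

lemma local_curve_smooth: "c \<in> A \<Longrightarrow> smooth_on (chart_times c) (local_curve c)"
  using curve_smooth unfolding smooth_curve_def chart_times_def local_curve_def[abs_def] o_def by blast

lemma local_curve_in: "x \<in> chart_times c \<Longrightarrow> local_curve c x \<in> chart_map c ` chart_dom c"
  by (simp add: chart_times_def local_curve_def)

lemma chart_inv_local_curve: "c \<in> A \<Longrightarrow> x \<in> chart_times c \<Longrightarrow> chart_inv c (local_curve c x) = \<gamma> x"
  by (simp add: chart_times_def local_curve_def chart_inv_chart_map)

lemma local_curve_deriv: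
  assumes c: "c \<in> A" and x: "x \<in> chart_times c"
  shows "(local_curve c has_vector_derivative vel x c) (at x within {0..1})"
proof -
  have "(local_curve c has_vector_derivative frechet_derivative (local_curve c) (at x within chart_times c) 1) (at x within {0..1})"
    using smooth_on_vector_derivative[OF local_curve_smooth[OF c] x] unfolding at_within_chart_times[OF c x] .
  moreover from this have "vector_derivative (local_curve c) (at x within {0..1}) = frechet_derivative (local_curve c) (at x within chart_times c) 1"
    using x by (intro vector_derivative_within_unit_interval) (auto simp: chart_times_def)
  moreover have "vel x c = vector_derivative (local_curve c) (at x within {0..1})"
    using c x by (simp add: velocity_def chart_times_def local_curve_def[abs_def] o_def)
  ultimately show ?thesis by simp
qed

lemma velocity_smooth:
  assumes c: "c \<in> A"
  shows "smooth_on (chart_times c) (\<lambda>x. vel x c)"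
proof (rule smooth_on_transform[OF smooth_on_frechet_derivative[OF local_curve_smooth[OF c], of 1]])
  fix x assume x: "x \<in> chart_times c"
  have "(local_curve c has_derivative (\<lambda>h. h *\<^sub>R vel x c)) (at x within chart_times c)"
    using local_curve_deriv[OF c x] unfolding has_vector_derivative_def at_within_chart_times[OF c x] .
  from thick_frechet_derivative[OF thick_chart_times[OF c] x this]
  show "frechet_derivative (local_curve c) (at x within chart_times c) 1 = vel x c" by simp
qed

lemma velocity_tangent:
  assumes x: "x \<in> {0..1}"
  shows "vel x \<in> tangent_space A (\<gamma> x)"
proof (rule tangent_spaceI)
  fix c assume "\<not> (c \<in> A \<and> \<gamma> x \<in> chart_dom c)"
  then show "vel x c = 0" by (auto simp: velocity_def)
next
  fix c d assume cd: "c \<in> A" "d \<in> A" "\<gamma> x \<in> chart_dom c" "\<gamma> x \<in> chart_dom d"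
  have xc: "x \<in> chart_times c" and xd: "x \<in> chart_times d" using x cd by (auto simp: chart_times_def)
  let ?T = "frechet_derivative (transition c d) (at (chart_map c (\<gamma> x)))"
  have "(local_curve c has_derivative (\<lambda>h. h *\<^sub>R vel x c)) (at x within chart_times c)"
    using local_curve_deriv[OF cd(1) xc] unfolding has_vector_derivative_def at_within_chart_times[OF cd(1) xc] .
  then have "((\<lambda>y. transition c d (local_curve c y)) has_derivative (\<lambda>h. ?T (h *\<^sub>R vel x c))) (at x within chart_times c)"
    by (rule has_derivative_compose) (use transition_has_derivative[OF cd] in \<open>simp add: local_curve_def\<close>)
  then have "(local_curve d has_derivative (\<lambda>h. ?T (h *\<^sub>R vel x c))) (at x within chart_times c)"
    by (rule has_derivative_transform[OF xc, rotated])
      (use cd in \<open>simp add: local_curve_def chart_times_def transition_chart_map\<close>)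
  then have "(local_curve d has_vector_derivative ?T (vel x c)) (at x within {0..1})"
    unfolding at_within_chart_times[OF cd(1) xc] has_vector_derivative_def
    by (simp add: linear_scale[OF transition_derivative_linear[OF cd]])
  then show "vel x d = ?T (vel x c)"
    using vector_derivative_within_unit_interval[OF x] local_curve_deriv[OF cd(2) xd] by metis
qed

lemma const_field_component_deriv:
  assumes cd: "c \<in> A" "d \<in> A" and x: "x \<in> chart_times c" "x \<in> chart_times d"
  shows "((\<lambda>y. const_field A c w (\<gamma> y) d) has_derivative
    (\<lambda>h. frechet_derivative (\<lambda>z. const_field A c w (chart_inv d z) d) (at (local_curve d x)) (h *\<^sub>R vel x d)))
    (at x within chart_times d)"
proof -
  have p: "\<gamma> x \<in> chart_dom c" "\<gamma> x \<in> chart_dom d" using x by (auto simp: chart_times_def)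
  have "(local_curve d has_derivative (\<lambda>h. h *\<^sub>R vel x d)) (at x within chart_times d)"
    using local_curve_deriv[OF cd(2) x(2)] unfolding has_vector_derivative_def at_within_chart_times[OF cd(2) x(2)] .
  from has_derivative_compose[OF this vector_field_has_derivative[OF cd(2) chart_openin[OF cd(1)]
      const_field_vector_field[OF cd(1)] p, of w, folded local_curve_def]]
  have "((\<lambda>y. const_field A c w (chart_inv d (local_curve d y)) d) has_derivative
    (\<lambda>h. frechet_derivative (\<lambda>z. const_field A c w (chart_inv d z) d) (at (local_curve d x)) (h *\<^sub>R vel x d)))
    (at x within chart_times d)" .
  then show ?thesis
    by (rule has_derivative_transform[OF x(2), rotated]) (simp add: chart_inv_local_curve[OF cd(2)])
qed

text \<open>A field with components \<open>\<xi>\<^sup>i\<close> in \<open>c\<close> is \<open>\<Sum>\<^sub>i \<xi>\<^sup>i E\<^sub>i\<close> for the coordinate fields \<open>E\<^sub>i\<close> of \<open>c\<close>, whose components in \<open>d\<close> are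
  differentiated by the chain rule.\<close>

lemma chart_change_derivative:
  assumes J: "J \<subseteq> {0..1}" "x \<in> J" and cd: "c \<in> A" "d \<in> A" "\<gamma> x \<in> chart_dom c" "\<gamma> x \<in> chart_dom d"
    and \<xi>: "\<And>y. y \<in> J \<Longrightarrow> \<xi> y \<in> tangent_space A (\<gamma> y)"
    and \<xi>': "((\<lambda>y. \<xi> y c) has_vector_derivative \<xi>') (at x within J)"
  shows "((\<lambda>y. \<xi> y d) has_vector_derivative
    (frechet_derivative (\<lambda>z. const_field A c (\<xi> x c) (chart_inv d z) d) (at (local_curve d x)) (vel x d)
      + const_field A c \<xi>' (\<gamma> x) d)) (at x within J)"
proof -
  have x: "x \<in> chart_times c" "x \<in> chart_times d" using J cd by (auto simp: chart_times_def)
  define T where "T y w = const_field A c w (\<gamma> y) d" for y w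
  define D where "D w h = frechet_derivative (\<lambda>z. const_field A c w (chart_inv d z) d) (at (local_curve d x)) (h *\<^sub>R vel x d)" for w h
  define S where "S = J \<inter> chart_times c \<inter> chart_times d"
  have S: "x \<in> S" "S \<subseteq> J" "S \<subseteq> chart_times d" using x J by (auto simp: S_def)
  have "at x within S = at x within (J \<inter> chart_times c)" unfolding S_def
    using J by (intro at_within_Int_chart_times[OF cd(2) _ x(2)]) auto
  also have "\<dots> = at x within J" by (rule at_within_Int_chart_times[OF cd(1) J(1) x(1)])
  finally have at: "at x within S = at x within J" .
  have linT: "linear (T y)" for y
    using const_field_linear[OF cd(1), of 1 _ 1 _ "\<gamma> y"] const_field_linear[OF cd(1), of _ _ 0 0 "\<gamma> y"]
    unfolding T_def by (intro linearI) (simp_all add: scaleR_fun_def)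
  have T: "((\<lambda>y. T y w) has_derivative D w) (at x within S)" for w
    unfolding T_def D_def by (rule has_derivative_subset[OF const_field_component_deriv[OF cd(1,2) x] S(3)])
  have linD: "linear (\<lambda>w. D w h)" for h
    unfolding D_def
  proof (rule linear_frechet_derivative_family[where T = "\<lambda>z w. const_field A c w (chart_inv d z) d",
      OF open_chart_image[OF cd(2) chart_openin[OF cd(1)]]])
    show "local_curve d x \<in> chart_map d ` (chart_dom d \<inter> chart_dom c)"
      using cd by (simp add: local_curve_def)
    show "linear (\<lambda>w. const_field A c w (chart_inv d z) d)" for z
      using const_field_linear[OF cd(1), of 1 _ 1 _ "chart_inv d z"] const_field_linear[OF cd(1), of _ _ 0 0 "chart_inv d z"]
      by (intro linearI) (simp_all add: scaleR_fun_def)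
    show "smooth_on (chart_map d ` (chart_dom d \<inter> chart_dom c)) (\<lambda>z. const_field A c w (chart_inv d z) d)" for w
      by (rule vector_fields_smooth[OF const_field_vector_field[OF cd(1)] cd(2)])
  qed
  have "((\<lambda>y. \<xi> y c) has_derivative (\<lambda>h. h *\<^sub>R \<xi>')) (at x within S)"
    using \<xi>' unfolding has_vector_derivative_def at .
  from has_derivative_linear_family[OF S(1) linT T linD this]
  have "((\<lambda>y. T y (\<xi> y c)) has_derivative (\<lambda>h. D (\<xi> x c) h + T x (h *\<^sub>R \<xi>'))) (at x within S)" .
  then have "((\<lambda>y. \<xi> y d) has_derivative (\<lambda>h. D (\<xi> x c) h + T x (h *\<^sub>R \<xi>'))) (at x within S)"
  proof (rule has_derivative_transform[OF S(1), rotated])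
    fix y assume y: "y \<in> S"
    then have "\<gamma> y \<in> chart_dom c" "\<xi> y \<in> tangent_space A (\<gamma> y)"
      using \<xi> by (auto simp: S_def chart_times_def)
    from tangent_eq_const_field[OF cd(1) this] show "\<xi> y d = T y (\<xi> y c)"
      unfolding T_def by (rule fun_cong)
  qed
  moreover have "D (\<xi> x c) h + T x (h *\<^sub>R \<xi>') = h *\<^sub>R (D (\<xi> x c) 1 + T x \<xi>')" for h
  proof -
    have "linear (frechet_derivative (\<lambda>z. const_field A c (\<xi> x c) (chart_inv d z) d) (at (local_curve d x)))"
      unfolding local_curve_def
      by (rule has_derivative_linear[OF vector_field_has_derivative[OF cd(2) chart_openin[OF cd(1)]
        const_field_vector_field[OF cd(1)] cd(3,4)]])
    then show ?thesis by (simp add: D_def linear_scale[OF linT] linear_scale scaleR_add_right)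
  qed
  ultimately show ?thesis
    unfolding has_vector_derivative_def at by (simp add: D_def T_def)
qed

lemma nab_velocity_in_chart:
  assumes "c \<in> A" "x \<in> chart_times c"
  shows "nab (\<gamma> x) (vel x) (const_field A c w) c = christoffel c (local_curve c x) (vel x c) w"
proof -
  have "x \<in> {0..1}" "\<gamma> x \<in> chart_dom c" using assms by (auto simp: chart_times_def)
  then show ?thesis
    using tangent_eq_const_field[OF assms(1) _ velocity_tangent, of x]
    by (simp add: christoffel_def chart_inv_local_curve[OF assms])
qed

text \<open>The covariant derivative is defined separately in each chart. The inhomogeneous terms in the change of
  the derivative of the components and in the change of the Christoffel symbols cancel, so that the
  definitions fit together.\<close>

lemma cov_deriv_along_eq:
  assumes x: "x \<in> {0..1}" and c: "c \<in> A" "\<gamma> x \<in> chart_dom c"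
    and \<xi>: "\<And>y. y \<in> {0..1} \<Longrightarrow> \<xi> y \<in> tangent_space A (\<gamma> y)"
    and \<xi>': "((\<lambda>y. \<xi> y c) has_vector_derivative \<xi>') (at x within {0..1})"
  shows "cov_deriv_along A nab \<gamma> \<xi> x = nab (\<gamma> x) (vel x) (const_field A c (\<xi> x c)) + const_field A c \<xi>' (\<gamma> x)"
    and "cov_deriv_along A nab \<gamma> \<xi> x \<in> tangent_space A (\<gamma> x)"
    and "cov_deriv_along A nab \<gamma> \<xi> x c = \<xi>' + christoffel c (local_curve c x) (vel x c) (\<xi> x c)"
proof -
  let ?E = "const_field A c (\<xi> x c)"
  note V = chart_openin[OF c(1)] c(2) and f = const_field_vector_field[OF c(1)]
  have tan: "nab (\<gamma> x) (vel x) ?E + const_field A c \<xi>' (\<gamma> x) \<in> tangent_space A (\<gamma> x)"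
    by (intro subspace_add[OF tangent_space_subspace] nab_tangent[OF V velocity_tangent[OF x] f] const_field_tangent[OF c])
  have "cov_deriv_along A nab \<gamma> \<xi> x d = (nab (\<gamma> x) (vel x) ?E + const_field A c \<xi>' (\<gamma> x)) d" for d
  proof (cases "d \<in> A \<and> \<gamma> x \<in> chart_dom d")
    case True
    then have d: "d \<in> A" "\<gamma> x \<in> chart_dom d" "x \<in> chart_times d" using x by (auto simp: chart_times_def)
    have "vector_derivative (\<lambda>y. \<xi> y d) (at x within {0..1}) =
      frechet_derivative (\<lambda>z. ?E (chart_inv d z) d) (at (local_curve d x)) (vel x d) + const_field A c \<xi>' (\<gamma> x) d"
      by (rule vector_derivative_within_unit_interval[OF x chart_change_derivative[OF order_refl x c(1) d(1) c(2) d(2) \<xi> \<xi>']])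
    moreover have "nab (\<gamma> x) (vel x) ?E d = frechet_derivative (\<lambda>z. ?E (chart_inv d z) d) (at (local_curve d x)) (vel x d)
        + christoffel d (local_curve d x) (vel x d) (\<xi> x d)"
      using nab_in_chart[OF V d(1,2) velocity_tangent[OF x] f, of "\<xi> x c", folded local_curve_def]
      unfolding tangent_eq_const_field[OF c \<xi>[OF x], symmetric] .
    ultimately show ?thesis
      using True x by (simp add: cov_deriv_along_def nab_velocity_in_chart[OF d(1,3)])
  next
    case False
    then show ?thesis using tangent_space_component_zero[OF tan False] by (auto simp: cov_deriv_along_def)
  qed
  then show *: "cov_deriv_along A nab \<gamma> \<xi> x = nab (\<gamma> x) (vel x) ?E + const_field A c \<xi>' (\<gamma> x)" by (rule ext)
  show "cov_deriv_along A nab \<gamma> \<xi> x \<in> tangent_space A (\<gamma> x)" unfolding * by (rule tan)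
  have "x \<in> chart_times c" using x c by (simp add: chart_times_def)
  then show "cov_deriv_along A nab \<gamma> \<xi> x c = \<xi>' + christoffel c (local_curve c x) (vel x c) (\<xi> x c)"
    by (simp add: * const_field_self[OF c] nab_velocity_in_chart[OF c(1)])
qed

lemma smooth_along:
  fixes F :: "real ^ 'n \<Rightarrow> 'b::real_normed_vector"
  assumes c: "c \<in> A" and F: "smooth_on (chart_map c ` chart_dom c) F"
  shows "smooth_on (chart_times c) (\<lambda>x. F (local_curve c x))"
  by (rule smooth_on_compose[OF thick_chart_times[OF c] chart_open_image[OF c] _ F local_curve_smooth[OF c]])
    (auto simp del: split_paired_All intro: local_curve_in)

lemma christoffel_along_smooth:
  assumes c: "c \<in> A"
  shows "smooth_on (chart_times c) (\<lambda>x. christoffel c (local_curve c x) (vel x c) w)"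
  by (rule smooth_on_linear_family[where T = "\<lambda>x v. christoffel c (local_curve c x) v w",
      OF thick_chart_times[OF c] christoffel_linear(1)[OF c local_curve_in] smooth_along[OF c christoffel_smooth[OF c]] velocity_smooth[OF c]])

section \<open>Parallel frames\<close>

text \<open>The equation \<open>\<xi>' + \<Gamma>(\<gamma>', \<xi>) = 0\<close> is required in all charts, with derivatives within the interval, so that
  solutions on adjacent intervals can be glued.\<close>

definition parallel_on :: "real \<Rightarrow> real \<Rightarrow> (real \<Rightarrow> ('a, 'n) tvec) \<Rightarrow> bool" where
  "parallel_on a b \<xi> \<longleftrightarrow> (\<forall>x\<in>{a..b}. \<xi> x \<in> tangent_space A (\<gamma> x)) \<and>
     (\<forall>x\<in>{a..b}. \<forall>c\<in>A. \<gamma> x \<in> chart_dom c \<longrightarrow>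
        ((\<lambda>y. \<xi> y c) has_vector_derivative - christoffel c (local_curve c x) (vel x c) (\<xi> x c)) (at x within {a..b}))"

text \<open>The linear equation is solved in the one chart \<open>c\<close>; vanishing of a tangent vector does not depend on the
  chart, which gives the equation in all others.\<close>

lemma parallel_exists_local:
  assumes c: "c \<in> A" and ab: "0 \<le> a" "a \<le> b" "b \<le> 1" "{a..b} \<subseteq> chart_times c" and v: "v \<in> tangent_space A (\<gamma> a)"
  shows "\<exists>\<xi>. \<xi> a = v \<and> parallel_on a b \<xi>"
proof -
  have times: "x \<in> chart_times c" "\<gamma> x \<in> chart_dom c" "x \<in> {0..1}" if "x \<in> {a..b}" for x
    using that ab(4) by (auto simp: chart_times_def)
  define B where "B x w = (if x \<in> {a..b} then - christoffel c (local_curve c x) (vel x c) w else 0)" for x w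
  have "bounded_linear (B x)" for x
  proof (cases "x \<in> {a..b}")
    case True
    then have "linear (christoffel c (local_curve c x) (vel x c))"
      by (intro christoffel_linear(2)[OF c] local_curve_in times)
    then have "linear (\<lambda>w. - christoffel c (local_curve c x) (vel x c) w)" by (rule linear_compose_neg)
    moreover have "B x = (\<lambda>w. - christoffel c (local_curve c x) (vel x c) w)" using True by (simp add: B_def fun_eq_iff)
    ultimately show ?thesis by (simp add: linear_conv_bounded_linear)
  next
    case False
    then have "B x = (\<lambda>w. 0)" by (auto simp: B_def)
    then show ?thesis by simp
  qed
  then have B: "blinfun_apply (Blinfun (B x)) = B x" for x by (rule bounded_linear_Blinfun_apply)
  have cont: "continuous_on {a..b} (\<lambda>x. Blinfun (B x))"
  proof (rule continuous_on_blinfun_componentwise)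
    fix i :: "real ^ 'n"
    have "continuous_on {a..b} (\<lambda>x. - christoffel c (local_curve c x) (vel x c) i)"
      by (intro continuous_intros continuous_on_subset[OF smooth_on_continuous[OF christoffel_along_smooth[OF c]] ab(4)])
    then have "continuous_on {a..b} (\<lambda>x. B x i)" by (rule continuous_on_eq) (simp add: B_def)
    then show "continuous_on {a..b} (\<lambda>x. blinfun_apply (Blinfun (B x)) i)" by (simp add: B)
  qed
  obtain y where y: "y a = v c" "\<And>x. x \<in> {a..b} \<Longrightarrow> (y has_vector_derivative B x (y x)) (at x within {a..b})"
    using linear_ode_exists[OF ab(2) cont, of "v c"] by (auto simp: B)
  define \<xi> where "\<xi> x = const_field A c (y x) (\<gamma> x)" for x
  have a: "a \<in> {a..b}" using ab by simp
  have tan: "\<xi> x \<in> tangent_space A (\<gamma> x)" if "x \<in> {a..b}" for x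
    unfolding \<xi>_def by (rule const_field_tangent[OF c times(2)[OF that]])
  have comp: "\<xi> x c = y x" if "x \<in> {a..b}" for x
    unfolding \<xi>_def by (rule const_field_self[OF c times(2)[OF that]])
  have dc: "((\<lambda>y. \<xi> y c) has_vector_derivative - christoffel c (local_curve c x) (vel x c) (\<xi> x c)) (at x within {a..b})"
    if x: "x \<in> {a..b}" for x
    by (rule has_vector_derivative_transform[OF x comp]) (use y(2)[OF x] x in \<open>simp_all add: comp B_def\<close>)
  have "((\<lambda>y. \<xi> y d) has_vector_derivative - christoffel d (local_curve d x) (vel x d) (\<xi> x d)) (at x within {a..b})"
    if x: "x \<in> {a..b}" and d: "d \<in> A" "\<gamma> x \<in> chart_dom d" for x d
  proof -
    note cx = times(2)[OF x] and x01 = times(3)[OF x]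
    note V = chart_openin[OF c] cx and f = const_field_vector_field[OF c]
    let ?\<xi>' = "- christoffel c (local_curve c x) (vel x c) (\<xi> x c)"
    let ?E = "const_field A c (\<xi> x c)"
    have sub: "{a..b} \<subseteq> {0..1}" using ab by auto
    have "nab (\<gamma> x) (vel x) ?E + const_field A c ?\<xi>' (\<gamma> x) = 0"
      by (rule tangent_eqI[OF c cx])
        (simp_all add: nab_velocity_in_chart[OF c times(1)[OF x]] const_field_self[OF c cx]
          subspace_add[OF tangent_space_subspace] subspace_0[OF tangent_space_subspace]
          nab_tangent[OF V velocity_tangent[OF x01] f] const_field_tangent[OF c cx])
    then have "(nab (\<gamma> x) (vel x) ?E + const_field A c ?\<xi>' (\<gamma> x)) d = 0" by simp
    moreover have "nab (\<gamma> x) (vel x) ?E d = frechet_derivative (\<lambda>z. ?E (chart_inv d z) d) (at (local_curve d x)) (vel x d)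
        + christoffel d (local_curve d x) (vel x d) (\<xi> x d)"
      using nab_in_chart[OF V d velocity_tangent[OF x01] f, of "\<xi> x c", folded local_curve_def]
      unfolding tangent_eq_const_field[OF c cx tan[OF x], symmetric] .
    ultimately have "frechet_derivative (\<lambda>z. ?E (chart_inv d z) d) (at (local_curve d x)) (vel x d) + const_field A c ?\<xi>' (\<gamma> x) d
        = - christoffel d (local_curve d x) (vel x d) (\<xi> x d)" by (simp add: algebra_simps eq_neg_iff_add_eq_0)
    then show ?thesis using chart_change_derivative[OF sub x c d(1) cx d(2) tan dc[OF x]] by simp
  qed
  then have "parallel_on a b \<xi>" unfolding parallel_on_def using tan by blast
  moreover have "\<xi> a = v" unfolding \<xi>_def y(1) by (rule tangent_eq_const_field[OF c times(2)[OF a] v, symmetric])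
  ultimately show ?thesis by blast
qed

lemma parallel_exists:
  assumes v: "v \<in> tangent_space A (\<gamma> 0)"
  obtains \<xi> where "\<xi> 0 = v" "parallel_on 0 1 \<xi>"
proof -
  have "0 \<le> (0::real) \<and> (1::real) \<le> 1 \<longrightarrow> (\<forall>v\<in>tangent_space A (\<gamma> 0). \<exists>\<xi>. \<xi> 0 = v \<and> parallel_on 0 1 \<xi>)"
    using zero_le_one
  proof (induction rule: Bolzano[where P = "\<lambda>a b. 0 \<le> a \<and> b \<le> 1 \<longrightarrow> (\<forall>v\<in>tangent_space A (\<gamma> a). \<exists>\<xi>. \<xi> a = v \<and> parallel_on a b \<xi>)"])
    case (trans a b e)
    show ?case
    proof (intro impI ballI)
      fix v assume ae: "0 \<le> a \<and> e \<le> 1" and v: "v \<in> tangent_space A (\<gamma> a)"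
      obtain \<xi> where \<xi>: "\<xi> a = v" "parallel_on a b \<xi>" using trans ae v by force
      have "\<xi> b \<in> tangent_space A (\<gamma> b)" using \<xi>(2) trans(3) by (simp add: parallel_on_def)
      then obtain \<eta> where \<eta>: "\<eta> b = \<xi> b" "parallel_on b e \<eta>" using trans ae by force
      let ?\<zeta> = "\<lambda>x. if x \<le> b then \<xi> x else \<eta> x"
      have "((\<lambda>y. ?\<zeta> y c) has_vector_derivative - christoffel c (local_curve c x) (vel x c) (?\<zeta> x c)) (at x within {a..e})"
        if x: "x \<in> {a..e}" and c: "c \<in> A" "\<gamma> x \<in> chart_dom c" for x c
      proof -
        have "((\<lambda>y. if y \<le> b then \<xi> y c else \<eta> y c) has_vector_derivative
          (if x \<le> b then - christoffel c (local_curve c x) (vel x c) (\<xi> x c) else - christoffel c (local_curve c x) (vel x c) (\<eta> x c)))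
          (at x within {a..e})"
          using \<xi>(2) \<eta> x c trans(3,4) unfolding parallel_on_def
          by (intro has_vector_derivative_glue) auto
        then show ?thesis by (simp add: if_distrib[of "\<lambda>\<zeta>. \<zeta> c"] if_distrib cong: if_cong)
      qed
      moreover have "?\<zeta> x \<in> tangent_space A (\<gamma> x)" if "x \<in> {a..e}" for x
        using \<xi>(2) \<eta>(2) that by (simp add: parallel_on_def)
      ultimately have "parallel_on a e ?\<zeta>" unfolding parallel_on_def by blast
      then show "\<exists>\<xi>. \<xi> a = v \<and> parallel_on a e \<xi>" using \<xi>(1) trans(3) by (intro exI[of _ ?\<zeta>]) simp
    qed
  next
    case (local x)
    then have "\<gamma> x \<in> topspace M" using curve_in by simp
    then obtain c where c: "c \<in> A" "\<gamma> x \<in> chart_dom c" by (rule chart_exists)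
    have "x \<in> chart_times c" using local c by (simp add: chart_times_def)
    then obtain r where r: "r > 0" "ball x r \<inter> {0..1} \<subseteq> chart_times c"
      using chart_times_openin[OF c(1)] unfolding openin_contains_ball by blast
    show ?case
    proof (intro exI[of _ r] conjI allI impI ballI r(1))
      fix a b v assume ab: "a \<le> x \<and> x \<le> b \<and> b - a < r" "0 \<le> a \<and> b \<le> 1" and v: "v \<in> tangent_space A (\<gamma> a)"
      have "{a..b} \<subseteq> ball x r \<inter> {0..1}" using ab by (auto simp: dist_real_def)
      then have "{a..b} \<subseteq> chart_times c" using r by blast
      then show "\<exists>\<xi>. \<xi> a = v \<and> parallel_on a b \<xi>" using ab v by (intro parallel_exists_local[OF c(1)]) auto
    qed
  qed
  then show ?thesis using v that by blast
qed

lemma cov_deriv_parallel: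
  assumes "parallel_on 0 1 \<xi>" "x \<in> {0..1}" "c \<in> A" "\<gamma> x \<in> chart_dom c"
  shows "cov_deriv_along A nab \<gamma> \<xi> x = 0"
  using assms cov_deriv_along_eq[of x c \<xi> "- christoffel c (local_curve c x) (vel x c) (\<xi> x c)"]
  by (intro tangent_eqI[of c "\<gamma> x"]) (auto simp: parallel_on_def subspace_0[OF tangent_space_subspace])

text \<open>In the chart, the metric is a family of bilinear forms; its derivative along the curve is found by
  applying metricity of the connection to fields with constant components.\<close>

lemma metric_along_deriv:
  assumes x: "x \<in> {0..1}" and c: "c \<in> A" "\<gamma> x \<in> chart_dom c"
    and \<xi>: "\<And>y. y \<in> {0..1} \<Longrightarrow> \<xi> y \<in> tangent_space A (\<gamma> y)"
    and \<xi>': "((\<lambda>y. \<xi> y c) has_vector_derivative \<xi>') (at x within {0..1})"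
    and \<eta>: "\<And>y. y \<in> {0..1} \<Longrightarrow> \<eta> y \<in> tangent_space A (\<gamma> y)"
    and \<eta>': "((\<lambda>y. \<eta> y c) has_vector_derivative \<eta>') (at x within {0..1})"
  shows "((\<lambda>y. g (\<gamma> y) (\<xi> y) (\<eta> y)) has_vector_derivative
    g (\<gamma> x) (cov_deriv_along A nab \<gamma> \<xi> x) (\<eta> x) + g (\<gamma> x) (\<xi> x) (cov_deriv_along A nab \<gamma> \<eta> x)) (at x within {0..1})"
proof -
  let ?S = "chart_times c" and ?U = "chart_map c ` chart_dom c"
  note V = chart_openin[OF c(1)] c(2) and f = const_field_vector_field[OF c(1)]
  note t = const_field_tangent[OF c(1)]
  have xS: "x \<in> ?S" using x c by (simp add: chart_times_def)
  note at = at_within_chart_times[OF c(1) xS]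
  let ?met = "metric_coord c"
  define z where "z = local_curve c x"
  have zU: "z \<in> ?U" unfolding z_def by (rule local_curve_in[OF xS])
  note met_smooth = metric_coord_smooth[OF c(1)] and lin1 = metric_coord_linear(1)[OF c(1)]
    and lin2 = metric_coord_linear(2)[OF c(1)]
  define D where "D a b h = frechet_derivative (\<lambda>z. ?met z a b) (at z) (h *\<^sub>R vel x c)" for a b and h :: real
  have k: "(local_curve c has_derivative (\<lambda>h. h *\<^sub>R vel x c)) (at x within ?S)"
    using local_curve_deriv[OF c(1) xS] unfolding has_vector_derivative_def at .
  have D: "((\<lambda>y. ?met (local_curve c y) a b) has_derivative D a b) (at x within ?S)" for a b
    unfolding D_def z_def
    by (rule has_derivative_compose[OF k smooth_on_open_has_derivative[OF chart_open_image[OF c(1)] met_smooth zU[unfolded z_def]]])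
  have linD1: "linear (\<lambda>a. D a b h)" for b h unfolding D_def
    by (rule linear_frechet_derivative_family[where T = "\<lambda>z a. ?met z a b", OF chart_open_image[OF c(1)] zU lin1 met_smooth])
  have linD2: "linear (\<lambda>b. D a b h)" for a h unfolding D_def
    by (rule linear_frechet_derivative_family[where T = "\<lambda>z b. ?met z a b", OF chart_open_image[OF c(1)] zU lin2 met_smooth])
  have d\<xi>: "((\<lambda>y. \<xi> y c) has_derivative (\<lambda>h. h *\<^sub>R \<xi>')) (at x within ?S)"
    and d\<eta>: "((\<lambda>y. \<eta> y c) has_derivative (\<lambda>h. h *\<^sub>R \<eta>')) (at x within ?S)"
    using \<xi>' \<eta>' unfolding has_vector_derivative_def at .
  have 1: "((\<lambda>y. ?met (local_curve c y) a (\<eta> y c)) has_derivative (\<lambda>h. D a (\<eta> x c) h + ?met z a (h *\<^sub>R \<eta>'))) (at x within ?S)" for a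
    unfolding z_def
    by (rule has_derivative_linear_family[where T = "\<lambda>y b. ?met (local_curve c y) a b", OF xS lin2[OF local_curve_in] D linD2 d\<eta>])
  have 2: "((\<lambda>y. ?met (local_curve c y) (\<xi> y c) (\<eta> y c)) has_derivative
      (\<lambda>h. (D (\<xi> x c) (\<eta> x c) h + ?met z (\<xi> x c) (h *\<^sub>R \<eta>')) + ?met z (h *\<^sub>R \<xi>') (\<eta> x c))) (at x within ?S)"
    unfolding z_def
  proof (rule has_derivative_linear_family[where T = "\<lambda>y a. ?met (local_curve c y) a (\<eta> y c)", OF xS lin1[OF local_curve_in] 1[unfolded z_def] _ d\<xi>])
    show "linear (\<lambda>v. D v (\<eta> x c) h + ?met (local_curve c x) v (h *\<^sub>R \<eta>'))" for h
      by (intro linear_compose_add linD1 lin1 local_curve_in xS)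
  qed
  have eq: "g (\<gamma> y) (\<xi> y) (\<eta> y) = ?met (local_curve c y) (\<xi> y c) (\<eta> y c)" if y: "y \<in> ?S" for y
    using metric_eq_metric_coord[OF c(1) _ \<xi> \<eta>, of y] y by (simp add: chart_times_def local_curve_def)
  let ?w = "D (\<xi> x c) (\<eta> x c) 1 + ?met z (\<xi> x c) \<eta>' + ?met z \<xi>' (\<eta> x c)"
  have "(D (\<xi> x c) (\<eta> x c) h + ?met z (\<xi> x c) (h *\<^sub>R \<eta>')) + ?met z (h *\<^sub>R \<xi>') (\<eta> x c) = h *\<^sub>R ?w" for h
    using linear_scale[OF lin1[OF zU]] linear_scale[OF lin2[OF zU]]
      linear_scale[OF has_derivative_linear[OF smooth_on_open_has_derivative[OF chart_open_image[OF c(1)] met_smooth zU]]]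
    by (simp add: D_def algebra_simps)
  then have "((\<lambda>y. ?met (local_curve c y) (\<xi> y c) (\<eta> y c)) has_vector_derivative ?w) (at x within ?S)"
    using 2 by (simp add: has_vector_derivative_def)
  then have "((\<lambda>y. g (\<gamma> y) (\<xi> y) (\<eta> y)) has_vector_derivative ?w) (at x within ?S)"
    by (rule has_vector_derivative_transform[OF xS eq, rotated])
  moreover have "?w = g (\<gamma> x) (cov_deriv_along A nab \<gamma> \<xi> x) (\<eta> x) + g (\<gamma> x) (\<xi> x) (cov_deriv_along A nab \<gamma> \<eta> x)"
  proof -
    note xi = tangent_eq_const_field[OF c \<xi>[OF x], symmetric] and eta = tangent_eq_const_field[OF c \<eta>[OF x], symmetric]
    note inv = chart_inv_local_curve[OF c(1) xS, folded z_def]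
    note M = curve_in[OF x] and nt = nab_tangent[OF V velocity_tangent[OF x] f] and ct = const_field_tangent[OF c]
    have "dir_deriv c (\<gamma> x) (vel x) (\<lambda>q. g q (const_field A c (\<xi> x c) q) (const_field A c (\<eta> x c) q)) =
      g (\<gamma> x) (nab (\<gamma> x) (vel x) (const_field A c (\<xi> x c))) (const_field A c (\<eta> x c) (\<gamma> x))
      + g (\<gamma> x) (const_field A c (\<xi> x c) (\<gamma> x)) (nab (\<gamma> x) (vel x) (const_field A c (\<eta> x c)))"
      by (rule nab_metric[OF V velocity_tangent[OF x] f f c])
    then have "D (\<xi> x c) (\<eta> x c) 1 = g (\<gamma> x) (nab (\<gamma> x) (vel x) (const_field A c (\<xi> x c))) (\<eta> x)
      + g (\<gamma> x) (\<xi> x) (nab (\<gamma> x) (vel x) (const_field A c (\<eta> x c)))"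
      unfolding xi eta by (simp add: D_def dir_deriv_def o_def metric_coord_def z_def local_curve_def)
    moreover have "cov_deriv_along A nab \<gamma> \<xi> x = nab (\<gamma> x) (vel x) (const_field A c (\<xi> x c)) + const_field A c \<xi>' (\<gamma> x)"
      by (rule cov_deriv_along_eq(1)[OF x c \<xi> \<xi>'])
    moreover have "cov_deriv_along A nab \<gamma> \<eta> x = nab (\<gamma> x) (vel x) (const_field A c (\<eta> x c)) + const_field A c \<eta>' (\<gamma> x)"
      by (rule cov_deriv_along_eq(1)[OF x c \<eta> \<eta>'])
    moreover have "?met z (\<xi> x c) \<eta>' = g (\<gamma> x) (\<xi> x) (const_field A c \<eta>' (\<gamma> x))"
      "?met z \<xi>' (\<eta> x c) = g (\<gamma> x) (const_field A c \<xi>' (\<gamma> x)) (\<eta> x)"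
      by (simp_all add: metric_coord_def inv xi eta)
    ultimately show ?thesis
      by (simp only: metric_add_left[OF M nt ct \<eta>[OF x]] metric_add_right[OF M nt ct \<xi>[OF x]])
  qed
  ultimately show ?thesis unfolding at by simp
qed

lemma smooth_on_parallel:
  assumes \<xi>: "parallel_on 0 1 \<xi>" and c: "c \<in> A"
  shows "smooth_on (chart_times c) (\<lambda>x. \<xi> x c)"
proof (rule smooth_on_linear_ode[where T = "\<lambda>x w. - christoffel c (local_curve c x) (vel x c) w", OF thick_chart_times[OF c]])
  show "linear (\<lambda>w. - christoffel c (local_curve c x) (vel x c) w)" if "x \<in> chart_times c" for x
    by (rule linear_compose_neg[OF christoffel_linear(2)[OF c local_curve_in[OF that]]])
  show "smooth_on (chart_times c) (\<lambda>x. - christoffel c (local_curve c x) (vel x c) v)" for v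
    by (rule smooth_on_bounded_linear[OF thick_chart_times[OF c] bounded_linear_minus[OF bounded_linear_ident] christoffel_along_smooth[OF c]])
  show "((\<lambda>x. \<xi> x c) has_vector_derivative - christoffel c (local_curve c x) (vel x c) (\<xi> x c)) (at x within chart_times c)"
    if x: "x \<in> chart_times c" for x
    using \<xi> x c unfolding at_within_chart_times[OF c x] parallel_on_def chart_times_iff by blast
qed

end

text \<open>Gram--Schmidt: as long as an index is missing, the vectors found so far do not span the space.\<close>

lemma orthonormal_family_exists:
  fixes b :: "real ^ 'n \<Rightarrow> real ^ 'n \<Rightarrow> real"
  assumes lin: "\<And>w. linear (\<lambda>v. b v w)" and sym: "\<And>v w. b v w = b w v" and pos: "\<And>v. v \<noteq> 0 \<Longrightarrow> b v v > 0"
  obtains E :: "'n \<Rightarrow> real ^ 'n" where "\<And>i j. b (E i) (E j) = (if i = j then 1 else 0)"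
proof -
  have lin2: "linear (b v)" for v
  proof -
    have "b v = (\<lambda>w. b w v)" using sym by (intro ext)
    then show ?thesis using lin[of v] by (simp only:)
  qed
  have "\<exists>E :: 'n \<Rightarrow> real ^ 'n. \<forall>i\<in>I. \<forall>j\<in>I. b (E i) (E j) = (if i = j then 1 else 0)" for I :: "'n set"
    using finite[of I]
  proof (induction I rule: finite_induct)
    case empty
    then show ?case by simp
  next
    case (insert k I)
    then obtain E :: "'n \<Rightarrow> real ^ 'n" where E: "\<And>i j. i \<in> I \<Longrightarrow> j \<in> I \<Longrightarrow> b (E i) (E j) = (if i = j then 1 else 0)" by blast
    have "span (E ` I) \<noteq> UNIV"
    proof
      assume "span (E ` I) = UNIV"
      then have "CARD('n) \<le> card (E ` I)"
        using dim_le_card[of "UNIV :: (real ^ 'n) set" "E ` I"] insert.hyps by simp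
      also have "\<dots> \<le> card I" by (rule card_image_le[OF insert.hyps(1)])
      also have "\<dots> < CARD('n)" using insert.hyps by (intro psubset_card_mono) auto
      finally show False by simp
    qed
    then obtain w where w: "w \<notin> span (E ` I)" by blast
    define v where "v = w - (\<Sum>i\<in>I. b w (E i) *\<^sub>R E i)"
    have "(\<Sum>i\<in>I. b w (E i) *\<^sub>R E i) \<in> span (E ` I)" by (intro span_sum span_scale span_base) auto
    then have "v \<noteq> 0" using w by (auto simp: v_def)
    then have bv: "b v v > 0" by (rule pos)
    have vE: "b v (E j) = 0" if j: "j \<in> I" for j
    proof -
      have "b v (E j) = b w (E j) - (\<Sum>i\<in>I. b w (E i) * b (E i) (E j))"
        unfolding v_def by (simp add: linear_diff[OF lin] linear_sum[OF lin] linear_scale[OF lin])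
      also have "(\<Sum>i\<in>I. b w (E i) * b (E i) (E j)) = (\<Sum>i\<in>I. if i = j then b w (E j) else 0)"
        using E j by (intro sum.cong) auto
      finally show ?thesis using j insert.hyps by simp
    qed
    define e where "e = (1 / sqrt (b v v)) *\<^sub>R v"
    have "b e e = 1" using bv by (simp add: e_def linear_scale[OF lin] linear_scale[OF lin2])
    moreover have "b e (E j) = 0" "b (E j) e = 0" if "j \<in> I" for j
      using vE[OF that] sym[of "E j" e] by (simp_all add: e_def linear_scale[OF lin])
    ultimately show ?case
      using E insert.hyps by (intro exI[of _ "E(k := e)"]) auto
  qed
  from this[of UNIV] show ?thesis using that by auto
qed

context curve_in_manifold
begin

lemma metric_zero_left:
  "p \<in> topspace M \<Longrightarrow> v \<in> tangent_space A p \<Longrightarrow> g p 0 v = 0"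
  using metric_scale_left[of p v v 0] by simp

lemma metric_zero_right:
  "p \<in> topspace M \<Longrightarrow> v \<in> tangent_space A p \<Longrightarrow> g p v 0 = 0"
  using metric_zero_left metric_sym[OF _ _ subspace_0[OF tangent_space_subspace], of p v] by simp

text \<open>By metricity the inner products of parallel fields are constant, so that parallel transport of an
  orthonormal basis at \<open>\<gamma> 0\<close> gives one at every point.\<close>

theorem parallel_frame_exists:
  obtains E :: "'n \<Rightarrow> real \<Rightarrow> ('a, 'n) tvec"
  where "\<And>i. parallel_on 0 1 (E i)"
    and "\<And>x i j. x \<in> {0..1} \<Longrightarrow> g (\<gamma> x) (E i x) (E j x) = (if i = j then 1 else 0)"
proof -
  have M: "\<gamma> 0 \<in> topspace M" by (rule curve_in) simp
  obtain c where c: "c \<in> A" "\<gamma> 0 \<in> chart_dom c" using chart_exists[OF M] .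
  note t = const_field_tangent[OF c]
  let ?z = "chart_map c (\<gamma> 0)"
  have z: "?z \<in> chart_map c ` chart_dom c" using c by simp
  have sym: "metric_coord c ?z v w = metric_coord c ?z w v" for v w
    unfolding metric_coord_def chart_inv_chart_map[OF c] by (rule metric_sym[OF M t t])
  have pos: "metric_coord c ?z v v > 0" if "v \<noteq> 0" for v
    unfolding metric_coord_def chart_inv_chart_map[OF c]
  proof (rule metric_pos[OF M t])
    show "const_field A c v (\<gamma> 0) \<noteq> 0"
      using const_field_self[OF c, of v] that by auto
  qed
  obtain B :: "'n \<Rightarrow> real ^ 'n" where B: "\<And>i j. metric_coord c ?z (B i) (B j) = (if i = j then 1 else 0)"
    using orthonormal_family_exists[OF metric_coord_linear(1)[OF c(1) z] sym pos] by metis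
  have "\<exists>\<xi>. \<xi> 0 = const_field A c (B i) (\<gamma> 0) \<and> parallel_on 0 1 \<xi>" for i
    using parallel_exists[OF t] by blast
  then obtain E where E: "\<And>i. E i 0 = const_field A c (B i) (\<gamma> 0)" "\<And>i. parallel_on 0 1 (E i)" by metis
  have tan: "E i y \<in> tangent_space A (\<gamma> y)" if "y \<in> {0..1}" for i y
    using E(2)[of i] that by (simp add: parallel_on_def)
  have "g (\<gamma> x) (E i x) (E j x) = (if i = j then 1 else 0)" if x: "x \<in> {0..1}" for x i j
  proof -
    let ?f = "\<lambda>y. g (\<gamma> y) (E i y) (E j y)"
    have "(?f has_vector_derivative 0) (at y within {0..1})" if y: "y \<in> {0..1}" for y
    proof -
      obtain d where d: "d \<in> A" "\<gamma> y \<in> chart_dom d" using chart_exists[OF curve_in[OF y]] .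
      have der: "((\<lambda>y. E k y d) has_vector_derivative - christoffel d (local_curve d y) (vel y d) (E k y d)) (at y within {0..1})" for k
        using E(2)[of k] y d unfolding parallel_on_def by blast
      have "(?f has_vector_derivative g (\<gamma> y) (cov_deriv_along A nab \<gamma> (E i) y) (E j y) + g (\<gamma> y) (E i y) (cov_deriv_along A nab \<gamma> (E j) y)) (at y within {0..1})"
        by (rule metric_along_deriv[of y d "E i" _ "E j", OF y d tan der tan der])
      then show ?thesis
        by (simp add: cov_deriv_parallel[OF E(2) y d] metric_zero_left[OF curve_in[OF y] tan[OF y]]
          metric_zero_right[OF curve_in[OF y] tan[OF y]])
    qed
    then obtain r where r: "\<And>y. y \<in> {0..1} \<Longrightarrow> ?f y = r"
      using has_vector_derivative_zero_constant[of "{0..1}" ?f] by auto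
    have "?f x = ?f 0" using r[OF x] r[of 0] by simp
    also have "\<dots> = (if i = j then 1 else 0)"
      using B[of i j] by (simp add: E(1) metric_coord_def chart_inv_chart_map[OF c])
    finally show ?thesis .
  qed
  then show ?thesis using that E(2) by blast
qed

end

section \<open>Fields along the curve in a parallel orthonormal frame\<close>

lemma sum_fun_apply: "(\<Sum>i\<in>I. f i) x = (\<Sum>i\<in>I. f i x)"
  by (induction I rule: infinite_finite_induct) auto

locale parallel_frame = curve_in_manifold M A g nab \<gamma>
  for M :: "'a topology" and A :: "('a, 'n::finite) chart set"
    and g :: "'a \<Rightarrow> ('a, 'n) tvec \<Rightarrow> ('a, 'n) tvec \<Rightarrow> real"
    and nab :: "'a \<Rightarrow> ('a, 'n) tvec \<Rightarrow> ('a \<Rightarrow> ('a, 'n) tvec) \<Rightarrow> ('a, 'n) tvec"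
    and \<gamma> :: "real \<Rightarrow> 'a" +
  fixes E :: "'n \<Rightarrow> real \<Rightarrow> ('a, 'n) tvec"
  assumes E_parallel: "parallel_on 0 1 (E i)"
    and E_orth: "x \<in> {0..1} \<Longrightarrow> g (\<gamma> x) (E i x) (E j x) = (if i = j then 1 else 0)"
begin

definition frame :: "real \<Rightarrow> real ^ 'n \<Rightarrow> ('a, 'n) tvec" where
  "frame x a = (\<Sum>i\<in>UNIV. (a $ i) *\<^sub>R E i x)"

definition coords :: "real \<Rightarrow> ('a, 'n) tvec \<Rightarrow> real ^ 'n" where
  "coords x v = (\<chi> i. g (\<gamma> x) v (E i x))"

definition field_of :: "(real \<Rightarrow> real ^ 'n) \<Rightarrow> real \<Rightarrow> ('a, 'n) tvec" where
  "field_of f x = (if x \<in> {0..1} then frame x (f x) else 0)"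

lemma E_tangent: "x \<in> {0..1} \<Longrightarrow> E i x \<in> tangent_space A (\<gamma> x)"
  using E_parallel[of i] by (simp add: parallel_on_def)

lemma frame_tangent: "x \<in> {0..1} \<Longrightarrow> frame x a \<in> tangent_space A (\<gamma> x)"
  unfolding frame_def
  by (intro subspace_sum[OF tangent_space_subspace] subspace_scale[OF tangent_space_subspace] E_tangent)

lemma frame_component: "frame x a c = (\<Sum>i\<in>UNIV. (a $ i) *\<^sub>R E i x c)"
  by (simp add: frame_def sum_fun_apply scaleR_fun_def)

lemma frame_linear: "frame x (r *\<^sub>R a + s *\<^sub>R b) = r *\<^sub>R frame x a + s *\<^sub>R frame x b"
  unfolding frame_def scaleR_sum_right sum.distrib[symmetric]
  by (intro sum.cong refl) (simp add: scaleR_add_left)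

lemma frame_zero: "frame x 0 = 0"
  using frame_linear[of x 0 0 0 0] by simp

lemma metric_sum_left:
  assumes p: "p \<in> topspace M" and v: "v \<in> tangent_space A p" and f: "\<And>i. i \<in> I \<Longrightarrow> f i \<in> tangent_space A p"
  shows "g p (\<Sum>i\<in>I. f i) v = (\<Sum>i\<in>I. g p (f i) v)"
  using f
proof (induction I rule: infinite_finite_induct)
  case (insert i I)
  then show ?case
    unfolding sum.insert[OF insert.hyps]
    by (subst metric_add_left[OF p _ subspace_sum[OF tangent_space_subspace] v]) auto
qed (use metric_zero_left[OF p v] in auto)

lemma metric_frame_left:
  assumes x: "x \<in> {0..1}" and v: "v \<in> tangent_space A (\<gamma> x)"
  shows "g (\<gamma> x) (frame x a) v = (\<Sum>i\<in>UNIV. a $ i * g (\<gamma> x) (E i x) v)"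
  unfolding frame_def
  by (subst metric_sum_left[OF curve_in[OF x] v])
    (simp_all add: subspace_scale[OF tangent_space_subspace E_tangent[OF x]] metric_scale_left[OF curve_in[OF x] E_tangent[OF x] v])

lemma coords_frame:
  assumes x: "x \<in> {0..1}"
  shows "coords x (frame x a) = a"
  unfolding vec_eq_iff coords_def
  by (simp add: metric_frame_left[OF x E_tangent[OF x]] E_orth[OF x] if_distrib cong: if_cong)

lemma coords_zero: "x \<in> {0..1} \<Longrightarrow> coords x 0 = 0"
  by (simp add: coords_def vec_eq_iff metric_zero_left[OF curve_in E_tangent])

lemma coords_linear:
  assumes x: "x \<in> {0..1}" and "u \<in> tangent_space A (\<gamma> x)" "v \<in> tangent_space A (\<gamma> x)"
  shows "coords x (r *\<^sub>R u + s *\<^sub>R v) = r *\<^sub>R coords x u + s *\<^sub>R coords x v"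
  by (simp add: coords_def vec_eq_iff metric_linear[OF curve_in[OF x] assms(2,3) E_tangent[OF x]])

lemma frame_coords:
  assumes x: "x \<in> {0..1}" and v: "v \<in> tangent_space A (\<gamma> x)"
  shows "frame x (coords x v) = v"
proof -
  obtain c where c: "c \<in> A" "\<gamma> x \<in> chart_dom c" using chart_exists[OF curve_in[OF x]] .
  have lin: "linear (\<lambda>a. frame x a c)"
    using frame_linear[of x 1 _ 1] frame_linear[of x _ _ 0 0]
    by (intro linearI) (simp_all add: scaleR_fun_def)
  have "a = 0" if "frame x a c = 0" for a
  proof -
    have "frame x a = 0"
      by (rule tangent_eqI[OF c frame_tangent[OF x] subspace_0[OF tangent_space_subspace]]) (simp add: that)
    then show ?thesis using coords_frame[OF x, of a] coords_zero[OF x] by simp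
  qed
  then have "inj (\<lambda>a. frame x a c)" using linear_injective_0[OF lin] by blast
  then have "surj (\<lambda>a. frame x a c)" by (intro linear_injective_imp_surjective lin) simp_all
  then obtain a where a: "v c = frame x a c" by (metis surjD)
  have "v = frame x a" by (rule tangent_eqI[OF c v frame_tangent[OF x] a])
  then show ?thesis by (simp add: coords_frame[OF x])
qed

lemma coords_inner:
  assumes x: "x \<in> {0..1}" and v: "v \<in> tangent_space A (\<gamma> x)"
  shows "coords x v \<bullet> b = g (\<gamma> x) v (frame x b)"
proof -
  have "g (\<gamma> x) v (frame x b) = g (\<gamma> x) (frame x b) v"
    by (rule metric_sym[OF curve_in[OF x] v frame_tangent[OF x]])
  also have "\<dots> = (\<Sum>i\<in>UNIV. b $ i * g (\<gamma> x) (E i x) v)" by (rule metric_frame_left[OF x v])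
  also have "\<dots> = (\<Sum>i\<in>UNIV. coords x v $ i * b $ i)"
    unfolding coords_def
    by (intro sum.cong refl) (simp add: metric_sym[OF curve_in[OF x] E_tangent[OF x] v])
  finally show ?thesis by (simp add: inner_vec_def)
qed

lemma metric_frame:
  assumes x: "x \<in> {0..1}"
  shows "g (\<gamma> x) (frame x a) (frame x b) = a \<bullet> b"
  using coords_inner[OF x frame_tangent[OF x], of a b] by (simp add: coords_frame[OF x])

lemma coords_sum: "coords x v = (\<Sum>i\<in>UNIV. g (\<gamma> x) v (E i x) *\<^sub>R axis i 1)"
  by (simp add: coords_def vec_eq_iff sum_component axis_def if_distrib cong: if_cong)

lemma field_of_fields_along: "field_of f \<in> fields_along A \<gamma>"
  unfolding fields_along_def field_of_def using frame_tangent by auto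

lemma field_of_coords:
  assumes "\<xi> \<in> fields_along A \<gamma>"
  shows "field_of (\<lambda>x. coords x (\<xi> x)) = \<xi>"
proof (rule ext)
  fix x show "field_of (\<lambda>x. coords x (\<xi> x)) x = \<xi> x"
    using assms frame_coords[of x "\<xi> x"] by (auto simp: field_of_def fields_along_def)
qed

lemma frame_deriv:
  assumes x: "x \<in> {0..1}" and f: "(f has_vector_derivative f') (at x within {0..1})"
    and c: "c \<in> A" "\<gamma> x \<in> chart_dom c"
  shows "((\<lambda>y. frame y (f y) c) has_vector_derivative
    (frame x f' c - christoffel c (local_curve c x) (vel x c) (frame x (f x) c))) (at x within {0..1})"
proof -
  let ?G = "christoffel c (local_curve c x) (vel x c)"
  have lin: "linear ?G"
    using x c by (intro christoffel_linear(2) local_curve_in) (simp_all add: chart_times_def)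
  have "((\<lambda>y. \<Sum>i\<in>UNIV. (f y $ i) *\<^sub>R E i y c) has_vector_derivative
      (\<Sum>i\<in>UNIV. (f x $ i) *\<^sub>R (- ?G (E i x c)) + (f' $ i) *\<^sub>R E i x c)) (at x within {0..1})"
  proof (intro has_vector_derivative_sum has_vector_derivative_scaleR)
    fix i
    show "((\<lambda>y. f y $ i) has_real_derivative f' $ i) (at x within {0..1})"
      unfolding has_real_derivative_iff_has_vector_derivative
      by (rule bounded_linear.has_vector_derivative[OF bounded_linear_vec_nth f])
    show "((\<lambda>y. E i y c) has_vector_derivative - ?G (E i x c)) (at x within {0..1})"
      using E_parallel[of i] x c unfolding parallel_on_def by blast
  qed
  moreover have "(\<Sum>i\<in>UNIV. (f x $ i) *\<^sub>R (- ?G (E i x c)) + (f' $ i) *\<^sub>R E i x c) = frame x f' c - ?G (frame x (f x) c)"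
    by (simp add: frame_component linear_sum[OF lin] linear_scale[OF lin] sum.distrib sum_negf sum_subtractf)
  ultimately show ?thesis by (simp add: frame_component)
qed

lemma field_of_deriv:
  assumes x: "x \<in> {0..1}" and f: "(f has_vector_derivative f') (at x within {0..1})"
    and c: "c \<in> A" "\<gamma> x \<in> chart_dom c"
  shows "((\<lambda>y. field_of f y c) has_vector_derivative
    (frame x f' c - christoffel c (local_curve c x) (vel x c) (frame x (f x) c))) (at x within {0..1})"
  by (rule has_vector_derivative_transform[OF x _ frame_deriv[OF assms]]) (simp add: field_of_def)

text \<open>The derivatives of the frame vectors cancel against the Christoffel symbols, which leaves the derivatives
  of the coefficients.\<close>

lemma cov_deriv_field_of:
  assumes x: "x \<in> {0..1}" and f: "(f has_vector_derivative f') (at x within {0..1})"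
  shows "cov_deriv_along A nab \<gamma> (field_of f) x = frame x f'"
proof -
  obtain c where c: "c \<in> A" "\<gamma> x \<in> chart_dom c" using chart_exists[OF curve_in[OF x]] .
  have tan: "\<And>y. y \<in> {0..1} \<Longrightarrow> field_of f y \<in> tangent_space A (\<gamma> y)"
    by (simp add: field_of_def frame_tangent)
  note eq = cov_deriv_along_eq[of x c "field_of f", OF x c tan field_of_deriv[OF x f c]]
  have "field_of f x = frame x (f x)" using x by (simp add: field_of_def)
  then have "cov_deriv_along A nab \<gamma> (field_of f) x c = frame x f' c" using eq(3) by simp
  from tangent_eqI[OF c eq(2) frame_tangent[OF x] this] show ?thesis .
qed

text \<open>The converse direction, for fields not known to arise from differentiable coordinates: the \<open>i\<close>-th
  coordinate is \<open>g(\<xi>, E\<^sub>i)\<close>, and \<open>E\<^sub>i\<close> is parallel.\<close>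

lemma coords_deriv:
  assumes x: "x \<in> {0..1}" and c: "c \<in> A" "\<gamma> x \<in> chart_dom c"
    and \<xi>: "\<And>y. y \<in> {0..1} \<Longrightarrow> \<xi> y \<in> tangent_space A (\<gamma> y)"
    and \<xi>': "((\<lambda>y. \<xi> y c) has_vector_derivative \<xi>') (at x within {0..1})"
  shows "((\<lambda>y. coords y (\<xi> y)) has_vector_derivative coords x (cov_deriv_along A nab \<gamma> \<xi> x)) (at x within {0..1})"
  unfolding coords_sum
proof (intro has_vector_derivative_sum)
  fix i
  have "((\<lambda>y. E i y c) has_vector_derivative - christoffel c (local_curve c x) (vel x c) (E i x c)) (at x within {0..1})"
    using E_parallel[of i] x c unfolding parallel_on_def by blast
  from metric_along_deriv[of x c \<xi> \<xi>' "E i", OF x c \<xi> \<xi>' E_tangent this]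
  have "((\<lambda>y. g (\<gamma> y) (\<xi> y) (E i y)) has_vector_derivative g (\<gamma> x) (cov_deriv_along A nab \<gamma> \<xi> x) (E i x)) (at x within {0..1})"
    by (simp add: cov_deriv_parallel[OF E_parallel x c] metric_zero_right[OF curve_in[OF x] \<xi>[OF x]])
  then have "((\<lambda>y. g (\<gamma> y) (\<xi> y) (E i y)) has_real_derivative g (\<gamma> x) (cov_deriv_along A nab \<gamma> \<xi> x) (E i x)) (at x within {0..1})"
    by (simp add: has_real_derivative_iff_has_vector_derivative)
  from has_vector_derivative_scaleR[OF this has_vector_derivative_const[of "axis i 1"]]
  show "((\<lambda>y. g (\<gamma> y) (\<xi> y) (E i y) *\<^sub>R axis i 1) has_vector_derivative
      g (\<gamma> x) (cov_deriv_along A nab \<gamma> \<xi> x) (E i x) *\<^sub>R axis i 1) (at x within {0..1})" by simp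
qed

text \<open>The value off the unit interval is chosen so that all \<open>curv_op x\<close> are linear.\<close>

definition curv_op :: "real \<Rightarrow> real ^ 'n \<Rightarrow> real ^ 'n" where
  "curv_op x a = (if x \<in> {0..1} then coords x (curvature A nab (\<gamma> x) (vel x) (frame x a) (vel x)) else 0)"

lemma curvature_tangent:
  assumes x: "x \<in> {0..1}" and u: "u \<in> tangent_space A (\<gamma> x)"
  shows "curvature A nab (\<gamma> x) (vel x) u (vel x) \<in> tangent_space A (\<gamma> x)"
proof -
  obtain c where c: "c \<in> A" "\<gamma> x \<in> chart_dom c" using chart_exists[OF curve_in[OF x]] .
  show ?thesis by (rule curvature_eq_curv_field(2)[OF c velocity_tangent[OF x] u velocity_tangent[OF x]])
qed

lemma curv_op_linear: "linear (curv_op x)"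
proof (cases "x \<in> {0..1}")
  case x: True
  obtain c where c: "c \<in> A" "\<gamma> x \<in> chart_dom c" using chart_exists[OF curve_in[OF x]] .
  let ?R = "\<lambda>u. curvature A nab (\<gamma> x) (vel x) u (vel x)"
  have z: "chart_map c (\<gamma> x) \<in> chart_map c ` chart_dom c" using c by simp
  note T = subspace_add[OF tangent_space_subspace] subspace_scale[OF tangent_space_subspace]
  have R: "?R (r *\<^sub>R u + s *\<^sub>R v) = r *\<^sub>R ?R u + s *\<^sub>R ?R v"
    if "u \<in> tangent_space A (\<gamma> x)" "v \<in> tangent_space A (\<gamma> x)" for r s u v
  proof (rule tangent_eqI[OF c])
    show "?R (r *\<^sub>R u + s *\<^sub>R v) c = (r *\<^sub>R ?R u + s *\<^sub>R ?R v) c"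
      by (simp add: curvature_in_chart[OF c] scaleR_fun_def linear_add[OF curv_coord_linear(2)[OF c(1) z]]
          linear_scale[OF curv_coord_linear(2)[OF c(1) z]])
  qed (intro curvature_tangent x T that)+
  have "curv_op x (r *\<^sub>R a + s *\<^sub>R b) = r *\<^sub>R curv_op x a + s *\<^sub>R curv_op x b" for r s a b
    using x by (simp add: curv_op_def frame_linear R[OF frame_tangent[OF x] frame_tangent[OF x]]
      coords_linear[OF x curvature_tangent[OF x frame_tangent[OF x]] curvature_tangent[OF x frame_tangent[OF x]]])
  from this[of 1 _ 1] this[of _ _ 0 0] show ?thesis by (intro linearI) simp_all
next
  case False
  then have "curv_op x = (\<lambda>a. 0)" by (auto simp: curv_op_def)
  then show ?thesis by (simp add: linear_zero)
qed

lemma curv_op_inner: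
  assumes x: "x \<in> {0..1}"
  shows "curv_op x a \<bullet> b = g (\<gamma> x) (curvature A nab (\<gamma> x) (vel x) (frame x a) (vel x)) (frame x b)"
  using x by (simp add: curv_op_def coords_inner[OF x curvature_tangent[OF x frame_tangent[OF x]]])

lemma curv_op_symmetric:
  assumes x: "x \<in> {0..1}"
  shows "curv_op x a \<bullet> b = a \<bullet> curv_op x b"
  unfolding curv_op_inner[OF x] inner_commute[of a]
  by (rule curvature_symmetric[OF curve_in[OF x] velocity_tangent[OF x] frame_tangent[OF x] frame_tangent[OF x]])

lemma frame_smooth:
  assumes c: "c \<in> A"
  shows "smooth_on (chart_times c) (\<lambda>x. frame x a c)"
  unfolding frame_component
  by (intro smooth_on_sum[OF thick_chart_times[OF c]]
      smooth_on_bounded_linear[OF thick_chart_times[OF c] bounded_linear_scaleR_right] smooth_on_parallel E_parallel c)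

lemma coords_along_smooth:
  assumes c: "c \<in> A" and \<xi>: "smooth_on (chart_times c) (\<lambda>x. \<xi> x c)"
    and tan: "\<And>x. x \<in> {0..1} \<Longrightarrow> \<xi> x \<in> tangent_space A (\<gamma> x)"
  shows "smooth_on (chart_times c) (\<lambda>x. coords x (\<xi> x))"
proof -
  note th = thick_chart_times[OF c]
  have 1: "smooth_on (chart_times c) (\<lambda>x. metric_coord c (local_curve c x) v (E i x c))" for v i
    by (rule smooth_on_linear_family[OF th metric_coord_linear(2)[OF c local_curve_in]
        smooth_along[OF c metric_coord_smooth[OF c]] smooth_on_parallel[OF E_parallel c]])
  have 2: "smooth_on (chart_times c) (\<lambda>x. metric_coord c (local_curve c x) (\<xi> x c) (E i x c))" for i
    by (rule smooth_on_linear_family[where T = "\<lambda>x v. metric_coord c (local_curve c x) v (E i x c)",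
        OF th metric_coord_linear(1)[OF c local_curve_in] 1 \<xi>])
  have sm: "smooth_on (chart_times c) (\<lambda>x. \<Sum>i\<in>UNIV. metric_coord c (local_curve c x) (\<xi> x c) (E i x c) *\<^sub>R axis i (1::real))"
    by (intro smooth_on_sum[OF th] smooth_on_bounded_linear[OF th bounded_linear_scaleR_left] 2)
  show ?thesis
  proof (rule smooth_on_transform[OF sm])
    fix x assume "x \<in> chart_times c"
    then have x: "x \<in> {0..1}" "\<gamma> x \<in> chart_dom c" by (auto simp: chart_times_def)
    show "(\<Sum>i\<in>UNIV. metric_coord c (local_curve c x) (\<xi> x c) (E i x c) *\<^sub>R axis i (1::real)) = coords x (\<xi> x)"
      unfolding coords_sum metric_eq_metric_coord[OF c x(2) tan[OF x(1)] E_tangent[OF x(1)]] local_curve_def ..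
  qed
qed

lemma curv_op_smooth:
  assumes c: "c \<in> A"
  shows "smooth_on (chart_times c) (\<lambda>x. curv_op x a)"
proof -
  note th = thick_chart_times[OF c]
  have 1: "smooth_on (chart_times c) (\<lambda>x. curv_coord c (local_curve c x) u v (vel x c))" for u v
    by (rule smooth_on_linear_family[OF th curv_coord_linear(3)[OF c local_curve_in]
        smooth_along[OF c curv_coord_smooth[OF c]] velocity_smooth[OF c]])
  have 2: "smooth_on (chart_times c) (\<lambda>x. curv_coord c (local_curve c x) u (frame x a c) (vel x c))" for u
    by (rule smooth_on_linear_family[where T = "\<lambda>x v. curv_coord c (local_curve c x) u v (vel x c)",
        OF th curv_coord_linear(2)[OF c local_curve_in] 1 frame_smooth[OF c]])
  have sm: "smooth_on (chart_times c) (\<lambda>x. curv_coord c (local_curve c x) (vel x c) (frame x a c) (vel x c))"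
    by (rule smooth_on_linear_family[where T = "\<lambda>x u. curv_coord c (local_curve c x) u (frame x a c) (vel x c)",
        OF th curv_coord_linear(1)[OF c local_curve_in] 2 velocity_smooth[OF c]])
  have "smooth_on (chart_times c) (\<lambda>x. coords x (curvature A nab (\<gamma> x) (vel x) (frame x a) (vel x)))"
  proof (rule coords_along_smooth[OF c])
    show "smooth_on (chart_times c) (\<lambda>x. curvature A nab (\<gamma> x) (vel x) (frame x a) (vel x) c)"
      by (rule smooth_on_transform[OF sm]) (simp add: chart_times_iff local_curve_def curvature_in_chart[OF c])
  qed (intro curvature_tangent frame_tangent)
  then show ?thesis by (rule smooth_on_transform) (simp add: chart_times_iff curv_op_def)
qed

lemma curv_op_continuous: "continuous_on {0..1} (\<lambda>x. curv_op x a)"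
  unfolding continuous_on_eq_continuous_within
proof
  fix x :: real assume x: "x \<in> {0..1}"
  obtain c where c: "c \<in> A" "\<gamma> x \<in> chart_dom c" using chart_exists[OF curve_in[OF x]] .
  have xc: "x \<in> chart_times c" using x c by (simp add: chart_times_def)
  have "continuous (at x within chart_times c) (\<lambda>x. curv_op x a)"
    using smooth_on_continuous[OF curv_op_smooth[OF c(1)]] xc by (simp add: continuous_on_eq_continuous_within)
  then show "continuous (at x within {0..1}) (\<lambda>x. curv_op x a)"
    unfolding at_within_chart_times[OF c(1) xc] .
qed

end

section \<open>Jacobi fields in a parallel frame\<close>

locale jacobi_frame = parallel_frame M A g nab \<gamma> E + jacobi_system S X Y
  for M :: "'a topology" and A :: "('a, 'n::finite) chart set"
    and g :: "'a \<Rightarrow> ('a, 'n) tvec \<Rightarrow> ('a, 'n) tvec \<Rightarrow> real"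
    and nab :: "'a \<Rightarrow> ('a, 'n) tvec \<Rightarrow> ('a \<Rightarrow> ('a, 'n) tvec) \<Rightarrow> ('a, 'n) tvec"
    and \<gamma> :: "real \<Rightarrow> 'a" and E :: "'n \<Rightarrow> real \<Rightarrow> ('a, 'n) tvec"
    and S X Y :: "real \<Rightarrow> (real ^ 'n) \<Rightarrow>\<^sub>L (real ^ 'n)" +
  assumes S_eq: "blinfun_apply (S x) = curv_op x"

lemma (in parallel_frame) jacobi_frame_exists:
  obtains S X Y where "jacobi_frame M A g nab \<gamma> E S X Y"
proof -
  define S where "S x = Blinfun (curv_op x)" for x
  have S: "blinfun_apply (S x) = curv_op x" for x
    unfolding S_def using curv_op_linear by (intro bounded_linear_Blinfun_apply) (simp add: linear_conv_bounded_linear)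
  have cont: "continuous_on {0..1} S"
    by (rule continuous_on_blinfun_componentwise) (simp add: S curv_op_continuous)
  obtain X Y where "jacobi_system S X Y"
    using jacobi_system_exists[OF cont] curv_op_symmetric unfolding S by blast
  then have "jacobi_frame M A g nab \<gamma> E S X Y"
    by (intro jacobi_frame.intro parallel_frame_axioms jacobi_frame_axioms.intro S)
  then show ?thesis by (rule that)
qed

context jacobi_frame
begin

definition jacobi_field :: "real ^ 'n \<Rightarrow> real \<Rightarrow> ('a, 'n) tvec" where
  "jacobi_field v = field_of (\<lambda>x. X x v)"

lemma curv_op_coords:
  assumes x: "x \<in> {0..1}"
  shows "frame x (curv_op x a) = curvature A nab (\<gamma> x) (vel x) (frame x a) (vel x)"
  using x by (simp add: curv_op_def frame_coords[OF x curvature_tangent[OF x frame_tangent[OF x]]])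

text \<open>The coordinates \<open>f\<close> of a Jacobi field solve \<open>f'' = - S f\<close>, and \<open>f 0 = 0\<close> leaves \<open>f' 0\<close> as the only
  freedom.\<close>

lemma jacobi_fields_vanishing_at_0:
  assumes \<xi>: "\<xi> \<in> jacobi_fields A nab \<gamma>" "\<xi> 0 = 0"
  shows "\<exists>v. \<xi> = jacobi_field v"
proof -
  have fld: "\<xi> \<in> fields_along A \<gamma>" and sm: "\<And>c. c \<in> A \<Longrightarrow> smooth_on (chart_times c) (\<lambda>x. \<xi> x c)"
    and jac: "\<And>x. x \<in> {0..1} \<Longrightarrow> cov_deriv_along A nab \<gamma> (cov_deriv_along A nab \<gamma> \<xi>) x
      + curvature A nab (\<gamma> x) (vel x) (\<xi> x) (vel x) = 0"
    using \<xi>(1) unfolding jacobi_fields_def smooth_fields_along_def chart_times_def by blast+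
  have tan: "\<xi> x \<in> tangent_space A (\<gamma> x)" if "x \<in> {0..1}" for x
    using fld that by (simp add: fields_along_def)
  let ?\<eta> = "cov_deriv_along A nab \<gamma> \<xi>"
  have der: "((\<lambda>y. \<xi> y c) has_vector_derivative frechet_derivative (\<lambda>y. \<xi> y c) (at x within chart_times c) 1) (at x within {0..1})"
    if c: "c \<in> A" and x: "x \<in> chart_times c" for c x
    using smooth_on_vector_derivative[OF sm[OF c] x] unfolding at_within_chart_times[OF c x] .
  have \<eta>: "?\<eta> x \<in> tangent_space A (\<gamma> x)"
    "?\<eta> x c = frechet_derivative (\<lambda>y. \<xi> y c) (at x within chart_times c) 1 + christoffel c (local_curve c x) (vel x c) (\<xi> x c)"
    if c: "c \<in> A" and x: "x \<in> chart_times c" for c x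
    using cov_deriv_along_eq(2,3)[of x c \<xi>, OF _ c _ tan der[OF c x]] x by (simp_all add: chart_times_iff)
  have \<eta>tan: "?\<eta> x \<in> tangent_space A (\<gamma> x)" if x: "x \<in> {0..1}" for x
  proof -
    obtain c where "c \<in> A" "\<gamma> x \<in> chart_dom c" using chart_exists[OF curve_in[OF x]] .
    then show ?thesis using x by (intro \<eta>(1)) (auto simp: chart_times_iff)
  qed
  have \<eta>sm: "smooth_on (chart_times c) (\<lambda>x. ?\<eta> x c)" if c: "c \<in> A" for c
  proof (rule smooth_on_transform[OF smooth_on_add[OF thick_chart_times[OF c]]])
    show "smooth_on (chart_times c) (\<lambda>x. frechet_derivative (\<lambda>y. \<xi> y c) (at x within chart_times c) 1)"
      by (rule smooth_on_frechet_derivative[OF sm[OF c]])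
    show "smooth_on (chart_times c) (\<lambda>x. christoffel c (local_curve c x) (vel x c) (\<xi> x c))"
      by (rule smooth_on_linear_family[OF thick_chart_times[OF c] christoffel_linear(2)[OF c local_curve_in]
          christoffel_along_smooth[OF c] sm[OF c]])
  qed (simp add: \<eta>(2)[OF c])
  define f where "f x = coords x (\<xi> x)" for x
  define f' where "f' x = coords x (?\<eta> x)" for x
  have f: "(f has_vector_derivative f' x) (at x within {0..1})" if x: "x \<in> {0..1}" for x
  proof -
    obtain c where c: "c \<in> A" "\<gamma> x \<in> chart_dom c" using chart_exists[OF curve_in[OF x]] .
    have xc: "x \<in> chart_times c" using x c by (simp add: chart_times_iff)
    show ?thesis unfolding f_def f'_def by (rule coords_deriv[OF x c tan der[OF c(1) xc]])
  qed
  have f': "(f' has_vector_derivative - S x (f x)) (at x within {0..1})" if x: "x \<in> {0..1}" for x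
  proof -
    obtain c where c: "c \<in> A" "\<gamma> x \<in> chart_dom c" using chart_exists[OF curve_in[OF x]] .
    have xc: "x \<in> chart_times c" using x c by (simp add: chart_times_iff)
    have "((\<lambda>y. ?\<eta> y c) has_vector_derivative frechet_derivative (\<lambda>y. ?\<eta> y c) (at x within chart_times c) 1) (at x within {0..1})"
      using smooth_on_vector_derivative[OF \<eta>sm[OF c(1)] xc] unfolding at_within_chart_times[OF c(1) xc] .
    from coords_deriv[of x c ?\<eta>, OF x c \<eta>tan this]
    have "(f' has_vector_derivative coords x (cov_deriv_along A nab \<gamma> ?\<eta> x)) (at x within {0..1})"
      unfolding f'_def .
    moreover have "cov_deriv_along A nab \<gamma> ?\<eta> x = (-1) *\<^sub>R curvature A nab (\<gamma> x) (vel x) (\<xi> x) (vel x) + 0 *\<^sub>R 0"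
      using jac[OF x] by (simp add: eq_neg_iff_add_eq_0)
    moreover have "coords x ((-1) *\<^sub>R curvature A nab (\<gamma> x) (vel x) (\<xi> x) (vel x) + 0 *\<^sub>R 0) = - S x (f x)"
      using x by (subst coords_linear[OF x curvature_tangent[OF x tan[OF x]] subspace_0[OF tangent_space_subspace]])
        (simp add: S_eq curv_op_def f_def frame_coords[OF x tan[OF x]])
    ultimately show ?thesis by simp
  qed
  have f0: "f 0 = 0" by (simp add: f_def \<xi>(2) coords_zero)
  have "f x = X x (f' 0)" if "x \<in> {0..1}" for x by (rule jacobi_solution_eq[OF f f' f0 that])
  then have "field_of f = jacobi_field (f' 0)" unfolding jacobi_field_def field_of_def by (intro ext) auto
  moreover have "field_of f = \<xi>" unfolding f_def by (rule field_of_coords[OF fld])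
  ultimately show ?thesis by auto
qed

lemma cov_deriv_field_of_C1:
  assumes f: "\<And>x. x \<in> {0..1} \<Longrightarrow> (f has_vector_derivative f' x) (at x within {0..1})"
  shows "cov_deriv_along A nab \<gamma> (field_of f) = field_of f'"
proof (rule ext)
  fix x
  show "cov_deriv_along A nab \<gamma> (field_of f) x = field_of f' x"
  proof (cases "x \<in> {0..1}")
    case True
    then show ?thesis using cov_deriv_field_of[OF True f[OF True]] by (simp add: field_of_def)
  next
    case False
    then show ?thesis by (intro ext) (auto simp: cov_deriv_along_def field_of_def)
  qed
qed

text \<open>Smoothness comes from the first order system for \<open>(X v, Y v)\<close>, whose coefficients are smooth on every
  chart.\<close>

lemma jacobi_field_in: "jacobi_field v \<in> jacobi_fields A nab \<gamma>"
  unfolding jacobi_fields_def smooth_fields_along_def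
proof (intro CollectI conjI ballI)
  show "jacobi_field v \<in> fields_along A \<gamma>" unfolding jacobi_field_def by (rule field_of_fields_along)
next
  fix c assume c: "c \<in> A"
  note th = thick_chart_times[OF c]
  let ?T = "\<lambda>x p. (snd p, - curv_op x (fst p))"
  have sm: "smooth_on (chart_times c) (\<lambda>x. (X x v, Y x v))"
  proof (rule smooth_on_linear_ode[where T = ?T, OF th])
    show "linear (?T x)" for x
      by (rule linearI) (simp_all add: linear_add[OF curv_op_linear] linear_scale[OF curv_op_linear])
    fix p :: "(real ^ 'n) \<times> (real ^ 'n)"
    have bl: "bounded_linear (\<lambda>b. (0 :: real ^ 'n, - b :: real ^ 'n))" 
      by (intro bounded_linear_Pair bounded_linear_zero bounded_linear_minus bounded_linear_ident)
    have "smooth_on (chart_times c) (\<lambda>x. (snd p, 0) + (0, - curv_op x (fst p)))"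
      by (intro smooth_on_add[OF th] smooth_on_const[OF th] smooth_on_bounded_linear[OF th bl] curv_op_smooth[OF c])
    then show "smooth_on (chart_times c) (\<lambda>x. ?T x p)" by simp
  next
    fix x assume x: "x \<in> chart_times c"
    then have x01: "x \<in> {0..1}" by (simp add: chart_times_iff)
    show "((\<lambda>x. (X x v, Y x v)) has_vector_derivative ?T x (X x v, Y x v)) (at x within chart_times c)"
      unfolding at_within_chart_times[OF c x]
      using has_vector_derivative_Pair[OF Xv_deriv[OF x01, of v] Yv_deriv[OF x01, of v]] by (simp add: S_eq)
  qed
  have "smooth_on (chart_times c) (\<lambda>x. X x v)"
    using smooth_on_bounded_linear[OF th bounded_linear_fst sm] by simp
  then have sm: "smooth_on (chart_times c) (\<lambda>x. frame x (X x v) c)"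
    unfolding frame_component
    by (intro smooth_on_sum[OF th] smooth_on_bilinear[OF th bounded_bilinear_scaleR]
        smooth_on_bounded_linear[OF th bounded_linear_vec_nth] smooth_on_parallel[OF E_parallel c])
  show "smooth_on {x \<in> {0..1}. \<gamma> x \<in> chart_dom c} (\<lambda>x. jacobi_field v x c)"
    unfolding chart_times_def[symmetric]
    by (rule smooth_on_transform[OF sm]) (simp add: jacobi_field_def field_of_def chart_times_iff)
next
  fix x :: real assume x: "x \<in> {0..1}"
  have "cov_deriv_along A nab \<gamma> (cov_deriv_along A nab \<gamma> (jacobi_field v)) = field_of (\<lambda>x. - S x (X x v))"
  proof -
    have "cov_deriv_along A nab \<gamma> (jacobi_field v) = field_of (\<lambda>x. Y x v)"
      unfolding jacobi_field_def by (rule cov_deriv_field_of_C1) (rule Xv_deriv)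
    moreover have "cov_deriv_along A nab \<gamma> (field_of (\<lambda>x. Y x v)) = field_of (\<lambda>x. - S x (X x v))"
      by (rule cov_deriv_field_of_C1) (rule Yv_deriv)
    ultimately show ?thesis by simp
  qed
  moreover have "frame x (- S x (X x v)) = - frame x (S x (X x v))"
    using frame_linear[of x "-1" "S x (X x v)" 0 0] by simp
  ultimately show "cov_deriv_along A nab \<gamma> (cov_deriv_along A nab \<gamma> (jacobi_field v)) x
     + curvature A nab (\<gamma> x) (vel x) (jacobi_field v x) (vel x) = 0"
    using x by (simp add: field_of_def jacobi_field_def S_eq curv_op_coords[OF x])
qed

lemma jacobi_field_linear: "linear jacobi_field"
proof -
  have "jacobi_field (r *\<^sub>R v + s *\<^sub>R w) = r *\<^sub>R jacobi_field v + s *\<^sub>R jacobi_field w" for r s v w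
  proof (rule ext)
    fix x
    have "jacobi_field (r *\<^sub>R v + s *\<^sub>R w) x = r *\<^sub>R jacobi_field v x + s *\<^sub>R jacobi_field w x"
      by (simp add: jacobi_field_def field_of_def blinfun.add_right blinfun.scaleR_right frame_linear)
    then show "jacobi_field (r *\<^sub>R v + s *\<^sub>R w) x = (r *\<^sub>R jacobi_field v + s *\<^sub>R jacobi_field w) x"
      unfolding plus_fun_apply scaleR_fun_def[of r "jacobi_field v"] scaleR_fun_def[of s "jacobi_field w"] .
  qed
  from this[of 1 _ 1] this[of _ _ 0 0] show ?thesis by (intro linearI) simp_all
qed

lemma frame_eq_0_iff: "x \<in> {0..1} \<Longrightarrow> frame x a = 0 \<longleftrightarrow> a = 0"
  using coords_frame[of x a] coords_zero[of x] frame_zero by auto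

lemma jacobi_field_inj:
  assumes "jacobi_field v = 0" shows "v = 0"
proof -
  have "X x v = 0" if x: "x \<in> {0..1}" for x
    using fun_cong[OF assms, of x] x frame_eq_0_iff[OF x] by (simp add: jacobi_field_def field_of_def)
  then have "((\<lambda>x. X x v) has_vector_derivative 0) (at 0 within {0..1})"
    by (intro has_vector_derivative_transform[OF _ _ has_vector_derivative_const[of 0]]) auto
  then have "vector_derivative (\<lambda>x. X x v) (at 0 within {0..1}) = 0"
    by (intro vector_derivative_within_unit_interval) auto
  moreover have "vector_derivative (\<lambda>x. X x v) (at 0 within {0..1}) = Y 0 v"
    by (intro vector_derivative_within_unit_interval Xv_deriv) auto
  ultimately show ?thesis by (simp add: Y_0)
qed

theorem conj_mult_eq_multiplicity:
  assumes t: "t \<in> {0..1}"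
  shows "conj_mult A nab \<gamma> t = enat (multiplicity t)"
proof -
  have val: "jacobi_field v x = 0 \<longleftrightarrow> X x v = 0" if "x \<in> {0..1}" for v x
    using that by (simp add: jacobi_field_def field_of_def frame_eq_0_iff)
  have "{\<xi> \<in> jacobi_fields A nab \<gamma>. \<xi> 0 = 0 \<and> \<xi> t = 0} = jacobi_field ` {v. X t v = 0}"
  proof (intro set_eqI iffI)
    fix \<xi> assume "\<xi> \<in> {\<xi> \<in> jacobi_fields A nab \<gamma>. \<xi> 0 = 0 \<and> \<xi> t = 0}"
    then have \<xi>: "\<xi> \<in> jacobi_fields A nab \<gamma>" "\<xi> 0 = 0" "\<xi> t = 0" by blast+
    obtain v where v: "\<xi> = jacobi_field v" using jacobi_fields_vanishing_at_0[OF \<xi>(1,2)] by blast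
    then show "\<xi> \<in> jacobi_field ` {v. X t v = 0}" using val[OF t, of v] \<xi>(3) by blast
  next
    fix \<xi> assume "\<xi> \<in> jacobi_field ` {v. X t v = 0}"
    then obtain v where v: "\<xi> = jacobi_field v" "X t v = 0" by blast
    have "jacobi_field v 0 = 0" "jacobi_field v t = 0"
      using val[OF t, of v] v(2) val[of 0 v] by (simp_all add: X_0)
    then show "\<xi> \<in> {\<xi> \<in> jacobi_fields A nab \<gamma>. \<xi> 0 = 0 \<and> \<xi> t = 0}"
      unfolding v(1) using jacobi_field_in by blast
  qed
  then show ?thesis
    unfolding conj_mult_def multiplicity_def
    using edim_linear_image[OF jacobi_field_linear kernel_subspace, of t] jacobi_field_inj by simp
qed

section \<open>The Hessian in a parallel frame\<close>

lemma H1_deriv_smooth_along: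
  fixes h :: "real \<Rightarrow> 'b::euclidean_space"
  assumes c: "c \<in> A" and ab: "{a..b} \<subseteq> chart_times c" and h: "smooth_on (chart_times c) h"
  shows "H1_deriv a b h (\<lambda>x. frechet_derivative h (at x within chart_times c) 1)"
proof (rule H1_deriv_C1)
  fix x assume "x \<in> {a..b}"
  then have "x \<in> chart_times c" using ab by blast
  from smooth_on_vector_derivative[OF h this]
  show "(h has_vector_derivative frechet_derivative h (at x within chart_times c) 1) (at x within {a..b})"
    by (rule has_vector_derivative_within_subset[OF _ ab])
qed (rule continuous_on_subset[OF smooth_on_continuous[OF smooth_on_frechet_derivative[OF h]] ab])

text \<open>Off the null set where \<open>f\<close> is not differentiable, both integrands agree with those of the index form,
  because the frame is parallel and orthonormal.\<close>

lemma hessian_field_of: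
  assumes f: "H1_deriv 0 1 f u"
  shows "energy_hessian A g nab \<gamma> (field_of f) (field_of f) = integral {0..1} (index_integrand f u)"
proof -
  let ?\<xi> = "field_of f"
  let ?F = "\<lambda>x. g (\<gamma> x) (cov_deriv_along A nab \<gamma> ?\<xi> x) (cov_deriv_along A nab \<gamma> ?\<xi> x)"
  let ?G = "\<lambda>x. g (\<gamma> x) (curvature A nab (\<gamma> x) (vel x) (?\<xi> x) (vel x)) (?\<xi> x)"
  obtain N where N: "negligible N" "\<forall>x\<in>{0..1} - N. (f has_vector_derivative u x) (at x within {0..1})"
    and u2: "(\<lambda>x. (norm (u x))\<^sup>2) integrable_on {0..1}"
    using f unfolding H1_deriv_def by blast
  have F: "?F x = (norm (u x))\<^sup>2" if x: "x \<in> {0..1} - N" for x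
    using x N(2) cov_deriv_field_of[of x f "u x"] metric_frame[of x "u x" "u x"] by (simp add: power2_norm_eq_inner)
  have "(\<lambda>x. (norm (u x))\<^sup>2) absolutely_integrable_on {0..1}"
    by (rule nonnegative_absolutely_integrable_1[OF u2]) simp
  then have "?F absolutely_integrable_on {0..1}" by (rule absolutely_integrable_spike[OF _ N(1) F])
  then have "(LINT x:{0..1}|lebesgue. ?F x) = integral {0..1} ?F" by (rule set_lebesgue_integral_eq_integral(2))
  also have "\<dots> = integral {0..1} (\<lambda>x. (norm (u x))\<^sup>2)" by (rule integral_spike[OF N(1)]) (use F in auto)
  finally have 1: "(LINT x:{0..1}|lebesgue. ?F x) = integral {0..1} (\<lambda>x. (norm (u x))\<^sup>2)" .
  have G: "?G x = f x \<bullet> S x (f x)" if x: "x \<in> {0..1}" for x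
    using x curv_op_inner[OF x, of "f x" "f x"] by (simp add: field_of_def S_eq inner_commute)
  have contf: "continuous_on {0..1} f"
    by (rule H1_deriv_continuous[OF f])
  have cont: "continuous_on {0..1} (\<lambda>x. f x \<bullet> S x (f x))" by (intro continuous_intros contf S_cont)
  then have "(\<lambda>x. f x \<bullet> S x (f x)) absolutely_integrable_on {0..1}" by (rule absolutely_integrable_continuous_real)
  then have "?G absolutely_integrable_on {0..1}"
    by (rule absolutely_integrable_spike[OF _ negligible_empty]) (use G in auto)
  then have "(LINT x:{0..1}|lebesgue. ?G x) = integral {0..1} ?G" by (rule set_lebesgue_integral_eq_integral(2))
  also have "\<dots> = integral {0..1} (\<lambda>x. f x \<bullet> S x (f x))" by (rule integral_cong) (use G in auto)
  finally have 2: "(LINT x:{0..1}|lebesgue. ?G x) = integral {0..1} (\<lambda>x. f x \<bullet> S x (f x))" .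
  show ?thesis
    unfolding energy_hessian_def 1 2 index_integrand_def[abs_def]
    by (rule integral_diff[symmetric, OF u2 integrable_continuous_real[OF cont]])
qed

lemma field_of_in_path_tangent_space:
  assumes f: "H1_deriv 0 1 f u" and "f 0 = 0" "f 1 = 0"
  shows "field_of f \<in> path_tangent_space A \<gamma>"
  unfolding path_tangent_space_def
proof (intro CollectI conjI ballI allI impI)
  show "field_of f \<in> fields_along A \<gamma>" by (rule field_of_fields_along)
  show "field_of f 0 = 0" "field_of f 1 = 0" using assms(2,3) by (simp_all add: field_of_def frame_zero)
  fix c a b assume c: "c \<in> A" and ab: "0 \<le> a" "a \<le> b" "b \<le> (1::real)" "\<gamma> ` {a..b} \<subseteq> chart_dom c"
  have times: "{a..b} \<subseteq> chart_times c" using ab by (auto simp del: split_paired_All simp: chart_times_iff)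
  have bil: "bounded_bilinear (\<lambda>(v :: real ^ 'n) w :: real ^ 'n. (v $ i) *\<^sub>R w)" for i
    by (rule bounded_bilinear.comp1[OF bounded_bilinear_scaleR bounded_linear_vec_nth])
  have "H1_deriv a b (\<lambda>x. \<Sum>i\<in>UNIV. (f x $ i) *\<^sub>R E i x c)
      (\<lambda>x. \<Sum>i\<in>UNIV. (f x $ i) *\<^sub>R frechet_derivative (\<lambda>y. E i y c) (at x within chart_times c) 1 + (u x $ i) *\<^sub>R E i x c)"
    by (intro H1_deriv_sum finite H1_deriv_bilinear[OF bil] H1_deriv_subset[OF f ab(1,3)]
        H1_deriv_smooth_along[OF c times] smooth_on_parallel[OF E_parallel c])
  then have "H1_on a b (\<lambda>x. \<Sum>i\<in>UNIV. (f x $ i) *\<^sub>R E i x c)" by (rule H1_deriv_imp_H1_on)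
  from H1_on_imp_H1_deriv[OF this] obtain w where w: "H1_deriv a b (\<lambda>x. \<Sum>i\<in>UNIV. (f x $ i) *\<^sub>R E i x c) w" by blast
  have "H1_deriv a b (\<lambda>x. field_of f x c) w"
    by (rule H1_deriv_cong_ae[OF w negligible_empty]) (use ab in \<open>auto simp: field_of_def frame_component\<close>)
  then show "H1_on a b (\<lambda>x. field_of f x c)" by (rule H1_deriv_imp_H1_on)
qed

text \<open>On an interval that is mapped into \<open>c\<close>, the coordinates of \<open>\<xi>\<close> in the frame are combinations of its
  components in \<open>c\<close> with smooth coefficients, namely the frame coordinates of the coordinate fields of
  \<open>c\<close>. This makes them \<open>H\<^sup>1\<close>, and their derivative is found pointwise almost everywhere.\<close>

lemma path_field_coords_local:
  assumes \<xi>: "\<xi> \<in> path_tangent_space A \<gamma>" and c: "c \<in> A"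
    and ab: "0 \<le> a" "a \<le> b" "b \<le> 1" "{a..b} \<subseteq> chart_times c"
  shows "H1_deriv a b (\<lambda>x. coords x (\<xi> x)) (\<lambda>x. coords x (cov_deriv_along A nab \<gamma> \<xi> x))"
proof -
  let ?f = "\<lambda>x. coords x (\<xi> x)"
  have tan: "\<xi> x \<in> tangent_space A (\<gamma> x)" if "x \<in> {0..1}" for x
    using \<xi> that by (simp add: path_tangent_space_def fields_along_def)
  have dom: "\<gamma> x \<in> chart_dom c" if "x \<in> {a..b}" for x using ab that by (auto simp del: split_paired_All simp: chart_times_iff)
  have "\<gamma> ` {a..b} \<subseteq> chart_dom c" using dom by blast
  then have "H1_on a b (\<lambda>x. \<xi> x c)" using \<xi> c ab unfolding path_tangent_space_def by blast
  then obtain w where w: "H1_deriv a b (\<lambda>x. \<xi> x c) w" by (rule H1_on_imp_H1_deriv)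
  then obtain N1 where N1: "negligible N1" "\<forall>x\<in>{a..b} - N1. ((\<lambda>x. \<xi> x c) has_vector_derivative w x) (at x within {a..b})"
    unfolding H1_deriv_def by blast
  define m where "m j x = coords x (if x \<in> chart_times c then const_field A c j (\<gamma> x) else 0)" for j x
  have m: "smooth_on (chart_times c) (m j)" for j
    unfolding m_def[abs_def]
  proof (rule coords_along_smooth[OF c])
    show "smooth_on (chart_times c) (\<lambda>x. (if x \<in> chart_times c then const_field A c j (\<gamma> x) else 0) c)"
      by (rule smooth_on_transform[OF smooth_on_const[OF thick_chart_times[OF c], of j]])
        (simp add: chart_times_iff const_field_self[OF c])
    show "(if x \<in> chart_times c then const_field A c j (\<gamma> x) else 0) \<in> tangent_space A (\<gamma> x)" for x
      using const_field_tangent[OF c, of "\<gamma> x" j] subspace_0[OF tangent_space_subspace] by (auto simp: chart_times_iff)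
  qed
  have bil: "bounded_bilinear (\<lambda>(v :: real ^ 'n) w :: real ^ 'n. (v \<bullet> j) *\<^sub>R w)" for j
    by (rule bounded_bilinear.comp1[OF bounded_bilinear_scaleR bounded_linear_inner_left])
  from H1_deriv_sum[OF finite_Basis H1_deriv_bilinear[OF bil w H1_deriv_smooth_along[OF c ab(4) m]]]
  obtain u0 where u0: "H1_deriv a b (\<lambda>x. \<Sum>j\<in>Basis. (\<xi> x c \<bullet> j) *\<^sub>R m j x) u0" ..
  have eq: "?f x = (\<Sum>j\<in>Basis. (\<xi> x c \<bullet> j) *\<^sub>R m j x)" if x: "x \<in> {a..b}" for x
  proof -
    have x01: "x \<in> {0..1}" and xt: "x \<in> chart_times c" using x ab by auto
    note tj = const_field_tangent[OF c dom[OF x]]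
    have "linear (\<lambda>w. coords x (const_field A c w (\<gamma> x)))"
      using coords_linear[OF x01 tj tj, of 1 _ 1] coords_linear[OF x01 tj tj, of _ _ 0 0]
        const_field_linear[OF c, of 1 _ 1 _ "\<gamma> x"] const_field_linear[OF c, of _ _ 0 0 "\<gamma> x"]
      by (intro linearI) simp_all
    from linear_basis_expansion[OF this, of "\<xi> x c"] show ?thesis
      unfolding tangent_eq_const_field[OF c dom[OF x] tan[OF x01], symmetric] using xt by (simp add: m_def)
  qed
  have f: "H1_deriv a b ?f u0" by (rule H1_deriv_cong_ae[OF u0 negligible_empty eq]) auto
  then obtain N0 where N0: "negligible N0" "\<forall>x\<in>{a..b} - N0. (?f has_vector_derivative u0 x) (at x within {a..b})"
    unfolding H1_deriv_def by blast
  have neg: "negligible (N0 \<union> N1 \<union> {a, b})" using N0 N1 by auto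
  show ?thesis
  proof (rule H1_deriv_cong_ae[OF f neg refl])
    fix x assume x: "x \<in> {a..b} - (N0 \<union> N1 \<union> {a, b})"
    then have xI: "a < x" "x < b" "x \<in> {0..1}" "x \<in> {a..b}" using ab by auto
    have at: "at x within {a..b} = at x" "at x within {0..1} = at x"
      using xI ab by (auto intro!: at_within_Icc_at)
    have "((\<lambda>x. \<xi> x c) has_vector_derivative w x) (at x within {a..b})" using N1(2) x by blast
    then have "((\<lambda>x. \<xi> x c) has_vector_derivative w x) (at x within {0..1})" unfolding at .
    from coords_deriv[OF xI(3) c dom[OF xI(4)] tan this]
    have "(?f has_vector_derivative coords x (cov_deriv_along A nab \<gamma> \<xi> x)) (at x)" unfolding at .
    moreover have "(?f has_vector_derivative u0 x) (at x within {a..b})" using N0(2) x by blast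
    then have "(?f has_vector_derivative u0 x) (at x)" unfolding at .
    ultimately show "coords x (cov_deriv_along A nab \<gamma> \<xi> x) = u0 x" by (rule vector_derivative_unique_at)
  qed
qed

lemma path_field_coords:
  assumes \<xi>: "\<xi> \<in> path_tangent_space A \<gamma>"
  shows "H1_deriv 0 1 (\<lambda>x. coords x (\<xi> x)) (\<lambda>x. coords x (cov_deriv_along A nab \<gamma> \<xi> x))"
proof -
  let ?H = "\<lambda>a b. H1_deriv a b (\<lambda>x. coords x (\<xi> x)) (\<lambda>x. coords x (cov_deriv_along A nab \<gamma> \<xi> x))"
  have "0 \<le> (0::real) \<and> (1::real) \<le> 1 \<longrightarrow> ?H 0 1"
    using zero_le_one
  proof (induction rule: Bolzano[where P = "\<lambda>a b. 0 \<le> a \<and> b \<le> 1 \<longrightarrow> ?H a b"])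
    case (trans a b c)
    then show ?case by (auto intro: H1_deriv_combine)
  next
    case (local x)
    then have "\<gamma> x \<in> topspace M" using curve_in by simp
    then obtain c where c: "c \<in> A" "\<gamma> x \<in> chart_dom c" by (rule chart_exists)
    have "x \<in> chart_times c" using local c by (simp add: chart_times_def)
    then obtain r where r: "r > 0" "ball x r \<inter> {0..1} \<subseteq> chart_times c"
      using chart_times_openin[OF c(1)] unfolding openin_contains_ball by blast
    show ?case
    proof (intro exI[of _ r] conjI allI impI r(1))
      fix a b assume ab: "a \<le> x \<and> x \<le> b \<and> b - a < r" "0 \<le> a \<and> b \<le> 1"
      have "{a..b} \<subseteq> ball x r \<inter> {0..1}" using ab by (auto simp: dist_real_def)
      then have "{a..b} \<subseteq> chart_times c" using r by blast
      then show "?H a b" using ab by (intro path_field_coords_local[OF \<xi> c(1)]) auto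
    qed
  qed
  then show ?thesis by simp
qed

section \<open>The index theorem\<close>

text \<open>The functionals \<open>\<xi> \<mapsto> \<xi> t \<bullet> Y t b\<close>, in frame coordinates, have no common zero in \<open>U\<close> except \<open>0\<close>, for the
  Hessian is nonnegative where all of them vanish.\<close>

lemma edim_negative_subspace_le:
  assumes U: "subspace U" "U \<subseteq> path_tangent_space A \<gamma>"
    and neg: "\<And>\<xi>. \<xi> \<in> U \<Longrightarrow> \<xi> \<noteq> 0 \<Longrightarrow> energy_hessian A g nab \<gamma> \<xi> \<xi> < 0"
  shows "edim U \<le> enat (\<Sum>t\<in>conjugate. multiplicity t)"
  unfolding card_basis_index[symmetric]
proof (rule edim_le_card_functionals[where \<phi> = "\<lambda>p \<xi>. coords (fst p) (\<xi> (fst p)) \<bullet> Y (fst p) (snd p)",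
    OF finite_basis_index U(1)])
  fix p \<xi> \<eta> r s assume p: "p \<in> basis_index" and "\<xi> \<in> U" "\<eta> \<in> U"
  then have "fst p \<in> {0..1}" "\<xi> (fst p) \<in> tangent_space A (\<gamma> (fst p))" "\<eta> (fst p) \<in> tangent_space A (\<gamma> (fst p))"
    using U(2) by (auto simp: basis_index_def conjugate_def path_tangent_space_def fields_along_def)
  from coords_linear[OF this, of r s]
  show "coords (fst p) ((r *\<^sub>R \<xi> + s *\<^sub>R \<eta>) (fst p)) \<bullet> Y (fst p) (snd p) =
      r * (coords (fst p) (\<xi> (fst p)) \<bullet> Y (fst p) (snd p)) + s * (coords (fst p) (\<eta> (fst p)) \<bullet> Y (fst p) (snd p))"
    by (simp add: scaleR_fun_def inner_add_left)
next
  fix \<xi> assume \<xi>: "\<xi> \<in> U" and ker: "\<And>p. p \<in> basis_index \<Longrightarrow> coords (fst p) (\<xi> (fst p)) \<bullet> Y (fst p) (snd p) = 0"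
  have \<xi>': "\<xi> \<in> path_tangent_space A \<gamma>" using \<xi> U by blast
  then have fld: "\<xi> \<in> fields_along A \<gamma>" "\<xi> 0 = 0" "\<xi> 1 = 0" by (auto simp: path_tangent_space_def)
  let ?f = "\<lambda>x. coords x (\<xi> x)"
  note f = path_field_coords[OF \<xi>']
  have "integral {0..1} (index_integrand ?f (\<lambda>x. coords x (cov_deriv_along A nab \<gamma> \<xi> x))) \<ge> 0"
  proof (rule index_form_nonneg[OF f])
    show "coords 0 (\<xi> 0) = 0" "coords 1 (\<xi> 1) = 0" using fld by (simp_all add: coords_zero)
    show "\<exists>v. coords t (\<xi> t) = X t v" if t: "t \<in> conjugate" for t
      using ker by (intro in_range_if_basis_orthogonal[OF t]) force
  qed
  then have "energy_hessian A g nab \<gamma> \<xi> \<xi> \<ge> 0"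
    using hessian_field_of[OF f] by (simp add: field_of_coords[OF fld(1)])
  then show "\<xi> = 0" using neg[OF \<xi>] by fastforce
qed

text \<open>Negativity also makes the linear map from kernel families to fields injective, so that no dimension is
  lost.\<close>

lemma negative_subspace_exists:
  assumes "1 \<notin> conjugate"
  obtains U where "subspace U" "U \<subseteq> path_tangent_space A \<gamma>"
    "\<And>\<xi>. \<xi> \<in> U \<Longrightarrow> \<xi> \<noteq> 0 \<Longrightarrow> energy_hessian A g nab \<gamma> \<xi> \<xi> < 0"
    "enat (\<Sum>t\<in>conjugate. multiplicity t) \<le> edim U"
proof -
  obtain w w' where w: "\<And>r c s d x. w (\<lambda>t. r *\<^sub>R c t + s *\<^sub>R d t) x = r *\<^sub>R w c x + s *\<^sub>R w d x"
    and w01: "\<And>c. w c 0 = 0" "\<And>c. w c 1 = 0"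
    and H1: "\<And>c. c \<in> kernel_families \<Longrightarrow> H1_deriv 0 1 (w c) (w' c)"
    and neg: "\<And>c. c \<in> kernel_families \<Longrightarrow> c \<noteq> 0 \<Longrightarrow> integral {0..1} (index_integrand (w c) (w' c)) < 0"
    using negative_fields_exist[OF assms] by blast
  define L where "L c = field_of (w c)" for c
  have "L (\<lambda>t. r *\<^sub>R c t + s *\<^sub>R d t) = r *\<^sub>R L c + s *\<^sub>R L d" for r s c d
  proof (rule ext)
    fix x
    have "L (\<lambda>t. r *\<^sub>R c t + s *\<^sub>R d t) x = r *\<^sub>R L c x + s *\<^sub>R L d x"
      by (simp add: L_def field_of_def w frame_linear)
    then show "L (\<lambda>t. r *\<^sub>R c t + s *\<^sub>R d t) x = (r *\<^sub>R L c + s *\<^sub>R L d) x"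
      unfolding plus_fun_apply scaleR_fun_def[of r "L c"] scaleR_fun_def[of s "L d"] .
  qed
  from this[of 1 _ 1] this[of _ _ 0 0]
  have L: "linear L" by (intro linearI) (simp_all add: plus_fun_def scaleR_fun_def)
  have K: "subspace kernel_families"
    unfolding kernel_families_def
    by (rule subspaceI) (auto simp: blinfun.add_right blinfun.scaleR_right blinfun.zero_right scaleR_fun_def)
  have hess: "energy_hessian A g nab \<gamma> (L c) (L c) = integral {0..1} (index_integrand (w c) (w' c))"
    if "c \<in> kernel_families" for c
    unfolding L_def by (rule hessian_field_of[OF H1[OF that]])
  have hess0: "energy_hessian A g nab \<gamma> 0 0 = 0"
  proof -
    have "H1_deriv 0 1 (\<lambda>x. 0 :: real ^ 'n) (\<lambda>x. 0)" by (rule H1_deriv_C1) auto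
    from hessian_field_of[OF this] have "energy_hessian A g nab \<gamma> (field_of (\<lambda>x. 0)) (field_of (\<lambda>x. 0)) = 0"
      by (simp add: index_integrand_def[abs_def])
    moreover have "field_of (\<lambda>x. 0) = 0" by (rule ext) (simp add: field_of_def frame_zero)
    ultimately show ?thesis by simp
  qed
  have inj: "c = 0" if c: "c \<in> kernel_families" "L c = 0" for c
    using hess[OF c(1)] neg[OF c(1)] hess0 c(2) by fastforce
  obtain B where B: "independent B" "finite B" "B \<subseteq> kernel_families" "card B = (\<Sum>t\<in>conjugate. multiplicity t)"
    using kernel_families_independent by blast
  have injL: "inj_on L kernel_families"
  proof (rule inj_onI)
    fix c d assume cd: "c \<in> kernel_families" "d \<in> kernel_families" "L c = L d"
    have "c - d = 0" by (rule inj) (use cd in \<open>auto simp: linear_diff[OF L] subspace_diff[OF K]\<close>)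
    then show "c = d" by simp
  qed
  have "span B \<subseteq> kernel_families" using B(3) K by (metis span_minimal)
  then have "independent (L ` B)"
    by (intro linear_independent_injective_image[OF L B(1)] inj_on_subset[OF injL])
  then have "enat (card (L ` B)) \<le> edim (L ` kernel_families)"
    using B by (intro card_independent_le_edim) auto
  also have "card (L ` B) = card B" by (rule card_image[OF inj_on_subset[OF injL B(3)]])
  finally have dim: "enat (\<Sum>t\<in>conjugate. multiplicity t) \<le> edim (L ` kernel_families)" by (simp add: B(4))
  show ?thesis
  proof (rule that[OF _ _ _ dim])
    show "subspace (L ` kernel_families)" by (rule linear_subspace_image[OF L K])
    show "L ` kernel_families \<subseteq> path_tangent_space A \<gamma>"
      unfolding L_def using field_of_in_path_tangent_space[OF H1 w01] by blast
    show "energy_hessian A g nab \<gamma> \<xi> \<xi> < 0" if \<xi>: "\<xi> \<in> L ` kernel_families" "\<xi> \<noteq> 0" for \<xi>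
    proof -
      obtain c where c: "c \<in> kernel_families" "\<xi> = L c" using \<xi>(1) by blast
      then have "c \<noteq> 0" using \<xi>(2) linear_0[OF L] by auto
      then show ?thesis using neg[OF c(1)] hess[OF c(1)] c(2) by simp
    qed
  qed
qed

theorem morse_index_theorem:
  assumes "conj_mult A nab \<gamma> 1 = 0"
  shows "finite {t \<in> {0<..1}. conj_mult A nab \<gamma> t \<noteq> 0}
    \<and> morse_index A g nab \<gamma>
        = (\<Sum>t \<in> {t \<in> {0<..1}. conj_mult A nab \<gamma> t \<noteq> 0}. conj_mult A nab \<gamma> t)"
proof -
  have mult: "multiplicity t \<noteq> 0 \<longleftrightarrow> t \<in> conjugate" if "t \<in> {0<..1}" for t
    using that by (auto simp: multiplicity_def conjugate_def dim_eq_0)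
  have "conj_mult A nab \<gamma> t \<noteq> 0 \<longleftrightarrow> t \<in> conjugate" if "t \<in> {0<..1}" for t
    using mult[OF that] conj_mult_eq_multiplicity[of t] that by (simp add: zero_enat_def)
  moreover have "conjugate \<subseteq> {0<..1}" by (auto simp: conjugate_def)
  ultimately have conj: "{t \<in> {0<..1}. conj_mult A nab \<gamma> t \<noteq> 0} = conjugate" by blast
  have 1: "1 \<notin> conjugate"
    unfolding conj[symmetric] using assms by blast
  have "(\<Sum>t\<in>conjugate. conj_mult A nab \<gamma> t) = (\<Sum>t\<in>conjugate. enat (multiplicity t))"
    by (intro sum.cong refl conj_mult_eq_multiplicity) (auto simp: conjugate_def)
  also have "\<dots> = enat (\<Sum>t\<in>conjugate. multiplicity t)"
    using finite_conjugate by (induction rule: finite_induct) (auto simp: zero_enat_def)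
  finally have sum: "(\<Sum>t\<in>conjugate. conj_mult A nab \<gamma> t) = enat (\<Sum>t\<in>conjugate. multiplicity t)" .
  have "morse_index A g nab \<gamma> = enat (\<Sum>t\<in>conjugate. multiplicity t)"
  proof (rule antisym)
    show "morse_index A g nab \<gamma> \<le> enat (\<Sum>t\<in>conjugate. multiplicity t)"
      unfolding morse_index_def
    proof (rule SUP_least)
      fix U assume "U \<in> {U. subspace U \<and> U \<subseteq> path_tangent_space A \<gamma> \<and>
        (\<forall>\<xi>\<in>U. \<xi> \<noteq> 0 \<longrightarrow> energy_hessian A g nab \<gamma> \<xi> \<xi> < 0)}"
      then have U: "subspace U" "U \<subseteq> path_tangent_space A \<gamma>"
        and neg: "\<forall>\<xi>\<in>U. \<xi> \<noteq> 0 \<longrightarrow> energy_hessian A g nab \<gamma> \<xi> \<xi> < 0" by blast+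
      show "edim U \<le> enat (\<Sum>t\<in>conjugate. multiplicity t)"
        by (rule edim_negative_subspace_le[OF U neg[rule_format]])
    qed
    obtain U where U: "subspace U" "U \<subseteq> path_tangent_space A \<gamma>"
      "\<And>\<xi>. \<xi> \<in> U \<Longrightarrow> \<xi> \<noteq> 0 \<Longrightarrow> energy_hessian A g nab \<gamma> \<xi> \<xi> < 0"
      "enat (\<Sum>t\<in>conjugate. multiplicity t) \<le> edim U"
      using negative_subspace_exists[OF 1] by blast
    show "enat (\<Sum>t\<in>conjugate. multiplicity t) \<le> morse_index A g nab \<gamma>"
      unfolding morse_index_def
    proof (rule order_trans[OF U(4)], rule SUP_upper, intro CollectI conjI ballI impI U(1,2))
      show "energy_hessian A g nab \<gamma> \<xi> \<xi> < 0" if "\<xi> \<in> U" "\<xi> \<noteq> 0" for \<xi> using U(3)[OF that] .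
    qed
  qed
  then show ?thesis unfolding conj sum using finite_conjugate by blast
qed

end

theorem theorem2p1:
  fixes M :: "'a topology" and A :: "('a, 'n::finite) chart set"
    and g :: "'a \<Rightarrow> ('a, 'n) tvec \<Rightarrow> ('a, 'n) tvec \<Rightarrow> real"
    and nab :: "'a \<Rightarrow> ('a, 'n) tvec \<Rightarrow> ('a \<Rightarrow> ('a, 'n) tvec) \<Rightarrow> ('a, 'n) tvec"
    and p q :: 'a and \<gamma> :: "real \<Rightarrow> 'a"
  assumes "riemannian_manifold M A g"
    and "levi_civita M A g nab"
    and "p \<in> topspace M" and "q \<in> topspace M" and "p \<noteq> q"
    and "geodesic M A nab \<gamma>" and "\<gamma> 0 = p" and "\<gamma> 1 = q"
    and "conj_mult A nab \<gamma> 1 = 0"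
  shows "finite {t \<in> {0<..1}. conj_mult A nab \<gamma> t \<noteq> 0}
    \<and> morse_index A g nab \<gamma>
        = (\<Sum>t \<in> {t \<in> {0<..1}. conj_mult A nab \<gamma> t \<noteq> 0}. conj_mult A nab \<gamma> t)"
proof -
  interpret curve_in_manifold M A g nab \<gamma>
    using assms(2,6) by (intro curve_in_manifold.intro curve_in_manifold_axioms.intro) (simp_all add: geodesic_def)
  obtain E where "parallel_frame M A g nab \<gamma> E"
    using parallel_frame_exists parallel_frame.intro[OF curve_in_manifold_axioms parallel_frame_axioms.intro] by metis
  then interpret parallel_frame M A g nab \<gamma> E .
  obtain S X Y where "jacobi_frame M A g nab \<gamma> E S X Y" by (rule jacobi_frame_exists)
  then interpret jacobi_frame M A g nab \<gamma> E S X Y .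
  show ?thesis by (rule morse_index_theorem[OF assms(9)])
qed

end
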